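(* Let $\Gamma$ and $\tilde\Gamma$ be Kleinian groups whose limit sets $S$ and $\tilde S$ are Schottky sets, and assume $\Gamma$ acts on $S$ and $\tilde\Gamma$ acts on $\tilde S$ as uniform convergence groups. Equip $S,\tilde S\subset\mathbb S^2$ with the spherical metric. Let $p\in S$ and $\tilde p\in\tilde S$. If there exist a weak tangent of $S$ at $p$ and a weak tangent of $\tilde S$ at $\tilde p$ which are quasisymmetrically equivalent, then there exists a Möbius transformation mapping $S$ onto $\tilde S$.
   Context: A Kleinian group is a discrete group of isometries of hyperbolic space $\mathbb H^3$; its limit set is the set of accumulation points in $\partial_\infty\mathbb H^3=\mathbb S^2$ of an orbit. A Schottky set is a compact subset of $\mathbb S^2$ whose complement is a union of at least three open round disks whose closures are pairwise disjoint. A group $G$ acting by homeomorphisms on a compact metrizable space $Z$ with at least three points acts as a uniform convergence group if the induced diagonal action on the space of triples of distinct points of $Z$ is properly discontinuous and cocompact. A weak tangent of a metric space $(X,d)$ at $p$ is a pointed Gromov–Hausdorff limit of $(X,p_n,d/\lambda_n)$ with $\lambda_n\to0^+$ and $p_n\to p$, where $(X_n,p_n,d_n)\to(Z,z,d)$ ($Z$ complete) means: for every $r,\varepsilon>0$, for all large $n$ there is a map $g:B(p_n,r)\to Z$ with $g(p_n)=z$, $\sup|d_n(x,y)-d(g(x),g(y))|<\varepsilon$ and $B(z,r-\varepsilon)$ in the $\varepsilon$-neighborhood of $g(B(p_n,r))$. Two metric spaces are quasisymmetrically equivalent if there is a quasisymmetric homeomorphism between them. *)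

theory Defs
  imports "HOL-Analysis.Analysis"
begin

type_synonym R3 = "real^3"

definition H3 :: "R3 set" where "H3 = ball 0 1"

definition S2 :: "R3 set" where "S2 = sphere 0 1"

definition hdist :: "R3 \<Rightarrow> R3 \<Rightarrow> real" where
  "hdist x y = arcosh (1 + 2 * (norm (x - y))\<^sup>2 / ((1 - (norm x)\<^sup>2) * (1 - (norm y)\<^sup>2)))"

text \<open>Isometries of H3. Convention: a group element is represented by a map on R3
  which is the identity outside H3, so that group elements are in bijection with
  their restrictions to H3.\<close>
definition hyp_isometry :: "(R3 \<Rightarrow> R3) \<Rightarrow> bool" where
  "hyp_isometry g \<longleftrightarrow> bij_betw g H3 H3 \<and> (\<forall>x\<in>H3. \<forall>y\<in>H3. hdist (g x) (g y) = hdist x y)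
     \<and> (\<forall>x. x \<notin> H3 \<longrightarrow> g x = x)"

definition isometry_group :: "(R3 \<Rightarrow> R3) set \<Rightarrow> bool" where
  "isometry_group G \<longleftrightarrow> (\<forall>g\<in>G. hyp_isometry g) \<and> id \<in> G
     \<and> (\<forall>g\<in>G. \<forall>h\<in>G. g \<circ> h \<in> G) \<and> (\<forall>g\<in>G. \<exists>h\<in>G. g \<circ> h = id)"

text \<open>Discreteness in the compact-open topology: the identity is isolated,
  i.e. some basic neighbourhood of the identity contains no other element.\<close>
definition kleinian :: "(R3 \<Rightarrow> R3) set \<Rightarrow> bool" where
  "kleinian G \<longleftrightarrow> isometry_group G \<and>
     (\<exists>K \<epsilon>. compact K \<and> K \<subseteq> H3 \<and> \<epsilon> > 0 \<and>
        (\<forall>g\<in>G. (\<forall>x\<in>K. hdist (g x) x < \<epsilon>) \<longrightarrow> g = id))"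

definition bext :: "(R3 \<Rightarrow> R3) \<Rightarrow> R3 \<Rightarrow> R3" where
  "bext g \<xi> = Lim (at \<xi> within H3) g"

definition limit_set :: "(R3 \<Rightarrow> R3) set \<Rightarrow> R3 set" where
  "limit_set G = {\<xi> \<in> S2. \<xi> islimpt ((\<lambda>g. g 0) ` G)}"

definition round_disk :: "R3 set \<Rightarrow> bool" where
  "round_disk D \<longleftrightarrow> (\<exists>c r. c \<in> S2 \<and> 0 < r \<and> r < 2 \<and> D = {x \<in> S2. dist x c < r})"

definition schottky_set :: "R3 set \<Rightarrow> bool" where
  "schottky_set S \<longleftrightarrow> compact S \<and> S \<subseteq> S2 \<and>
     (\<exists>\<D>. (\<forall>D\<in>\<D>. round_disk D) \<and> (infinite \<D> \<or> card \<D> \<ge> 3) \<and>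
        (\<forall>D\<in>\<D>. \<forall>D'\<in>\<D>. D \<noteq> D' \<longrightarrow> closure D \<inter> closure D' = {}) \<and>
        S2 - S = \<Union>\<D>)"

definition triples :: "'a set \<Rightarrow> ('a \<times> 'a \<times> 'a) set" where
  "triples Z = {(x, y, z). x \<in> Z \<and> y \<in> Z \<and> z \<in> Z \<and> x \<noteq> y \<and> y \<noteq> z \<and> x \<noteq> z}"

definition diag_act :: "('a \<Rightarrow> 'a) \<Rightarrow> 'a \<times> 'a \<times> 'a \<Rightarrow> 'a \<times> 'a \<times> 'a" where
  "diag_act f = (\<lambda>(x, y, z). (f x, f y, f z))"

definition uniform_convergence_group ::
    "'g set \<Rightarrow> ('g \<Rightarrow> 'a \<Rightarrow> 'a) \<Rightarrow> 'a::metric_space set \<Rightarrow> bool" where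
  "uniform_convergence_group G act Z \<longleftrightarrow>
     compact Z \<and> (\<exists>a b c. a \<in> Z \<and> b \<in> Z \<and> c \<in> Z \<and> a \<noteq> b \<and> b \<noteq> c \<and> a \<noteq> c) \<and>
     (\<forall>g\<in>G. \<exists>h. homeomorphism Z Z (act g) h) \<and>
     (\<forall>K. compact K \<and> K \<subseteq> triples Z \<longrightarrow>
        finite {g \<in> G. diag_act (act g) ` K \<inter> K \<noteq> {}}) \<and>
     (\<exists>K. compact K \<and> K \<subseteq> triples Z \<and> (\<Union>g\<in>G. diag_act (act g) ` K) = triples Z)"

definition pGH_conv ::
    "'a set \<Rightarrow> (nat \<Rightarrow> 'a) \<Rightarrow> (nat \<Rightarrow> 'a \<Rightarrow> 'a \<Rightarrow> real) \<Rightarrow> 'b set \<Rightarrow> ('b \<Rightarrow> 'b \<Rightarrow> real) \<Rightarrow> 'b \<Rightarrow> bool"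
  where
  "pGH_conv X p dn Z d z \<longleftrightarrow>
     Metric_space Z d \<and> Metric_space.mcomplete Z d \<and> z \<in> Z \<and>
     (\<forall>r>0. \<forall>\<epsilon>>0. \<exists>N. \<forall>n\<ge>N.
        (let B = {x \<in> X. dn n (p n) x < r} in
         \<exists>g. g ` B \<subseteq> Z \<and> g (p n) = z \<and>
           (\<exists>\<delta><\<epsilon>. \<forall>x\<in>B. \<forall>y\<in>B. \<bar>dn n x y - d (g x) (g y)\<bar> \<le> \<delta>) \<and>
           Metric_space.mball Z d z (r - \<epsilon>) \<subseteq> {w \<in> Z. \<exists>y\<in>g ` B. d w y < \<epsilon>}))"

definition weak_tangent :: "R3 set \<Rightarrow> R3 \<Rightarrow> 'b set \<Rightarrow> ('b \<Rightarrow> 'b \<Rightarrow> real) \<Rightarrow> 'b \<Rightarrow> bool" where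
  "weak_tangent X p Z d z \<longleftrightarrow>
     (\<exists>lam q. (\<forall>n. lam n > 0) \<and> lam \<longlonglongrightarrow> 0 \<and> (\<forall>n. q n \<in> X) \<and> q \<longlonglongrightarrow> p \<and>
        pGH_conv X q (\<lambda>n x y. dist x y / lam n) Z d z)"

definition quasisymmetric ::
    "'a set \<Rightarrow> ('a \<Rightarrow> 'a \<Rightarrow> real) \<Rightarrow> 'b set \<Rightarrow> ('b \<Rightarrow> 'b \<Rightarrow> real) \<Rightarrow> ('a \<Rightarrow> 'b) \<Rightarrow> bool" where
  "quasisymmetric X dX Y dY f \<longleftrightarrow>
     homeomorphic_map (Metric_space.mtopology X dX) (Metric_space.mtopology Y dY) f \<and>
     (\<exists>\<eta> \<eta>'. homeomorphism {0::real..} {0..} \<eta> \<eta>' \<and>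
        (\<forall>x\<in>X. \<forall>y\<in>X. \<forall>z\<in>X. x \<noteq> z \<longrightarrow>
           dY (f x) (f y) / dY (f x) (f z) \<le> \<eta> (dX x y / dX x z)))"

definition qs_equivalent ::
    "'a set \<Rightarrow> ('a \<Rightarrow> 'a \<Rightarrow> real) \<Rightarrow> 'b set \<Rightarrow> ('b \<Rightarrow> 'b \<Rightarrow> real) \<Rightarrow> bool" where
  "qs_equivalent X dX Y dY \<longleftrightarrow> (\<exists>f. quasisymmetric X dX Y dY f)"

text \<open>Reflections of S2 in circles of S2: restrictions of the reflection in a plane
  through 0, or of the inversion in a sphere orthogonal to S2.\<close>
definition circle_reflection :: "(R3 \<Rightarrow> R3) \<Rightarrow> bool" where
  "circle_reflection \<sigma> \<longleftrightarrow>
     (\<exists>u. norm u = 1 \<and> \<sigma> = (\<lambda>x. x - (2 * (x \<bullet> u)) *\<^sub>R u)) \<or>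
     (\<exists>a r. r > 0 \<and> (norm a)\<^sup>2 = 1 + r\<^sup>2 \<and>
        \<sigma> = (\<lambda>x. a + (r\<^sup>2 / (norm (x - a))\<^sup>2) *\<^sub>R (x - a)))"

inductive moebius :: "(R3 \<Rightarrow> R3) \<Rightarrow> bool" where
  moebius_id: "moebius id"
| moebius_comp: "moebius f \<Longrightarrow> circle_reflection \<sigma> \<Longrightarrow> moebius (\<sigma> \<circ> f)"

end

theory Submission
  imports Defs "HOL-Complex_Analysis.Contour_Integration"
begin

text \<open>
  Cocompactness on triples lets one blow up \<open>S\<close> by group elements, so every weak tangent of \<open>S\<close> is
  isometric to \<open>S - {a}\<close> for some \<open>a \<in> S\<close>, with the metric \<open>s |x - y| / (|x - a| |y - a|)\<close>. A
  quasisymmetry of weak tangents therefore extends to a homeomorphism \<open>f\<close> of \<open>S\<close> onto \<open>S'\<close>. By the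
  Jordan curve theorem the peripheral circles are the non-separating simple closed curves of a
  Schottky set, so \<open>f\<close> maps peripheral circles to peripheral circles.

  Draw \<open>S\<close> and \<open>S'\<close> in the plane so that a complementary disk and its partner become the exterior of
  the unit disk; let \<open>r\<^sub>i\<close>, \<open>r'\<^sub>i\<close> be the radii of the other disks in the two pictures. The width \<open>V\<close>
  of the pair of pictures is the integral of \<open>|f u - f v|\<close> over the vertical chords \<open>uv\<close> of the unit
  circle. Following a chord through the disks which it crosses gives
  \<open>V \<le> \<Sum>\<^sub>i r\<^sub>i r'\<^sub>i V\<^sub>i\<close>, where \<open>V\<^sub>i\<close> is the width after inversion in the \<open>i\<close>-th disk and its partner;
  porosity and quasisymmetry show that the rest of \<open>S\<close> contributes nothing. All widths are at most
  4, and by area \<open>\<Sum> r\<^sub>i\<^sup>2 \<le> 1\<close> and \<open>\<Sum> r'\<^sub>i\<^sup>2 \<le> 1\<close>. By Cauchy-Schwarz a pair of pictures of nearly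
  maximal width has \<open>r\<^sub>i \<approx> r'\<^sub>i\<close> for all \<open>i\<close>, and, iterating once more, the radii after one inversion
  nearly agree too. Renormalising by the groups and passing to an ultralimit produces pictures of \<open>S\<close>
  and \<open>S'\<close> for which these radii agree exactly. They determine the distances between the centres, so
  the two pictures differ by a Euclidean isometry, which is a Moebius map of \<open>S\<close> onto \<open>S'\<close>.
\<close>

section \<open>Ultralimits\<close>

text \<open>The map \<open>f\<close> lives on \<open>S\<close> only, so the image of a chord has to
  be controlled through disks alone. The part of a chord that meets no large disk is covered by
  small balls. Porosity puts near the centre of each a disk of comparable size, whose partner
  controls the oscillation of \<open>f\<close> there; the error becomes a sum of products
  \<open>r r'\<close> over disks outside a prescribed finite set, small by Cauchy-Schwarz. The point
  \<open>a\<close> where this control fails sits in one small ball. There is no reason for the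
  supremum of the widths to be attained, since pictures form a noncompact family. The two groups
  supply compactness, but they act independently, so \<open>f\<close> does not survive the limit:
  what survives is a bijection between disks together with radii. One generation of inversions gives
  equal radii only. The second gives the distances between centres, and the radius of the inverted
  outer disk gives their distances from 0. The final map is built from the disks and is not claimed
  to extend \<open>f\<close>. Limits are taken along an ultrafilter because uncountably many
  sequences, one for each point, must converge together.\<close>

definition ultra :: "'a filter \<Rightarrow> bool" where
  "ultra U \<longleftrightarrow> U \<noteq> bot \<and> (\<forall>P. eventually P U \<or> eventually (\<lambda>x. \<not> P x) U)"

text \<open>Zorn's lemma for families of sets that contain every tail of the naturals; the resulting
  filter refines \<open>sequentially\<close>, so ordinary limits persist along it.\<close>

lemma ultra_exists: "\<exists>U :: nat filter. ultra U \<and> U \<le> sequentially"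
proof -
  define C where "C = {A :: nat set set. {} \<notin> A \<and> (\<forall>X\<in>A. \<forall>Y\<in>A. X \<inter> Y \<in> A) \<and>
      (\<forall>X\<in>A. \<forall>Y. X \<subseteq> Y \<longrightarrow> Y \<in> A) \<and> (\<forall>n. {n..} \<in> A)}"
  have ne: "{X. \<exists>n. {n..} \<subseteq> X} \<in> C"
  proof -
    have "X \<inter> Y \<in> {X. \<exists>n::nat. {n..} \<subseteq> X}" if "{n..} \<subseteq> X" "{k..} \<subseteq> Y" for X Y n k
    proof -
      have "{max n k..} \<subseteq> X \<inter> Y" using that by auto
      then show ?thesis by blast
    qed
    then show ?thesis unfolding C_def by blast
  qed
  have "\<exists>M\<in>C. \<forall>X\<in>C. M \<subseteq> X \<longrightarrow> X = M"
  proof (rule subset_Zorn_nonempty)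
    show "C \<noteq> {}" using ne by auto
    fix K assume K: "K \<noteq> {}" "subset.chain C K"
    have KC: "K \<subseteq> C" and ch: "\<And>X Y. X \<in> K \<Longrightarrow> Y \<in> K \<Longrightarrow> X \<subseteq> Y \<or> Y \<subseteq> X"
      using K(2) unfolding subset.chain_def by auto
    have "X \<inter> Y \<in> \<Union>K" if "X \<in> A" "A \<in> K" "Y \<in> B" "B \<in> K" for X Y A B
    proof -
      have "\<exists>D\<in>K. X \<in> D \<and> Y \<in> D" using ch[of A B] that by blast
      then show ?thesis using KC unfolding C_def by blast
    qed
    then have 1: "\<forall>X\<in>\<Union>K. \<forall>Y\<in>\<Union>K. X \<inter> Y \<in> \<Union>K" by blast
    have KC': "{} \<notin> A" "\<And>X Y. X \<in> A \<Longrightarrow> X \<subseteq> Y \<Longrightarrow> Y \<in> A" "\<And>n. {n..} \<in> A" if "A \<in> K" for A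
      using KC that unfolding C_def by auto
    obtain A0 where A0: "A0 \<in> K" using K(1) by blast
    have 2: "{} \<notin> \<Union>K" using KC'(1) by blast
    have 3: "\<forall>X\<in>\<Union>K. \<forall>Y. X \<subseteq> Y \<longrightarrow> Y \<in> \<Union>K" using KC'(2) by blast
    have 4: "\<forall>n. {n..} \<in> \<Union>K" using KC'(3)[OF A0] A0 by blast
    show "\<Union>K \<in> C" unfolding C_def using 1 2 3 4 by simp
  qed
  then obtain M where M: "M \<in> C" and max: "\<And>X. X \<in> C \<Longrightarrow> M \<subseteq> X \<Longrightarrow> X = M" by blast
  have M1: "{} \<notin> M" "\<And>X Y. X \<in> M \<Longrightarrow> Y \<in> M \<Longrightarrow> X \<inter> Y \<in> M"
    "\<And>X Y. X \<in> M \<Longrightarrow> X \<subseteq> Y \<Longrightarrow> Y \<in> M" "\<And>n. {n..} \<in> M"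
    using M unfolding C_def by blast+
  have dich: "X \<in> M \<or> - X \<in> M" for X
  proof (rule ccontr)
    assume H: "\<not> (X \<in> M \<or> - X \<in> M)"
    \<comment> \<open>The family generated by \<open>M\<close> and \<open>X\<close>. It omits the
      empty set, because \<open>Y \<inter> X = {}\<close> with \<open>Y \<in> M\<close> would put
      \<open>- X\<close> into \<open>M\<close>.\<close>
    let ?N = "{Z. \<exists>Y\<in>M. Y \<inter> X \<subseteq> Z}"
    have "{} \<notin> ?N" using H M1(3) by blast
    moreover have "A \<inter> B \<in> ?N" if "A \<in> ?N" "B \<in> ?N" for A B
    proof -
      obtain Y Y' where "Y \<in> M" "Y' \<in> M" "Y \<inter> X \<subseteq> A" "Y' \<inter> X \<subseteq> B" using \<open>A \<in> ?N\<close> \<open>B \<in> ?N\<close> by blast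
      moreover have "Y \<inter> Y' \<in> M" using calculation M1(2) by blast
      ultimately show ?thesis by blast
    qed
    moreover have "\<forall>A\<in>?N. \<forall>B. A \<subseteq> B \<longrightarrow> B \<in> ?N" by blast
    moreover have "\<forall>n. {n..} \<in> ?N" using M1(4) by blast
    ultimately have "?N \<in> C" unfolding C_def by simp
    moreover have "M \<subseteq> ?N" by blast
    ultimately have "?N = M" using max by blast
    moreover have "X \<in> ?N" using M1(4) by blast
    ultimately show False using H by blast
  qed
  define U where "U = Abs_filter (\<lambda>P. Collect P \<in> M)"
  have "is_filter (\<lambda>P. Collect P \<in> M)"
  proof
    show "Collect (\<lambda>x. True) \<in> M" using M1(3)[OF M1(4)[of 0]] by auto
    show "Collect (\<lambda>x. P x \<and> Q x) \<in> M" if "Collect P \<in> M" "Collect Q \<in> M" for P Q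
      using M1(2)[OF that] by (simp add: Collect_conj_eq)
    show "\<forall>x. P x \<longrightarrow> Q x \<Longrightarrow> Collect P \<in> M \<Longrightarrow> Collect Q \<in> M" for P Q
      using M1(3)[of "Collect P" "Collect Q"] by blast
  qed
  then have ev: "eventually P U \<longleftrightarrow> Collect P \<in> M" for P
    unfolding U_def by (rule eventually_Abs_filter)
  have "ultra U"
    unfolding ultra_def
  proof (intro conjI allI)
    show "U \<noteq> bot" using ev[of "\<lambda>_. False"] M1(1) by (auto simp: trivial_limit_def)
    show "eventually P U \<or> (\<forall>\<^sub>F x in U. \<not> P x)" for P
      using dich[of "Collect P"] by (simp add: ev Collect_neg_eq)
  qed
  moreover have "U \<le> sequentially"
  proof (rule filter_leI)
    fix P assume "eventually P sequentially"
    then obtain n where "{n..} \<subseteq> Collect P" by (auto simp: eventually_sequentially)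
    then show "eventually P U" unfolding ev using M1(3)[OF M1(4)] by blast
  qed
  ultimately show ?thesis by blast
qed

text \<open>Compactness gives a cluster point of the image filter. Along an ultrafilter a
  neighbourhood of it is either eventually entered or eventually avoided, and a cluster point
  excludes the second.\<close>

lemma ultra_compact_limit:
  assumes "ultra U" "compact K" "eventually (\<lambda>n. x n \<in> K) U"
  shows "\<exists>l\<in>K. (x \<longlongrightarrow> l) U"
proof -
  have "filtermap x U \<noteq> bot" using assms(1) by (simp add: ultra_def filtermap_bot_iff)
  moreover have "eventually (\<lambda>y. y \<in> K) (filtermap x U)" using assms(3) by (simp add: eventually_filtermap)
  ultimately obtain l where l: "l \<in> K" "inf (nhds l) (filtermap x U) \<noteq> bot"
    using assms(2) unfolding compact_filter by blast
  have "(x \<longlongrightarrow> l) U"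
  proof (rule topological_tendstoI)
    fix T assume T: "open T" "l \<in> T"
    show "eventually (\<lambda>n. x n \<in> T) U"
    proof (rule ccontr)
      assume "\<not> ?thesis"
      then have "eventually (\<lambda>n. x n \<notin> T) U" using assms(1) unfolding ultra_def by blast
      then have "eventually (\<lambda>y. y \<notin> T) (filtermap x U)" by (simp add: eventually_filtermap)
      moreover have "eventually (\<lambda>y. y \<in> T) (nhds l)" using T by (simp add: eventually_nhds) blast
      ultimately have "eventually (\<lambda>_. False) (inf (nhds l) (filtermap x U))"
        unfolding eventually_inf by (metis (mono_tags, lifting))
      then show False using l(2) by (simp add: trivial_limit_def)
    qed
  qed
  then show ?thesis using l(1) by blast
qed

text \<open>The discrete counterpart, used to freeze choices of disks that vary with
  \<open>n\<close>.\<close>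

lemma ultra_finite_limit:
  assumes "ultra U" "finite A" "eventually (\<lambda>n. x n \<in> A) U"
  shows "\<exists>a\<in>A. eventually (\<lambda>n. x n = a) U"
proof (rule ccontr)
  assume "\<not> ?thesis"
  then have "\<forall>a\<in>A. eventually (\<lambda>n. x n \<noteq> a) U" using assms(1) unfolding ultra_def by blast
  then have "eventually (\<lambda>n. \<forall>a\<in>A. x n \<noteq> a) U" using assms(2) by (simp add: eventually_ball_finite)
  with assms(3) have "eventually (\<lambda>n. False) U" by eventually_elim auto
  then show False using assms(1) by (simp add: ultra_def trivial_limit_def)
qed

section \<open>Moebius maps of the sphere\<close>

text \<open>Moebius maps are the bijections of the sphere which distort distances by \<open>w x w y\<close>. Unlike the
  inductive definition by reflections, this form is stable under limits.\<close>
definition Mob :: "(R3 \<Rightarrow> R3) \<Rightarrow> bool" where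
  "Mob F \<longleftrightarrow> bij_betw F S2 S2 \<and>
     (\<exists>w. (\<forall>x\<in>S2. w x > 0) \<and> (\<forall>x\<in>S2. \<forall>y\<in>S2. dist (F x) (F y) = w x * w y * dist x y))"

lemma arcosh_eqD: "arcosh x = arcosh y \<Longrightarrow> 1 \<le> x \<Longrightarrow> 1 \<le> y \<Longrightarrow> x = (y::real)"
  by (metis cosh_arcosh_real)

text \<open>The hyperbolic distance is a function of |x - y|^2 / ((1 - |x|^2)(1 - |y|^2)), so an
  isometry preserves this quotient. \<open>W\<close> is the conformal factor of \<open>g\<close>;
  its explicit formula stays continuous and positive up to the unit sphere, which gives control at
  the boundary.\<close>

lemma hyp_isometry_weight:
  assumes "hyp_isometry g"
  obtains W where "continuous_on (cball 0 1) W" "\<And>x. x \<in> cball 0 1 \<Longrightarrow> W x > 0"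
    "\<And>x y. x \<in> H3 \<Longrightarrow> y \<in> H3 \<Longrightarrow> (dist (g x) (g y))\<^sup>2 = W x * W y * (dist x y)\<^sup>2"
    "\<And>x. x \<in> H3 \<Longrightarrow> 1 - (norm (g x))\<^sup>2 = W x * (1 - (norm x)\<^sup>2)"
proof -
  define N where "N x = 1 - (norm x)\<^sup>2" for x :: R3
  have bij: "bij_betw g H3 H3" and iso: "\<And>x y. x \<in> H3 \<Longrightarrow> y \<in> H3 \<Longrightarrow> hdist (g x) (g y) = hdist x y"
    using assms unfolding hyp_isometry_def by auto
  have gH: "g x \<in> H3" if "x \<in> H3" for x using bij that bij_betwE by blast
  have Npos: "N x > 0" if "x \<in> H3" for x
  proof -
    have "norm x < 1" using that by (simp add: H3_def)
    then have "(norm x)\<^sup>2 < 1" by (simp add: abs_square_less_1)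
    then show ?thesis by (simp add: N_def)
  qed
  have key: "(dist (g x) (g y))\<^sup>2 / (N (g x) * N (g y)) = (dist x y)\<^sup>2 / (N x * N y)"
    if "x \<in> H3" "y \<in> H3" for x y
  proof -
    have "1 + 2 * (norm (g x - g y))\<^sup>2 / (N (g x) * N (g y)) = 1 + 2 * (norm (x - y))\<^sup>2 / (N x * N y)"
    proof (rule arcosh_eqD)
      show "arcosh (1 + 2 * (norm (g x - g y))\<^sup>2 / (N (g x) * N (g y))) = arcosh (1 + 2 * (norm (x - y))\<^sup>2 / (N x * N y))"
        using iso[OF that] unfolding hdist_def N_def .
      have "N (g x) * N (g y) \<ge> 0" "N x * N y \<ge> 0"
        using Npos that gH by (auto intro!: mult_nonneg_nonneg less_imp_le)
      then show "1 \<le> 1 + 2 * (norm (g x - g y))\<^sup>2 / (N (g x) * N (g y))" "1 \<le> 1 + 2 * (norm (x - y))\<^sup>2 / (N x * N y)"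
        by simp_all
    qed
    then show ?thesis by (simp add: dist_norm)
  qed
  have "0 \<in> H3" by (simp add: H3_def)
  then obtain b where b: "b \<in> H3" "g b = 0" using bij by (metis bij_betw_def imageE)
  define W where "W x = 1 / (N x + (dist x b)\<^sup>2 / N b)" for x
  have Nb: "N b > 0" using Npos b by simp
  have Wden: "N x + (dist x b)\<^sup>2 / N b > 0" if "x \<in> cball 0 1" for x
  proof (cases "x = b")
    case True then show ?thesis using Nb by simp
  next
    case False
    have "norm x \<le> 1" using that by simp
    then have "N x \<ge> 0" by (simp add: N_def power_le_one)
    moreover have "(dist x b)\<^sup>2 / N b > 0" using False Nb by simp
    ultimately show ?thesis by linarith
  qed
  have 1: "continuous_on (cball 0 1) W"
  proof -
    have "continuous_on (cball 0 1) (\<lambda>x. N x + (dist x b)\<^sup>2 / N b)"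
      unfolding N_def divide_inverse by (intro continuous_intros)
    then show ?thesis unfolding W_def using Wden
      by (intro continuous_on_divide continuous_on_const) (auto simp: less_le)
  qed
  have 2: "W x > 0" if "x \<in> cball 0 1" for x using Wden[OF that] by (simp add: W_def)
  have NW: "N (g x) = W x * N x" if x: "x \<in> H3" for x
  proof -
    let ?s = "(dist x b)\<^sup>2 / (N x * N b)"
    have "(norm (g x))\<^sup>2 / N (g x) = ?s" using key[OF x b(1)] by (simp add: b(2) N_def)
    then have "(norm (g x))\<^sup>2 = ?s * N (g x)" using Npos[OF gH[OF x]] by (simp add: field_simps)
    then have "N (g x) * (1 + ?s) = 1" unfolding N_def by (simp add: algebra_simps)
    moreover have "1 + ?s = (N x + (dist x b)\<^sup>2 / N b) / N x" using Npos[OF x] Nb by (simp add: field_simps)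
    ultimately have "N (g x) * ((N x + (dist x b)\<^sup>2 / N b) / N x) = 1" by simp
    moreover have "N x + (dist x b)\<^sup>2 / N b > 0" using Wden x by (simp add: H3_def)
    ultimately show ?thesis unfolding W_def using Npos[OF x] by (simp add: field_simps)
  qed
  have 3: "(dist (g x) (g y))\<^sup>2 = W x * W y * (dist x y)\<^sup>2" if "x \<in> H3" "y \<in> H3" for x y
  proof -
    have p: "N x > 0" "N y > 0" "W x > 0" "W y > 0" using Npos 2 that by (auto simp: H3_def)
    have "(dist (g x) (g y))\<^sup>2 = (dist x y)\<^sup>2 / (N x * N y) * (N (g x) * N (g y))"
      using key[OF that] Npos[OF gH[OF that(1)]] Npos[OF gH[OF that(2)]] by (simp add: field_simps)
    then show ?thesis using p by (simp add: NW[OF that(1)] NW[OF that(2)] field_simps)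
  qed
  show ?thesis using that[OF 1 2 3] NW unfolding N_def by blast
qed

text \<open>Boundedness of \<open>W\<close> makes \<open>g\<close> Lipschitz on the open ball, so
  \<open>g\<close> extends; the identities for \<open>W\<close> pass to the boundary one variable at
  a time. The weight on the sphere is the square root of \<open>W\<close>, since weights enter
  distances unsquared.\<close>

lemma bext_weight:
  assumes "hyp_isometry g"
  shows "\<xi> \<in> S2 \<Longrightarrow> (g \<longlongrightarrow> bext g \<xi>) (at \<xi> within H3)"
    and "\<xi> \<in> S2 \<Longrightarrow> bext g \<xi> \<in> S2"
    and "\<exists>w. (\<forall>x\<in>S2. w x > 0) \<and> (\<forall>x\<in>S2. \<forall>y\<in>S2. dist (bext g x) (bext g y) = w x * w y * dist x y)"
proof -
  obtain W where cW: "continuous_on (cball 0 1) W" and Wp: "\<And>x. x \<in> cball 0 1 \<Longrightarrow> W x > 0"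
    and Wd: "\<And>x y. x \<in> H3 \<Longrightarrow> y \<in> H3 \<Longrightarrow> (dist (g x) (g y))\<^sup>2 = W x * W y * (dist x y)\<^sup>2"
    and Wn: "\<And>x. x \<in> H3 \<Longrightarrow> 1 - (norm (g x))\<^sup>2 = W x * (1 - (norm x)\<^sup>2)"
    using hyp_isometry_weight[OF assms] by metis
  obtain M where M: "\<And>x. x \<in> cball 0 1 \<Longrightarrow> W x \<le> M"
  proof -
    have "bounded (W ` cball 0 1)" using cW compact_cball compact_continuous_image compact_imp_bounded by blast
    then show ?thesis using that unfolding bounded_iff
      by (metis abs_le_D1 imageI real_norm_def)
  qed
  have H3c: "x \<in> H3 \<Longrightarrow> x \<in> cball 0 1" for x by (simp add: H3_def)
  have S2c: "x \<in> S2 \<Longrightarrow> x \<in> cball 0 1" for x by (simp add: S2_def)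
  have Mp: "M > 0" using M[of 0] Wp[of 0] by simp
  have lip: "dist (g x) (g y) \<le> M * dist x y" if "x \<in> H3" "y \<in> H3" for x y
  proof (rule power2_le_imp_le)
    have "W x * W y \<le> M * M" using M[OF H3c] Wp[OF H3c] that Mp by (intro mult_mono) (auto intro: less_imp_le)
    then show "(dist (g x) (g y))\<^sup>2 \<le> (M * dist x y)\<^sup>2"
      unfolding Wd[OF that] power_mult_distrib by (simp add: power2_eq_square mult_right_mono)
    show "0 \<le> M * dist x y" using Mp by simp
  qed
  have uc: "uniformly_continuous_on H3 g"
    unfolding uniformly_continuous_on_def
  proof (intro allI impI)
    fix e :: real assume e: "e > 0"
    show "\<exists>d>0. \<forall>x\<in>H3. \<forall>x'\<in>H3. dist x' x < d \<longrightarrow> dist (g x') (g x) < e"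
    proof (intro exI[of _ "e/M"] conjI ballI impI)
      show "e / M > 0" using e Mp by simp
      fix x x' assume H: "x \<in> H3" "x' \<in> H3" "dist x' x < e / M"
      have "dist (g x') (g x) \<le> M * dist x' x" using lip H by blast
      also have "\<dots> < e" using H(3) Mp by (simp add: field_simps)
      finally show "dist (g x') (g x) < e" .
    qed
  qed
  have clos: "\<xi> \<in> closure H3" if "\<xi> \<in> S2" for \<xi> using that by (simp add: H3_def S2_def)
  have nb: "at \<xi> within H3 \<noteq> bot" if "\<xi> \<in> S2" for \<xi>
  proof -
    have "\<xi> \<notin> H3" using that by (simp add: H3_def S2_def)
    then show ?thesis using clos[OF that] by (simp add: at_within_eq_bot_iff)
  qed
  have lim: "(g \<longlongrightarrow> bext g \<xi>) (at \<xi> within H3)" if x: "\<xi> \<in> S2" for \<xi>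
  proof -
    obtain l where "(g \<longlongrightarrow> l) (at \<xi> within H3)"
      using uniformly_continuous_on_extension_at_closure[OF uc clos[OF x]] by blast
    then show ?thesis unfolding bext_def using tendsto_Lim[OF nb[OF x]] by metis
  qed
  show "(g \<longlongrightarrow> bext g \<xi>) (at \<xi> within H3)" if x: "\<xi> \<in> S2" for \<xi> using lim that .
  have Wlim: "(W \<longlongrightarrow> W \<xi>) (at \<xi> within H3)" if "\<xi> \<in> S2" for \<xi>
    using cW S2c[OF that] unfolding continuous_on_def
    by (metis H3c subsetI tendsto_within_subset)
  have ev: "eventually (\<lambda>x. x \<in> H3) (at \<xi> within H3)" for \<xi> by (simp add: eventually_at_filter)
  show "bext g \<xi> \<in> S2" if x: "\<xi> \<in> S2" for \<xi>
  proof -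
    have "((\<lambda>x. 1 - (norm (g x))\<^sup>2) \<longlongrightarrow> 1 - (norm (bext g \<xi>))\<^sup>2) (at \<xi> within H3)"
      by (intro tendsto_intros lim x)
    moreover have "((\<lambda>x. W x * (1 - (norm x)\<^sup>2)) \<longlongrightarrow> W \<xi> * (1 - (norm \<xi>)\<^sup>2)) (at \<xi> within H3)"
      by (intro tendsto_intros Wlim x)
    then have "((\<lambda>x. 1 - (norm (g x))\<^sup>2) \<longlongrightarrow> W \<xi> * (1 - (norm \<xi>)\<^sup>2)) (at \<xi> within H3)"
      by (rule Lim_transform_eventually) (use ev[of \<xi>] in \<open>eventually_elim, simp add: Wn\<close>)
    ultimately have "1 - (norm (bext g \<xi>))\<^sup>2 = W \<xi> * (1 - (norm \<xi>)\<^sup>2)" using tendsto_unique[OF nb[OF x]] by blast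
    also have "\<dots> = 0" using x by (simp add: S2_def)
    finally have "(norm (bext g \<xi>))\<^sup>2 = 1" by simp
    then show ?thesis by (simp add: S2_def power2_eq_1_iff)
      (metis abs_norm_cancel one_neq_neg_one norm_not_less_zero zero_less_one neg_less_0_iff_less)
  qed
  have d1: "(dist (bext g \<xi>) (g y))\<^sup>2 = W \<xi> * W y * (dist \<xi> y)\<^sup>2" if x: "\<xi> \<in> S2" and y: "y \<in> H3" for \<xi> y
  proof -
    have "((\<lambda>x. (dist (g x) (g y))\<^sup>2) \<longlongrightarrow> (dist (bext g \<xi>) (g y))\<^sup>2) (at \<xi> within H3)"
      by (intro tendsto_intros lim x)
    moreover have "((\<lambda>x. W x * W y * (dist x y)\<^sup>2) \<longlongrightarrow> W \<xi> * W y * (dist \<xi> y)\<^sup>2) (at \<xi> within H3)"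
      by (intro tendsto_intros Wlim x)
    then have "((\<lambda>x. (dist (g x) (g y))\<^sup>2) \<longlongrightarrow> W \<xi> * W y * (dist \<xi> y)\<^sup>2) (at \<xi> within H3)"
      by (rule Lim_transform_eventually) (use ev[of \<xi>] in \<open>eventually_elim, simp add: Wd y\<close>)
    ultimately show ?thesis using tendsto_unique[OF nb[OF x]] by blast
  qed
  have d2: "(dist (bext g \<xi>) (bext g y))\<^sup>2 = W \<xi> * W y * (dist \<xi> y)\<^sup>2" if x: "\<xi> \<in> S2" and y: "y \<in> S2" for \<xi> y
  proof -
    have "((\<lambda>z. (dist (bext g \<xi>) (g z))\<^sup>2) \<longlongrightarrow> (dist (bext g \<xi>) (bext g y))\<^sup>2) (at y within H3)"
      by (intro tendsto_intros lim y)
    moreover have "((\<lambda>z. W \<xi> * W z * (dist \<xi> z)\<^sup>2) \<longlongrightarrow> W \<xi> * W y * (dist \<xi> y)\<^sup>2) (at y within H3)"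
      by (intro tendsto_intros Wlim y)
    then have "((\<lambda>z. (dist (bext g \<xi>) (g z))\<^sup>2) \<longlongrightarrow> W \<xi> * W y * (dist \<xi> y)\<^sup>2) (at y within H3)"
      by (rule Lim_transform_eventually) (use ev[of y] in \<open>eventually_elim, simp add: d1 x\<close>)
    ultimately show ?thesis using tendsto_unique[OF nb[OF y]] by blast
  qed
  show "\<exists>w. (\<forall>x\<in>S2. w x > 0) \<and> (\<forall>x\<in>S2. \<forall>y\<in>S2. dist (bext g x) (bext g y) = w x * w y * dist x y)"
  proof (intro exI[of _ "\<lambda>x. sqrt (W x)"] conjI ballI)
    fix x assume x: "x \<in> S2"
    show "sqrt (W x) > 0" using Wp S2c x by simp
    fix y assume y: "y \<in> S2"
    have "dist (bext g x) (bext g y) = sqrt ((dist (bext g x) (bext g y))\<^sup>2)" by simp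
    also have "\<dots> = sqrt (W x) * sqrt (W y) * dist x y"
      unfolding d2[OF x y] by (simp add: real_sqrt_mult)
    finally show "dist (bext g x) (bext g y) = sqrt (W x) * sqrt (W y) * dist x y" .
  qed
qed

lemma bext_inverse:
  assumes g: "hyp_isometry g" and h: "hyp_isometry h" and id: "g \<circ> h = id" and x: "\<xi> \<in> S2"
  shows "bext g (bext h \<xi>) = \<xi>"
proof -
  have hx: "bext h \<xi> \<in> S2" using bext_weight(2)[OF h x] .
  have lh: "(h \<longlongrightarrow> bext h \<xi>) (at \<xi> within H3)" using bext_weight(1)[OF h x] .
  have "eventually (\<lambda>x. x \<in> H3) (at \<xi> within H3)" by (simp add: eventually_at_filter)
  then have "eventually (\<lambda>x. h x \<in> H3 \<and> h x \<noteq> bext h \<xi>) (at \<xi> within H3)"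
  proof eventually_elim
    case (elim x)
    have "h x \<in> H3" using h elim unfolding hyp_isometry_def by (metis bij_betwE)
    moreover have "bext h \<xi> \<notin> H3" using hx by (simp add: S2_def H3_def)
    ultimately show ?case by auto
  qed
  then have "filterlim h (at (bext h \<xi>) within H3) (at \<xi> within H3)"
    using lh by (simp add: filterlim_at)
  then have "((\<lambda>x. g (h x)) \<longlongrightarrow> bext g (bext h \<xi>)) (at \<xi> within H3)"
    using filterlim_compose[OF bext_weight(1)[OF g hx]] by blast
  then have "((\<lambda>x. x) \<longlongrightarrow> bext g (bext h \<xi>)) (at \<xi> within H3)"
    using id by (simp add: fun_eq_iff)
  moreover have "((\<lambda>x. x) \<longlongrightarrow> \<xi>) (at \<xi> within H3)" by (rule tendsto_ident_at)
  moreover have "at \<xi> within H3 \<noteq> bot"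
    using x by (simp add: at_within_eq_bot_iff H3_def S2_def)
  ultimately show ?thesis using tendsto_unique by blast
qed

text \<open>The group axioms as encoded give a right inverse. Injectivity of the boundary map, read
  off from the weights, makes it two-sided on the sphere.\<close>

lemma isometry_group_bext:
  assumes "isometry_group G" "g \<in> G"
  shows "Mob (bext g)" and "\<exists>h\<in>G. \<forall>x\<in>S2. bext g (bext h x) = x \<and> bext h (bext g x) = x"
proof -
  have hyp: "\<And>g. g \<in> G \<Longrightarrow> hyp_isometry g" and inv: "\<And>g. g \<in> G \<Longrightarrow> \<exists>h\<in>G. g \<circ> h = id"
    using assms(1) unfolding isometry_group_def by auto
  obtain h where h: "h \<in> G" "g \<circ> h = id" using inv assms(2) by blast
  have gh: "bext g (bext h x) = x" if "x \<in> S2" for x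
    using bext_inverse[OF hyp[OF assms(2)] hyp[OF h(1)] h(2) that] .
  have cl: "bext g x \<in> S2" "bext h x \<in> S2" if "x \<in> S2" for x
    using bext_weight(2)[OF hyp[OF assms(2)] that] bext_weight(2)[OF hyp[OF h(1)] that] by auto
  obtain w where w: "\<forall>x\<in>S2. w x > 0" "\<forall>x\<in>S2. \<forall>y\<in>S2. dist (bext g x) (bext g y) = w x * w y * dist x y"
    using bext_weight(3)[OF hyp[OF assms(2)]] by blast
  have inj: "inj_on (bext g) S2"
  proof (rule inj_onI)
    fix x y assume "x \<in> S2" "y \<in> S2" "bext g x = bext g y"
    then have "w x * w y * dist x y = 0" "w x > 0" "w y > 0" using w by force+
    then show "x = y" by auto
  qed
  have "bext g ` S2 = S2" using gh cl by force
  then show "Mob (bext g)" unfolding Mob_def bij_betw_def using inj w by blast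
  have "bext h (bext g x) = x" if "x \<in> S2" for x
    using inj gh cl that by (meson inj_onD)
  then show "\<exists>h\<in>G. \<forall>x\<in>S2. bext g (bext h x) = x \<and> bext h (bext g x) = x" using gh h(1) by blast
qed

section \<open>From weighted bijections of the sphere to compositions of reflections\<close>

lemma moebius_compose: "moebius f \<Longrightarrow> moebius g \<Longrightarrow> moebius (f \<circ> g)"
proof (induction rule: moebius.induct)
  case moebius_id then show ?case by simp
next
  case (moebius_comp f \<sigma>)
  then have "moebius (\<sigma> \<circ> (f \<circ> g))" using moebius.moebius_comp by blast
  then show ?case by (simp only: comp_assoc)
qed

text \<open>Reflection in the plane that bisects \<open>v\<close> and \<open>w\<close>; points
  equidistant from both stay fixed. For \<open>v = w\<close> there is no such plane and the identity
  serves.\<close>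

lemma plane_reflection_swap:
  fixes v w :: R3
  assumes "norm v = norm w"
  obtains R where "moebius R" "orthogonal_transformation R" "R v = w" "R \<circ> R = id"
    "\<And>x. x \<bullet> v = x \<bullet> w \<Longrightarrow> R x = x"
proof (cases "v = w")
  case True
  show ?thesis by (rule that[of id]) (auto simp: True moebius_id orthogonal_transformation_def linear_id)
next
  case False
  define u where "u = (v - w) /\<^sub>R norm (v - w)"
  have nu: "norm u = 1" using False by (simp add: u_def)
  then have uu: "u \<bullet> u = 1" by (simp add: norm_eq_1)
  define R where "R = (\<lambda>x. x - (2 * (x \<bullet> u)) *\<^sub>R u)"
  have "moebius (R \<circ> id)" by (rule moebius_comp[OF moebius_id]) (use nu in \<open>auto simp: circle_reflection_def R_def\<close>)
  then have 1: "moebius R" by simp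
  have lin: "linear R" unfolding R_def by (rule linearI) (auto simp: algebra_simps inner_add_left)
  have 2: "orthogonal_transformation R"
    unfolding orthogonal_transformation_def
  proof (intro conjI lin allI)
    fix x y show "R x \<bullet> R y = x \<bullet> y"
      unfolding R_def by (simp add: inner_diff_left inner_diff_right uu inner_commute)
  qed
  have 3: "R \<circ> R = id" by (rule ext) (simp add: R_def inner_diff_left uu algebra_simps)
  have 5: "R x = x" if "x \<bullet> v = x \<bullet> w" for x
    using that by (simp add: R_def u_def inner_diff_right)
  have vw: "v \<bullet> v = w \<bullet> w" using assms by (simp add: norm_eq)
  have "(norm (v - w))\<^sup>2 = 2 * (v \<bullet> (v - w))"
    unfolding power2_norm_eq_inner using vw by (simp add: inner_diff_left inner_diff_right inner_commute)
  then have "(2 * (v \<bullet> u)) *\<^sub>R u = v - w"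
  proof -
    assume "(norm (v - w))\<^sup>2 = 2 * (v \<bullet> (v - w))"
    moreover have "(2 * (v \<bullet> u)) *\<^sub>R u = (2 * (v \<bullet> (v - w)) / (norm (v - w))\<^sup>2) *\<^sub>R (v - w)"
      unfolding u_def power2_eq_square inner_scaleR_right scaleR_scaleR by (simp only: divide_inverse inverse_mult_distrib mult_ac)
    ultimately show ?thesis using False by (metis divide_self scaleR_one power_not_zero norm_eq_zero right_minus_eq)
  qed
  then have 4: "R v = w" by (simp add: R_def)
  show ?thesis by (rule that[OF 1 2 4 3 5])
qed

text \<open>Basis vectors are put back one at a time. A vector already restored has the same inner
  product with the next basis vector and with its image, hence the next reflection fixes it; after
  three steps the map is the identity.\<close>

lemma orthogonal_moebius:
  fixes T :: "R3 \<Rightarrow> R3"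
  assumes "orthogonal_transformation T"
  shows "moebius T"
proof -
  have step: "\<exists>R. moebius R \<and> R \<circ> R = id \<and> orthogonal_transformation (R \<circ> T) \<and> R (T (axis j 1)) = axis j 1 \<and>
     (\<forall>i. i \<noteq> j \<and> T (axis i 1) = axis i 1 \<longrightarrow> R (T (axis i 1)) = axis i 1)"
    if T: "orthogonal_transformation T" for T :: "R3 \<Rightarrow> R3" and j :: 3
  proof -
    have "norm (T (axis j 1)) = norm (axis j 1 :: R3)" using T by (simp add: orthogonal_transformation_norm)
    then obtain R where R: "moebius R" "orthogonal_transformation R" "R (T (axis j 1)) = axis j 1" "R \<circ> R = id"
        "\<And>x. x \<bullet> T (axis j 1) = x \<bullet> axis j 1 \<Longrightarrow> R x = x"
      using plane_reflection_swap by metis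
    have "R (T (axis i 1)) = axis i 1" if i: "i \<noteq> j" "T (axis i 1) = axis i 1" for i
    proof -
      have "T (axis i 1) \<bullet> T (axis j 1) = axis i 1 \<bullet> (axis j 1 :: R3)"
        using T unfolding orthogonal_transformation_def by blast
      then show ?thesis using R(5) i(2) by auto
    qed
    then show ?thesis using R orthogonal_transformation_compose[OF R(2) T] by blast
  qed
  obtain R1 where R1: "moebius R1" "R1 \<circ> R1 = id" "orthogonal_transformation (R1 \<circ> T)" "(R1 \<circ> T) (axis 1 1) = axis 1 1"
    using step[OF assms, of 1] by auto
  obtain R2 where R2: "moebius R2" "R2 \<circ> R2 = id" "orthogonal_transformation (R2 \<circ> (R1 \<circ> T))"
     "(R2 \<circ> (R1 \<circ> T)) (axis 2 1) = axis 2 1" "(R2 \<circ> (R1 \<circ> T)) (axis 1 1) = axis 1 1"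
    using step[OF R1(3), of 2] R1(4) by auto
  obtain R3 where R3: "moebius R3" "R3 \<circ> R3 = id" "orthogonal_transformation (R3 \<circ> (R2 \<circ> (R1 \<circ> T)))"
     "(R3 \<circ> (R2 \<circ> (R1 \<circ> T))) (axis 3 1) = axis 3 1" "(R3 \<circ> (R2 \<circ> (R1 \<circ> T))) (axis 2 1) = axis 2 1"
     "(R3 \<circ> (R2 \<circ> (R1 \<circ> T))) (axis 1 1) = axis 1 1"
    using step[OF R2(3), of 3] R2(4,5) by auto
  let ?Q = "R3 \<circ> (R2 \<circ> (R1 \<circ> T))"
  have "?Q = id"
  proof (rule linear_eq_stdbasis)
    show "linear ?Q" using R3(3) by (simp add: orthogonal_transformation_def)
    show "linear (id :: R3 \<Rightarrow> R3)" by (simp add: linear_id)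
    fix b :: R3 assume "b \<in> Basis"
    then obtain i where i: "b = axis i 1" by (auto simp: Basis_vec_def)
    show "?Q b = id b" using exhaust_3[of i] R3(4,5,6) by (auto simp: i)
  qed
  then have "R1 \<circ> (R2 \<circ> (R3 \<circ> (R3 \<circ> (R2 \<circ> (R1 \<circ> T))))) = R1 \<circ> (R2 \<circ> R3)" by simp
  then have "T = R1 \<circ> (R2 \<circ> R3)"
    using R1(2) R2(2) R3(2) by (simp add: comp_assoc[symmetric])
  then show ?thesis using moebius_compose R1(1) R2(1) R3(1) by metis
qed

text \<open>Squared distances from a point of the sphere to two antipodes add up to 4. Written for
  \<open>F x\<close> and the antipodes \<open>F q\<close>, \<open>- F q\<close> in terms of weights,
  this makes the reciprocal of the squared weight affine. The bound
  \<open>norm \<beta> < \<alpha>\<close> keeps the affine function positive on the closed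
  ball.\<close>

lemma Mob_weight_affine:
  assumes "Mob F"
  obtains w \<alpha> \<beta> where "\<And>x. x \<in> S2 \<Longrightarrow> w x > 0"
    "\<And>x y. x \<in> S2 \<Longrightarrow> y \<in> S2 \<Longrightarrow> dist (F x) (F y) = w x * w y * dist x y"
    "norm \<beta> < \<alpha>" "\<And>x. x \<in> S2 \<Longrightarrow> (w x)\<^sup>2 * (\<alpha> - \<beta> \<bullet> x) = 1"
proof -
  obtain w where bij: "bij_betw F S2 S2" and w: "\<And>x. x \<in> S2 \<Longrightarrow> w x > 0"
    "\<And>x y. x \<in> S2 \<Longrightarrow> y \<in> S2 \<Longrightarrow> dist (F x) (F y) = w x * w y * dist x y"
    using assms unfolding Mob_def by blast
  define q :: R3 where "q = axis 1 1"
  have q: "q \<in> S2" by (simp add: q_def S2_def)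
  have Fq: "F q \<in> S2" using bij q bij_betwE by blast
  then have "- F q \<in> S2" by (simp add: S2_def)
  then obtain y where y: "y \<in> S2" "F y = - F q" using bij by (metis bij_betw_def imageE)
  have qy: "q \<noteq> y"
  proof
    assume "q = y"
    then have "F q = - F q" using y(2) by simp
    then have "2 *\<^sub>R F q = 0" by (metis add.right_inverse scaleR_2)
    then have "F q = 0" by simp
    then show False using Fq by (simp add: S2_def)
  qed
  define A B where "A = (w q)\<^sup>2" and "B = (w y)\<^sup>2"
  have AB: "A > 0" "B > 0" using w(1)[OF q] w(1)[OF y(1)] by (auto simp: A_def B_def)
  have sq: "(dist x z)\<^sup>2 = 2 - 2 * (x \<bullet> z)" if "x \<in> S2" "z \<in> S2" for x z
    using that unfolding dist_norm power2_norm_eq_inner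
    by (simp add: S2_def norm_eq_1 inner_diff_left inner_diff_right inner_commute)
  have main: "(w x)\<^sup>2 * ((A + B) / 2 - ((A / 2) *\<^sub>R q + (B / 2) *\<^sub>R y) \<bullet> x) = 1" if x: "x \<in> S2" for x
  proof -
    have Fx: "F x \<in> S2" using bij x bij_betwE by blast
    have "(dist (F x) (F q))\<^sup>2 + (dist (F x) (F y))\<^sup>2 = 4"
      using sq[OF Fx Fq] sq[OF Fx, of "F y"] y(2) \<open>- F q \<in> S2\<close> by simp
    moreover have "(dist (F x) (F q))\<^sup>2 = (w x)\<^sup>2 * (A * (2 - 2 * (x \<bullet> q)))"
      unfolding w(2)[OF x q] power_mult_distrib A_def sq[OF x q] by simp
    moreover have "(dist (F x) (F y))\<^sup>2 = (w x)\<^sup>2 * (B * (2 - 2 * (x \<bullet> y)))"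
      unfolding w(2)[OF x y(1)] power_mult_distrib B_def sq[OF x y(1)] by simp
    ultimately have "(w x)\<^sup>2 * (A * (2 - 2 * (x \<bullet> q))) + (w x)\<^sup>2 * (B * (2 - 2 * (x \<bullet> y))) = 4" by simp
    then show ?thesis by (simp add: inner_add_left inner_commute algebra_simps)
  qed
  have "norm ((A / 2) *\<^sub>R q + (B / 2) *\<^sub>R y) < (A + B) / 2"
  proof (rule power2_less_imp_less)
    have "q \<bullet> y < 1" using sq[OF q y(1)] qy by (smt (verit) zero_less_dist_iff zero_less_power)
    then have "A * B * (q \<bullet> y) < A * B * 1" using AB by (intro mult_strict_left_mono) auto
    then show "(norm ((A / 2) *\<^sub>R q + (B / 2) *\<^sub>R y))\<^sup>2 < ((A + B) / 2)\<^sup>2"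
      unfolding power2_norm_eq_inner using q y(1)
      by (simp add: S2_def norm_eq_1 inner_add_left inner_add_right inner_commute power2_eq_square field_simps)
    show "0 \<le> (A + B) / 2" using AB by simp
  qed
  then show ?thesis using that[of w] w main by blast
qed

text \<open>A similarity of the unit sphere onto itself has factor 1, because pairs at the maximal
  distance 2 exist in the source as well as in the image. An isometry of the sphere is
  orthogonal.\<close>

lemma Mob_constant_weight_moebius:
  assumes F: "\<And>x. x \<in> S2 \<Longrightarrow> F x \<in> S2" "F ` S2 = S2"
    and c: "c \<ge> 0" "\<And>x y. x \<in> S2 \<Longrightarrow> y \<in> S2 \<Longrightarrow> dist (F x) (F y) = c * dist x y"
  obtains f where "moebius f" "\<And>x. x \<in> S2 \<Longrightarrow> f x = F x"
proof -
  have le2: "dist x y \<le> 2" if "x \<in> S2" "y \<in> S2" for x y :: R3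
  proof -
    have "dist x y \<le> norm x + norm y" by (simp add: dist_norm norm_triangle_ineq4)
    then show ?thesis using that by (simp add: S2_def)
  qed
  define q :: R3 where "q = axis 1 1"
  have q: "q \<in> S2" "- q \<in> S2" by (auto simp: q_def S2_def)
  have d2: "dist q (- q) = 2"
  proof -
    have "dist q (- q) = norm (2 *\<^sub>R q)" by (simp add: dist_norm scaleR_2)
    then show ?thesis using q(1) by (simp add: S2_def)
  qed
  have "c * 2 \<le> 2" using le2[OF F(1)[OF q(1)] F(1)[OF q(2)]] c(2)[OF q] d2 by simp
  moreover obtain a b where ab: "a \<in> S2" "b \<in> S2" "F a = q" "F b = - q" using q F(2) by (metis imageE)
  have "2 = c * dist a b" using c(2)[OF ab(1,2)] ab d2 by simp
  then have "2 \<le> c * 2" using le2[OF ab(1,2)] c(1) by (metis mult_left_mono)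
  ultimately have "c = 1" by simp
  then have "\<exists>g. orthogonal_transformation g \<and> (\<forall>x. norm x = 1 \<longrightarrow> g x = F x)"
    using F(1) c(2) by (intro isometry_sphere_extend) (auto simp: S2_def)
  then show ?thesis using orthogonal_moebius that by (auto simp: S2_def)
qed

text \<open>The condition on \<open>a\<close> says that the sphere of inversion is orthogonal to the
  unit sphere. The last identity exhibits the weight \<open>r / dist x a\<close>, the model for
  every nonconstant weight.\<close>

lemma sphere_inversion:
  fixes a :: R3
  assumes "r > 0" "(norm a)\<^sup>2 = 1 + r\<^sup>2"
    and \<sigma>_def: "\<sigma> = (\<lambda>x. a + (r\<^sup>2 / (norm (x - a))\<^sup>2) *\<^sub>R (x - a))"
  shows "moebius \<sigma>" and "x \<in> S2 \<Longrightarrow> x \<noteq> a" and "x \<in> S2 \<Longrightarrow> \<sigma> x \<in> S2" and "x \<in> S2 \<Longrightarrow> \<sigma> (\<sigma> x) = x"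
    and "x \<in> S2 \<Longrightarrow> dist (\<sigma> x) a * dist x a = r\<^sup>2"
    and "x \<in> S2 \<Longrightarrow> y \<in> S2 \<Longrightarrow> dist (\<sigma> x) (\<sigma> y) = r\<^sup>2 / (dist x a * dist y a) * dist x y"
proof -
  have "moebius (\<sigma> \<circ> id)" using assms unfolding \<sigma>_def
    by (intro moebius_comp[OF moebius_id]) (auto simp: circle_reflection_def)
  then show "moebius \<sigma>" by simp
  have na: "norm a \<noteq> 1" using assms by auto
  show xa: "x \<in> S2 \<Longrightarrow> x \<noteq> a" for x using na by (auto simp: S2_def)
  have d: "norm (\<sigma> x - a) = r\<^sup>2 / norm (x - a)" if "x \<in> S2" for x
    using xa[OF that] by (simp add: \<sigma>_def power2_eq_square)
  show "dist (\<sigma> x) a * dist x a = r\<^sup>2" if "x \<in> S2" for x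
    using xa[OF that] d[OF that] by (simp add: dist_norm)
  have aa: "a \<bullet> a = 1 + r\<^sup>2" using assms by (simp add: power2_norm_eq_inner)
  show "\<sigma> x \<in> S2" if x: "x \<in> S2" for x
  proof -
    have xx: "x \<bullet> x = 1" using x by (simp add: S2_def norm_eq_1)
    define t where "t = r\<^sup>2 / (norm (x - a))\<^sup>2"
    have n2: "(norm (x - a))\<^sup>2 = 2 + r\<^sup>2 - 2 * (x \<bullet> a)"
      unfolding power2_norm_eq_inner by (simp add: inner_diff_left inner_diff_right inner_commute aa xx)
    have np: "(norm (x - a))\<^sup>2 > 0" using xa[OF x] by simp
    have t: "t * (norm (x - a))\<^sup>2 = r\<^sup>2" using np unfolding t_def by simp
    have "(norm (a + t *\<^sub>R v))\<^sup>2 = a \<bullet> a + 2 * t * (a \<bullet> v) + t * (t * (norm v)\<^sup>2)" for v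
      unfolding power2_norm_eq_inner by (simp add: inner_add_left inner_add_right inner_commute)
    then have "(norm (\<sigma> x))\<^sup>2 = a \<bullet> a + 2 * t * (a \<bullet> (x - a)) + t * (t * (norm (x - a))\<^sup>2)"
      unfolding \<sigma>_def t_def[symmetric] by blast
    also have "a \<bullet> (x - a) = x \<bullet> a - 1 - r\<^sup>2" by (simp add: inner_diff_right aa inner_commute)
    also have "x \<bullet> a = (2 + r\<^sup>2 - (norm (x - a))\<^sup>2) / 2" using n2 by simp
    finally have "(norm (\<sigma> x))\<^sup>2 = 1 + r\<^sup>2 - t * r\<^sup>2 - t * (norm (x - a))\<^sup>2 + t * (t * (norm (x - a))\<^sup>2)"
      by (simp add: aa field_simps)
    then have "(norm (\<sigma> x))\<^sup>2 = 1" unfolding t by simp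
    then show ?thesis by (simp add: S2_def power2_eq_1_iff) (smt (verit) norm_ge_zero)
  qed
  show "\<sigma> (\<sigma> x) = x" if x: "x \<in> S2" for x
  proof -
    have "\<sigma> x - a = (r\<^sup>2 / (norm (x - a))\<^sup>2) *\<^sub>R (x - a)" by (simp add: \<sigma>_def)
    then have "\<sigma> (\<sigma> x) = a + (r\<^sup>2 / (r\<^sup>2 / norm (x - a))\<^sup>2 * (r\<^sup>2 / (norm (x - a))\<^sup>2)) *\<^sub>R (x - a)"
      using d[OF x] by (simp add: \<sigma>_def)
    also have "r\<^sup>2 / (r\<^sup>2 / norm (x - a))\<^sup>2 * (r\<^sup>2 / (norm (x - a))\<^sup>2) = 1"
      using xa[OF x] assms(1) by (simp add: field_simps power2_eq_square)
    finally show ?thesis by simp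
  qed
  show "dist (\<sigma> x) (\<sigma> y) = r\<^sup>2 / (dist x a * dist y a) * dist x y" if x: "x \<in> S2" and y: "y \<in> S2" for x y
  proof (rule power2_eq_imp_eq)
    define X Y where "X = x - a" and "Y = y - a"
    have p: "norm X > 0" "norm Y > 0" using xa x y by (auto simp: X_def Y_def)
    have "(dist (\<sigma> x) (\<sigma> y))\<^sup>2 = (norm ((r\<^sup>2 / (norm X)\<^sup>2) *\<^sub>R X - (r\<^sup>2 / (norm Y)\<^sup>2) *\<^sub>R Y))\<^sup>2"
      by (simp add: \<sigma>_def dist_norm X_def Y_def)
    also have "\<dots> = r^4 / (norm X)\<^sup>2 + r^4 / (norm Y)\<^sup>2 - 2 * (r^4 / ((norm X)\<^sup>2 * (norm Y)\<^sup>2)) * (X \<bullet> Y)"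
    proof -
      have "(norm (s *\<^sub>R X - t *\<^sub>R Y))\<^sup>2 = s\<^sup>2 * (norm X)\<^sup>2 + t\<^sup>2 * (norm Y)\<^sup>2 - 2 * (s * t) * (X \<bullet> Y)" for s t
        unfolding power2_norm_eq_inner by (simp add: inner_diff_left inner_diff_right inner_commute power2_eq_square algebra_simps)
      then show ?thesis using p by (simp only:) (simp add: power_divide field_simps flip: power_mult)
    qed
    also have "\<dots> = (r\<^sup>2 / (norm X * norm Y))\<^sup>2 * (norm (X - Y))\<^sup>2"
    proof -
      have "(norm (X - Y))\<^sup>2 = (norm X)\<^sup>2 + (norm Y)\<^sup>2 - 2 * (X \<bullet> Y)"
        unfolding power2_norm_eq_inner by (simp add: inner_diff_left inner_diff_right inner_commute)
      then show ?thesis using p by (simp only:) (simp add: power_divide power_mult_distrib field_simps flip: power_mult)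
    qed
    finally show "(dist (\<sigma> x) (\<sigma> y))\<^sup>2 = (r\<^sup>2 / (dist x a * dist y a) * dist x y)\<^sup>2"
      by (simp add: power_mult_distrib power_divide X_def Y_def dist_norm)
  qed auto
qed

text \<open>Precomposition with a suitable inversion makes the weight constant. The inversion is
  found by writing the affine function of \<open>Mob_weight_affine\<close> as a multiple of the
  squared distance to a point \<open>a\<close> outside the ball.\<close>

lemma Mob_moebius:
  assumes "Mob F"
  obtains f where "moebius f" "\<And>x. x \<in> S2 \<Longrightarrow> f x = F x"
proof -
  obtain w \<alpha> \<beta> where w: "\<And>x. x \<in> S2 \<Longrightarrow> w x > 0"
    "\<And>x y. x \<in> S2 \<Longrightarrow> y \<in> S2 \<Longrightarrow> dist (F x) (F y) = w x * w y * dist x y"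
    "norm \<beta> < \<alpha>" "\<And>x. x \<in> S2 \<Longrightarrow> (w x)\<^sup>2 * (\<alpha> - \<beta> \<bullet> x) = 1"
    using Mob_weight_affine[OF assms] by metis
  have bij: "bij_betw F S2 S2" using assms by (simp add: Mob_def)
  then have FS: "F ` S2 = S2" "\<And>x. x \<in> S2 \<Longrightarrow> F x \<in> S2" by (auto simp: bij_betw_def)
  show ?thesis
  proof (cases "\<beta> = 0")
    case True
    then have \<alpha>: "\<alpha> > 0" using w(3) by simp
    have wx: "w x = sqrt (1 / \<alpha>)" if "x \<in> S2" for x
    proof -
      have "(w x)\<^sup>2 = 1 / \<alpha>" using w(4)[OF that] True \<alpha> by (simp add: field_simps)
      then show ?thesis using w(1)[OF that] by (metis less_imp_le real_sqrt_unique)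
    qed
    show ?thesis
      by (rule Mob_constant_weight_moebius[of F "1 / \<alpha>"]) (use FS \<alpha> w(2) wx that in auto)
  next
    case False
    define t where "t = \<alpha> / norm \<beta>"
    have t: "t > 1" using False w(3) by (simp add: t_def)
    \<comment> \<open>The larger root of R^2 - 2 t R + 1 = 0. This equation makes |y - a|^2
      proportional to the affine function for \<open>y\<close> on the sphere, and R > 1 places
      \<open>a\<close> outside.\<close>
    define R where "R = t + sqrt (t\<^sup>2 - 1)"
    have t2: "t\<^sup>2 > 1" using t by simp
    have "sqrt (t\<^sup>2 - 1) \<ge> 0" using t2 by simp
    then have R1: "R > 1" using t unfolding R_def by linarith
    have R2: "R\<^sup>2 + 1 = 2 * t * R" using t2 by (simp add: R_def power2_sum power2_eq_square algebra_simps)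
    define a where "a = (R / norm \<beta>) *\<^sub>R \<beta>"
    have na: "norm a = R" using False R1 by (simp add: a_def)
    define r where "r = sqrt (R\<^sup>2 - 1)"
    have R21: "R\<^sup>2 > 1" using R1 by simp
    have r: "r > 0" "(norm a)\<^sup>2 = 1 + r\<^sup>2" using R21 by (auto simp: r_def na)
    define c where "c = norm \<beta> / (2 * R)"
    have cp: "c > 0" using False R1 by (simp add: c_def)
    define \<sigma> where "\<sigma> = (\<lambda>x. a + (r\<^sup>2 / (norm (x - a))\<^sup>2) *\<^sub>R (x - a))"
    note inv = sphere_inversion[OF r \<sigma>_def]
    have aff: "\<alpha> - \<beta> \<bullet> y = c * (dist y a)\<^sup>2" if "y \<in> S2" for y
    proof -
      have "(dist y a)\<^sup>2 = 1 + R\<^sup>2 - 2 * (y \<bullet> a)"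
      proof -
        have "y \<bullet> y = 1" "a \<bullet> a = R\<^sup>2" using that na by (simp_all add: S2_def norm_eq_1 power2_norm_eq_inner[symmetric])
        then show ?thesis unfolding dist_norm power2_norm_eq_inner
          by (simp add: inner_diff_left inner_diff_right inner_commute)
      qed
      also have "\<dots> = 2 * t * R - 2 * (R / norm \<beta>) * (\<beta> \<bullet> y)" using R2 by (simp add: a_def inner_commute)
      finally have "c * (dist y a)\<^sup>2 = c * (2 * t * R - 2 * (R / norm \<beta>) * (\<beta> \<bullet> y))" by simp
      also have "\<dots> = \<alpha> - \<beta> \<bullet> y" using False R1 by (simp add: c_def t_def field_simps)
      finally show ?thesis by simp
    qed
    have wt: "w y * dist y a = sqrt (1 / c)" if "y \<in> S2" for y
    proof -
      have "(w y * dist y a)\<^sup>2 = 1 / c" using w(4)[OF that] aff[OF that] cp by (simp add: power_mult_distrib field_simps)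
      then show ?thesis using w(1)[OF that] by (metis less_imp_le real_sqrt_unique zero_le_dist zero_le_mult_iff)
    qed
    have "dist (F (\<sigma> x)) (F (\<sigma> y)) = 1 / (c * r\<^sup>2) * dist x y" if x: "x \<in> S2" and y: "y \<in> S2" for x y
    proof -
      have p: "dist x a > 0" "dist y a > 0" using inv(2) x y by auto
      have sx: "dist (\<sigma> x) a = r\<^sup>2 / dist x a" "dist (\<sigma> y) a = r\<^sup>2 / dist y a"
        using inv(5)[OF x] inv(5)[OF y] p by (simp_all add: field_simps)
      have "w (\<sigma> x) = sqrt (1/c) * dist x a / r\<^sup>2" "w (\<sigma> y) = sqrt (1/c) * dist y a / r\<^sup>2"
        using wt[OF inv(3)[OF x]] wt[OF inv(3)[OF y]] sx p r(1) by (simp_all add: field_simps)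
      then have "dist (F (\<sigma> x)) (F (\<sigma> y)) = (sqrt (1/c) * dist x a / r\<^sup>2) * (sqrt (1/c) * dist y a / r\<^sup>2) * (r\<^sup>2 / (dist x a * dist y a) * dist x y)"
        using w(2)[OF inv(3)[OF x] inv(3)[OF y]] inv(6)[OF x y] by simp
      also have "\<dots> = (sqrt (1/c) * sqrt (1/c)) / r\<^sup>2 * dist x y"
      proof -
        have "(s * X / r\<^sup>2) * (s * Y / r\<^sup>2) * (r\<^sup>2 / (X * Y) * D) = (s * s) / r\<^sup>2 * D"
          if "X > 0" "Y > 0" for s X Y D :: real
          using that r(1) by (simp add: field_simps power2_eq_square)
        then show ?thesis using p by blast
      qed
      also have "sqrt (1/c) * sqrt (1/c) = 1 / c" using cp by simp
      finally show ?thesis by simp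
    qed
    moreover have "(F \<circ> \<sigma>) ` S2 = S2"
    proof -
      have "\<sigma> ` S2 = S2" using inv(3,4) by force
      then show ?thesis using FS by (metis image_comp)
    qed
    ultimately have D: "(F \<circ> \<sigma>) ` S2 = S2"
      "\<And>x y. x \<in> S2 \<Longrightarrow> y \<in> S2 \<Longrightarrow> dist ((F \<circ> \<sigma>) x) ((F \<circ> \<sigma>) y) = 1 / (c * r\<^sup>2) * dist x y"
      by simp_all
    have "1 / (c * r\<^sup>2) \<ge> 0" "\<And>x. x \<in> S2 \<Longrightarrow> (F \<circ> \<sigma>) x \<in> S2" using cp FS(2) inv(3) by simp_all
    then obtain f where f: "moebius f" "\<And>x. x \<in> S2 \<Longrightarrow> f x = (F \<circ> \<sigma>) x"
      using Mob_constant_weight_moebius[OF _ D(1) _ D(2)] by metis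
    show ?thesis
    proof (rule that[of "f \<circ> \<sigma>"])
      show "moebius (f \<circ> \<sigma>)" using moebius_compose f(1) inv(1) by blast
      show "(f \<circ> \<sigma>) x = F x" if "x \<in> S2" for x using f(2)[OF inv(3)[OF that]] inv(4)[OF that] by simp
    qed
  qed
qed

lemma S2_dist_le: "x \<in> S2 \<Longrightarrow> y \<in> S2 \<Longrightarrow> dist x y \<le> 2"
  unfolding S2_def mem_sphere by (metis dist_triangle3 one_add_one)

lemma S2_antipode:
  assumes "x \<in> S2" "p \<in> S2"
  shows "- p \<in> S2" "(dist x (- p))\<^sup>2 = 4 - (dist x p)\<^sup>2" "- p \<noteq> p" "dist (- p) p = 2"
proof -
  show p: "- p \<in> S2" using assms by (simp add: S2_def)
  have "x \<bullet> x = 1" "p \<bullet> p = 1" using assms by (auto simp: S2_def norm_eq_1)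
  then show "(dist x (- p))\<^sup>2 = 4 - (dist x p)\<^sup>2"
    unfolding dist_norm power2_norm_eq_inner by (simp add: inner_diff_left inner_diff_right inner_add_left inner_add_right inner_commute)
  have "dist (- p) p = dist p (- p)" by (rule dist_commute)
  also have "\<dots> = norm (2 *\<^sub>R p)" by (simp add: dist_norm scaleR_2)
  finally have "dist (- p) p = norm (2 *\<^sub>R p)" .
  then show "dist (- p) p = 2" using assms by (simp add: S2_def)
  then show "- p \<noteq> p" by (metis dist_self zero_neq_numeral)
qed

section \<open>Planar charts\<close>

definition circ :: "R3 set \<Rightarrow> R3 set" where "circ D = closure D - D"

text \<open>Stereographic projections from \<open>p\<close>, up to similarities of the plane.\<close>
definition chart :: "(R3 \<Rightarrow> complex) \<Rightarrow> R3 \<Rightarrow> real \<Rightarrow> bool" where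
  "chart m p k \<longleftrightarrow> p \<in> S2 \<and> k > 0 \<and> bij_betw m (S2 - {p}) UNIV \<and>
     (\<forall>x\<in>S2 - {p}. \<forall>y\<in>S2 - {p}. dist (m x) (m y) = k * dist x y / (dist x p * dist y p))"

lemma chartD:
  assumes "chart m p k"
  shows "p \<in> S2" "k > 0" "bij_betw m (S2 - {p}) UNIV" "inj_on m (S2 - {p})" "\<And>z. \<exists>x\<in>S2 - {p}. m x = z"
    "\<And>x y. x \<in> S2 \<Longrightarrow> x \<noteq> p \<Longrightarrow> y \<in> S2 \<Longrightarrow> y \<noteq> p \<Longrightarrow> dist (m x) (m y) = k * dist x y / (dist x p * dist y p)"
proof -
  show 1: "p \<in> S2" "k > 0" "bij_betw m (S2 - {p}) UNIV" using assms by (auto simp: chart_def)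
  then show "inj_on m (S2 - {p})" "\<And>z. \<exists>x\<in>S2 - {p}. m x = z" unfolding bij_betw_def by (auto simp: image_iff) (metis UNIV_I image_iff)
  show "\<And>x y. x \<in> S2 \<Longrightarrow> x \<noteq> p \<Longrightarrow> y \<in> S2 \<Longrightarrow> y \<noteq> p \<Longrightarrow> dist (m x) (m y) = k * dist x y / (dist x p * dist y p)"
    using assms by (auto simp: chart_def)
qed

text \<open>Completing the square: the points where this difference is constant form a circle of
  Apollonius, centred at the point on the right.\<close>

lemma apollonius:
  fixes z a b :: complex
  assumes "s < 1"
  shows "(dist z a)\<^sup>2 - s * (dist z b)\<^sup>2 =
    (1 - s) * (dist z ((a - s *\<^sub>R b) /\<^sub>R (1 - s)))\<^sup>2 - s * (dist a b)\<^sup>2 / (1 - s)"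
proof -
  define u v where "u = z - a" and "v = z - b"
  have "(1 - s) *\<^sub>R (z - (a - s *\<^sub>R b) /\<^sub>R (1 - s)) = u - s *\<^sub>R v"
  proof -
    have "(1 - s) *\<^sub>R ((a - s *\<^sub>R b) /\<^sub>R (1 - s)) = a - s *\<^sub>R b" using assms by simp
    then show ?thesis unfolding scaleR_diff_right[of "1 - s" z] by (simp add: u_def v_def algebra_simps)
  qed
  then have e: "z - (a - s *\<^sub>R b) /\<^sub>R (1 - s) = (u - s *\<^sub>R v) /\<^sub>R (1 - s)"
    using assms by (metis eq_iff_diff_eq_0 less_irrefl scaleR_one scaleR_scaleR left_inverse)
  have "(dist z ((a - s *\<^sub>R b) /\<^sub>R (1 - s)))\<^sup>2 = (norm (u - s *\<^sub>R v))\<^sup>2 / (1 - s)\<^sup>2"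
    unfolding dist_norm e by (simp add: power_mult_distrib divide_inverse power_inverse)
  moreover have "(dist a b)\<^sup>2 = (norm (u - v))\<^sup>2" by (simp add: u_def v_def dist_norm norm_minus_commute)
  moreover have "(1 - s) * ((norm (u - s *\<^sub>R v))\<^sup>2 / (1 - s)\<^sup>2) - s * (norm (u - v))\<^sup>2 / (1 - s)
     = ((norm (u - s *\<^sub>R v))\<^sup>2 - s * (norm (u - v))\<^sup>2) / (1 - s)"
    using assms by (simp add: power2_eq_square divide_simps)
  moreover have "(norm (u - s *\<^sub>R v))\<^sup>2 - s * (norm (u - v))\<^sup>2 = (1 - s) * ((norm u)\<^sup>2 - s * (norm v)\<^sup>2)"
    unfolding power2_norm_eq_inner
    by (simp add: inner_diff_left inner_diff_right inner_commute algebra_simps)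
  ultimately show ?thesis using assms by (simp add: u_def v_def dist_norm)
qed

text \<open>The distance to the antipode of \<open>p\<close> recovers the distance to
  \<open>p\<close>, because the two squares add up to 4. In the chart a cap around \<open>c\<close>
  therefore becomes an Apollonius condition on the distances to \<open>m c\<close> and
  \<open>m (- p)\<close>.\<close>

lemma chart_cap:
  assumes ch: "chart m p k" and c: "c \<in> S2" and r: "0 < r" "r < dist p c"
  obtains z R where "R > 0" "m ` {x \<in> S2. dist x c < r} = ball z R" "m ` {x \<in> S2. dist x c = r} = sphere z R"
proof -
  note C = chartD[OF ch]
  have pS: "p \<in> S2" and k: "k > 0" using C by auto
  have cp: "c \<noteq> p" using r by auto
  define e where "e = dist c p"
  have e: "e > r" "e > 0" using r by (auto simp: e_def dist_commute)
  define s where "s = r\<^sup>2 / e\<^sup>2"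
  have "r\<^sup>2 < e\<^sup>2" using e r by (intro power_strict_mono) auto
  then have s: "0 < s" "s < 1" using e r by (auto simp: s_def)
  define a b where "a = m c" and "b = m (- p)"
  define Z where "Z = (a - s *\<^sub>R b) /\<^sub>R (1 - s)"
  \<comment> \<open>The squared radius that \<open>apollonius\<close> produces; \<open>s < 1\<close>
    because the pole lies outside the closed cap.\<close>
  define Q where "Q = (k\<^sup>2 * s / 4 + s * (dist a b)\<^sup>2 / (1 - s)) / (1 - s)"
  have Q: "Q > 0" using s k by (auto simp: Q_def intro!: divide_pos_pos add_pos_nonneg)
  have key: "(dist (m x) Z)\<^sup>2 - Q = k\<^sup>2 / (e\<^sup>2 * (dist x p)\<^sup>2 * (1 - s)) * ((dist x c)\<^sup>2 - r\<^sup>2)"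
    if x: "x \<in> S2" "x \<noteq> p" for x
  proof -
    have xp: "dist x p > 0" using x by simp
    have 1: "dist (m x) a = k * dist x c / (dist x p * e)"
      unfolding a_def e_def using C(6)[OF x c cp] .
    have "dist (m x) b = k * dist x (- p) / (dist x p * 2)"
      unfolding b_def using C(6)[OF x S2_antipode(1)[OF pS pS] S2_antipode(3)[OF pS pS]] S2_antipode(4)[OF pS pS] by simp
    then have 2: "(dist (m x) b)\<^sup>2 = k\<^sup>2 * (4 - (dist x p)\<^sup>2) / ((dist x p)\<^sup>2 * 4)"
      using S2_antipode(2)[OF x(1) pS] by (simp add: power_mult_distrib power_divide)
    have "(1 - s) * ((dist (m x) Z)\<^sup>2 - Q) = (dist (m x) a)\<^sup>2 - s * (dist (m x) b)\<^sup>2 - k\<^sup>2 * s / 4"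
    proof -
      have "(1 - s) * Q = k\<^sup>2 * s / 4 + s * (dist a b)\<^sup>2 / (1 - s)" unfolding Q_def using s by simp
      then show ?thesis
        unfolding apollonius[OF s(2), of "m x" a b] Z_def[symmetric] by (simp add: right_diff_distrib)
    qed
    also have "\<dots> = k\<^sup>2 * (dist x c)\<^sup>2 / ((dist x p)\<^sup>2 * e\<^sup>2) - s * k\<^sup>2 / (dist x p)\<^sup>2"
      unfolding 1 2 using xp by (simp add: power_mult_distrib power_divide field_simps)
    also have "\<dots> = k\<^sup>2 / (e\<^sup>2 * (dist x p)\<^sup>2) * ((dist x c)\<^sup>2 - r\<^sup>2)"
      unfolding s_def using xp e by (simp add: field_simps)
    finally have E: "(1 - s) * ((dist (m x) Z)\<^sup>2 - Q) = k\<^sup>2 / (e\<^sup>2 * (dist x p)\<^sup>2) * ((dist x c)\<^sup>2 - r\<^sup>2)" .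
    have "(dist (m x) Z)\<^sup>2 - Q = (1 - s) * ((dist (m x) Z)\<^sup>2 - Q) / (1 - s)" using s by simp
    then show ?thesis unfolding E by simp
  qed
  define K where "K x = k\<^sup>2 / (e\<^sup>2 * (dist x p)\<^sup>2 * (1 - s))" for x
  have Kp: "K x > 0" if "x \<noteq> p" for x using that k e s by (simp add: K_def)
  define R where "R = sqrt Q"
  have R: "R > 0" "R\<^sup>2 = Q" using Q by (auto simp: R_def)
  have lt: "dist (m x) Z < R \<longleftrightarrow> dist x c < r" if x: "x \<in> S2" "x \<noteq> p" for x
  proof -
    have "dist (m x) Z < R \<longleftrightarrow> (dist (m x) Z)\<^sup>2 < R\<^sup>2" using R by (smt (verit) power2_less_imp_less power_strict_mono zero_le_dist zero_less_numeral)
    also have "\<dots> \<longleftrightarrow> K x * ((dist x c)\<^sup>2 - r\<^sup>2) < 0" using key[OF x] R K_def by auto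
    also have "\<dots> \<longleftrightarrow> (dist x c)\<^sup>2 < r\<^sup>2" using Kp[OF x(2)] by (simp add: mult_less_0_iff not_less_iff_gr_or_eq)
    also have "\<dots> \<longleftrightarrow> dist x c < r" using r by (smt (verit) power2_less_imp_less power_strict_mono zero_le_dist zero_less_numeral)
    finally show ?thesis .
  qed
  have eq: "dist (m x) Z = R \<longleftrightarrow> dist x c = r" if x: "x \<in> S2" "x \<noteq> p" for x
  proof -
    have "dist (m x) Z = R \<longleftrightarrow> (dist (m x) Z)\<^sup>2 = R\<^sup>2" using R(1) by simp
    also have "\<dots> \<longleftrightarrow> K x * ((dist x c)\<^sup>2 - r\<^sup>2) = 0" using key[OF x] R K_def by auto
    also have "\<dots> \<longleftrightarrow> (dist x c)\<^sup>2 = r\<^sup>2" using Kp[OF x(2)] by simp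
    also have "\<dots> \<longleftrightarrow> dist x c = r" using r by simp
    finally show ?thesis .
  qed
  show ?thesis
  proof (rule that[OF R(1)])
    show "m ` {x \<in> S2. dist x c < r} = ball Z R"
    proof (intro equalityI subsetI)
      fix z assume "z \<in> m ` {x \<in> S2. dist x c < r}"
      then obtain x where x: "x \<in> S2" "dist x c < r" "z = m x" by blast
      then have "x \<noteq> p" using r(2) by auto
      then show "z \<in> ball Z R" using lt x by (simp add: dist_commute)
    next
      fix z assume z: "z \<in> ball Z R"
      obtain x where "x \<in> S2 - {p}" "m x = z" using C(5) by blast
      then show "z \<in> m ` {x \<in> S2. dist x c < r}" using lt[of x] z by (auto simp: dist_commute)
    qed
    show "m ` {x \<in> S2. dist x c = r} = sphere Z R"
    proof (intro equalityI subsetI)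
      fix z assume "z \<in> m ` {x \<in> S2. dist x c = r}"
      then obtain x where x: "x \<in> S2" "dist x c = r" "z = m x" by blast
      then have "x \<noteq> p" using r(2) by auto
      then show "z \<in> sphere Z R" using eq x by (simp add: dist_commute)
    next
      fix z assume z: "z \<in> sphere Z R"
      obtain x where "x \<in> S2 - {p}" "m x = z" using C(5) by blast
      then show "z \<in> m ` {x \<in> S2. dist x c = r}" using eq[of x] z by (auto simp: dist_commute)
    qed
  qed
qed

text \<open>For the pole \<open>e\<close> one has |x - e|^2 = 2 (1 - x3), which turns the classical
  distance formula into the chart identity with constant 2.\<close>

lemma stereographic_chart: "\<exists>m. chart m (axis 3 1) 2"
proof -
  define e :: R3 where "e = axis 3 1"
  have e3: "e $ 1 = 0" "e $ 2 = 0" "e $ 3 = 1" by (simp_all add: e_def axis_def)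
  define m :: "R3 \<Rightarrow> complex" where "m x = Complex (x $ 1 / (1 - x $ 3)) (x $ 2 / (1 - x $ 3))" for x
  have S: "x \<in> S2 \<longleftrightarrow> (x $ 1)\<^sup>2 + (x $ 2)\<^sup>2 + (x $ 3)\<^sup>2 = 1" for x :: R3
    unfolding S2_def mem_sphere_0 norm_eq_1 by (simp add: inner_vec_def sum_3 power2_eq_square)
  have nz: "x $ 3 < 1" if "x \<in> S2" "x \<noteq> e" for x :: R3
  proof -
    have "(x $ 3)\<^sup>2 \<le> 1" using that(1) unfolding S by (smt (verit) zero_le_power2)
    then have "x $ 3 \<le> 1" by (simp add: abs_square_le_1)
    moreover have "x $ 3 \<noteq> 1"
    proof
      assume "x $ 3 = 1"
      then have "x $ 1 = 0" "x $ 2 = 0" using that(1) unfolding S by (auto simp: sum_power2_eq_zero_iff)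
      then have "x = e" using \<open>x $ 3 = 1\<close> e3 by (simp add: vec_eq_iff forall_3)
      then show False using that by simp
    qed
    ultimately show ?thesis by simp
  qed
  have d3: "(dist x y)\<^sup>2 = (x$1 - y$1)\<^sup>2 + (x$2 - y$2)\<^sup>2 + (x$3 - y$3)\<^sup>2" for x y :: R3
    unfolding dist_norm power2_norm_eq_inner by (simp add: inner_vec_def sum_3 power2_eq_square)
  have de: "(dist x e)\<^sup>2 = 2 * (1 - x$3)" if "x \<in> S2" for x :: R3
    using that unfolding S d3 e3 by (simp add: power2_eq_square algebra_simps)
  have dd: "dist (m x) (m y) = 2 * dist x y / (dist x e * dist y e)" if x: "x \<in> S2" "x \<noteq> e" and y: "y \<in> S2" "y \<noteq> e" for x y :: R3
  proof (rule power2_eq_imp_eq)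
    define a b where "a = 1 - x$3" and "b = 1 - y$3"
    have ab: "a > 0" "b > 0" using nz x y by (auto simp: a_def b_def)
    have Sx: "(x$1)\<^sup>2 + (x$2)\<^sup>2 = 2*a - a\<^sup>2" using x(1) unfolding S a_def by (simp add: power2_eq_square algebra_simps)
    have Sy: "(y$1)\<^sup>2 + (y$2)\<^sup>2 = 2*b - b\<^sup>2" using y(1) unfolding S b_def by (simp add: power2_eq_square algebra_simps)
    have dxy: "(dist x y)\<^sup>2 = (x$1 - y$1)\<^sup>2 + (x$2 - y$2)\<^sup>2 + (a - b)\<^sup>2"
      unfolding d3 a_def b_def by (simp add: power2_eq_square algebra_simps)
    have xyab: "2 * (x$1 * y$1 + x$2 * y$2) = (2*a - a\<^sup>2) + (2*b - b\<^sup>2) - ((dist x y)\<^sup>2 - (a - b)\<^sup>2)"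
      unfolding dxy Sx[symmetric] Sy[symmetric] by (simp add: power2_eq_square algebra_simps)
    have xyab2: "2 * a * b * (x$1 * y$1 + x$2 * y$2) = a * b * ((2*a - a\<^sup>2) + (2*b - b\<^sup>2) - ((dist x y)\<^sup>2 - (a - b)\<^sup>2))"
      unfolding xyab[symmetric] by simp
    have "(dist (m x) (m y))\<^sup>2 = (x$1/a - y$1/b)\<^sup>2 + (x$2/a - y$2/b)\<^sup>2"
      unfolding dist_norm m_def cmod_power2 a_def b_def by simp
    also have "\<dots> = ((b * x$1 - a * y$1)\<^sup>2 + (b * x$2 - a * y$2)\<^sup>2) / (a * b)\<^sup>2"
      using ab by (simp add: field_simps power2_eq_square)
    also have "(b * x$1 - a * y$1)\<^sup>2 + (b * x$2 - a * y$2)\<^sup>2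
       = b\<^sup>2 * ((x$1)\<^sup>2 + (x$2)\<^sup>2) + a\<^sup>2 * ((y$1)\<^sup>2 + (y$2)\<^sup>2) - 2 * a * b * (x$1 * y$1 + x$2 * y$2)"
      by (simp add: power2_eq_square algebra_simps)
    also note xyab2
    also have "b\<^sup>2 * ((x$1)\<^sup>2 + (x$2)\<^sup>2) + a\<^sup>2 * ((y$1)\<^sup>2 + (y$2)\<^sup>2) - a * b * ((2*a - a\<^sup>2) + (2*b - b\<^sup>2) - ((dist x y)\<^sup>2 - (a - b)\<^sup>2))
        = a * b * (dist x y)\<^sup>2"
      unfolding Sx Sy by (simp add: power2_eq_square algebra_simps)
    finally have 1: "(dist (m x) (m y))\<^sup>2 = (dist x y)\<^sup>2 / (a * b)" using ab by (simp add: power2_eq_square)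
    have "(dist x e)\<^sup>2 = 2 * a" "(dist y e)\<^sup>2 = 2 * b" using de x y by (auto simp: a_def b_def)
    then show "(dist (m x) (m y))\<^sup>2 = (2 * dist x y / (dist x e * dist y e))\<^sup>2"
      unfolding 1 by (simp add: power_divide power_mult_distrib)
  qed auto
  have inj: "inj_on m (S2 - {e})"
  proof (rule inj_onI)
    fix x y assume "x \<in> S2 - {e}" "y \<in> S2 - {e}" "m x = m y"
    then show "x = y" using dd[of x y] by auto
  qed
  have surj: "\<exists>x\<in>S2 - {e}. m x = z" for z
  proof -
    define n where "n = (Re z)\<^sup>2 + (Im z)\<^sup>2 + 1"
    have n: "n > 0" unfolding n_def by (smt (verit) zero_le_power2)
    define x :: R3 where "x = vector [2 * Re z / n, 2 * Im z / n, (n - 2) / n]"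
    have xc: "x$1 = 2 * Re z / n" "x$2 = 2 * Im z / n" "x$3 = (n - 2) / n" by (simp_all add: x_def)
    have "(2 * Re z)\<^sup>2 + (2 * Im z)\<^sup>2 + (n - 2)\<^sup>2 = n\<^sup>2"
      unfolding n_def by (simp add: power2_eq_square algebra_simps)
    then have "x \<in> S2" unfolding S xc using n
      by (simp add: power_divide add_divide_distrib[symmetric])
    moreover have x3: "1 - x$3 = 2 / n" unfolding xc using n by (simp add: field_simps)
    then have "x \<noteq> e" using e3 n by auto
    moreover have "m x = z" unfolding m_def x3 xc(1,2) using n by (simp add: complex_eq_iff)
    ultimately show ?thesis by blast
  qed
  have "m ` (S2 - {e}) = UNIV"
  proof (rule UNIV_eq_I[symmetric])
    fix z show "z \<in> m ` (S2 - {e})" using surj[of z] by (blast intro: image_eqI[OF sym])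
  qed
  then have "chart m e 2" unfolding chart_def bij_betw_def using inj dd by (auto simp: S e3)
  then show ?thesis unfolding e_def by blast
qed

lemma Mob_inverse:
  assumes "Mob g"
  obtains h where "Mob h" "\<And>x. x \<in> S2 \<Longrightarrow> h x \<in> S2" "\<And>x. x \<in> S2 \<Longrightarrow> h (g x) = x" "\<And>x. x \<in> S2 \<Longrightarrow> g (h x) = x"
proof -
  obtain w where bij: "bij_betw g S2 S2" and w: "\<forall>x\<in>S2. w x > 0" "\<forall>x\<in>S2. \<forall>y\<in>S2. dist (g x) (g y) = w x * w y * dist x y"
    using assms unfolding Mob_def by blast
  define h where "h = inv_into S2 g"
  have h: "h x \<in> S2" "h (g x) = x" "g (h x) = x" if "x \<in> S2" for x
    using bij that unfolding h_def bij_betw_def by (auto simp: inv_into_into f_inv_into_f)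
  have "dist (h x) (h y) = 1 / w (h x) * (1 / w (h y)) * dist x y" if x: "x \<in> S2" and y: "y \<in> S2" for x y
  proof -
    have "dist x y = w (h x) * w (h y) * dist (h x) (h y)"
      using w(2) h x y by metis
    moreover have "w (h x) > 0" "w (h y) > 0" using w h x y by auto
    ultimately show ?thesis by simp
  qed
  moreover have "bij_betw h S2 S2" using bij unfolding h_def by (rule bij_betw_inv_into)
  ultimately have "Mob h" unfolding Mob_def using w h
    by (intro conjI exI[of _ "\<lambda>x. 1 / w (h x)"]) auto
  then show ?thesis using h that by blast
qed

text \<open>The weight at the new pole occurs once in each factor of the denominator, so it changes
  only the constant, to \<open>k / (w q)\<^sup>2\<close>.\<close>

lemma chart_Mob:
  assumes ch: "chart m p k" and h: "Mob h" "q \<in> S2" "h q = p"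
  shows "\<exists>k'. chart (m \<circ> h) q k'"
proof -
  note C = chartD[OF ch]
  obtain w where bij: "bij_betw h S2 S2" and w: "\<forall>x\<in>S2. w x > 0" "\<forall>x\<in>S2. \<forall>y\<in>S2. dist (h x) (h y) = w x * w y * dist x y"
    using h(1) unfolding Mob_def by blast
  have b2: "bij_betw h (S2 - {q}) (S2 - {p})"
    using bij h(2,3) unfolding bij_betw_def by (auto simp: inj_on_def)
  have hx: "h x \<in> S2" "h x \<noteq> p" if "x \<in> S2" "x \<noteq> q" for x using b2 that by (auto simp: bij_betw_def)
  have "chart (m \<circ> h) q (k / (w q)\<^sup>2)"
    unfolding chart_def
  proof (intro conjI ballI h(2))
    have "w q > 0" using w h by blast
    then show "k / (w q)\<^sup>2 > 0" using C(2) by simp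
    show "bij_betw (m \<circ> h) (S2 - {q}) UNIV" using bij_betw_trans[OF b2 C(3)] .
    fix x y assume "x \<in> S2 - {q}" "y \<in> S2 - {q}"
    then have x: "x \<in> S2" "x \<noteq> q" and y: "y \<in> S2" "y \<noteq> q" by auto
    have wp: "w x > 0" "w y > 0" "w q > 0" using w x y h by auto
    have "dist (h x) p = w x * w q * dist x q" "dist (h y) p = w y * w q * dist y q"
      "dist (h x) (h y) = w x * w y * dist x y" using w x y h by metis+
    then have "dist ((m \<circ> h) x) ((m \<circ> h) y) = k * (w x * w y * dist x y) / (w x * w q * dist x q * (w y * w q * dist y q))"
      using C(6)[OF hx[OF x] hx[OF y]] by simp
    also have "\<dots> = k / (w q)\<^sup>2 * dist x y / (dist x q * dist y q)"
      using wp by (simp add: field_simps power2_eq_square)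
    finally show "dist ((m \<circ> h) x) ((m \<circ> h) y) = k / (w q)\<^sup>2 * dist x y / (dist x q * dist y q)" .
  qed
  then show ?thesis by blast
qed

lemma Mob_orthogonal:
  assumes "orthogonal_transformation T" shows "Mob T"
proof -
  have d: "dist (T x) (T y) = dist x y" for x y
    using assms by (simp add: orthogonal_transformation_isometry)
  have "bij T" using assms orthogonal_transformation_bij by blast
  moreover have "T ` S2 = S2"
  proof -
    have n: "norm (T x) = norm x" for x using assms by (simp add: orthogonal_transformation_norm)
    have "x \<in> T ` S2" if "x \<in> S2" for x
    proof -
      obtain y where "T y = x" using \<open>bij T\<close> by (metis bij_pointE)
      then show ?thesis using n[of y] that by (auto simp: S2_def)
    qed
    then show ?thesis using n by (auto simp: S2_def)
  qed
  ultimately have "bij_betw T S2 S2" unfolding bij_betw_def by (metis bij_is_inj inj_on_subset subset_UNIV)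
  then show ?thesis unfolding Mob_def using d by (intro conjI exI[of _ "\<lambda>_. 1"]) auto
qed

lemma chart_exists:
  assumes "p \<in> S2"
  obtains m k where "chart m p k"
proof -
  obtain m where m: "chart m (axis 3 1) 2" using stereographic_chart by blast
  have "norm p = norm (axis 3 1 :: R3)" using assms by (simp add: S2_def)
  then obtain T where T: "orthogonal_transformation T" "T p = (axis 3 1 :: R3)"
    by (rule orthogonal_transformation_exists)
  then show ?thesis using chart_Mob[OF m Mob_orthogonal[OF T(1)] assms T(2)] that by blast
qed

lemma chart_affine:
  assumes ch: "chart m p k" and R: "R > 0"
  shows "chart (\<lambda>x. (m x - z) / of_real R) p (k / R)"
proof -
  note C = chartD[OF ch]
  have b: "bij (\<lambda>w. (w - z) / complex_of_real R)"
    by (rule o_bij[of "\<lambda>w. w * of_real R + z"]) (use R in \<open>auto simp: fun_eq_iff\<close>)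
  show ?thesis
    unfolding chart_def
  proof (intro conjI ballI C(1))
    show "k / R > 0" using C R by simp
    show "bij_betw (\<lambda>x. (m x - z) / complex_of_real R) (S2 - {p}) UNIV"
      using bij_betw_trans[OF C(3) b] by (simp add: comp_def)
    fix x y assume "x \<in> S2 - {p}" "y \<in> S2 - {p}"
    then have "dist (m x) (m y) = k * dist x y / (dist x p * dist y p)" using C(6) by auto
    moreover have "dist ((m x - z) / complex_of_real R) ((m y - z) / complex_of_real R) = dist (m x) (m y) / R"
      using R by (simp add: dist_norm norm_divide flip: diff_divide_distrib)
    ultimately show "dist ((m x - z) / complex_of_real R) ((m y - z) / complex_of_real R) = k / R * dist x y / (dist x p * dist y p)"
      by simp
  qed
qed

lemma cnj_inversion_dist:
  fixes z w c :: complex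
  assumes "z \<noteq> c" "w \<noteq> c" "R > 0"
  shows "dist (of_real R / cnj (z - c)) (of_real R / cnj (w - c)) = R * dist z w / (dist z c * dist w c)"
proof -
  have "of_real R / cnj (z - c) - of_real R / cnj (w - c) = of_real R * cnj (w - z) / (cnj (z - c) * cnj (w - c))"
    using assms by (simp add: field_simps)
  then have "dist (of_real R / cnj (z - c)) (of_real R / cnj (w - c)) = cmod (of_real R * cnj (w - z) / (cnj (z - c) * cnj (w - c)))"
    by (simp add: dist_norm)
  also have "\<dots> = R * cmod (w - z) / (cmod (z - c) * cmod (w - c))"
    using assms(3) by (simp only: norm_divide norm_mult complex_mod_cnj norm_of_real abs_of_pos)
  finally show ?thesis by (simp add: dist_norm norm_minus_commute)
qed

text \<open>Inversion in the circle of radius \<open>R\<close> about \<open>m q\<close>, followed by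
  division by \<open>R\<close>. The conjugate makes it a true reflection: on that circle it agrees
  with the affine map \<open>(z - m q) / R\<close>. The old pole lands at 0.\<close>

lemma chart_child:
  assumes ch: "chart m p k" and q: "q \<in> S2" "q \<noteq> p" and R: "R > 0"
  shows "chart (\<lambda>x. if x = p then 0 else of_real R / cnj (m x - m q)) q (R * (dist q p)\<^sup>2 / k)" (is "chart ?n q ?k")
proof -
  note C = chartD[OF ch]
  have k: "k > 0" using C by simp
  have mq: "m x \<noteq> m q" if "x \<in> S2" "x \<noteq> p" "x \<noteq> q" for x
    using C(4) that q by (auto dest: inj_onD)
  have f1: "dist (?n x) (?n y) = ?k * dist x y / (dist x q * dist y q)"
    if x: "x \<in> S2" "x \<noteq> q" "x \<noteq> p" and y: "y \<in> S2" "y \<noteq> q" "y \<noteq> p" for x y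
  proof -
    have "dist (?n x) (?n y) = R * dist (m x) (m y) / (dist (m x) (m q) * dist (m y) (m q))"
      using cnj_inversion_dist[OF mq mq R, of x y] x y by simp
    also have "\<dots> = R * (k * dist x y / (dist x p * dist y p)) / ((k * dist x q / (dist x p * dist q p)) * (k * dist y q / (dist y p * dist q p)))"
      using C(6) x y q by simp
    also have "\<dots> = ?k * dist x y / (dist x q * dist y q)"
    proof -
      have "dist x p > 0" "dist y p > 0" "dist q p > 0" "dist x q > 0" "dist y q > 0" using x y q by auto
      then show ?thesis using k by (simp add: field_simps power2_eq_square)
    qed
    finally show ?thesis .
  qed
  have f2: "dist (?n p) (?n y) = ?k * dist p y / (dist p q * dist y q)" if y: "y \<in> S2" "y \<noteq> q" "y \<noteq> p" for y
  proof -
    have "dist (?n p) (?n y) = R / dist (m y) (m q)" using y R by (simp add: dist_norm norm_divide del: complex_cnj_diff)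
    also have "\<dots> = R / (k * dist y q / (dist y p * dist q p))" using C(6) y q by simp
    also have "\<dots> = ?k * dist p y / (dist p q * dist y q)"
    proof -
      have "dist y p > 0" "dist q p > 0" "dist y q > 0" using y q by auto
      then show ?thesis using k by (simp add: field_simps power2_eq_square dist_commute)
    qed
    finally show ?thesis .
  qed
  have dd: "dist (?n x) (?n y) = ?k * dist x y / (dist x q * dist y q)" if x: "x \<in> S2" "x \<noteq> q" and y: "y \<in> S2" "y \<noteq> q" for x y
  proof (cases "x = p")
    case True
    then show ?thesis using f2[of y] y by (cases "y = p") auto
  next
    case xp: False
    show ?thesis
    proof (cases "y = p")
      case True
      then show ?thesis using f2[OF x xp] by (simp add: dist_commute mult.commute)
    next
      case False then show ?thesis using f1 x y xp by blast
    qed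
  qed
  have kp: "?k > 0" using R k q by simp
  have inj: "inj_on ?n (S2 - {q})"
  proof (rule inj_onI)
    fix x y assume xy: "x \<in> S2 - {q}" "y \<in> S2 - {q}" "?n x = ?n y"
    then have "?k * dist x y / (dist x q * dist y q) = 0" using dd[of x y] by simp
    then show "x = y" using kp xy by auto
  qed
  have surj: "\<exists>x\<in>S2 - {q}. ?n x = z" for z
  proof (cases "z = 0")
    case True then show ?thesis using C(1) q by (intro bexI[of _ p]) auto
  next
    case False
    obtain x where x: "x \<in> S2 - {p}" "m x = m q + of_real R / cnj z" using C(5) by blast
    have "x \<noteq> q" using x False R by auto
    moreover have "?n x = z" using x False R by auto
    ultimately show ?thesis using x by blast
  qed
  have "?n ` (S2 - {q}) = UNIV"
  proof (rule UNIV_eq_I[symmetric])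
    fix z show "z \<in> ?n ` (S2 - {q})" using surj[of z] by (blast intro: image_eqI[OF sym])
  qed
  then show ?thesis unfolding chart_def bij_betw_def using inj dd kp q by auto
qed

lemma chart_continuous:
  assumes ch: "chart m p k"
  shows "continuous_on (S2 - {p}) m"
  unfolding continuous_on_def
proof
  fix x assume x: "x \<in> S2 - {p}"
  note C = chartD[OF ch]
  have "((\<lambda>y. k * dist y x / (dist y p * dist x p)) \<longlongrightarrow> k * dist x x / (dist x p * dist x p)) (at x within (S2 - {p}))"
    by (intro tendsto_intros) (use x in auto)
  then have "((\<lambda>y. dist (m y) (m x)) \<longlongrightarrow> 0) (at x within (S2 - {p}))"
  proof -
    assume "((\<lambda>y. k * dist y x / (dist y p * dist x p)) \<longlongrightarrow> k * dist x x / (dist x p * dist x p)) (at x within (S2 - {p}))"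
    moreover have "eventually (\<lambda>y. k * dist y x / (dist y p * dist x p) = dist (m y) (m x)) (at x within (S2 - {p}))"
      using C(6) x by (auto simp: eventually_at_filter)
    ultimately show ?thesis using Lim_transform_eventually by fastforce
  qed
  then show "(m \<longlongrightarrow> m x) (at x within S2 - {p})" by (subst tendsto_dist_iff)
qed

lemma chart_inverse_continuous:
  assumes ch: "chart m p k"
  shows "continuous_on UNIV (inv_into (S2 - {p}) m)"
proof -
  note C = chartD[OF ch]
  let ?h = "inv_into (S2 - {p}) m"
  have h: "?h z \<in> S2" "?h z \<noteq> p" "m (?h z) = z" for z
    using C(3) unfolding bij_betw_def by (metis DiffE UNIV_I inv_into_into, metis DiffE UNIV_I inv_into_into insertI1, metis UNIV_I f_inv_into_f)
  have lip: "dist (?h z) (?h w) \<le> 4 / k * dist z w" for z w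
  proof -
    have "dist z w = k * dist (?h z) (?h w) / (dist (?h z) p * dist (?h w) p)"
      using C(6)[OF h(1,2) h(1,2), of z w] h(3) by simp
    then have "dist (?h z) (?h w) = dist z w / k * (dist (?h z) p * dist (?h w) p)"
      using C(2) h(2) by simp
    also have "\<dots> \<le> dist z w / k * (2 * 2)"
      using C(2) S2_dist_le[OF h(1) C(1)] by (intro mult_left_mono mult_mono) auto
    finally show ?thesis by (simp add: mult.commute)
  qed
  show ?thesis
    unfolding continuous_on_iff
  proof (intro ballI allI impI)
    fix z and e :: real assume e: "e > 0"
    show "\<exists>d>0. \<forall>z'\<in>UNIV. dist z' z < d \<longrightarrow> dist (?h z') (?h z) < e"
    proof (intro exI[of _ "e * k / 4"] conjI ballI impI)
      show "e * k / 4 > 0" using e C by simp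
      fix z' assume "dist z' z < e * k / 4"
      then have "4 / k * dist z' z < e" using C(2) by (simp add: field_simps)
      then show "dist (?h z') (?h z) < e" using lip[of z' z] by linarith
    qed
  qed
qed

text \<open>Read off in the plane through a chart with pole \<open>- c\<close>; the bound
  \<open>r < 2\<close> keeps this pole away from the closed cap.\<close>

lemma cap_closure:
  assumes c: "c \<in> S2" and r: "0 < r" "r < 2" and D: "D = {x \<in> S2. dist x c < r}"
  shows "closure D = {x \<in> S2. dist x c \<le> r}" "circ D = {x \<in> S2. dist x c = r}"
    "connected D" "connected (circ D)" "circ D \<noteq> {}"
proof -
  obtain m k where ch: "chart m (- c) k" using chart_exists S2_antipode(1)[OF c c] by blast
  note C = chartD[OF ch]
  have "r < dist (- c) c" using r S2_antipode(4)[OF c c] by simp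
  then obtain z R where R: "R > 0" "m ` {x \<in> S2. dist x c < r} = ball z R" "m ` {x \<in> S2. dist x c = r} = sphere z R"
    by (rule chart_cap[OF ch c r(1)]) blast
  define h where "h = inv_into (S2 - {- c}) m"
  have hm: "h (m x) = x" if "x \<in> S2" "x \<noteq> - c" for x
    unfolding h_def using C(4) that by (simp add: inv_into_f_f)
  have ne: "x \<noteq> - c" if "dist x c \<le> r" for x using that r S2_antipode(4)[OF c c] by auto
  have cont: "continuous_on A h" for A unfolding h_def using chart_inverse_continuous[OF ch] continuous_on_subset by blast
  have Dh: "D = h ` ball z R"
  proof -
    have "h ` (m ` D) = D" using hm ne unfolding D by (force simp: image_image)
    then show ?thesis using R(2) D by simp
  qed
  have Eh: "{x \<in> S2. dist x c = r} = h ` sphere z R"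
  proof -
    have "h ` (m ` {x \<in> S2. dist x c = r}) = {x \<in> S2. dist x c = r}" using hm ne by (force simp: image_image)
    then show ?thesis using R(3) by simp
  qed
  have conD: "connected D" unfolding Dh by (intro connected_continuous_image cont) simp
  have conE: "connected {x \<in> S2. dist x c = r}" unfolding Eh
    by (intro connected_continuous_image cont connected_sphere) simp
  have closed: "closed {x \<in> S2. dist x c \<le> r}"
  proof -
    have "{x \<in> S2. dist x c \<le> r} = sphere 0 1 \<inter> cball c r" by (auto simp: S2_def dist_commute)
    then show ?thesis by auto
  qed
  have "closure D \<subseteq> {x \<in> S2. dist x c \<le> r}" by (rule closure_minimal[OF _ closed]) (auto simp: D)
  moreover have "{x \<in> S2. dist x c = r} \<subseteq> closure D"
  proof -
    have "h ` closure (ball z R) \<subseteq> closure (h ` ball z R)"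
      by (rule image_closure_subset[OF cont closed_closure closure_subset])
    moreover have "sphere z R \<subseteq> closure (ball z R)" using R(1) by auto
    ultimately show ?thesis unfolding Eh Dh by blast
  qed
  moreover have "D \<subseteq> closure D" by (rule closure_subset)
  ultimately have cl: "closure D = {x \<in> S2. dist x c \<le> r}" unfolding D by force
  then show "closure D = {x \<in> S2. dist x c \<le> r}" .
  show ci: "circ D = {x \<in> S2. dist x c = r}" unfolding circ_def cl by (auto simp: D)
  show "circ D \<noteq> {}" unfolding ci Eh using R(1) by auto
  show "connected D" "connected (circ D)" using conD conE ci by simp_all
qed

lemma round_disk_obtain:
  assumes "round_disk D"
  obtains c r where "c \<in> S2" "0 < r" "r < 2" "D = {x \<in> S2. dist x c < r}"
    "closure D = {x \<in> S2. dist x c \<le> r}" "circ D = {x \<in> S2. dist x c = r}"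
    "connected D" "connected (circ D)" "circ D \<noteq> {}"
proof -
  obtain c r where c: "c \<in> S2" "0 < r" "r < 2" "D = {x \<in> S2. dist x c < r}"
    using assms unfolding round_disk_def by blast
  show ?thesis using that[OF c] cap_closure[OF c] by blast
qed

text \<open>The complementary cap is centred at the antipode, with radius \<open>s\<close> given by
  s^2 = 4 - r^2. Thus the outside of a disk can be treated as a disk, also when the pole of a chart
  lies in the disk.\<close>

lemma round_disk_complement:
  assumes "round_disk D"
  shows "round_disk (S2 - closure D)" "connected (S2 - closure D)" "circ (S2 - closure D) = circ D"
    "closure (S2 - closure D) = S2 - D"
proof -
  obtain c r where D: "c \<in> S2" "0 < r" "r < 2" "D = {x \<in> S2. dist x c < r}"
    "closure D = {x \<in> S2. dist x c \<le> r}" "circ D = {x \<in> S2. dist x c = r}"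
    by (rule round_disk_obtain[OF assms]) blast
  define s where "s = sqrt (4 - r\<^sup>2)"
  have r2: "r\<^sup>2 < 4" "r\<^sup>2 > 0" using D(2,3) abs_square_less_1[of "r/2"] by (auto simp: power_divide)
  have s: "0 < s" "s < 2" "s\<^sup>2 = 4 - r\<^sup>2" using r2 by (auto simp: s_def real_less_lsqrt)
  have iff: "dist x (- c) < s \<longleftrightarrow> r < dist x c" "dist x (- c) = s \<longleftrightarrow> r = dist x c" if "x \<in> S2" for x
  proof -
    have e: "(dist x (- c))\<^sup>2 - s\<^sup>2 = r\<^sup>2 - (dist x c)\<^sup>2" using S2_antipode(2)[OF that D(1)] s(3) by simp
    have "dist x (- c) < s \<longleftrightarrow> (dist x (- c))\<^sup>2 < s\<^sup>2" "r < dist x c \<longleftrightarrow> r\<^sup>2 < (dist x c)\<^sup>2"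
      using s(1) D(2) by (auto intro: power_strict_mono dest: power2_less_imp_less power_less_imp_less_base)
    then show "dist x (- c) < s \<longleftrightarrow> r < dist x c" using e by auto
    have "dist x (- c) = s \<longleftrightarrow> (dist x (- c))\<^sup>2 = s\<^sup>2" "r = dist x c \<longleftrightarrow> r\<^sup>2 = (dist x c)\<^sup>2"
      using s(1) D(2) by auto
    then show "dist x (- c) = s \<longleftrightarrow> r = dist x c" using e by auto
  qed
  have E: "S2 - closure D = {x \<in> S2. dist x (- c) < s}" using iff D(5) by auto
  have c': "- c \<in> S2" using S2_antipode(1)[OF D(1) D(1)] .
  show "round_disk (S2 - closure D)" unfolding round_disk_def using E s c' by blast
  note cc = cap_closure[OF c' s(1,2) E]
  show "connected (S2 - closure D)" by (rule cc(3))
  show "circ (S2 - closure D) = circ D" unfolding cc(2) D(6) using iff(2) by auto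
  show "closure (S2 - closure D) = S2 - D"
  proof -
    have "dist x (- c) \<le> s \<longleftrightarrow> \<not> dist x c < r" if "x \<in> S2" for x using iff[OF that] by linarith
    then have "{x \<in> S2. dist x (- c) \<le> s} = S2 - {x \<in> S2. dist x c < r}" by blast
    then show ?thesis using cc(1) D(4) by simp
  qed
qed

lemma chart_disk:
  assumes ch: "chart m p k" and D: "round_disk D" "p \<notin> closure D"
  obtains z R where "R > 0" "m ` D = ball z R" "m ` circ D = sphere z R"
proof -
  obtain c r where c: "c \<in> S2" "0 < r" "D = {x \<in> S2. dist x c < r}"
    "closure D = {x \<in> S2. dist x c \<le> r}" "circ D = {x \<in> S2. dist x c = r}"
    by (rule round_disk_obtain[OF D(1)]) blast
  have "r < dist p c" using D(2) c(4) chartD(1)[OF ch] by auto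
  then show ?thesis
  proof (rule chart_cap[OF ch c(1,2)])
    fix z R assume "R > 0" "m ` {x \<in> S2. dist x c < r} = ball z R" "m ` {x \<in> S2. dist x c = r} = sphere z R"
    then show ?thesis using that c(3,5) by simp
  qed
qed

lemma chart_outer:
  assumes ch: "chart m p k" and D: "round_disk D" "p \<in> D"
  obtains z R where "R > 0" "m ` (S2 - closure D) = ball z R" "m ` circ D = sphere z R"
proof -
  have "p \<notin> closure (S2 - closure D)" unfolding round_disk_complement(4)[OF D(1)] using D(2) by simp
  then show ?thesis
    by (rule chart_disk[OF ch round_disk_complement(1)[OF D(1)]])
      (use that in \<open>simp add: round_disk_complement(3)[OF D(1)]\<close>)
qed

text \<open>The affine form of the reciprocal squared weight bounds the weight, so the map is
  Lipschitz.\<close>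

lemma Mob_continuous:
  assumes "Mob g"
  shows "continuous_on S2 g"
proof -
  obtain w \<alpha> \<beta> where w: "\<And>x. x \<in> S2 \<Longrightarrow> w x > 0"
    "\<And>x y. x \<in> S2 \<Longrightarrow> y \<in> S2 \<Longrightarrow> dist (g x) (g y) = w x * w y * dist x y"
    "norm \<beta> < \<alpha>" "\<And>x. x \<in> S2 \<Longrightarrow> (w x)\<^sup>2 * (\<alpha> - \<beta> \<bullet> x) = 1"
    by (rule Mob_weight_affine[OF assms]) blast
  define M where "M = 1 / (\<alpha> - norm \<beta>)"
  have M: "M > 0" using w(3) by (simp add: M_def)
  have w2: "(w x)\<^sup>2 \<le> M" if x: "x \<in> S2" for x
  proof -
    have "\<beta> \<bullet> x \<le> norm \<beta> * norm x" by (rule norm_cauchy_schwarz)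
    then have "\<alpha> - norm \<beta> \<le> \<alpha> - \<beta> \<bullet> x" using x by (simp add: S2_def)
    then have "(w x)\<^sup>2 * (\<alpha> - norm \<beta>) \<le> 1" using w(4)[OF x] by (metis mult_left_mono zero_le_power2)
    then show ?thesis using w(3) by (simp add: M_def field_simps)
  qed
  have lip: "dist (g x) (g y) \<le> M * dist x y" if "x \<in> S2" "y \<in> S2" for x y
  proof -
    have "w x * w y \<le> ((w x)\<^sup>2 + (w y)\<^sup>2) / 2" using sum_squares_bound[of "w x" "w y"] by simp
    then have "w x * w y \<le> M" using w2[OF that(1)] w2[OF that(2)] by (simp add: field_simps)
    then show ?thesis using w(2)[OF that] by (simp add: mult_right_mono)
  qed
  show ?thesis
    unfolding continuous_on_iff
  proof (intro ballI allI impI)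
    fix x and e :: real assume e: "e > 0" "x \<in> S2"
    show "\<exists>d>0. \<forall>x'\<in>S2. dist x' x < d \<longrightarrow> dist (g x') (g x) < e"
    proof (intro exI[of _ "e / M"] conjI ballI impI)
      show "e / M > 0" using e M by simp
      fix x' assume "x' \<in> S2" "dist x' x < e / M"
      then have "M * dist x' x < e" using M by (simp add: field_simps)
      then show "dist (g x') (g x) < e" using lip[OF \<open>x' \<in> S2\<close> e(2)] by linarith
    qed
  qed
qed

section \<open>Schottky sets\<close>

locale schottky =
  fixes S :: "R3 set" and \<D> :: "R3 set set"
  assumes compact_S: "compact S" and S_S2: "S \<subseteq> S2"
    and round: "D \<in> \<D> \<Longrightarrow> round_disk D"
    and three: "infinite \<D> \<or> card \<D> \<ge> 3"
    and disj_closure: "D \<in> \<D> \<Longrightarrow> D' \<in> \<D> \<Longrightarrow> D \<noteq> D' \<Longrightarrow> closure D \<inter> closure D' = {}"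
    and compl: "S2 - S = \<Union>\<D>"
begin

lemma disk_S2: "D \<in> \<D> \<Longrightarrow> D \<subseteq> S2" "D \<in> \<D> \<Longrightarrow> D \<inter> S = {}" "D \<in> \<D> \<Longrightarrow> closure D \<subseteq> S2"
  "D \<in> \<D> \<Longrightarrow> D \<noteq> {}"
proof -
  assume D: "D \<in> \<D>"
  show "D \<subseteq> S2" "D \<inter> S = {}" using compl D by auto
  obtain c r where "closure D = {x \<in> S2. dist x c \<le> r}" by (rule round_disk_obtain[OF round[OF D]]) blast
  then show "closure D \<subseteq> S2" by auto
  show "D \<noteq> {}"
  proof -
    have "circ D \<noteq> {}" by (rule round_disk_obtain[OF round[OF D]]) blast
    then show ?thesis unfolding circ_def by auto
  qed
qed

lemma disk_cases: "x \<in> S2 \<Longrightarrow> x \<notin> S \<Longrightarrow> \<exists>D\<in>\<D>. x \<in> D"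
  using compl by blast

lemma disk_unique: "D \<in> \<D> \<Longrightarrow> D' \<in> \<D> \<Longrightarrow> x \<in> closure D \<Longrightarrow> x \<in> closure D' \<Longrightarrow> D = D'"
  using disj_closure by blast

lemma disk_closure: "x \<in> D \<Longrightarrow> x \<in> closure D" for D :: "R3 set"
  using closure_subset by blast

lemma circ_S: "D \<in> \<D> \<Longrightarrow> circ D \<subseteq> S"
proof
  fix x assume D: "D \<in> \<D>" and x: "x \<in> circ D"
  then have xc: "x \<in> closure D" "x \<notin> D" "x \<in> S2" using disk_S2(3)[OF D] by (auto simp: circ_def)
  show "x \<in> S"
  proof (rule ccontr)
    assume "x \<notin> S"
    then obtain D' where "D' \<in> \<D>" "x \<in> D'" using disk_cases xc by blast
    then show False using disk_unique[OF D, of D' x] xc disk_closure by blast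
  qed
qed

lemma closure_disk_S: "D \<in> \<D> \<Longrightarrow> closure D \<inter> S = circ D"
  using circ_S[of D] disk_S2(2)[of D] by (auto simp: circ_def)

lemma disk_open:
  assumes "D \<in> \<D>" obtains T where "open T" "D = S2 \<inter> T"
proof -
  obtain c r where "D = {x \<in> S2. dist x c < r}" by (rule round_disk_obtain[OF round[OF assms]]) blast
  then have "D = S2 \<inter> ball c r" by (auto simp: dist_commute)
  then show ?thesis using that by blast
qed

text \<open>A separation of \<open>W \<inter> S\<close> would extend to a separation of
  \<open>W\<close>: the boundary circle of each disk is connected, hence lies on one side, and the
  disk is filled in on that side.\<close>

lemma connected_part:
  assumes W: "connected W" "W = S2 \<inter> T" "open T"
    and D: "\<And>D. D \<in> \<D> \<Longrightarrow> closure D \<subseteq> W \<or> D \<inter> W = {}"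
  shows "connected (W \<inter> S)"
proof (rule ccontr)
  assume "\<not> connected (W \<inter> S)"
  then obtain A B where AB: "open A" "open B" "W \<inter> S \<subseteq> A \<union> B" "A \<inter> B \<inter> (W \<inter> S) = {}"
     "A \<inter> (W \<inter> S) \<noteq> {}" "B \<inter> (W \<inter> S) \<noteq> {}"
    unfolding connected_def by blast
  have circW: "circ D \<subseteq> W \<inter> S" if "D \<in> \<D>" "D \<inter> W \<noteq> {}" for D
    using D[OF that(1)] circ_S[OF that(1)] that(2) by (auto simp: circ_def)
  have conn: "connected (circ D)" "circ D \<noteq> {}" if "D \<in> \<D>" for D by (rule round_disk_obtain[OF round[OF that]], blast)+
  \<comment> \<open>The trace of \<open>X\<close> on \<open>W \<inter> S\<close>, together with the
    disks in \<open>W\<close> that are filled in because their circles lie in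
    \<open>X\<close>.\<close>
  define E where "E X = (X \<inter> W \<inter> S) \<union> \<Union>{D \<in> \<D>. D \<inter> W \<noteq> {} \<and> circ D \<subseteq> X}" for X :: "R3 set"
  have opn: "\<exists>e>0. ball x e \<inter> W \<subseteq> E X" if X: "open X" "x \<in> E X"
    and sep: "\<And>D. D \<in> \<D> \<Longrightarrow> D \<inter> W \<noteq> {} \<Longrightarrow> circ D \<inter> X \<noteq> {} \<Longrightarrow> circ D \<subseteq> X" for x X
  proof (cases "x \<in> S")
    case True
    then have xX: "x \<in> X" "x \<in> W" using X(2) disk_S2(2) unfolding E_def by auto
    obtain e where e: "e > 0" "ball x e \<subseteq> X" using X(1) xX(1) open_contains_ball by blast
    define e' where "e' = min e 1"
    have e': "e' > 0" "e' < 2" "ball x e' \<subseteq> X" using e by (auto simp: e'_def)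
    have xS2: "x \<in> S2" using True S_S2 by blast
    have cap: "connected {y \<in> S2. dist y x < e'}" using cap_closure(3)[OF xS2 e'(1,2) refl] .
    have "ball x e' \<inter> W \<subseteq> E X"
    proof
      fix y assume y: "y \<in> ball x e' \<inter> W"
      show "y \<in> E X"
      proof (cases "y \<in> S")
        case True then show ?thesis using y e'(3) unfolding E_def by auto
      next
        case False
        then obtain D0 where D0: "D0 \<in> \<D>" "y \<in> D0" using disk_cases y W(2) by blast
        have DW: "D0 \<inter> W \<noteq> {}" using D0 y by auto
        \<comment> \<open>A disk that enters a small cap around a point of \<open>S\<close> has
          boundary points in the cap: otherwise the disk and the complement of its closure would
          separate the cap.\<close>
        have "circ D0 \<inter> X \<noteq> {}"
        proof (rule ccontr)
          assume H: "\<not> circ D0 \<inter> X \<noteq> {}"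
          obtain T0 where T0: "open T0" "D0 = S2 \<inter> T0" using disk_open[OF D0(1)] by blast
          have "T0 \<inter> (- closure D0) \<inter> {y \<in> S2. dist y x < e'} = {}"
            using T0 closure_subset[of D0] by blast
          moreover have "{y \<in> S2. dist y x < e'} \<subseteq> T0 \<union> (- closure D0)"
          proof
            fix u assume u: "u \<in> {y \<in> S2. dist y x < e'}"
            then have "u \<in> X" using e'(3) by (auto simp: dist_commute)
            then have "u \<notin> circ D0" using H by auto
            then show "u \<in> T0 \<union> (- closure D0)" using u T0 by (auto simp: circ_def)
          qed
          moreover have "y \<in> T0 \<inter> {y \<in> S2. dist y x < e'}" using y D0 T0 W(2) by (auto simp: dist_commute)
          moreover have "x \<in> - closure D0 \<inter> {y \<in> S2. dist y x < e'}"
          proof -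
            have "x \<notin> closure D0" using H xX(1) True closure_disk_S[OF D0(1)] by blast
            then show ?thesis using xS2 e' by simp
          qed
          ultimately show False using connectedD[OF cap T0(1), of "- closure D0"] by blast
        qed
        then have "circ D0 \<subseteq> X" using sep[OF D0(1) DW] by blast
        then show ?thesis unfolding E_def using D0 DW by blast
      qed
    qed
    then show ?thesis using e' by blast
  next
    case False
    then obtain D0 where D0: "D0 \<in> \<D>" "D0 \<inter> W \<noteq> {}" "circ D0 \<subseteq> X" "x \<in> D0" using X(2) unfolding E_def by auto
    obtain T0 where T0: "open T0" "D0 = S2 \<inter> T0" using disk_open[OF D0(1)] by blast
    then obtain e where "e > 0" "ball x e \<subseteq> T0" using D0(4) open_contains_ball by blast
    then have "ball x e \<inter> W \<subseteq> D0" using T0(2) W(2) by blast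
    then show ?thesis using \<open>e > 0\<close> D0 unfolding E_def by blast
  qed
  have dich: "circ D \<subseteq> A \<or> circ D \<subseteq> B" if "D \<in> \<D>" "D \<inter> W \<noteq> {}" for D
    using connectedD[OF conn(1)[OF that(1)] AB(1,2)] circW[OF that] AB(3,4) by blast
  have sepA: "circ D \<subseteq> A" if "D \<in> \<D>" "D \<inter> W \<noteq> {}" "circ D \<inter> A \<noteq> {}" for D
    using dich[OF that(1,2)] that(3) circW[OF that(1,2)] AB(4) by blast
  have sepB: "circ D \<subseteq> B" if "D \<in> \<D>" "D \<inter> W \<noteq> {}" "circ D \<inter> B \<noteq> {}" for D
    using dich[OF that(1,2)] that(3) circW[OF that(1,2)] AB(4) by blast
  \<comment> \<open>\<open>A'\<close> and \<open>B'\<close> are open sets of the ambient space that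
    cut \<open>E A\<close> and \<open>E B\<close> out of \<open>W\<close>.\<close>
  define A' where "A' = \<Union>{ball x e | x e. ball x e \<inter> W \<subseteq> E A}"
  define B' where "B' = \<Union>{ball x e | x e. ball x e \<inter> W \<subseteq> E B}"
  have "open A'" "open B'" unfolding A'_def B'_def by auto
  moreover have A'W: "A' \<inter> W = E A"
  proof -
    have "E A \<subseteq> W" unfolding E_def using D disk_closure by blast
    moreover have "E A \<subseteq> A'"
    proof
      fix x assume "x \<in> E A"
      then obtain e where "e > 0" "ball x e \<inter> W \<subseteq> E A" using opn[OF AB(1) _ sepA] by blast
      then show "x \<in> A'" unfolding A'_def using centre_in_ball by blast
    qed
    ultimately show ?thesis unfolding A'_def by blast
  qed
  moreover have B'W: "B' \<inter> W = E B"
  proof -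
    have "E B \<subseteq> W" unfolding E_def using D disk_closure by blast
    moreover have "E B \<subseteq> B'"
    proof
      fix x assume "x \<in> E B"
      then obtain e where "e > 0" "ball x e \<inter> W \<subseteq> E B" using opn[OF AB(2) _ sepB] by blast
      then show "x \<in> B'" unfolding B'_def using centre_in_ball by blast
    qed
    ultimately show ?thesis unfolding B'_def by blast
  qed
  moreover have "W \<subseteq> E A \<union> E B"
  proof
    fix x assume x: "x \<in> W"
    show "x \<in> E A \<union> E B"
    proof (cases "x \<in> S")
      case True then show ?thesis using x AB(3) unfolding E_def by auto
    next
      case False
      then obtain D0 where "D0 \<in> \<D>" "x \<in> D0" using disk_cases x W(2) by blast
      then show ?thesis using dich[of D0] x unfolding E_def by auto
    qed
  qed
  moreover have "E A \<inter> E B = {}"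
  proof (rule ccontr)
    assume "E A \<inter> E B \<noteq> {}"
    then obtain x where x: "x \<in> E A" "x \<in> E B" by blast
    show False
    proof (cases "x \<in> S")
      case True then show False using x AB(4) disk_S2(2) unfolding E_def by auto
    next
      case False
      then obtain D1 D2 where D12: "D1 \<in> \<D>" "D1 \<inter> W \<noteq> {}" "circ D1 \<subseteq> A" "x \<in> D1" "D2 \<in> \<D>" "circ D2 \<subseteq> B" "x \<in> D2"
        using x unfolding E_def by auto
      then have "D1 = D2" using disk_unique disk_closure by blast
      then show False using D12 conn(2)[OF D12(1)] circW[OF D12(1,2)] AB(4) by blast
    qed
  qed
  moreover have "E A \<noteq> {}" "E B \<noteq> {}" using AB(5,6) unfolding E_def by auto
  ultimately show False using connectedD[OF W(1), of A' B'] by blast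
qed

lemma connected_S: "connected S"
proof -
  have "connected S2" unfolding S2_def by (rule connected_sphere) simp
  then have "connected (S2 \<inter> S)" by (rule connected_part[where T=UNIV]) (auto dest: disk_S2(3))
  then show ?thesis using S_S2 by (simp add: Int_absorb1)
qed

text \<open>Apply \<open>connected_part\<close> to the outside of the closed disk. This is the
  topological mark of a peripheral circle: a closed curve that does not separate
  \<open>S\<close>.\<close>

lemma connected_S_minus_circ:
  assumes "D \<in> \<D>" shows "connected (S - circ D)"
proof -
  have "connected ((S2 - closure D) \<inter> S)"
  proof (rule connected_part[where T="- closure D"])
    show "connected (S2 - closure D)" using round_disk_complement(2)[OF round[OF assms]] .
    show "closure D' \<subseteq> S2 - closure D \<or> D' \<inter> (S2 - closure D) = {}" if "D' \<in> \<D>" for D'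
      using disj_closure[OF that assms] disk_S2(3)[OF that] closure_subset[of D] by (cases "D' = D") auto
  qed auto
  moreover have "(S2 - closure D) \<inter> S = S - circ D" using S_S2 closure_disk_S[OF assms] by blast
  ultimately show ?thesis by simp
qed

lemma two_disks:
  obtains D1 D2 where "D1 \<in> \<D>" "D2 \<in> \<D>" "D1 \<noteq> D2"
proof -
  have "\<not> (\<exists>D. \<D> \<subseteq> {D})"
  proof
    assume "\<exists>D. \<D> \<subseteq> {D}"
    then obtain D where "\<D> \<subseteq> {D}" by blast
    then have "finite \<D>" "card \<D> \<le> 1" using finite_subset card_mono[of "{D}" \<D>] by auto
    then show False using three by auto
  qed
  then show ?thesis using that by blast
qed

lemma two_points: obtains a b where "a \<in> S" "b \<in> S" "a \<noteq> b"
proof -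
  obtain D1 D2 where D: "D1 \<in> \<D>" "D2 \<in> \<D>" "D1 \<noteq> D2" by (rule two_disks)
  have cirne: "circ D \<noteq> {}" if "D \<in> \<D>" for D by (rule round_disk_obtain[OF round[OF that]]) blast
  have "circ D1 \<noteq> {}" "circ D2 \<noteq> {}" using cirne D(1,2) by blast+
  then obtain a b where "a \<in> circ D1" "b \<in> circ D2" by blast
  moreover have "a \<noteq> b" using calculation disk_unique[OF D(1,2), of a] D(3) by (auto simp: circ_def)
  ultimately show ?thesis using that circ_S D by blast
qed

text \<open>Distances from a point to the connected set \<open>S\<close> fill an interval, and one
  of two fixed points is at least half their mutual distance away. Every blow-up needs points at a
  prescribed scale.\<close>

lemma scale_points: "\<exists>t0>0. \<forall>x\<in>S. \<forall>t. 0 < t \<and> t \<le> t0 \<longrightarrow> (\<exists>y\<in>S. dist x y = t)"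
proof -
  obtain a b where ab: "a \<in> S" "b \<in> S" "a \<noteq> b" by (rule two_points)
  show ?thesis
  proof (intro exI[of _ "dist a b / 2"] conjI ballI allI impI)
    show "dist a b / 2 > 0" using ab by simp
    fix x t assume x: "x \<in> S" and t: "0 < t \<and> t \<le> dist a b / 2"
    have "dist a b \<le> dist x a + dist x b" by (metis dist_commute dist_triangle)
    then have "t \<le> dist x a \<or> t \<le> dist x b" using t by linarith
    then obtain c where c: "c \<in> S" "t \<le> dist x c" using ab by blast
    have "connected ((\<lambda>y. dist x y) ` S)" by (intro connected_continuous_image connected_S continuous_intros)
    moreover have "dist x x \<in> (\<lambda>y. dist x y) ` S" "dist x c \<in> (\<lambda>y. dist x y) ` S" using x c by auto
    ultimately have "t \<in> (\<lambda>y. dist x y) ` S" using t c unfolding connected_iff_interval by (metis dist_self less_imp_le)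
    then show "\<exists>y\<in>S. dist x y = t" by auto
  qed
qed

lemma connected_in_disk:
  assumes "connected A" "A \<subseteq> \<Union>\<D>" "A \<noteq> {}"
  shows "\<exists>D\<in>\<D>. A \<subseteq> D"
proof -
  obtain x D where x: "x \<in> A" "D \<in> \<D>" "x \<in> D" using assms by blast
  have "\<exists>T. \<forall>D\<in>\<D>. open (T D) \<and> D = S2 \<inter> T D" by (rule bchoice) (blast elim: disk_open)
  then obtain T where T: "\<And>D. D \<in> \<D> \<Longrightarrow> open (T D)" "\<And>D. D \<in> \<D> \<Longrightarrow> D = S2 \<inter> T D" by blast
  define O2 where "O2 = \<Union>(T ` (\<D> - {D}))"
  have AS: "A \<subseteq> S2" using assms(2) disk_S2(1) by blast
  have "open O2" unfolding O2_def using T(1) by blast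
  moreover have "T D \<inter> O2 \<inter> A = {}"
  proof (rule ccontr)
    assume "T D \<inter> O2 \<inter> A \<noteq> {}"
    then obtain y D' where "y \<in> T D" "D' \<in> \<D>" "D' \<noteq> D" "y \<in> T D'" "y \<in> S2" unfolding O2_def using AS by blast
    then have "y \<in> D" "y \<in> D'" using T(2) x(2) by blast+
    then show False using disk_unique[OF x(2) \<open>D' \<in> \<D>\<close>, of y] disk_closure \<open>D' \<noteq> D\<close> by blast
  qed
  moreover have "A \<subseteq> T D \<union> O2"
  proof
    fix y assume "y \<in> A"
    then obtain D' where "D' \<in> \<D>" "y \<in> D'" using assms(2) by blast
    then show "y \<in> T D \<union> O2" unfolding O2_def using T(2) by (cases "D' = D") blast+
  qed
  ultimately have "O2 \<inter> A = {}"
    using connectedD[OF assms(1) T(1)[OF x(2)], of O2] x T(2) by blast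
  then have "A \<subseteq> D" using \<open>A \<subseteq> T D \<union> O2\<close> T(2)[OF x(2)] AS by blast
  then show ?thesis using x by blast
qed

text \<open>The connected image of a disk misses \<open>S\<close>, so it lies in a single disk;
  applying the inverse map turns the inclusion into equality. Closures and circles follow by
  compactness and injectivity.\<close>

lemma Mob_disk:
  assumes g: "Mob g" "g ` S = S" and D: "D \<in> \<D>"
  shows "g ` D \<in> \<D>" "closure (g ` D) = g ` closure D" "g ` circ D = circ (g ` D)"
proof -
  obtain h where h: "Mob h" "\<And>x. x \<in> S2 \<Longrightarrow> h x \<in> S2" "\<And>x. x \<in> S2 \<Longrightarrow> h (g x) = x" "\<And>x. x \<in> S2 \<Longrightarrow> g (h x) = x"
    by (rule Mob_inverse[OF g(1)]) blast
  have gS2: "g x \<in> S2" if "x \<in> S2" for x using g(1) that unfolding Mob_def by (metis bij_betwE)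
  have hS: "h ` S = S"
  proof -
    have "h ` g ` S = S" using h(3) S_S2 by (force simp: image_image)
    then show ?thesis using g(2) by simp
  qed
  have step: "\<exists>D'\<in>\<D>. f ` E \<subseteq> D'" if f: "Mob f" "\<And>x. x \<in> S2 \<Longrightarrow> f x \<in> S2" "\<And>x. x \<in> S2 \<Longrightarrow> f x \<in> S \<Longrightarrow> x \<in> S" and E: "E \<in> \<D>" for f E
  proof (rule connected_in_disk)
    have "connected E" by (rule round_disk_obtain[OF round[OF E]]) blast
    then show "connected (f ` E)" using connected_continuous_image continuous_on_subset[OF Mob_continuous[OF f(1)] disk_S2(1)[OF E]] by blast
    show "f ` E \<subseteq> \<Union>\<D>" unfolding compl[symmetric] using f disk_S2[OF E] by blast
    show "f ` E \<noteq> {}" using disk_S2(4)[OF E] by simp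
  qed
  have gi: "x \<in> S" if "x \<in> S2" "g x \<in> S" for x using hS h(3)[OF that(1)] that(2) by (metis imageI)
  have hi: "x \<in> S" if "x \<in> S2" "h x \<in> S" for x using g(2) h(4)[OF that(1)] that(2) by (metis imageI)
  obtain D' where D': "D' \<in> \<D>" "g ` D \<subseteq> D'" using step[OF g(1) gS2 gi D] by blast
  obtain D'' where D'': "D'' \<in> \<D>" "h ` D' \<subseteq> D''" using step[OF h(1,2) hi D'(1)] by blast
  have hgD: "h ` g ` D = D" using h(3) disk_S2(1)[OF D] by (force simp: image_image)
  then have "D \<subseteq> D''" using D' D'' by blast
  then have "D = D''" using disk_unique[OF D D''(1)] disk_S2(4)[OF D] disk_closure by blast
  then have "D' \<subseteq> g ` D"
  proof -
    have "g ` h ` D' = D'" using h(4) disk_S2(1)[OF D'(1)] by (force simp: image_image)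
    then show ?thesis using D''(2) \<open>D = D''\<close> by blast
  qed
  then have "g ` D = D'" using D' by blast
  then show "g ` D \<in> \<D>" using D' by simp
  have cg: "continuous_on (closure D) g" using continuous_on_subset[OF Mob_continuous[OF g(1)] disk_S2(3)[OF D]] .
  have "compact (closure D)"
    using disk_S2(3)[OF D] by (metis S2_def bounded_sphere bounded_subset closed_closure compact_eq_bounded_closed)
  then have "closed (g ` closure D)" using compact_continuous_image[OF cg] compact_imp_closed by blast
  then have "closure (g ` D) \<subseteq> g ` closure D" by (metis closure_minimal closure_subset image_mono)
  moreover have "g ` closure D \<subseteq> closure (g ` D)"
    by (rule image_closure_subset[OF cg closed_closure closure_subset])
  ultimately show cl: "closure (g ` D) = g ` closure D" by blast
  have "inj_on g S2" using g(1) unfolding Mob_def bij_betw_def by blast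
  then have "g ` (closure D - D) = g ` closure D - g ` D"
    using disk_S2[OF D] by (intro inj_on_image_set_diff[of g S2]) auto
  then show "g ` circ D = circ (g ` D)" unfolding circ_def cl .
qed

end

definition weight_of :: "(R3 \<Rightarrow> real) \<Rightarrow> (R3 \<Rightarrow> R3) \<Rightarrow> bool" where
  "weight_of w g \<longleftrightarrow> (\<forall>x\<in>S2. w x > 0) \<and> (\<forall>x\<in>S2. \<forall>y\<in>S2. dist (g x) (g y) = w x * w y * dist x y)"

lemma weight_ofD:
  assumes "weight_of w g"
  shows "x \<in> S2 \<Longrightarrow> w x > 0" "x \<in> S2 \<Longrightarrow> y \<in> S2 \<Longrightarrow> dist (g x) (g y) = w x * w y * dist x y"
  using assms by (auto simp: weight_of_def)

lemma Mob_weight: "Mob g \<Longrightarrow> \<exists>w. weight_of w g" "Mob g \<Longrightarrow> x \<in> S2 \<Longrightarrow> g x \<in> S2"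
  unfolding Mob_def weight_of_def by (blast, metis bij_betwE)

text \<open>Recovers one factor from pairwise products: p^2 = (p q)(p r) / (q r).\<close>

lemma product_lower:
  fixes p q r :: real
  assumes "p > 0" "q > 0" "r > 0" "A \<le> p * q" "B \<le> p * r" "q * r \<le> C" "0 < A" "0 < B"
  shows "A * B / C \<le> p\<^sup>2"
proof -
  have C: "C > 0" using assms by (meson less_le_trans mult_pos_pos)
  have "A * B \<le> (p * q) * (p * r)" using assms by (intro mult_mono) auto
  also have "\<dots> = p\<^sup>2 * (q * r)" by (simp add: power2_eq_square)
  also have "\<dots> \<le> p\<^sup>2 * C" using assms by (intro mult_left_mono) auto
  finally show ?thesis using C by (simp add: divide_le_eq)
qed

section \<open>Cocompact group actions\<close>

text \<open>Cocompactness on triples in quantitative form: \<open>\<kappa>\<close> bounds from below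
  the separation of the triples in a compact set whose translates cover all triples.\<close>

locale schottky_group = schottky +
  fixes G :: "(R3 \<Rightarrow> R3) set" and \<kappa> :: real
  assumes G_Mob: "g \<in> G \<Longrightarrow> Mob g" and G_S: "g \<in> G \<Longrightarrow> g ` S = S" and kappa: "\<kappa> > 0"
    and cocompact: "x \<in> S \<Longrightarrow> y \<in> S \<Longrightarrow> z \<in> S \<Longrightarrow> x \<noteq> y \<Longrightarrow> y \<noteq> z \<Longrightarrow> x \<noteq> z \<Longrightarrow>
      \<exists>g\<in>G. \<kappa> \<le> dist (g x) (g y) \<and> \<kappa> \<le> dist (g y) (g z) \<and> \<kappa> \<le> dist (g x) (g z)"
begin

text \<open>A conformal elevator. A triple of diameter about \<open>t\<close> at \<open>x\<close> is
  moved to a \<kappa>-separated one. The pairwise products of the weights at the three points are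
  then comparable to \<open>1 / t\<close>, hence so is each squared weight, and no squared weight on
  the sphere is of larger order.\<close>

lemma scale_group:
  "\<exists>t0>0. \<forall>x\<in>S. \<forall>t. 0 < t \<and> t \<le> t0 \<longrightarrow> (\<exists>g\<in>G. \<exists>w. \<exists>y\<in>S. dist x y = t \<and> weight_of w g \<and> \<kappa> \<le> dist (g x) (g y) \<and>
      \<kappa>\<^sup>2 / (6 * t) \<le> (w x)\<^sup>2 \<and> (\<forall>a\<in>S2. (w a)\<^sup>2 \<le> 384 / (\<kappa>\<^sup>2 * t)))"
proof -
  obtain t0 where t0: "t0 > 0" "\<And>x t. x \<in> S \<Longrightarrow> 0 < t \<Longrightarrow> t \<le> t0 \<Longrightarrow> \<exists>y\<in>S. dist x y = t"
    using scale_points by blast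
  show ?thesis
  proof (intro exI[of _ t0] conjI ballI allI impI t0(1))
    fix x t assume x: "x \<in> S" and t: "0 < t \<and> t \<le> t0"
    obtain y where y: "y \<in> S" "dist x y = t" using t0(2)[OF x] t by blast
    \<comment> \<open>Distances \<open>t\<close> and \<open>t / 2\<close> from \<open>x\<close> keep
      the third side between \<open>t / 2\<close> and \<open>3 * t / 2\<close>.\<close>
    obtain z where z: "z \<in> S" "dist x z = t / 2" using t0(2)[OF x, of "t/2"] t by auto
    have yz: "t / 2 \<le> dist y z" "dist y z \<le> 3 * t / 2"
      using dist_triangle[of x y z] dist_triangle[of y z x] y z by (auto simp: dist_commute)
    have S2: "x \<in> S2" "y \<in> S2" "z \<in> S2" using x y z S_S2 by auto
    obtain g where g: "g \<in> G" "\<kappa> \<le> dist (g x) (g y)" "\<kappa> \<le> dist (g y) (g z)" "\<kappa> \<le> dist (g x) (g z)"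
      using cocompact[OF x y(1) z(1)] y z yz t by force
    obtain w where w: "weight_of w g" using Mob_weight(1)[OF G_Mob[OF g(1)]] by blast
    note W = weight_ofD[OF w]
    have gS: "g u \<in> S2" if "u \<in> S2" for u using Mob_weight(2)[OF G_Mob[OF g(1)] that] .
    have p: "w x > 0" "w y > 0" "w z > 0" using W(1) S2 by auto
    have le: "dist (g u) (g v) \<le> 2" if "u \<in> S2" "v \<in> S2" for u v using S2_dist_le gS that by blast
    have xy: "\<kappa> / t \<le> w x * w y" "w x * w y \<le> 2 / t"
      using W(2)[OF S2(1,2)] g(2) le[OF S2(1,2)] y t by (auto simp: field_simps)
    have xz: "2 * \<kappa> / t \<le> w x * w z" "w x * w z \<le> 4 / t"
      using W(2)[OF S2(1,3)] g(4) le[OF S2(1,3)] z t by (auto simp: field_simps)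
    have yzp: "w y * w z > 0" using p by simp
    have yz1: "2 * \<kappa> / (3 * t) \<le> w y * w z"
    proof -
      have "\<kappa> \<le> w y * w z * (3 * t / 2)"
        using W(2)[OF S2(2,3)] g(3) yz(2) yzp by (metis mult_left_mono less_imp_le order_trans)
      then show ?thesis using t by (simp add: field_simps)
    qed
    have yz2: "w y * w z \<le> 4 / t"
    proof -
      have "w y * w z * (t / 2) \<le> 2"
        using W(2)[OF S2(2,3)] le[OF S2(2,3)] yz(1) yzp by (metis mult_left_mono less_imp_le order_trans)
      then show ?thesis using t by (simp add: field_simps)
    qed
    have "0 < \<kappa> / t" "0 < 2 * \<kappa> / t" "0 < 2 * \<kappa> / (3 * t)" using kappa t by auto
    note pos = this
    have wx: "\<kappa>\<^sup>2 / (6 * t) \<le> (w x)\<^sup>2"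
    proof -
      have "\<kappa> / t * (2 * \<kappa> / t) / (4 / t) \<le> (w x)\<^sup>2"
        by (rule product_lower[OF p xy(1) xz(1) yz2 pos(1,2)])
      moreover have "\<kappa> / t * (2 * \<kappa> / t) / (4 / t) = \<kappa>\<^sup>2 / (2 * t)" using t by (simp add: field_simps power2_eq_square)
      moreover have "\<kappa>\<^sup>2 / (6 * t) \<le> \<kappa>\<^sup>2 / (2 * t)" using t by (simp add: divide_left_mono)
      ultimately show ?thesis by linarith
    qed
    have wy: "\<kappa>\<^sup>2 / (6 * t) \<le> (w y)\<^sup>2"
    proof -
      have "\<kappa> / t * (2 * \<kappa> / (3 * t)) / (4 / t) \<le> (w y)\<^sup>2"
        by (rule product_lower[OF p(2,1,3) _ yz1 xz(2) pos(1,3)]) (use xy(1) in \<open>simp add: mult.commute\<close>)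
      moreover have "\<kappa> / t * (2 * \<kappa> / (3 * t)) / (4 / t) = \<kappa>\<^sup>2 / (6 * t)" using t by (simp add: field_simps power2_eq_square)
      ultimately show ?thesis by simp
    qed
    have wz: "\<kappa>\<^sup>2 / (6 * t) \<le> (w z)\<^sup>2"
    proof -
      have "2 * \<kappa> / t * (2 * \<kappa> / (3 * t)) / (2 / t) \<le> (w z)\<^sup>2"
        by (rule product_lower[OF p(3,1,2) _ _ xy(2) pos(2,3)]) (use xz(1) yz1 in \<open>simp_all add: mult.commute\<close>)
      moreover have "2 * \<kappa> / t * (2 * \<kappa> / (3 * t)) / (2 / t) = 2 * \<kappa>\<^sup>2 / (3 * t)" using t by (simp add: field_simps power2_eq_square)
      moreover have "\<kappa>\<^sup>2 / (6 * t) \<le> 2 * \<kappa>\<^sup>2 / (3 * t)" using t by (simp add: field_simps)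
      ultimately show ?thesis by linarith
    qed
    have "(w a)\<^sup>2 \<le> 384 / (\<kappa>\<^sup>2 * t)" if a: "a \<in> S2" for a
    proof -
      \<comment> \<open>Since \<open>x\<close> and \<open>y\<close> are \<open>t\<close> apart, one
        of them is at least \<open>t / 4\<close> from \<open>a\<close>. Image distances are at most
        2, so \<open>w a * w r \<le> 8 / t\<close>, and the lower bound for \<open>w r\<close>
        yields the constant 64 * 6.\<close>
      have "\<exists>r\<in>S2. t / 4 \<le> dist a r \<and> \<kappa>\<^sup>2 / (6 * t) \<le> (w r)\<^sup>2"
      proof (cases "t / 4 \<le> dist a x")
        case True then show ?thesis using wx S2 by blast
      next
        case False
        have "dist x y \<le> dist a x + dist a y" by (metis dist_commute dist_triangle)
        then have "t / 4 \<le> dist a y" using False y t by linarith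
        then show ?thesis using wy S2 by blast
      qed
      then obtain r where r: "r \<in> S2" "t / 4 \<le> dist a r" "\<kappa>\<^sup>2 / (6 * t) \<le> (w r)\<^sup>2" by blast
      have wa: "w a > 0" "w r > 0" using W(1) a r by auto
      have "w a * w r * (t / 4) \<le> 2"
        using W(2)[OF a r(1)] le[OF a r(1)] r(2) wa by (metis mult_left_mono mult_pos_pos less_imp_le order_trans)
      then have "w a * w r \<le> 8 / t" using t by (simp add: field_simps)
      then have "(w a * w r)\<^sup>2 \<le> (8 / t)\<^sup>2" using wa by (intro power_mono) auto
      then have "(w a)\<^sup>2 * (w r)\<^sup>2 \<le> 64 / t\<^sup>2" by (simp add: power_mult_distrib power_divide)
      moreover have "(w a)\<^sup>2 * (\<kappa>\<^sup>2 / (6 * t)) \<le> (w a)\<^sup>2 * (w r)\<^sup>2" using r(3) by (intro mult_left_mono) auto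
      ultimately have "(w a)\<^sup>2 * (\<kappa>\<^sup>2 / (6 * t)) \<le> 64 / t\<^sup>2" by linarith
      moreover have "\<kappa>\<^sup>2 / (6 * t) > 0" using kappa t by simp
      ultimately have "(w a)\<^sup>2 \<le> 64 / t\<^sup>2 / (\<kappa>\<^sup>2 / (6 * t))" by (simp only: pos_le_divide_eq)
      also have "\<dots> = 384 / (\<kappa>\<^sup>2 * t)" using kappa t by (simp add: field_simps power2_eq_square)
      finally show ?thesis .
    qed
    then show "\<exists>g\<in>G. \<exists>w. \<exists>y\<in>S. dist x y = t \<and> weight_of w g \<and> \<kappa> \<le> dist (g x) (g y) \<and>
      \<kappa>\<^sup>2 / (6 * t) \<le> (w x)\<^sup>2 \<and> (\<forall>a\<in>S2. (w a)\<^sup>2 \<le> 384 / (\<kappa>\<^sup>2 * t))"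
      using g w y wx by blast
  qed
qed

lemma circ_two: "D \<in> \<D> \<Longrightarrow> \<exists>u\<in>circ D. \<exists>v\<in>circ D. u \<noteq> v"
proof -
  assume D: "D \<in> \<D>"
  obtain p where p: "p \<in> D" using disk_S2(4)[OF D] by blast
  then have "p \<in> S2" using disk_S2(1)[OF D] by blast
  then obtain m k where m: "chart m p k" by (rule chart_exists)
  obtain z R where R: "R > 0" "m ` circ D = sphere z R" by (rule chart_outer[OF m round[OF D] p]) blast
  have "z + of_real R \<in> m ` circ D" "z - of_real R \<in> m ` circ D" using R by (auto simp: dist_norm)
  then obtain u v where "u \<in> circ D" "v \<in> circ D" "m u = z + of_real R" "m v = z - of_real R" by (metis imageE)
  moreover have "z + of_real R \<noteq> z - of_real R" using R(1) by (simp add: complex_eq_iff)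
  ultimately show ?thesis by metis
qed

text \<open>Enlarge the neighbourhood of \<open>x\<close> by the elevator. What lies outside the
  ball is squeezed into a set too small to meet two fixed disks at positive distance, so one of them
  pulls back into the ball; the upper bound on the weights prevents it from becoming too
  small.\<close>

lemma porosity:
  "\<exists>C>0. \<exists>\<rho>0>0. \<forall>x\<in>S. \<forall>\<rho>. 0 < \<rho> \<and> \<rho> < \<rho>0 \<longrightarrow>
     (\<exists>D\<in>\<D>. closure D \<subseteq> ball x \<rho> \<and> (\<exists>u\<in>circ D. \<exists>v\<in>circ D. \<rho> \<le> C * dist u v))"
proof -
  obtain t0 where t0: "t0 > 0" and T0: "\<And>x t. x \<in> S \<Longrightarrow> 0 < t \<Longrightarrow> t \<le> t0 \<Longrightarrow> (\<exists>g\<in>G. \<exists>w. \<exists>y\<in>S. dist x y = t \<and> weight_of w g \<and> \<kappa> \<le> dist (g x) (g y) \<and>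
      \<kappa>\<^sup>2 / (6 * t) \<le> (w x)\<^sup>2 \<and> (\<forall>a\<in>S2. (w a)\<^sup>2 \<le> 384 / (\<kappa>\<^sup>2 * t)))"
    using scale_group by blast
  obtain D1 D2 where D: "D1 \<in> \<D>" "D2 \<in> \<D>" "D1 \<noteq> D2" by (rule two_disks)
  have cpt: "compact (closure D)" if "D \<in> \<D>" for D
    using disk_S2(3)[OF that] by (metis S2_def bounded_sphere bounded_subset closed_closure compact_eq_bounded_closed)
  obtain e0 where e0: "e0 > 0" "\<And>u v. u \<in> closure D1 \<Longrightarrow> v \<in> closure D2 \<Longrightarrow> e0 \<le> dist u v"
    using separate_compact_closed[OF cpt[OF D(1)] closed_closure disj_closure[OF D]] by blast
  obtain u1 v1 where uv1: "u1 \<in> circ D1" "v1 \<in> circ D1" "u1 \<noteq> v1" using circ_two D by blast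
  obtain u2 v2 where uv2: "u2 \<in> circ D2" "v2 \<in> circ D2" "u2 \<noteq> v2" using circ_two D by blast
  define l where "l = min (dist u1 v1) (dist u2 v2)"
  have l: "l > 0" using uv1 uv2 by (simp add: l_def)
  \<comment> \<open>So large that points at distance at least \<open>L * t\<close> from
    \<open>x\<close> have images less than \<open>e0\<close> apart.\<close>
  define L where "L = 48 / (\<kappa>\<^sup>2 * e0) + 1"
  have L: "L \<ge> 1" "48 / (\<kappa>\<^sup>2 * L) < e0"
  proof -
    show "L \<ge> 1" using kappa e0 by (simp add: L_def)
    have "\<kappa>\<^sup>2 * e0 > 0" using kappa e0 by simp
    moreover from this have "L * (\<kappa>\<^sup>2 * e0) = 48 + \<kappa>\<^sup>2 * e0"
      using kappa e0(1) by (simp only: L_def distrib_right) simp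
    ultimately have "48 < L * (\<kappa>\<^sup>2 * e0)" by simp
    then show "48 / (\<kappa>\<^sup>2 * L) < e0" using kappa \<open>L \<ge> 1\<close> by (simp add: field_simps)
  qed
  define C where "C = 384 * L / (l * \<kappa>\<^sup>2)"
  show ?thesis
  proof (rule exI[of _ C], intro conjI exI[of _ t0] ballI allI impI t0)
    show "C > 0" using L l kappa by (simp add: C_def)
    fix x \<rho> assume x: "x \<in> S" and rho: "0 < \<rho> \<and> \<rho> < t0"
    define t where "t = \<rho> / L"
    have "\<rho> \<le> \<rho> * L" using rho L(1) by simp
    then have "t \<le> \<rho>" using L(1) by (simp add: t_def divide_le_eq)
    then have t: "0 < t" "t \<le> t0" "\<rho> = L * t" using rho L(1) by (auto simp: t_def)
    obtain g w where g: "g \<in> G" and w: "weight_of w g" and wx: "\<kappa>\<^sup>2 / (6 * t) \<le> (w x)\<^sup>2" and wa: "\<And>a. a \<in> S2 \<Longrightarrow> (w a)\<^sup>2 \<le> 384 / (\<kappa>\<^sup>2 * t)"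
      using T0[OF x t(1,2)] by blast
    note W = weight_ofD[OF w]
    have xS: "x \<in> S2" using x S_S2 by blast
    have gS: "g u \<in> S2" if "u \<in> S2" for u using Mob_weight(2)[OF G_Mob[OF g] that] .
    have wxp: "w x > 0" using W(1) xS by blast
    have far: "dist (g a) (g b) < e0" if a: "a \<in> S2" "\<rho> \<le> dist a x" and b: "b \<in> S2" "\<rho> \<le> dist b x" for a b
    proof -
      have wab: "w a > 0" "w b > 0" using W(1) a b by auto
      have 1: "w a * dist a x \<le> 2 / w x" "w b * dist b x \<le> 2 / w x"
        using S2_dist_le[OF gS gS, of a x] S2_dist_le[OF gS gS, of b x] W(2)[OF a(1) xS] W(2)[OF b(1) xS] a b xS wxp
        by (auto simp: field_simps)
      have "w a * \<rho> \<le> w a * dist a x" "w b * \<rho> \<le> w b * dist b x" using a(2) b(2) wab by (auto intro: mult_left_mono)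
      moreover have r0: "\<rho> > 0" using rho by simp
      ultimately have 2: "w a \<le> 2 / w x / \<rho>" "w b \<le> 2 / w x / \<rho>"
        unfolding pos_le_divide_eq[OF r0] using 1 by linarith+
      have "dist (g a) (g b) \<le> w a * w b * (dist a x + dist b x)"
        unfolding W(2)[OF a(1) b(1)] using wab dist_triangle2[of a b x] by (intro mult_left_mono) auto
      also have "\<dots> = w b * (w a * dist a x) + w a * (w b * dist b x)" by (simp add: algebra_simps)
      also have "\<dots> \<le> (2 / w x / \<rho>) * (2 / w x) + (2 / w x / \<rho>) * (2 / w x)"
        using 1 2 wab wxp rho by (intro add_mono mult_mono) auto
      also have "\<dots> = 8 / ((w x)\<^sup>2 * \<rho>)" using wxp rho by (simp add: field_simps power2_eq_square)
      also have "\<dots> \<le> 8 / (\<kappa>\<^sup>2 / (6 * t) * \<rho>)"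
        using wx rho kappa t wxp by (intro divide_left_mono mult_right_mono mult_pos_pos) auto
      also have "\<dots> = 48 / (\<kappa>\<^sup>2 * L)" unfolding t(3) using t(1) L(1) kappa by (simp add: field_simps)
      finally show ?thesis using L(2) by simp
    qed
    obtain h where h: "Mob h" "\<And>x. x \<in> S2 \<Longrightarrow> h x \<in> S2" "\<And>x. x \<in> S2 \<Longrightarrow> h (g x) = x" "\<And>x. x \<in> S2 \<Longrightarrow> g (h x) = x"
      by (rule Mob_inverse[OF G_Mob[OF g]]) blast
    have hS: "h ` S = S"
    proof -
      have "h ` g ` S = S" using h(3) S_S2 by (force simp: image_image)
      then show ?thesis using G_S[OF g] by simp
    qed
    \<comment> \<open>If the preimages of both fixed disks left the ball, two points of different
      disks would be less than \<open>e0\<close> apart.\<close>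
    have ex: "\<exists>E u v. E \<in> \<D> \<and> u \<in> circ E \<and> v \<in> circ E \<and> l \<le> dist u v \<and> (\<forall>a\<in>closure E. dist (h a) x < \<rho>)"
    proof (rule ccontr)
      assume H: "\<not> ?thesis"
      have "l \<le> dist u1 v1" "l \<le> dist u2 v2" by (auto simp: l_def)
      then obtain a b where ab: "a \<in> closure D1" "\<not> dist (h a) x < \<rho>" "b \<in> closure D2" "\<not> dist (h b) x < \<rho>"
        using H D uv1 uv2 by meson
      have S2ab: "a \<in> S2" "b \<in> S2" using ab disk_S2(3) D by blast+
      then have "dist (g (h a)) (g (h b)) < e0" using far[of "h a" "h b"] h(2) ab by auto
      then show False using e0(2)[OF ab(1,3)] h(4) S2ab by auto
    qed
    then obtain E u v where E: "E \<in> \<D>" "u \<in> circ E" "v \<in> circ E" "l \<le> dist u v" "\<And>a. a \<in> closure E \<Longrightarrow> dist (h a) x < \<rho>" by blast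
    have hE: "h ` E \<in> \<D>" "closure (h ` E) = h ` closure E" "h ` circ E = circ (h ` E)"
      using Mob_disk[OF h(1) hS E(1)] by auto
    have uv: "u \<in> S2" "v \<in> S2" using E circ_S S_S2 by blast+
    have "dist u v = w (h u) * w (h v) * dist (h u) (h v)" using W(2)[OF h(2) h(2)] uv h(4) by metis
    also have "\<dots> \<le> 384 / (\<kappa>\<^sup>2 * t) * dist (h u) (h v)"
    proof (rule mult_right_mono)
      have "w (h u) * w (h v) \<le> ((w (h u))\<^sup>2 + (w (h v))\<^sup>2) / 2" using sum_squares_bound[of "w (h u)" "w (h v)"] by simp
      also have "\<dots> \<le> (384 / (\<kappa>\<^sup>2 * t) + 384 / (\<kappa>\<^sup>2 * t)) / 2" using wa[OF h(2)] uv by (intro divide_right_mono add_mono) auto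
      finally show "w (h u) * w (h v) \<le> 384 / (\<kappa>\<^sup>2 * t)" by (simp add: mult.commute)
    qed simp
    finally have "l \<le> 384 / (\<kappa>\<^sup>2 * t) * dist (h u) (h v)" using E(4) by linarith
    then have "\<rho> \<le> C * dist (h u) (h v)" unfolding C_def t(3) using t(1) l kappa L(1) by (simp add: field_simps)
    moreover have "closure (h ` E) \<subseteq> ball x \<rho>" unfolding hE(2) using E(5) by (auto simp: dist_commute)
    moreover have "h u \<in> circ (h ` E)" "h v \<in> circ (h ` E)" using E hE(3) by blast+
    ultimately show "\<exists>D\<in>\<D>. closure D \<subseteq> ball x \<rho> \<and> (\<exists>u\<in>circ D. \<exists>v\<in>circ D. \<rho> \<le> C * dist u v)"
      using hE(1) by blast
  qed
qed

end

section \<open>Pictures: charts in which one complementary disk becomes the exterior of the unit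
  disk\<close>

definition picture :: "R3 set set \<Rightarrow> (R3 \<Rightarrow> complex) \<Rightarrow> R3 \<Rightarrow> real \<Rightarrow> R3 set \<Rightarrow> bool" where
  "picture \<D> m p k D \<longleftrightarrow> chart m p k \<and> D \<in> \<D> \<and> p \<in> D \<and> m ` (S2 - closure D) = ball 0 1 \<and> m ` circ D = sphere 0 1"

lemma pictureD:
  assumes "picture \<D> m p k D"
  shows "chart m p k" "D \<in> \<D>" "p \<in> D" "m ` (S2 - closure D) = ball 0 1" "m ` circ D = sphere 0 1"
  using assms by (auto simp: picture_def)

context schottky begin

lemma picture_S:
  assumes "picture \<D> m p k D"
  shows "x \<in> S \<Longrightarrow> x \<in> S2 \<and> x \<noteq> p" "x \<in> S \<Longrightarrow> cmod (m x) \<le> 1"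
proof -
  note P = pictureD[OF assms]
  show 1: "x \<in> S2 \<and> x \<noteq> p" if "x \<in> S" for x using that S_S2 P(3) disk_S2(2)[OF P(2)] by blast
  assume x: "x \<in> S"
  show "cmod (m x) \<le> 1"
  proof (cases "x \<in> closure D")
    case True
    then have "x \<in> circ D" using x closure_disk_S[OF P(2)] by blast
    then have "m x \<in> sphere 0 1" using P(5) by blast
    then show ?thesis by simp
  next
    case False
    then have "m x \<in> ball 0 1" using P(4) x S_S2 by blast
    then show ?thesis by simp
  qed
qed

lemma picture_exists:
  assumes "D \<in> \<D>" obtains m p k where "picture \<D> m p k D"
proof -
  obtain p where p: "p \<in> D" using disk_S2(4)[OF assms] by blast
  then have "p \<in> S2" using disk_S2(1)[OF assms] by blast
  then obtain m k where m: "chart m p k" by (rule chart_exists)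
  obtain z R where R: "R > 0" "m ` (S2 - closure D) = ball z R" "m ` circ D = sphere z R"
    by (rule chart_outer[OF m round[OF assms] p]) blast
  define n where "n = (\<lambda>x. (m x - z) / of_real R)"
  have n: "chart n p (k / R)" unfolding n_def by (rule chart_affine[OF m R(1)])
  have im: "n ` A = (\<lambda>w. (w - z) / of_real R) ` (m ` A)" for A by (simp add: n_def image_image)
  have d: "cmod ((w - z) / of_real R) = dist z w / R" for w
    using R(1) by (simp add: norm_divide dist_norm norm_minus_commute)
  have inv: "v = (z + of_real R * v - z) / of_real R" for v using R(1) by simp
  have "n ` (S2 - closure D) = ball 0 1" unfolding im R(2)
  proof (intro equalityI subsetI)
    fix v assume "v \<in> (\<lambda>w. (w - z) / of_real R) ` ball z R"
    then show "v \<in> ball 0 1" using d R(1) by (auto simp: divide_less_eq)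
  next
    fix v assume "v \<in> ball (0::complex) 1"
    then have "z + of_real R * v \<in> ball z R" using R(1) by (simp add: dist_norm norm_mult)
    then show "v \<in> (\<lambda>w. (w - z) / of_real R) ` ball z R" using inv by blast
  qed
  moreover have "n ` circ D = sphere 0 1" unfolding im R(3)
  proof (intro equalityI subsetI)
    fix v assume "v \<in> (\<lambda>w. (w - z) / of_real R) ` sphere z R"
    then show "v \<in> sphere 0 1" using d R(1) by auto
  next
    fix v assume "v \<in> sphere (0::complex) 1"
    then have "z + of_real R * v \<in> sphere z R" using R(1) by (simp add: dist_norm norm_mult)
    then show "v \<in> (\<lambda>w. (w - z) / of_real R) ` sphere z R" using inv by blast
  qed
  ultimately show ?thesis using that n assms p unfolding picture_def by blast
qed

text \<open>Moving the sphere by \<open>g\<close> and precomposing the chart with its inverse leaves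
  the planar image unchanged; only the pole and the names of the disks move.\<close>

lemma picture_Mob:
  assumes P: "picture \<D> m p k D" and g: "Mob g" "g ` S = S"
    and h: "Mob h" "\<And>x. x \<in> S2 \<Longrightarrow> h x \<in> S2" "\<And>x. x \<in> S2 \<Longrightarrow> h (g x) = x" "\<And>x. x \<in> S2 \<Longrightarrow> g (h x) = x"
  shows "\<exists>k'. picture \<D> (m \<circ> h) (g p) k' (g ` D)"
proof -
  note P = pictureD[OF P]
  have pS: "p \<in> S2" "g p \<in> S2" using chartD(1)[OF P(1)] Mob_weight(2)[OF g(1)] by auto
  obtain k' where k': "chart (m \<circ> h) (g p) k'" using chart_Mob[OF P(1) h(1) pS(2)] h(3) pS by blast
  note D = Mob_disk[OF g P(2)]
  have gS: "g x \<in> S2" if "x \<in> S2" for x using Mob_weight(2)[OF g(1) that] .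
  have "h ` (S2 - closure (g ` D)) = S2 - closure D"
  proof (intro equalityI subsetI)
    fix y assume "y \<in> h ` (S2 - closure (g ` D))"
    then obtain x where x: "x \<in> S2" "x \<notin> g ` closure D" "y = h x" unfolding D(2) by blast
    then have "y \<notin> closure D" using h(4) by (metis imageI)
    then show "y \<in> S2 - closure D" using x h(2) by blast
  next
    fix y assume y: "y \<in> S2 - closure D"
    have "g y \<notin> g ` closure D"
    proof
      assume "g y \<in> g ` closure D"
      then obtain u where u: "u \<in> closure D" "g y = g u" by blast
      then have "y = u" using h(3)[of y] h(3)[of u] y disk_S2(3)[OF P(2)] by auto
      then show False using u y by blast
    qed
    then have "g y \<in> S2 - closure (g ` D)" unfolding D(2) using gS y by blast
    moreover have "y = h (g y)" using h(3) y by simp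
    ultimately show "y \<in> h ` (S2 - closure (g ` D))" by blast
  qed
  then have 1: "(m \<circ> h) ` (S2 - closure (g ` D)) = ball 0 1" using P(4) by (metis image_comp)
  have "h ` circ (g ` D) = circ D" unfolding D(3)[symmetric]
    using h(3) circ_S[OF P(2)] S_S2 by (force simp: image_image)
  then have 2: "(m \<circ> h) ` circ (g ` D) = sphere 0 1" using P(5) by (metis image_comp)
  show ?thesis unfolding picture_def using k' D(1) P(3) 1 2 by blast
qed

end

context schottky_group begin

text \<open>Three points of the outer circle, far apart in the picture, are moved to
  \<kappa>-separated position. If the pole came close to \<open>v\<close> in \<open>S\<close>, two
  of the three would stay far from \<open>v\<close>, which bounds the chart constant
  \<open>K\<close> below. Comparing one of them with the preimage of \<open>v\<close>, whose picture
  lies in the unit disk, then bounds the distance from the pole to \<open>v\<close> below.\<close>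

lemma interior_cocompact:
  "\<exists>\<epsilon>>0. \<forall>m p k D. picture \<D> m p k D \<longrightarrow> (\<exists>g\<in>G. \<forall>x\<in>S. \<epsilon> \<le> dist (g p) x)"
proof (intro exI[of _ "min (\<kappa> / 4) (\<kappa>^3 / 256)"] conjI allI impI)
  show "min (\<kappa> / 4) (\<kappa>^3 / 256) > 0" using kappa by simp
  fix m p k D assume P0: "picture \<D> m p k D"
  note P = pictureD[OF P0]
  note C = chartD[OF P(1)]
  note PS = picture_S[OF P0]
  have "1 \<in> m ` circ D" "-1 \<in> m ` circ D" "\<i> \<in> m ` circ D" using P(5) by auto
  then obtain x y z where "x \<in> circ D" "y \<in> circ D" "z \<in> circ D" and mxyz: "m x = 1" "m y = -1" "m z = \<i>" by (metis imageE)
  then have xyz: "x \<in> S" "y \<in> S" "z \<in> S" using circ_S[OF P(2)] by blast+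
  have "x \<noteq> y" "y \<noteq> z" "x \<noteq> z" using mxyz by (auto simp: complex_eq_iff)
  then obtain g where g: "g \<in> G" "\<kappa> \<le> dist (g x) (g y)" "\<kappa> \<le> dist (g y) (g z)" "\<kappa> \<le> dist (g x) (g z)"
    using cocompact[OF xyz] by blast
  obtain w where w: "weight_of w g" using Mob_weight(1)[OF G_Mob[OF g(1)]] by blast
  note W = weight_ofD[OF w]
  have gS: "g u \<in> S2" if "u \<in> S2" for u using Mob_weight(2)[OF G_Mob[OF g(1)] that] .
  \<comment> \<open>The constant of the chart transported by \<open>g\<close>; \<open>form\<close>
    is its distance formula with the denominators cleared.\<close>
  define K where "K = k * (w p)\<^sup>2"
  have wp: "w p > 0" using W(1) C(1) by blast
  have K: "K > 0" using C(2) wp by (simp add: K_def)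
  have form: "dist (m a) (m b) * (dist (g a) (g p) * dist (g b) (g p)) = K * dist (g a) (g b)" if ab: "a \<in> S" "b \<in> S" for a b
  proof -
    have S2: "a \<in> S2" "b \<in> S2" "a \<noteq> p" "b \<noteq> p" using PS(1) ab by auto
    have "dist (m a) (m b) * (dist a p * dist b p) = k * dist a b" using C(6) S2 by simp
    then have "(w a * w b * (w p)\<^sup>2) * (dist (m a) (m b) * (dist a p * dist b p)) = (w a * w b * (w p)\<^sup>2) * (k * dist a b)" by simp
    then show ?thesis using W(2)[OF S2(1) C(1)] W(2)[OF S2(2) C(1)] W(2)[OF S2(1,2)]
      by (simp add: K_def power2_eq_square mult_ac)
  qed
  have d12: "1 \<le> dist (m x) (m y)" "1 \<le> dist (m y) (m z)" "1 \<le> dist (m x) (m z)"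
  proof -
    have "1 \<le> cmod (1 - \<i>)" "1 \<le> cmod (- 1 - \<i>)" by (simp_all add: cmod_def)
    then show "1 \<le> dist (m x) (m y)" "1 \<le> dist (m y) (m z)" "1 \<le> dist (m x) (m z)" by (simp_all add: mxyz dist_norm)
  qed
  have "min (\<kappa> / 4) (\<kappa>^3 / 256) \<le> dist (g p) v" if v: "v \<in> S" for v
  proof (rule ccontr)
    assume "\<not> ?thesis"
    then have lt: "dist (g p) v < \<kappa> / 4" "dist (g p) v < \<kappa>^3 / 256" by auto
    obtain u where u: "u \<in> S" "g u = v" using v G_S[OF g(1)] by (metis imageE)
    have tri: "\<kappa> \<le> dist v a + dist v b" if "\<kappa> \<le> dist a b" for a b using that dist_triangle2[of a b v] by (simp add: dist_commute)
    have "\<exists>a b. a \<in> S \<and> b \<in> S \<and> 1 \<le> dist (m a) (m b) \<and> \<kappa> / 2 \<le> dist v (g a) \<and> \<kappa> / 2 \<le> dist v (g b)"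
    proof (cases "\<kappa> / 2 \<le> dist v (g x)")
      case True
      then show ?thesis using tri[OF g(3)] d12 xyz by (cases "\<kappa> / 2 \<le> dist v (g y)") fastforce+
    next
      case False
      then have "\<kappa> / 2 \<le> dist v (g y)" "\<kappa> / 2 \<le> dist v (g z)" using tri[OF g(2)] tri[OF g(4)] by linarith+
      then show ?thesis using d12 xyz by blast
    qed
    then obtain a b where ab: "a \<in> S" "b \<in> S" "1 \<le> dist (m a) (m b)" "\<kappa> / 2 \<le> dist v (g a)" "\<kappa> / 2 \<le> dist v (g b)" by blast
    have "dist v (g a) \<le> dist (g p) v + dist (g a) (g p)" "dist v (g b) \<le> dist (g p) v + dist (g b) (g p)"
      by (metis dist_commute dist_triangle)+
    then have far: "\<kappa> / 4 \<le> dist (g a) (g p)" "\<kappa> / 4 \<le> dist (g b) (g p)" using ab lt by linarith+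
    have S2: "a \<in> S2" "b \<in> S2" "u \<in> S2" using ab u PS(1) by auto
    have "\<kappa> / 4 * (\<kappa> / 4) \<le> dist (g a) (g p) * dist (g b) (g p)" using far kappa by (intro mult_mono) auto
    also have "\<dots> \<le> dist (m a) (m b) * (dist (g a) (g p) * dist (g b) (g p))"
      using mult_right_mono[OF ab(3), of "dist (g a) (g p) * dist (g b) (g p)"] by simp
    also have "\<dots> = K * dist (g a) (g b)" by (rule form[OF ab(1,2)])
    also have "\<dots> \<le> K * 2" using S2_dist_le[OF gS gS] S2 K by (intro mult_left_mono) auto
    finally have Kl: "\<kappa>\<^sup>2 / 32 \<le> K" by (simp add: power2_eq_square)
    have "\<kappa>\<^sup>2 / 32 * (\<kappa> / 2) \<le> K * dist (g u) (g a)" using Kl ab(4) u kappa K by (intro mult_mono) auto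
    also have "\<dots> = dist (m u) (m a) * (dist (g u) (g p) * dist (g a) (g p))" using form[OF u(1) ab(1)] by simp
    also have "\<dots> \<le> 2 * (dist (g u) (g p) * 2)"
    proof (intro mult_mono)
      show "dist (m u) (m a) \<le> 2" using PS(2)[OF u(1)] PS(2)[OF ab(1)] norm_triangle_ineq4[of "m u" "m a"] by (simp add: dist_norm)
      show "dist (g a) (g p) \<le> 2" using S2_dist_le[OF gS gS] S2 C(1) by blast
    qed auto
    finally have "\<kappa>^3 / 256 \<le> dist (g p) v" using u by (simp add: power3_eq_cube power2_eq_square dist_commute)
    then show False using lt by linarith
  qed
  then show "\<exists>g\<in>G. \<forall>x\<in>S. min (\<kappa> / 4) (\<kappa>^3 / 256) \<le> dist (g p) x" using g(1) by blast
qed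

end

text \<open>\<open>\<kappa>\<close> is a positive lower bound over the compact set \<open>K\<close>
  for the smallest distance within a triple. Translates of \<open>K\<close> cover all triples, so
  the inverse element brings a given triple into \<open>K\<close>.\<close>

lemma kleinian_schottky_group:
  assumes "kleinian \<Gamma>" "schottky_set (limit_set \<Gamma>)" "uniform_convergence_group \<Gamma> bext (limit_set \<Gamma>)"
  obtains \<D> \<kappa> where "schottky_group (limit_set \<Gamma>) \<D> (bext ` \<Gamma>) \<kappa>"
proof -
  let ?S = "limit_set \<Gamma>"
  have iso: "isometry_group \<Gamma>" using assms(1) by (simp add: kleinian_def)
  obtain \<D> where D: "compact ?S" "?S \<subseteq> S2" "\<forall>D\<in>\<D>. round_disk D" "infinite \<D> \<or> card \<D> \<ge> 3"
     "\<forall>D\<in>\<D>. \<forall>D'\<in>\<D>. D \<noteq> D' \<longrightarrow> closure D \<inter> closure D' = {}" "S2 - ?S = \<Union>\<D>"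
  proof -
    note s = assms(2)[unfolded schottky_set_def]
    have "\<exists>\<D>. (\<forall>D\<in>\<D>. round_disk D) \<and> (infinite \<D> \<or> card \<D> \<ge> 3) \<and>
        (\<forall>D\<in>\<D>. \<forall>D'\<in>\<D>. D \<noteq> D' \<longrightarrow> closure D \<inter> closure D' = {}) \<and> S2 - ?S = \<Union>\<D>"
      using s by (elim conjE)
    then show ?thesis using s that by (elim exE conjE) simp
  qed
  have ug: "\<And>g. g \<in> \<Gamma> \<Longrightarrow> \<exists>h. homeomorphism ?S ?S (bext g) h"
     "\<exists>K. compact K \<and> K \<subseteq> triples ?S \<and> (\<Union>g\<in>\<Gamma>. diag_act (bext g) ` K) = triples ?S"
    using assms(3) unfolding uniform_convergence_group_def by auto
  then obtain K where K: "compact K" "K \<subseteq> triples ?S" "(\<Union>g\<in>\<Gamma>. diag_act (bext g) ` K) = triples ?S" by blast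
  define \<phi> :: "R3 \<times> R3 \<times> R3 \<Rightarrow> real" where
    "\<phi> t = min (dist (fst t) (fst (snd t))) (min (dist (fst (snd t)) (snd (snd t))) (dist (fst t) (snd (snd t))))" for t
  have "\<exists>\<kappa>>0. \<forall>t\<in>K. \<kappa> \<le> \<phi> t"
  proof (cases "K = {}")
    case True then show ?thesis by (intro exI[of _ 1]) auto
  next
    case False
    have "continuous_on K \<phi>" unfolding \<phi>_def by (intro continuous_intros)
    then obtain t where t: "t \<in> K" "\<And>s. s \<in> K \<Longrightarrow> \<phi> t \<le> \<phi> s"
      using continuous_attains_inf[OF K(1) False] by blast
    have "\<phi> t > 0" using t(1) K(2) unfolding \<phi>_def triples_def by auto
    then show ?thesis using t by blast
  qed
  then obtain \<kappa> where \<kappa>: "\<kappa> > 0" "\<And>t. t \<in> K \<Longrightarrow> \<kappa> \<le> \<phi> t" by blast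
  have "schottky_group ?S \<D> (bext ` \<Gamma>) \<kappa>"
  proof
    show "compact ?S" "?S \<subseteq> S2" "infinite \<D> \<or> card \<D> \<ge> 3" "S2 - ?S = \<Union>\<D>" "\<kappa> > 0" by fact+
    show "round_disk D" if "D \<in> \<D>" for D using D that by blast
    show "closure D \<inter> closure D' = {}" if "D \<in> \<D>" "D' \<in> \<D>" "D \<noteq> D'" for D D' using D that by blast
    show "Mob g" if "g \<in> bext ` \<Gamma>" for g using isometry_group_bext(1)[OF iso] that by blast
    show "g ` ?S = ?S" if "g \<in> bext ` \<Gamma>" for g using ug(1) that by (metis homeomorphism_image1 imageE)
    fix x y z assume "x \<in> ?S" "y \<in> ?S" "z \<in> ?S" "x \<noteq> y" "y \<noteq> z" "x \<noteq> z"
    then have "(x, y, z) \<in> triples ?S" by (simp add: triples_def)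
    then obtain g t where g: "g \<in> \<Gamma>" "t \<in> K" "(x, y, z) = diag_act (bext g) t" using K(3) by blast
    obtain a b c where t: "t = (a, b, c)" by (metis prod.exhaust)
    have abc: "a \<in> S2" "b \<in> S2" "c \<in> S2" using g(2) K(2) D(2) t by (auto simp: triples_def)
    obtain h where h: "h \<in> \<Gamma>" "\<And>x. x \<in> S2 \<Longrightarrow> bext h (bext g x) = x" using isometry_group_bext(2)[OF iso g(1)] by blast
    have "bext h x = a" "bext h y = b" "bext h z = c" using g(3) t h(2) abc by (auto simp: diag_act_def)
    then show "\<exists>g\<in>bext ` \<Gamma>. \<kappa> \<le> dist (g x) (g y) \<and> \<kappa> \<le> dist (g y) (g z) \<and> \<kappa> \<le> dist (g x) (g z)"
      using \<kappa>(2)[OF g(2)] h(1) t unfolding \<phi>_def by (intro bexI[of _ "bext h"]) auto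
  qed
  then show ?thesis using that by blast
qed

context schottky_group begin

text \<open>A diagonal choice: the single index \<open>k\<close> governs the radius
  \<open>k + 1\<close>, the error \<open>1 / (k + 1)\<close> and the position
  \<open>n \<ge> k\<close>; the scale is at most \<open>t0\<close>, where \<open>scale_group\<close>
  applies.\<close>

lemma pGH_choice:
  assumes "pGH_conv S q (\<lambda>n x y. dist x y / lam n) Z d z" "\<And>n. lam n > 0" "lam \<longlonglongrightarrow> 0" "\<And>n. q n \<in> S" "t0 > (0::real)"
  shows "\<exists>n f. k \<le> n \<and> lam n \<le> t0 \<and>
    (\<forall>x\<in>S. dist (q n) x / lam n < real k + 1 \<longrightarrow> f x \<in> Z) \<and> f (q n) = z \<and>
    (\<forall>x\<in>S. \<forall>y\<in>S. dist (q n) x / lam n < real k + 1 \<longrightarrow> dist (q n) y / lam n < real k + 1 \<longrightarrow>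
        \<bar>dist x y / lam n - d (f x) (f y)\<bar> \<le> 1 / (real k + 1)) \<and>
    (\<forall>w\<in>Z. d z w < real k \<longrightarrow> (\<exists>x\<in>S. dist (q n) x / lam n < real k + 1 \<and> d w (f x) < 1 / (real k + 1)))"
proof -
  have MZ: "Metric_space Z d" and zZ: "z \<in> Z" using assms(1) by (auto simp: pGH_conv_def)
  let ?r = "real k + 1" and ?e = "1 / (real k + 1)"
  have "?r > 0" "?e > 0" by auto
  then obtain N where N: "\<And>n. n \<ge> N \<Longrightarrow> (let B = {x \<in> S. dist (q n) x / lam n < ?r} in
         \<exists>g. g ` B \<subseteq> Z \<and> g (q n) = z \<and>
           (\<exists>\<delta><?e. \<forall>x\<in>B. \<forall>y\<in>B. \<bar>dist x y / lam n - d (g x) (g y)\<bar> \<le> \<delta>) \<and>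
           Metric_space.mball Z d z (?r - ?e) \<subseteq> {w \<in> Z. \<exists>y\<in>g ` B. d w y < ?e})"
    using assms(1) unfolding pGH_conv_def by meson
  have "eventually (\<lambda>n. lam n < t0) sequentially" using assms(3,5) by (rule order_tendstoD(2))
  then obtain N2 where N2: "\<And>n. n \<ge> N2 \<Longrightarrow> lam n < t0" by (auto simp: eventually_sequentially)
  define n where "n = max k (max N N2)"
  have n: "n \<ge> k" "n \<ge> N" "lam n \<le> t0" using N2[of n] unfolding n_def by linarith+
  define B where "B = {x \<in> S. dist (q n) x / lam n < ?r}"
  obtain g \<delta> where g: "g ` B \<subseteq> Z" "g (q n) = z" "\<delta> < ?e" "\<And>x y. x \<in> B \<Longrightarrow> y \<in> B \<Longrightarrow> \<bar>dist x y / lam n - d (g x) (g y)\<bar> \<le> \<delta>"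
      "Metric_space.mball Z d z (?r - ?e) \<subseteq> {w \<in> Z. \<exists>y\<in>g ` B. d w y < ?e}"
    using N[OF n(2)] unfolding Let_def B_def[symmetric] by blast
  \<comment> \<open>Radius minus error is then at least \<open>k\<close>, so the ball of radius
    \<open>k\<close> is approximately covered.\<close>
  have "?e \<le> 1" by simp
  have sur: "\<exists>x\<in>S. dist (q n) x / lam n < ?r \<and> d w (g x) < ?e" if w: "w \<in> Z" "d z w < real k" for w
  proof -
    have "w \<in> Metric_space.mball Z d z (?r - ?e)"
    proof -
      have "d z w < ?r - ?e" using w(2) \<open>?e \<le> 1\<close> by linarith
      then show ?thesis unfolding Metric_space.in_mball[OF MZ] using w(1) zZ by blast
    qed
    then have "\<exists>y\<in>g ` B. d w y < ?e" using g(5) by blast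
    then show ?thesis unfolding B_def by blast
  qed
  show ?thesis
    by (rule exI[of _ n], rule exI[of _ g]) (use n g sur in \<open>force simp: B_def\<close>)
qed

end

lemma ultra_const: "ultra U \<Longrightarrow> eventually (\<lambda>x. P) U \<Longrightarrow> P"
  by (simp add: ultra_def)

context schottky_group begin

section \<open>Weak tangents\<close>

text \<open>The rescaling is absorbed by group elements \<open>g k\<close> that enlarge the same
  scale. In the new coordinates the rescaled metric has a closed formula whose pole is the image
  \<open>A k\<close> of a fixed point \<open>b\<close>. Along the ultrafilter the pole tends to
  \<open>a\<close>, and the formula tends to the metric of \<open>S\<close> with \<open>a\<close> at
  infinity.\<close>

theorem tangent:
  assumes tan: "weak_tangent S p Z d z" and p: "p \<in> S"
  shows "\<exists>a\<in>S. \<exists>s>0. \<exists>\<psi>. bij_betw \<psi> (S - {a}) Z \<and>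
    (\<forall>x\<in>S - {a}. \<forall>y\<in>S - {a}. d (\<psi> x) (\<psi> y) = s * dist x y / (dist x a * dist y a))"
proof -
  obtain lam q where lam: "\<And>n. lam n > 0" "lam \<longlonglongrightarrow> 0" and q: "\<And>n. q n \<in> S" "q \<longlonglongrightarrow> p"
    and GH: "pGH_conv S q (\<lambda>n x y. dist x y / lam n) Z d z"
    using tan unfolding weak_tangent_def by blast
  have MZ: "Metric_space Z d" and mc: "Metric_space.mcomplete Z d" and zZ: "z \<in> Z"
    using GH by (auto simp: pGH_conv_def)
  interpret Z: Metric_space Z d by fact
  obtain t0 where t0: "t0 > 0" and T0: "\<And>x t. x \<in> S \<Longrightarrow> 0 < t \<Longrightarrow> t \<le> t0 \<Longrightarrow> (\<exists>g\<in>G. \<exists>w. \<exists>y\<in>S. dist x y = t \<and> weight_of w g \<and> \<kappa> \<le> dist (g x) (g y) \<and>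
      \<kappa>\<^sup>2 / (6 * t) \<le> (w x)\<^sup>2 \<and> (\<forall>a\<in>S2. (w a)\<^sup>2 \<le> 384 / (\<kappa>\<^sup>2 * t)))"
    using scale_group by blast
  obtain U :: "nat filter" where U: "ultra U" "U \<le> sequentially" using ultra_exists by blast
  have Unb: "U \<noteq> bot" using U by (simp add: ultra_def)
  have Useq: "eventually P U" if "eventually P sequentially" for P using U(2) that by (rule filter_leD)
  obtain nn ff where nf: "\<And>k. k \<le> nn k \<and> lam (nn k) \<le> t0 \<and>
    (\<forall>x\<in>S. dist (q (nn k)) x / lam (nn k) < real k + 1 \<longrightarrow> ff k x \<in> Z) \<and> ff k (q (nn k)) = z \<and>
    (\<forall>x\<in>S. \<forall>y\<in>S. dist (q (nn k)) x / lam (nn k) < real k + 1 \<longrightarrow> dist (q (nn k)) y / lam (nn k) < real k + 1 \<longrightarrow>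
        \<bar>dist x y / lam (nn k) - d (ff k x) (ff k y)\<bar> \<le> 1 / (real k + 1)) \<and>
    (\<forall>w\<in>Z. d z w < real k \<longrightarrow> (\<exists>x\<in>S. dist (q (nn k)) x / lam (nn k) < real k + 1 \<and> d w (ff k x) < 1 / (real k + 1)))"
    using pGH_choice[OF GH lam q(1) t0] by metis
  define l where "l k = lam (nn k)" for k
  define c where "c k = q (nn k)" for k
  have l: "l k > 0" "l k \<le> t0" for k using lam(1) nf by (auto simp: l_def)
  have c: "c k \<in> S" for k using q by (simp add: c_def)
  have nninf: "filterlim nn at_top sequentially"
    unfolding filterlim_at_top by (metis (mono_tags, lifting) eventually_sequentially nf order_trans)
  have "(\<lambda>k. lam (nn k)) \<longlonglongrightarrow> 0" using filterlim_compose[OF lam(2) nninf] .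
  then have l0: "(l \<longlongrightarrow> 0) U" unfolding l_def by (rule tendsto_mono[OF U(2)])
  have "(\<lambda>k. q (nn k)) \<longlonglongrightarrow> p" using filterlim_compose[OF q(2) nninf] .
  then have cp: "(c \<longlongrightarrow> p) U" unfolding c_def by (rule tendsto_mono[OF U(2)])
  have "\<forall>k. \<exists>g w y. g \<in> G \<and> y \<in> S \<and> dist (c k) y = l k \<and> weight_of w g \<and> \<kappa> \<le> dist (g (c k)) (g y) \<and>
      \<kappa>\<^sup>2 / (6 * l k) \<le> (w (c k))\<^sup>2 \<and> (\<forall>a\<in>S2. (w a)\<^sup>2 \<le> 384 / (\<kappa>\<^sup>2 * l k))"
    using T0[OF c l] by blast
  then obtain g w y where g: "\<And>k. g k \<in> G" and y: "\<And>k. y k \<in> S" "\<And>k. dist (c k) (y k) = l k" and w: "\<And>k. weight_of (w k) (g k)"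
     and sep: "\<And>k. \<kappa> \<le> dist (g k (c k)) (g k (y k))" and wc: "\<And>k. \<kappa>\<^sup>2 / (6 * l k) \<le> (w k (c k))\<^sup>2"
     and wa: "\<And>k a. a \<in> S2 \<Longrightarrow> (w k a)\<^sup>2 \<le> 384 / (\<kappa>\<^sup>2 * l k)"
    by metis
  note W = weight_ofD[OF w]
  have SS2: "x \<in> S \<Longrightarrow> x \<in> S2" for x using S_S2 by blast
  have gS: "g k x \<in> S" if "x \<in> S" for k x using G_S[OF g] that by blast
  have "\<forall>k. \<exists>h. (\<forall>x\<in>S. h x \<in> S \<and> h (g k x) = x \<and> g k (h x) = x)"
  proof
    fix k
    obtain h where h: "\<And>x. x \<in> S2 \<Longrightarrow> h x \<in> S2" "\<And>x. x \<in> S2 \<Longrightarrow> h (g k x) = x" "\<And>x. x \<in> S2 \<Longrightarrow> g k (h x) = x"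
      by (rule Mob_inverse[OF G_Mob[OF g[of k]]]) blast
    have "h x \<in> S" if "x \<in> S" for x
    proof -
      obtain u where "u \<in> S" "x = g k u" using \<open>x \<in> S\<close> G_S[OF g] by (metis imageE)
      then show ?thesis using h(2) SS2 by metis
    qed
    then show "\<exists>h. (\<forall>x\<in>S. h x \<in> S \<and> h (g k x) = x \<and> g k (h x) = x)" using h SS2 by blast
  qed
  then obtain h where h: "\<And>k x. x \<in> S \<Longrightarrow> h k x \<in> S" "\<And>k x. x \<in> S \<Longrightarrow> h k (g k x) = x" "\<And>k x. x \<in> S \<Longrightarrow> g k (h k x) = x"
    by metis
  \<comment> \<open>A point other than \<open>p\<close> recedes to infinity under rescaling; its
    images \<open>A k\<close> mark where infinity sits.\<close>
  obtain b where b: "b \<in> S" "b \<noteq> p" by (metis two_points)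
  define \<beta> where "\<beta> = dist p b"
  have \<beta>: "\<beta> > 0" using b by (simp add: \<beta>_def)
  define X where "X k = g k (c k)" for k
  define A where "A k = g k b" for k
  have XA: "X k \<in> S" "A k \<in> S" for k using gS c b by (auto simp: X_def A_def)
  have hX: "h k (X k) = c k" for k using h(2) c by (simp add: X_def)
  have wpos: "w k x > 0" if "x \<in> S" for k x using W(1)[OF SS2[OF that]] .
  define B where "B k = (w k b)\<^sup>2 / l k" for k
  have Bpos: "B k > 0" for k using wpos[OF b(1), of k] l(1)[of k] by (simp add: B_def)
  define dd where "dd k u v = dist (h k u) (h k v) / l k" for k u v
  \<comment> \<open>Each distance is a product of two weights and a distance before the move. All
    weights cancel except the one at \<open>b\<close>, which is collected in
    \<open>B k\<close>.\<close>
  have form: "dd k u v * (dist u (A k) * dist v (A k)) = B k * dist u v * (dist (h k u) b * dist (h k v) b)"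
    if uv: "u \<in> S" "v \<in> S" for k u v
  proof -
    let ?u = "h k u" and ?v = "h k v"
    have S: "?u \<in> S" "?v \<in> S" using h(1) uv by auto
    have 1: "dist u v = w k ?u * w k ?v * dist ?u ?v" using W(2)[OF SS2[OF S(1)] SS2[OF S(2)], of k] h(3) uv by simp
    have 2: "dist u (A k) = w k ?u * w k b * dist ?u b" using W(2)[OF SS2[OF S(1)] SS2[OF b(1)], of k] h(3) uv by (simp add: A_def)
    have 3: "dist v (A k) = w k ?v * w k b * dist ?v b" using W(2)[OF SS2[OF S(2)] SS2[OF b(1)], of k] h(3) uv by (simp add: A_def)
    show ?thesis unfolding dd_def B_def 1 2 3 by (simp add: power2_eq_square mult_ac)
  qed
  have cb: "((\<lambda>k. dist (c k) b) \<longlongrightarrow> \<beta>) U" unfolding \<beta>_def by (intro tendsto_intros cp)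
  have evcb: "eventually (\<lambda>k. \<beta> / 2 < dist (c k) b) U" by (rule order_tendstoD(1)[OF cb]) (use \<beta> in simp)
  have Bup: "eventually (\<lambda>k. B k \<le> 96 / (\<kappa>\<^sup>2 * \<beta>\<^sup>2)) U"
    using evcb
  proof eventually_elim
    case (elim k)
    have "w k (c k) * w k b * dist (c k) b \<le> 2"
      using W(2)[OF SS2[OF c] SS2[OF b(1)], of k] S2_dist_le[OF SS2[OF gS[OF c]] SS2[OF gS[OF b(1)]]] by metis
    moreover have "w k (c k) * w k b * (\<beta> / 2) \<le> w k (c k) * w k b * dist (c k) b"
      using elim wpos[OF c] wpos[OF b(1)] by (intro mult_left_mono) (auto simp: less_imp_le)
    ultimately have "w k (c k) * w k b * (\<beta> / 2) \<le> 2" by linarith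
    then have "w k (c k) * w k b \<le> 4 / \<beta>" using \<beta> by (simp add: field_simps)
    then have "(w k (c k) * w k b)\<^sup>2 \<le> (4 / \<beta>)\<^sup>2" using wpos[OF c] wpos[OF b(1)] by (intro power_mono) (auto simp: less_imp_le)
    then have "(w k b)\<^sup>2 * (w k (c k))\<^sup>2 \<le> 16 / \<beta>\<^sup>2" by (simp add: power_mult_distrib power_divide mult.commute)
    moreover have "(w k b)\<^sup>2 * (\<kappa>\<^sup>2 / (6 * l k)) \<le> (w k b)\<^sup>2 * (w k (c k))\<^sup>2" using wc by (intro mult_left_mono) auto
    ultimately have "(w k b)\<^sup>2 * (\<kappa>\<^sup>2 / (6 * l k)) \<le> 16 / \<beta>\<^sup>2" by linarith
    moreover have "(w k b)\<^sup>2 * (\<kappa>\<^sup>2 / (6 * l k)) = B k * (\<kappa>\<^sup>2 / 6)" by (simp add: B_def)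
    ultimately have "B k * (\<kappa>\<^sup>2 / 6) \<le> 16 / \<beta>\<^sup>2" by (simp only:)
    moreover have "\<kappa>\<^sup>2 / 6 > 0" using kappa by simp
    ultimately have "B k \<le> 16 / \<beta>\<^sup>2 / (\<kappa>\<^sup>2 / 6)" by (simp only: pos_le_divide_eq)
    also have "\<dots> = 96 / (\<kappa>\<^sup>2 * \<beta>\<^sup>2)" using kappa \<beta> by (simp add: field_simps)
    finally show ?case .
  qed
  \<comment> \<open>The images of \<open>c k\<close> and \<open>y k\<close> are \<kappa>-separated,
    so one of them is \<open>\<kappa> / 2\<close> away from \<open>A k\<close>; this keeps the
    weight at \<open>b\<close> from being too small.\<close>
  have Blow: "\<kappa>^4 / 6144 \<le> B k" for k
  proof -
    have "\<kappa> \<le> dist (A k) (g k (c k)) + dist (A k) (g k (y k))"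
      using sep[of k] dist_triangle3[of "g k (c k)" "g k (y k)" "A k"] by linarith
    then have "\<exists>r\<in>S. \<kappa> / 2 \<le> dist (g k r) (A k)" using c[of k] y(1)[of k]
      by (metis dist_commute field_sum_of_halves linorder_not_less add_strict_mono)
    then obtain r where r: "r \<in> S" "\<kappa> / 2 \<le> dist (g k r) (A k)" by blast
    have "dist (g k r) (A k) = w k r * w k b * dist r b" unfolding A_def using W(2)[OF SS2[OF r(1)] SS2[OF b(1)]] .
    also have "\<dots> \<le> w k r * w k b * 2" using S2_dist_le[OF SS2[OF r(1)] SS2[OF b(1)]] wpos[OF r(1)] wpos[OF b(1)]
      by (intro mult_left_mono) (auto simp: less_imp_le)
    finally have "\<kappa> / 4 \<le> w k r * w k b" using r(2) by simp
    then have "(\<kappa> / 4)\<^sup>2 \<le> (w k r * w k b)\<^sup>2" using kappa by (intro power_mono) auto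
    also have "\<dots> = (w k b)\<^sup>2 * (w k r)\<^sup>2" by (simp add: power_mult_distrib mult.commute)
    also have "\<dots> \<le> (w k b)\<^sup>2 * (384 / (\<kappa>\<^sup>2 * l k))" using wa[OF SS2[OF r(1)]] by (intro mult_left_mono) auto
    also have "\<dots> = B k * (384 / \<kappa>\<^sup>2)" by (simp add: B_def)
    finally have "\<kappa>\<^sup>2 / 16 \<le> B k * (384 / \<kappa>\<^sup>2)" by (simp add: power_divide)
    then have "\<kappa>\<^sup>2 / 16 * \<kappa>\<^sup>2 \<le> B k * 384" using kappa by (simp add: field_simps)
    then show ?thesis by (simp add: power2_eq_square power4_eq_xxxx)
  qed
  obtain B0 where B0: "(B \<longlongrightarrow> B0) U" "B0 \<in> {\<kappa>^4 / 6144 .. 96 / (\<kappa>\<^sup>2 * \<beta>\<^sup>2)}"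
  proof -
    have "eventually (\<lambda>k. B k \<in> {\<kappa>^4 / 6144 .. 96 / (\<kappa>\<^sup>2 * \<beta>\<^sup>2)}) U" using Bup by eventually_elim (use Blow in auto)
    then show ?thesis using ultra_compact_limit[OF U(1), of "{\<kappa>^4 / 6144 .. 96 / (\<kappa>\<^sup>2 * \<beta>\<^sup>2)}" B] that by auto
  qed
  have B0p: "B0 > 0"
  proof -
    have "\<kappa>^4 / 6144 > 0" using kappa by simp
    moreover have "\<kappa>^4 / 6144 \<le> B0" using B0(2) by (simp only: atLeastAtMost_iff)
    ultimately show ?thesis by linarith
  qed
  obtain x0 where x0: "x0 \<in> S" "(X \<longlongrightarrow> x0) U" using ultra_compact_limit[OF U(1) compact_S, of X] XA by auto
  obtain a where a: "a \<in> S" "(A \<longlongrightarrow> a) U" using ultra_compact_limit[OF U(1) compact_S, of A] XA by auto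
  have XAsq: "(dist (X k) (A k))\<^sup>2 = (w k (c k))\<^sup>2 * (w k b)\<^sup>2 * (dist (c k) b)\<^sup>2" for k
    unfolding X_def A_def W(2)[OF SS2[OF c] SS2[OF b(1)]] by (simp add: power_mult_distrib)
  \<comment> \<open>In \<open>XAsq\<close> the squared weight at \<open>c k\<close> is at least of
    order \<open>1 / l k\<close> and the squared weight at \<open>b\<close> at least of order
    \<open>l k\<close>, so the product does not tend to 0.\<close>
  have "x0 \<noteq> a"
  proof
    assume "x0 = a"
    then have t0: "((\<lambda>k. (dist (X k) (A k))\<^sup>2) \<longlongrightarrow> (dist a a)\<^sup>2) U" using x0 a by (intro tendsto_intros) auto
    have "\<kappa>\<^sup>2 / 6 * (\<kappa>^4 / 6144) * (\<beta> / 2)\<^sup>2 > 0" using kappa \<beta> by simp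
    then have "eventually (\<lambda>k. (dist (X k) (A k))\<^sup>2 < \<kappa>\<^sup>2 / 6 * (\<kappa>^4 / 6144) * (\<beta> / 2)\<^sup>2) U"
      by (intro order_tendstoD(2)[OF t0]) (simp only: dist_self power_zero_numeral)
    then have "eventually (\<lambda>k. False) U" using evcb
    proof eventually_elim
      case (elim k)
      have "\<kappa>\<^sup>2 / 6 * (\<kappa>^4 / 6144) * (\<beta> / 2)\<^sup>2 \<le> ((w k (c k))\<^sup>2 * l k) * B k * (dist (c k) b)\<^sup>2"
      proof (intro mult_mono)
        have "\<kappa>\<^sup>2 / (6 * l k) * l k \<le> (w k (c k))\<^sup>2 * l k" using wc l by (intro mult_right_mono) (auto simp: less_imp_le)
        then show "\<kappa>\<^sup>2 / 6 \<le> (w k (c k))\<^sup>2 * l k" using l[of k] by simp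
        show "\<kappa>^4 / 6144 \<le> B k" by (rule Blow)
        show "(\<beta> / 2)\<^sup>2 \<le> (dist (c k) b)\<^sup>2" using elim(2) \<beta> by (intro power_mono) auto
      qed (use kappa l[of k] Bpos[of k] in \<open>auto simp: less_imp_le\<close>)
      also have "\<dots> = (dist (X k) (A k))\<^sup>2" unfolding XAsq B_def using l[of k] by simp
      finally show False using elim(1) by linarith
    qed
    then show False using Unb by (simp add: trivial_limit_def)
  qed
  define s where "s = B0 * \<beta>\<^sup>2"
  have s: "s > 0" using B0p \<beta> by (simp add: s_def)
  define D where "D u v = s * dist u v / (dist u a * dist v a)" for u v
  \<comment> \<open>A bounded rescaled distance is a true distance of order \<open>l k\<close>, so
    the preimages are drawn to the base point \<open>p\<close>.\<close>
  have hlim: "((\<lambda>k. h k (u k)) \<longlongrightarrow> p) U" if bd: "eventually (\<lambda>k. dd k (u k) (X k) \<le> M) U" for u M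
  proof -
    have "((\<lambda>k. dist (h k (u k)) (c k)) \<longlongrightarrow> 0) U"
    proof (rule tendsto_sandwich[of "\<lambda>_. 0" _ _ "\<lambda>k. M * l k"])
      show "eventually (\<lambda>k. dist (h k (u k)) (c k) \<le> M * l k) U" using bd
        by eventually_elim (use l in \<open>simp add: dd_def hX divide_le_eq\<close>)
      show "((\<lambda>k. M * l k) \<longlongrightarrow> 0) U" using tendsto_mult_left[OF l0, of M] by simp
    qed auto
    moreover have "((\<lambda>k. dist (c k) p) \<longlongrightarrow> 0) U" using cp by (subst (asm) tendsto_dist_iff)
    ultimately have s0: "((\<lambda>k. dist (h k (u k)) (c k) + dist (c k) p) \<longlongrightarrow> 0) U" using tendsto_add by fastforce
    have "((\<lambda>k. dist (h k (u k)) p) \<longlongrightarrow> 0) U"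
      by (rule Lim_null_comparison[OF _ s0]) (auto intro!: always_eventually dist_triangle)
    then show ?thesis by (subst tendsto_dist_iff)
  qed
  have bounded: "\<exists>M. eventually (\<lambda>k. dd k (u k) (X k) \<le> M) U"
    if u: "\<And>k. u k \<in> S" "(u \<longlongrightarrow> u0) U" "u0 \<noteq> a" for u u0
  proof -
    define \<delta> where "\<delta> = dist u0 a * dist x0 a"
    have \<delta>: "\<delta> > 0" using u(3) \<open>x0 \<noteq> a\<close> by (simp add: \<delta>_def)
    have "((\<lambda>k. dist (u k) (A k) * dist (X k) (A k)) \<longlongrightarrow> \<delta>) U" unfolding \<delta>_def by (intro tendsto_intros u a x0)
    then have e1: "eventually (\<lambda>k. \<delta> / 2 < dist (u k) (A k) * dist (X k) (A k)) U" by (rule order_tendstoD(1)) (use \<delta> in simp)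
    have "eventually (\<lambda>k. dd k (u k) (X k) \<le> 96 / (\<kappa>\<^sup>2 * \<beta>\<^sup>2) * 2 * (2 * 2) / (\<delta> / 2)) U"
      using e1 Bup
    proof eventually_elim
      case (elim k)
      have dd0: "dd k (u k) (X k) \<ge> 0" using l[of k] by (simp add: dd_def)
      have "dd k (u k) (X k) * (\<delta> / 2) \<le> dd k (u k) (X k) * (dist (u k) (A k) * dist (X k) (A k))"
        using elim(1) dd0 by (intro mult_left_mono) auto
      also have "\<dots> = B k * dist (u k) (X k) * (dist (h k (u k)) b * dist (h k (X k)) b)" by (rule form[OF u(1) XA(1)])
      also have "\<dots> \<le> 96 / (\<kappa>\<^sup>2 * \<beta>\<^sup>2) * 2 * (2 * 2)"
        using elim(2) Bpos[of k] S2_dist_le SS2 u(1) XA h(1) b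
        by (intro mult_mono) (auto simp: less_imp_le intro!: mult_nonneg_nonneg)
      finally show ?case using \<delta> by (subst pos_le_divide_eq) auto
    qed
    then show ?thesis by blast
  qed
  have conv: "((\<lambda>k. dd k (u k) (v k)) \<longlongrightarrow> D u0 v0) U"
    if u: "\<And>k. u k \<in> S" "(u \<longlongrightarrow> u0) U" "u0 \<noteq> a" and v: "\<And>k. v k \<in> S" "(v \<longlongrightarrow> v0) U" "v0 \<noteq> a" for u u0 v v0
  proof -
    have hu: "((\<lambda>k. h k (u k)) \<longlongrightarrow> p) U" using hlim bounded[OF u] by blast
    have hv: "((\<lambda>k. h k (v k)) \<longlongrightarrow> p) U" using hlim bounded[OF v] by blast
    have "((\<lambda>k. B k * dist (u k) (v k) * (dist (h k (u k)) b * dist (h k (v k)) b) / (dist (u k) (A k) * dist (v k) (A k)))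
        \<longlongrightarrow> B0 * dist u0 v0 * (dist p b * dist p b) / (dist u0 a * dist v0 a)) U"
      by (intro tendsto_intros B0 u v hu hv a) (use u v in auto)
    also have "B0 * dist u0 v0 * (dist p b * dist p b) / (dist u0 a * dist v0 a) = D u0 v0"
      by (simp add: D_def s_def \<beta>_def power2_eq_square)
    finally show ?thesis
    proof (rule Lim_transform_eventually)
      have "((\<lambda>k. dist (u k) (A k) * dist (v k) (A k)) \<longlongrightarrow> dist u0 a * dist v0 a) U" by (intro tendsto_intros u v a)
      then have "eventually (\<lambda>k. 0 < dist (u k) (A k) * dist (v k) (A k)) U"
        by (rule order_tendstoD(1)) (use u v in auto)
      then show "eventually (\<lambda>k. B k * dist (u k) (v k) * (dist (h k (u k)) b * dist (h k (v k)) b) / (dist (u k) (A k) * dist (v k) (A k)) = dd k (u k) (v k)) U"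
      proof eventually_elim
        case (elim k)
        then have "dist (u k) (A k) * dist (v k) (A k) \<noteq> 0" by linarith
        then show ?case unfolding form[OF u(1) v(1), symmetric] by (rule nonzero_mult_div_cancel_right)
      qed
    qed
  qed
  have Dtri: "D u v \<le> D u x + D x v" if "u \<in> S - {a}" "v \<in> S - {a}" "x \<in> S - {a}" for u v x
  proof -
    have "((\<lambda>k. dd k u v) \<longlongrightarrow> D u v) U" "((\<lambda>k. dd k u x + dd k x v) \<longlongrightarrow> D u x + D x v) U"
      using that by (auto intro!: conv tendsto_intros)
    moreover have "dd k u v \<le> dd k u x + dd k x v" for k
      unfolding dd_def using l[of k] dist_triangle[of "h k u" "h k v" "h k x"] by (simp add: divide_right_mono flip: add_divide_distrib)
    ultimately show ?thesis using tendsto_le[OF Unb] by (metis (no_types, lifting) always_eventually)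
  qed
  have D0: "D u v = 0 \<Longrightarrow> u = v" if "u \<in> S - {a}" "v \<in> S - {a}" for u v
    using that s by (auto simp: D_def)
  \<comment> \<open>Bounded points do not escape to infinity: at \<open>a\<close> the left side of
    \<open>form\<close> would tend to 0 and the right side to a positive number.\<close>
  have notA: "u0 \<noteq> a" if u: "\<And>k. u k \<in> S" "(u \<longlongrightarrow> u0) U" and bd: "eventually (\<lambda>k. dd k (u k) (X k) \<le> M) U" for u u0 M
  proof
    assume u0: "u0 = a"
    have hu: "((\<lambda>k. h k (u k)) \<longlongrightarrow> p) U" using hlim[OF bd] .
    have "((\<lambda>k. B k * dist (u k) (X k) * (dist (h k (u k)) b * dist (c k) b)) \<longlongrightarrow> B0 * dist u0 x0 * (dist p b * dist p b)) U"
      by (intro tendsto_intros B0 u x0 hu cp)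
    moreover have "((\<lambda>k. M * (dist (u k) (A k) * dist (X k) (A k))) \<longlongrightarrow> M * (dist u0 a * dist x0 a)) U"
      by (intro tendsto_intros u x0 a)
    moreover have "eventually (\<lambda>k. B k * dist (u k) (X k) * (dist (h k (u k)) b * dist (c k) b) \<le> M * (dist (u k) (A k) * dist (X k) (A k))) U"
      using bd
    proof eventually_elim
      case (elim k)
      have "B k * dist (u k) (X k) * (dist (h k (u k)) b * dist (c k) b) = dd k (u k) (X k) * (dist (u k) (A k) * dist (X k) (A k))"
        using form[OF u(1) XA(1), of k k] by (simp only: hX)
      also have "\<dots> \<le> M * (dist (u k) (A k) * dist (X k) (A k))" using elim by (intro mult_right_mono) auto
      finally show ?case .
    qed
    ultimately have "B0 * dist u0 x0 * (dist p b * dist p b) \<le> M * (dist u0 a * dist x0 a)" using tendsto_le[OF Unb] by blast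
    moreover have "0 < B0 * dist u0 x0 * (dist p b * dist p b)" using B0p b \<open>x0 \<noteq> a\<close> u0 by auto
    ultimately show False using u0 by simp
  qed
  define ok where "ok k x \<longleftrightarrow> x \<in> S \<and> dist (c k) x / l k < real k + 1" for k x
  have fZ: "ff k x \<in> Z" if "ok k x" for k x using nf[of k] that by (auto simp: ok_def c_def l_def)
  have fc: "ff k (c k) = z" for k using nf[of k] by (auto simp: c_def)
  have fd: "\<bar>dist x y / l k - d (ff k x) (ff k y)\<bar> \<le> 1 / (real k + 1)" if "ok k x" "ok k y" for k x y
    using nf[of k] that by (auto simp: ok_def c_def l_def)
  have fs: "\<exists>x. ok k x \<and> d w (ff k x) < 1 / (real k + 1)" if "w \<in> Z" "d z w < real k" for k w
    using nf[of k] that by (auto simp: ok_def c_def l_def)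
  have okc: "ok k (c k)" for k using c l by (simp add: ok_def)
  have "(\<lambda>k. 1 / (real k + 1)) \<longlonglongrightarrow> 0" using LIMSEQ_Suc[OF lim_const_over_n[of "1::real"]] by (simp add: add.commute)
  then have inv0: "((\<lambda>k. 1 / (real k + 1)) \<longlongrightarrow> 0) U" by (rule tendsto_mono[OF U(2)])
  have big: "eventually (\<lambda>k. M < real k) U" for M :: real
  proof (rule Useq)
    obtain N where "M < real N" using reals_Archimedean2 by blast
    then show "eventually (\<lambda>k. M < real k) sequentially" unfolding eventually_sequentially
      by (intro exI[of _ N]) auto
  qed
  \<comment> \<open>Follows a point \<open>w\<close> of the tangent: an approximate preimage of
    \<open>w\<close>, moved by \<open>g k\<close>. Until the radius reaches \<open>w\<close> the
    value is the default \<open>X k\<close>.\<close>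
  define T where "T w k = (if d z w < real k then g k (SOME x. ok k x \<and> d w (ff k x) < 1 / (real k + 1)) else X k)" for w k
  have T: "ok k (h k (T w k)) \<and> d w (ff k (h k (T w k))) < 1 / (real k + 1)" if "w \<in> Z" "d z w < real k" for w k
  proof -
    let ?x = "SOME x. ok k x \<and> d w (ff k x) < 1 / (real k + 1)"
    have "ok k ?x \<and> d w (ff k ?x) < 1 / (real k + 1)" by (rule someI_ex[OF fs[OF that]])
    moreover have "h k (T w k) = ?x" using calculation that h(2) by (simp add: T_def ok_def)
    ultimately show ?thesis by simp
  qed
  have TS: "T w k \<in> S" if "w \<in> Z" for w k
  proof (cases "d z w < real k")
    case True
    then have "ok k (SOME x. ok k x \<and> d w (ff k x) < 1 / (real k + 1))" using someI_ex[OF fs[OF that True]] by blast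
    then show ?thesis using True gS by (auto simp: T_def ok_def)
  qed (simp add: T_def XA)
  have "\<forall>w\<in>Z. \<exists>\<theta>. \<theta> \<in> S \<and> (T w \<longlongrightarrow> \<theta>) U"
    using ultra_compact_limit[OF U(1) compact_S] TS by (metis (mono_tags, lifting) always_eventually)
  then obtain \<theta> where \<theta>: "\<And>w. w \<in> Z \<Longrightarrow> \<theta> w \<in> S" "\<And>w. w \<in> Z \<Longrightarrow> (T w \<longlongrightarrow> \<theta> w) U" by metis
  have \<theta>a: "\<theta> w \<noteq> a" if w: "w \<in> Z" for w
  proof (rule notA[OF TS[OF w] \<theta>(2)[OF w]])
    show "eventually (\<lambda>k. dd k (T w k) (X k) \<le> d z w + 2) U" using big[of "d z w"]
    proof eventually_elim
      case (elim k)
      note t = T[OF w elim]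
      have e1: "1 / (real k + 1) \<le> 1" by simp
      have "dd k (T w k) (X k) \<le> d (ff k (h k (T w k))) z + 1 / (real k + 1)"
        using fd[OF conjunct1[OF t] okc] unfolding dd_def hX fc by linarith
      moreover have "d (ff k (h k (T w k))) z \<le> d (ff k (h k (T w k))) w + d w z"
        using Z.triangle[OF fZ w zZ] t by blast
      ultimately show ?case using t e1 Z.commute[of w z] Z.commute[of w "ff k (h k (T w k))"] by linarith
    qed
  qed
  have \<theta>iso: "D (\<theta> w) (\<theta> w') = d w w'" if w: "w \<in> Z" "w' \<in> Z" for w w'
  proof -
    have "((\<lambda>k. dd k (T w k) (T w' k) - d w w') \<longlongrightarrow> D (\<theta> w) (\<theta> w') - d w w') U"
      by (intro tendsto_intros conv TS \<theta> \<theta>a w)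
    moreover have "((\<lambda>k. dd k (T w k) (T w' k) - d w w') \<longlongrightarrow> 0) U"
    proof (rule Lim_null_comparison)
      show "((\<lambda>k. 3 * (1 / (real k + 1))) \<longlongrightarrow> 0) U" using tendsto_mult_left[OF inv0, of 3] by simp
      show "eventually (\<lambda>k. norm (dd k (T w k) (T w' k) - d w w') \<le> 3 * (1 / (real k + 1))) U"
        using big[of "d z w"] big[of "d z w'"]
      proof eventually_elim
        case (elim k)
        let ?f = "ff k (h k (T w k))" and ?f' = "ff k (h k (T w' k))"
        note t = T[OF w(1) elim(1)] and t' = T[OF w(2) elim(2)]
        have fz: "?f \<in> Z" "?f' \<in> Z" using t t' fZ by auto
        have "\<bar>dd k (T w k) (T w' k) - d ?f ?f'\<bar> \<le> 1 / (real k + 1)" unfolding dd_def using fd t t' by blast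
        moreover have "d ?f ?f' \<le> d ?f w + d w w' + d w' ?f'"
          using Z.triangle[OF fz(1) w(1) fz(2)] Z.triangle[OF w(1) w(2) fz(2)] by linarith
        moreover have "d w w' \<le> d w ?f + d ?f ?f' + d ?f' w'"
          using Z.triangle[OF w(1) fz(1) w(2)] Z.triangle[OF fz(1) fz(2) w(2)] by linarith
        moreover have "d w ?f < 1 / (real k + 1)" "d w' ?f' < 1 / (real k + 1)" using t t' by auto
        ultimately show ?case using Z.commute[of w ?f] Z.commute[of w' ?f'] unfolding real_norm_def by linarith
      qed
    qed
    ultimately have "D (\<theta> w) (\<theta> w') - d w w' = 0" using tendsto_unique[OF Unb] by blast
    then show ?thesis by simp
  qed
  \<comment> \<open>Completeness of \<open>Z\<close> enters here. The approximations send
    \<open>u\<close> to points \<open>\<psi> k\<close> of \<open>Z\<close>; their images under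
    \<open>\<theta>\<close> converge in \<open>S\<close> by compactness, and since
    \<open>\<theta>\<close> is isometric a sequence chosen among the \<open>\<psi> k\<close> is
    Cauchy.\<close>
  have sur: "\<exists>w\<in>Z. \<theta> w = u" if u: "u \<in> S" "u \<noteq> a" for u
  proof -
    have uk: "((\<lambda>k. dd k u (X k)) \<longlongrightarrow> D u x0) U" by (intro conv u x0 XA) (auto simp: u \<open>x0 \<noteq> a\<close>)
    then have "eventually (\<lambda>k. dd k u (X k) < D u x0 + 1) U" by (rule order_tendstoD(2)) simp
    then have evok: "eventually (\<lambda>k. ok k (h k u)) U" using big[of "D u x0"]
      by eventually_elim (auto simp: ok_def dd_def hX h(1) u dist_commute)
    define \<psi> where "\<psi> k = (if ok k (h k u) then ff k (h k u) else z)" for k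
    have \<psi>Z: "\<psi> k \<in> Z" for k using fZ zZ by (simp add: \<psi>_def)
    obtain u' where u': "u' \<in> S" "((\<lambda>k. \<theta> (\<psi> k)) \<longlongrightarrow> u') U"
      using ultra_compact_limit[OF U(1) compact_S, of "\<lambda>k. \<theta> (\<psi> k)"] \<theta>(1) \<psi>Z by auto
    have \<theta>z: "\<theta> z \<in> S" "\<theta> z \<noteq> a" using \<theta> \<theta>a zZ by auto
    have "u' \<noteq> a"
    proof
      assume e: "u' = a"
      have "((\<lambda>k. s * dist (\<theta> (\<psi> k)) (\<theta> z)) \<longlongrightarrow> s * dist a (\<theta> z)) U" using u'(2) e by (intro tendsto_intros) auto
      moreover have "((\<lambda>k. (D u x0 + 2) * (dist (\<theta> (\<psi> k)) a * dist (\<theta> z) a)) \<longlongrightarrow> (D u x0 + 2) * (dist a a * dist (\<theta> z) a)) U"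
        using u'(2) e by (intro tendsto_intros) auto
      moreover have "eventually (\<lambda>k. s * dist (\<theta> (\<psi> k)) (\<theta> z) \<le> (D u x0 + 2) * (dist (\<theta> (\<psi> k)) a * dist (\<theta> z) a)) U"
        using evok \<open>eventually (\<lambda>k. dd k u (X k) < D u x0 + 1) U\<close>
      proof eventually_elim
        case (elim k)
        have e1: "1 / (real k + 1) \<le> 1" by simp
        have "d (\<psi> k) z \<le> dd k u (X k) + 1 / (real k + 1)"
          using fd[OF elim(1) okc] fc[of k] elim(1) unfolding \<psi>_def dd_def hX by simp
        then have "D (\<theta> (\<psi> k)) (\<theta> z) \<le> D u x0 + 2" using \<theta>iso[OF \<psi>Z zZ, of k] elim(2) e1 by linarith
        moreover have "0 < dist (\<theta> (\<psi> k)) a * dist (\<theta> z) a" using \<theta>a[OF \<psi>Z] \<theta>z by simp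
        ultimately show ?case unfolding D_def by (simp add: pos_divide_le_eq)
      qed
      ultimately have "s * dist a (\<theta> z) \<le> (D u x0 + 2) * (dist a a * dist (\<theta> z) a)" using tendsto_le[OF Unb] by blast
      moreover have "s * dist a (\<theta> z) > 0" using s \<theta>z by simp
      ultimately show False by simp
    qed
    then have u'a: "u' \<in> S - {a}" using u' by blast
    have Dlim: "((\<lambda>k. D (\<theta> (\<psi> k)) u') \<longlongrightarrow> 0) U"
    proof -
      have "((\<lambda>k. D (\<theta> (\<psi> k)) u') \<longlongrightarrow> s * dist u' u' / (dist u' a * dist u' a)) U"
        unfolding D_def by (intro tendsto_intros u') (use u'a in auto)
      then show ?thesis by simp
    qed
    have "\<exists>k. D (\<theta> (\<psi> k)) u' < 1 / (real i + 1)" for i :: nat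
    proof -
      have "eventually (\<lambda>k. D (\<theta> (\<psi> k)) u' < 1 / (real i + 1)) U" by (rule order_tendstoD(2)[OF Dlim]) simp
      then show ?thesis using Unb eventually_happens by blast
    qed
    then obtain ki where ki: "\<And>i. D (\<theta> (\<psi> (ki i))) u' < 1 / (real i + 1)" by metis
    \<comment> \<open>A genuine sequence is extracted, since completeness speaks of Cauchy sequences
      and not of ultralimits.\<close>
    define wi where "wi i = \<psi> (ki i)" for i
    have wiZ: "wi i \<in> Z" for i using \<psi>Z by (simp add: wi_def)
    have \<theta>w: "\<theta> v \<in> S - {a}" if "v \<in> Z" for v using \<theta>(1) \<theta>a that by blast
    have Dsym: "D x y = D y x" for x y by (simp add: D_def dist_commute mult.commute)
    have "Z.MCauchy wi"
      unfolding Z.MCauchy_def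
    proof (intro conjI allI impI)
      show "range wi \<subseteq> Z" using wiZ by blast
      fix e :: real assume "e > 0"
      then obtain N :: nat where N: "2 / e < real N" using reals_Archimedean2 by blast
      show "\<exists>N. \<forall>n n'. N \<le> n \<longrightarrow> N \<le> n' \<longrightarrow> d (wi n) (wi n') < e"
      proof (intro exI[of _ N] allI impI)
        fix n n' assume n: "N \<le> n" "N \<le> n'"
        have N0: "real N > 0" using N \<open>e > 0\<close> by (smt (verit) divide_nonneg_pos)
        have "1 / (real n + 1) \<le> 1 / real N" "1 / (real n' + 1) \<le> 1 / real N" using n N0 by (auto intro!: divide_left_mono)
        moreover have "d (wi n) (wi n') \<le> D (\<theta> (wi n)) u' + D u' (\<theta> (wi n'))"
          using \<theta>iso[OF wiZ wiZ] Dtri[OF \<theta>w[OF wiZ] \<theta>w[OF wiZ] u'a] by metis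
        moreover have "D (\<theta> (wi n)) u' < 1 / (real n + 1)" "D u' (\<theta> (wi n')) < 1 / (real n' + 1)"
          using ki[of n] ki[of n'] Dsym by (auto simp: wi_def)
        moreover have "2 / real N < e" using N N0 \<open>e > 0\<close> by (simp add: field_simps)
        moreover have "2 / real N = 1 / real N + 1 / real N" by simp
        ultimately show "d (wi n) (wi n') < e" by linarith
      qed
    qed
    then obtain v where v: "limitin Z.mtopology wi v sequentially" using mc unfolding Z.mcomplete_def by blast
    then have vZ: "v \<in> Z" and vlim: "\<And>e. e > 0 \<Longrightarrow> \<exists>N. \<forall>n\<ge>N. d (wi n) v < e"
      unfolding Z.limit_metric_sequentially by blast+
    have \<theta>v: "\<theta> v = u'"
    proof (rule D0[OF \<theta>w[OF vZ] u'a])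
      have "D (\<theta> v) u' \<le> e" if "e > 0" for e :: real
      proof -
        obtain N1 where N1: "\<And>n. n \<ge> N1 \<Longrightarrow> d (wi n) v < e / 2" using vlim[of "e/2"] \<open>e > 0\<close> by auto
        obtain N2 :: nat where N2: "2 / e < real N2" using reals_Archimedean2 by blast
        let ?n = "max N1 N2"
        have "2 / e < real ?n + 1" using N2 by linarith
        then have "1 / (real ?n + 1) < e / 2" using \<open>e > 0\<close> by (simp add: field_simps)
        moreover have "D (\<theta> v) u' \<le> D (\<theta> v) (\<theta> (wi ?n)) + D (\<theta> (wi ?n)) u'" using Dtri[OF \<theta>w[OF vZ] u'a \<theta>w[OF wiZ]] .
        moreover have "D (\<theta> v) (\<theta> (wi ?n)) = d (wi ?n) v" using \<theta>iso[OF wiZ vZ] Dsym by metis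
        ultimately show ?thesis using N1[of ?n] ki[of ?n] unfolding wi_def by simp
      qed
      then have "D (\<theta> v) u' \<le> 0" by (meson dense_ge not_less)
      moreover have "D (\<theta> v) u' \<ge> 0" using s by (simp add: D_def)
      ultimately show "D (\<theta> v) u' = 0" by simp
    qed
    \<comment> \<open>One quantity with two limits: \<open>D u (\<theta> v)\<close> by the metric
      formula, and 0 by the approximations.\<close>
    have "((\<lambda>k. dd k u (T v k)) \<longlongrightarrow> D u (\<theta> v)) U" using conv[OF _ tendsto_const _ TS[OF vZ] \<theta>(2)[OF vZ] \<theta>a[OF vZ], of u] u by auto
    moreover have "((\<lambda>k. dd k u (T v k)) \<longlongrightarrow> 0) U"
    proof (rule Lim_null_comparison)
      show "((\<lambda>k. 2 * (1 / (real k + 1)) + D (\<theta> (\<psi> k)) u') \<longlongrightarrow> 0) U"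
        using tendsto_add[OF tendsto_mult_left[OF inv0, of 2] Dlim] by simp
      show "eventually (\<lambda>k. norm (dd k u (T v k)) \<le> 2 * (1 / (real k + 1)) + D (\<theta> (\<psi> k)) u') U"
        using evok big[of "d z v"]
      proof eventually_elim
        case (elim k)
        note t = T[OF vZ elim(2)]
        let ?f = "ff k (h k (T v k))"
        have fz: "?f \<in> Z" using t fZ by blast
        have psi: "\<psi> k = ff k (h k u)" using elim(1) by (simp add: \<psi>_def)
        have "\<bar>dd k u (T v k) - d (\<psi> k) ?f\<bar> \<le> 1 / (real k + 1)" unfolding dd_def psi using fd elim(1) t by blast
        moreover have "d (\<psi> k) ?f \<le> d (\<psi> k) v + d v ?f" using Z.triangle[OF \<psi>Z vZ fz] .
        moreover have "d (\<psi> k) v = D (\<theta> (\<psi> k)) u'" using \<theta>iso[OF \<psi>Z vZ] \<theta>v by metis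
        moreover have "dd k u (T v k) \<ge> 0" using l[of k] by (simp add: dd_def)
        ultimately show ?case using t unfolding real_norm_def by linarith
      qed
    qed
    ultimately have "D u (\<theta> v) = 0" using tendsto_unique[OF Unb] by blast
    then have "u = \<theta> v" using D0 u \<theta>w[OF vZ] by blast
    then show ?thesis using vZ by blast
  qed
  have inj: "inj_on \<theta> Z"
  proof (rule inj_onI)
    fix x y assume "x \<in> Z" "y \<in> Z" "\<theta> x = \<theta> y"
    then show "x = y" using \<theta>iso[of x y] by (simp add: D_def)
  qed
  have "\<theta> ` Z = S - {a}" using sur \<theta>(1) \<theta>a by blast
  then have bij: "bij_betw \<theta> Z (S - {a})" using inj by (simp add: bij_betw_def)
  define \<psi> where "\<psi> = inv_into Z \<theta>"
  have b2: "bij_betw \<psi> (S - {a}) Z" unfolding \<psi>_def by (rule bij_betw_inv_into[OF bij])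
  have "d (\<psi> x) (\<psi> y) = s * dist x y / (dist x a * dist y a)" if "x \<in> S - {a}" "y \<in> S - {a}" for x y
  proof -
    have "\<theta> (\<psi> x) = x" "\<theta> (\<psi> y) = y" "\<psi> x \<in> Z" "\<psi> y \<in> Z"
      using bij that b2 unfolding \<psi>_def by (auto simp: bij_betw_inv_into_right dest: bij_betwE)
    then show ?thesis using \<theta>iso[of "\<psi> x" "\<psi> y"] by (simp add: D_def)
  qed
  then show ?thesis using a(1) s b2 by blast
qed

end

section \<open>The width of a map on a disk packing\<close>

definition top_pt :: "real \<Rightarrow> complex" where "top_pt t = Complex t (sqrt (1 - t\<^sup>2))"
definition bot_pt :: "real \<Rightarrow> complex" where "bot_pt t = Complex t (- sqrt (1 - t\<^sup>2))"

definition width :: "(complex \<Rightarrow> complex) \<Rightarrow> real" where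
  "width \<psi> = integral {-1..1} (\<lambda>t. cmod (\<psi> (top_pt t) - \<psi> (bot_pt t)))"

lemma top_bot_sphere: "t \<in> {-1..1} \<Longrightarrow> top_pt t \<in> sphere 0 1" "t \<in> {-1..1} \<Longrightarrow> bot_pt t \<in> sphere 0 1"
proof -
  assume "t \<in> {-1..1}"
  then have "t\<^sup>2 \<le> 1" by (auto simp: abs_square_le_1)
  then show "top_pt t \<in> sphere 0 1" "bot_pt t \<in> sphere 0 1" by (simp_all add: top_pt_def bot_pt_def cmod_def)
qed

lemma width_integrand_continuous:
  assumes "continuous_on (sphere 0 1) \<psi>"
  shows "continuous_on {-1..1} (\<lambda>t. cmod (\<psi> (top_pt t) - \<psi> (bot_pt t)))"
proof -
  have "continuous_on {-1..1} top_pt" "continuous_on {-1..1} bot_pt"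
    unfolding top_pt_def bot_pt_def Complex_eq by (intro continuous_intros)+
  then have "continuous_on {-1..1} (\<lambda>t. \<psi> (top_pt t))" "continuous_on {-1..1} (\<lambda>t. \<psi> (bot_pt t))"
    using top_bot_sphere by (auto intro!: continuous_on_compose2[OF assms])
  then show ?thesis by (intro continuous_intros)
qed

lemma width_has_integral:
  assumes "continuous_on (sphere 0 1) \<psi>"
  shows "((\<lambda>t. cmod (\<psi> (top_pt t) - \<psi> (bot_pt t))) has_integral width \<psi>) {-1..1}"
  unfolding width_def using integrable_continuous_interval[OF width_integrand_continuous[OF assms]]
  by (rule integrable_integral)

text \<open>Subadditivity of length. Two index sets occur because large disks and small balls are
  charged differently.\<close>

lemma interval_cover_length:
  fixes \<alpha> \<beta> :: real
  assumes "finite A" "finite B" "{\<alpha>..\<beta>} \<subseteq> (\<Union>i\<in>A. {l i..u i}) \<union> (\<Union>j\<in>B. {l' j..u' j})"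
    "\<And>i. i \<in> A \<Longrightarrow> l i \<le> u i" "\<And>j. j \<in> B \<Longrightarrow> l' j \<le> u' j"
  shows "\<beta> - \<alpha> \<le> (\<Sum>i\<in>A. u i - l i) + (\<Sum>j\<in>B. u' j - l' j)"
proof (cases "\<alpha> \<le> \<beta>")
  case True
  let ?P = "\<Union>i\<in>A. {l i..u i}" and ?Q = "\<Union>j\<in>B. {l' j..u' j}"
  have "compact ?P" "compact ?Q" using assms by (auto intro!: compact_UN)
  then have f: "?P \<in> fmeasurable lborel" "?Q \<in> fmeasurable lborel" using fmeasurable_compact by blast+
  have "\<beta> - \<alpha> = measure lborel {\<alpha>..\<beta>}" using True by simp
  also have "\<dots> \<le> measure lborel (?P \<union> ?Q)" using assms(3) f by (intro measure_mono_fmeasurable) auto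
  also have "\<dots> \<le> measure lborel ?P + measure lborel ?Q" using f by (intro measure_Un_le) auto
  also have "\<dots> \<le> (\<Sum>i\<in>A. measure lborel {l i..u i}) + (\<Sum>j\<in>B. measure lborel {l' j..u' j})"
    using assms by (intro add_mono measure_UNION_le) auto
  also have "\<dots> = (\<Sum>i\<in>A. u i - l i) + (\<Sum>j\<in>B. u' j - l' j)"
    using assms(4,5) by simp
  finally show ?thesis .
next
  case False
  have "0 \<le> (\<Sum>i\<in>A. u i - l i) + (\<Sum>j\<in>B. u' j - l' j)" using assms by (intro add_nonneg_nonneg sum_nonneg) auto
  then show ?thesis using False by linarith
qed

locale disk_packing =
  fixes I :: "'i set" and c :: "'i \<Rightarrow> complex" and r :: "'i \<Rightarrow> real" and X :: "complex set"
  assumes rpos: "i \<in> I \<Longrightarrow> r i > 0" and inside: "i \<in> I \<Longrightarrow> ball (c i) (r i) \<subseteq> ball 0 1"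
    and disjoint: "i \<in> I \<Longrightarrow> j \<in> I \<Longrightarrow> i \<noteq> j \<Longrightarrow> ball (c i) (r i) \<inter> ball (c j) (r j) = {}"
    and X_def: "X = cball 0 1 - (\<Union>i\<in>I. ball (c i) (r i))"
begin

lemma closed_X: "closed X" "compact X"
proof -
  have "open (\<Union>i\<in>I. ball (c i) (r i))" by auto
  then show "closed X" unfolding X_def by (intro closed_Diff) auto
  then show "compact X" using bounded_subset[OF bounded_cball, of X 0 1] by (auto simp: X_def compact_eq_bounded_closed)
qed

lemma sphere_X: "i \<in> I \<Longrightarrow> sphere (c i) (r i) \<subseteq> X"
proof
  fix z assume i: "i \<in> I" and z: "z \<in> sphere (c i) (r i)"
  have "closure (ball (c i) (r i)) \<subseteq> cball 0 1"
    using closure_mono[OF inside[OF i]] by simp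
  moreover have "z \<in> closure (ball (c i) (r i))" using z rpos[OF i] by simp
  ultimately have 1: "z \<in> cball 0 1" by blast
  have "z \<notin> ball (c j) (r j)" if j: "j \<in> I" for j
  proof (cases "j = i")
    case True then show ?thesis using z by simp
  next
    case False
    have "ball (c j) (r j) \<inter> closure (ball (c i) (r i)) = {}"
      using disjoint[OF j i False] open_Int_closure_eq_empty[of "ball (c j) (r j)"] by blast
    then show ?thesis using z rpos[OF i] by auto
  qed
  then show "z \<in> X" unfolding X_def using 1 by blast
qed

lemma unit_sphere_X: "sphere 0 1 \<subseteq> X"
  unfolding X_def using inside by force

text \<open>Values of the projected map on the chord need not fill the interval between the end
  values, because the chord has gaps where it crosses disks. A missing value lies between the values
  at the ends of a gap; it is charged to the disk if the disk is large, and otherwise to the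
  covering ball.\<close>

lemma line_bound:
  assumes phi: "continuous_on X \<phi>"
    and I0: "finite I0" "I0 \<subseteq> I" "\<And>i. i \<in> I \<Longrightarrow> i \<notin> I0 \<Longrightarrow> r i \<le> \<rho>"
    and J: "finite J" "X \<subseteq> (\<Union>j\<in>J. ball (x j) (s j))" "\<And>j. j \<in> J \<Longrightarrow> 2 * \<rho> \<le> s j"
    and d: "\<And>j. j \<in> J \<Longrightarrow> 0 \<le> d j" "\<And>j u v. j \<in> J \<Longrightarrow> u \<in> X \<Longrightarrow> v \<in> X \<Longrightarrow> u \<in> ball (x j) (2 * s j) \<Longrightarrow> v \<in> ball (x j) (2 * s j) \<Longrightarrow> cmod (\<phi> u - \<phi> v) \<le> d j"
    and t: "t \<in> {-1..1}"
  shows "cmod (\<phi> (top_pt t) - \<phi> (bot_pt t)) \<le>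
     (\<Sum>i\<in>I0. if t \<in> {Re (c i) - r i..Re (c i) + r i} then cmod (\<phi> (c i + r i *\<^sub>R top_pt ((t - Re (c i)) / r i)) - \<phi> (c i + r i *\<^sub>R bot_pt ((t - Re (c i)) / r i))) else 0)
     + (\<Sum>j\<in>J. if t \<in> {Re (x j) - 2 * s j..Re (x j) + 2 * s j} then 2 * d j else 0)" (is "?L \<le> (\<Sum>i\<in>I0. ?K i) + (\<Sum>j\<in>J. ?M j)")
proof -
  define h where "h = sqrt (1 - t\<^sup>2)"
  have t2: "t\<^sup>2 \<le> 1" using t by (auto simp: abs_square_le_1)
  have h0: "h \<ge> 0" using t2 by (simp add: h_def)
  have h2: "t\<^sup>2 + h\<^sup>2 = 1" using t2 by (simp add: h_def)
  define E where "E = {y. Complex t y \<in> X}"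
  have contC: "continuous_on A (Complex t)" for A unfolding Complex_eq by (intro continuous_intros)
  have closedE: "closed E"
    unfolding E_def using closed_vimage[OF closed_X(1) contC] by (simp add: vimage_def)
  have EB: "y \<in> E \<Longrightarrow> \<bar>y\<bar> \<le> h" for y
  proof -
    assume "y \<in> E"
    then have "cmod (Complex t y) \<le> 1" by (simp add: E_def X_def)
    then have "t\<^sup>2 + y\<^sup>2 \<le> 1" by (simp add: cmod_def)
    then have "y\<^sup>2 \<le> h\<^sup>2" using h2 by linarith
    then show "\<bar>y\<bar> \<le> h" using h0 by (simp add: abs_le_square_iff[symmetric])
  qed
  have EC: "\<bar>y\<bar> \<le> h \<Longrightarrow> y \<notin> E \<Longrightarrow> \<exists>i\<in>I. Complex t y \<in> ball (c i) (r i)" for y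
  proof -
    assume y: "\<bar>y\<bar> \<le> h" "y \<notin> E"
    then have "y\<^sup>2 \<le> h\<^sup>2" using h0 by (simp add: abs_le_square_iff[symmetric])
    then have "t\<^sup>2 + y\<^sup>2 \<le> 1" using h2 by linarith
    then have "cmod (Complex t y) \<le> 1" by (simp add: cmod_def)
    then show "\<exists>i\<in>I. Complex t y \<in> ball (c i) (r i)" using y(2) unfolding E_def X_def by auto
  qed
  have tb: "top_pt t = Complex t h" "bot_pt t = Complex t (- h)" by (simp_all add: top_pt_def bot_pt_def h_def)
  have hE: "h \<in> E" "- h \<in> E" using top_bot_sphere[OF t] unit_sphere_X unfolding tb E_def by blast+
  \<comment> \<open>Projection to the direction of the image of the chord reduces the claim to
    covering a real interval.\<close>
  define w where "w = sgn (\<phi> (top_pt t) - \<phi> (bot_pt t))"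
  define f where "f y = Re (cnj w * \<phi> (Complex t y))" for y
  have w1: "cmod w \<le> 1" unfolding w_def by (simp add: norm_sgn)
  have fd: "\<bar>f y - f y'\<bar> \<le> cmod (\<phi> (Complex t y) - \<phi> (Complex t y'))" for y y'
  proof -
    have "f y - f y' = Re (cnj w * (\<phi> (Complex t y) - \<phi> (Complex t y')))" by (simp add: f_def right_diff_distrib)
    then have "\<bar>f y - f y'\<bar> \<le> cmod w * cmod (\<phi> (Complex t y) - \<phi> (Complex t y'))"
      by (metis abs_Re_le_cmod norm_mult complex_mod_cnj)
    also have "\<dots> \<le> 1 * cmod (\<phi> (Complex t y) - \<phi> (Complex t y'))" using w1 by (intro mult_right_mono) auto
    finally show ?thesis by simp
  qed
  have ftb: "f h - f (- h) = ?L"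
  proof -
    have "cnj (sgn v) * v = of_real (cmod v)" for v :: complex
    proof (cases "v = 0")
      case False
      have "cnj v * v = of_real (cmod v) * of_real (cmod v)"
        by (metis complex_norm_square mult.commute of_real_mult power2_eq_square)
      moreover have "cnj (sgn v) * v = (cnj v * v) / of_real (cmod v)" by (simp add: sgn_eq)
      ultimately show ?thesis using False by simp
    qed simp
    then have "f h - f (- h) = Re (of_real ?L)" unfolding f_def tb[symmetric] w_def
      by (metis minus_complex.simps(1) right_diff_distrib)
    then show ?thesis by simp
  qed
  have cf: "continuous_on E f"
  proof -
    have "continuous_on E (\<lambda>y. \<phi> (Complex t y))"
      by (rule continuous_on_compose2[OF phi contC]) (auto simp: E_def)
    then show ?thesis unfolding f_def by (intro continuous_intros)
  qed
  \<comment> \<open>Half the length of the vertical chord of the \<open>i\<close>-th disk at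
    abscissa \<open>t\<close>.\<close>
  define q where "q i = sqrt ((r i)\<^sup>2 - (t - Re (c i))\<^sup>2)" for i
  have inball: "Complex t y \<in> ball (c i) (r i) \<longleftrightarrow> (t - Re (c i))\<^sup>2 + (y - Im (c i))\<^sup>2 < (r i)\<^sup>2" if "i \<in> I" for i y
  proof -
    have "dist (c i) (Complex t y) = sqrt ((t - Re (c i))\<^sup>2 + (y - Im (c i))\<^sup>2)"
      unfolding dist_norm cmod_def by (simp add: power2_commute)
    moreover have "sqrt u < r i \<longleftrightarrow> u < (r i)\<^sup>2" if "u \<ge> 0" for u
      using rpos[OF \<open>i \<in> I\<close>] that by (metis less_imp_le real_sqrt_less_iff real_sqrt_unique)
    ultimately show ?thesis by simp
  qed
  have chord: "\<bar>t - Re (c i)\<bar> < r i \<and> q i > 0 \<and> Im (c i) - q i \<in> E \<and> Im (c i) + q i \<in> E \<and>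
      (\<forall>y. Im (c i) - q i < y \<and> y < Im (c i) + q i \<longrightarrow> y \<notin> E) \<and> Im (c i) - q i < y0 \<and> y0 < Im (c i) + q i"
    if i: "i \<in> I" and y0: "Complex t y0 \<in> ball (c i) (r i)" for i y0
  proof -
    have lt: "(t - Re (c i))\<^sup>2 + (y0 - Im (c i))\<^sup>2 < (r i)\<^sup>2" using inball[OF i] y0 by blast
    then have "(t - Re (c i))\<^sup>2 < (r i)\<^sup>2" by (smt (verit) zero_le_power2)
    then have "\<bar>t - Re (c i)\<bar>\<^sup>2 < (r i)\<^sup>2" by simp
    then have 1: "\<bar>t - Re (c i)\<bar> < r i" "q i > 0"
      using power2_less_imp_less[OF _ less_imp_le[OF rpos[OF i]]] by (auto simp: q_def)
    have q2: "(q i)\<^sup>2 = (r i)\<^sup>2 - (t - Re (c i))\<^sup>2" using \<open>(t - Re (c i))\<^sup>2 < (r i)\<^sup>2\<close> by (simp add: q_def)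
    have on: "Complex t (Im (c i) + e) \<in> sphere (c i) (r i)" if "e\<^sup>2 = (q i)\<^sup>2" for e
    proof -
      have "dist (c i) (Complex t (Im (c i) + e)) = sqrt ((t - Re (c i))\<^sup>2 + e\<^sup>2)"
        unfolding dist_norm cmod_def by (simp add: power2_commute)
      also have "\<dots> = r i" unfolding that q2 using rpos[OF i] by simp
      finally show ?thesis by simp
    qed
    have 2: "Im (c i) - q i \<in> E" "Im (c i) + q i \<in> E"
      using on[of "- q i"] on[of "q i"] sphere_X[OF i] unfolding E_def by auto
    have 3: "y \<notin> E" if "Im (c i) - q i < y \<and> y < Im (c i) + q i" for y
    proof -
      have "\<bar>y - Im (c i)\<bar> < q i" using that by auto
      then have "(y - Im (c i))\<^sup>2 < (q i)\<^sup>2" using 1 by (metis abs_ge_zero power2_abs power_strict_mono zero_less_numeral)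
      then have "Complex t y \<in> ball (c i) (r i)" using inball[OF i] q2 by simp
      then show ?thesis unfolding E_def X_def using i by blast
    qed
    have "(y0 - Im (c i))\<^sup>2 < (q i)\<^sup>2" using lt q2 by simp
    then have "\<bar>y0 - Im (c i)\<bar> < q i" using 1(2) by (metis abs_ge_zero less_imp_le power2_abs power_less_imp_less_base)
    then show ?thesis using 1 2 3 by auto
  qed
  have Kpt: "c i + r i *\<^sub>R top_pt ((t - Re (c i)) / r i) = Complex t (Im (c i) + q i)"
     "c i + r i *\<^sub>R bot_pt ((t - Re (c i)) / r i) = Complex t (Im (c i) - q i)" if i: "i \<in> I" for i
  proof -
    have rr: "r i > 0" using rpos i by blast
    have "r i * sqrt (1 - ((t - Re (c i)) / r i)\<^sup>2) = sqrt ((r i)\<^sup>2 * (1 - ((t - Re (c i)) / r i)\<^sup>2))"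
      using rr by (simp add: real_sqrt_mult)
    also have "(r i)\<^sup>2 * (1 - ((t - Re (c i)) / r i)\<^sup>2) = (r i)\<^sup>2 - (t - Re (c i))\<^sup>2"
      using rr by (simp add: power_divide right_diff_distrib)
    finally have e: "r i * sqrt (1 - ((t - Re (c i)) / r i)\<^sup>2) = q i" by (simp add: q_def)
    show "c i + r i *\<^sub>R top_pt ((t - Re (c i)) / r i) = Complex t (Im (c i) + q i)"
      "c i + r i *\<^sub>R bot_pt ((t - Re (c i)) / r i) = Complex t (Im (c i) - q i)"
      using rr e by (simp_all add: top_pt_def bot_pt_def complex_eq_iff)
  qed
  define A where "A = {i \<in> I0. \<bar>t - Re (c i)\<bar> < r i}"
  define B where "B = {j \<in> J. \<bar>t - Re (x j)\<bar> < 2 * s j}"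
  define lo hi where "lo i = min (f (Im (c i) - q i)) (f (Im (c i) + q i))" and "hi i = max (f (Im (c i) - q i)) (f (Im (c i) + q i))" for i
  \<comment> \<open>A reference height for each ball: on the part of the slice inside the doubled
    ball, \<open>f\<close> stays within \<open>d j\<close> of its value there.\<close>
  define \<sigma> where "\<sigma> j = (SOME y. y \<in> E \<and> Complex t y \<in> ball (x j) (2 * s j))" for j
  have piece: "j \<in> B \<and> \<bar>f y - f (\<sigma> j)\<bar> \<le> d j" if j: "j \<in> J" and y: "y \<in> E" "Complex t y \<in> ball (x j) (2 * s j)" for j y
  proof -
    have "\<sigma> j \<in> E \<and> Complex t (\<sigma> j) \<in> ball (x j) (2 * s j)" unfolding \<sigma>_def by (rule someI[of _ y]) (use y in blast)
    then have "cmod (\<phi> (Complex t y) - \<phi> (Complex t (\<sigma> j))) \<le> d j" using d(2)[OF j] y unfolding E_def by blast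
    then have 1: "\<bar>f y - f (\<sigma> j)\<bar> \<le> d j" using fd order_trans by blast
    have "\<bar>Re (x j - Complex t y)\<bar> \<le> cmod (x j - Complex t y)" by (rule abs_Re_le_cmod)
    also have "\<dots> < 2 * s j" using y(2) by (simp add: dist_norm)
    finally have "\<bar>t - Re (x j)\<bar> < 2 * s j" by simp
    then show ?thesis using 1 j by (simp add: B_def)
  qed
  have "{f (- h)..f h} \<subseteq> (\<Union>i\<in>A. {lo i..hi i}) \<union> (\<Union>j\<in>B. {f (\<sigma> j) - d j..f (\<sigma> j) + d j})"
  proof
    fix y assume y: "y \<in> {f (- h)..f h}"
    \<comment> \<open>The last height with value at most \<open>y\<close> either attains
      \<open>y\<close> or is the lower end of a gap: later heights of the slice have values above
      \<open>y\<close>, so by continuity they keep a positive distance.\<close>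
    define P where "P = {u \<in> E. f u \<le> y}"
    have PE: "closed P"
    proof -
      have "P = E \<inter> f -` {..y}" by (auto simp: P_def)
      then show ?thesis using continuous_closed_preimage[OF cf closedE, of "{..y}"] by simp
    qed
    have Pb: "bdd_above P" using EB unfolding P_def bdd_above_def by (intro exI[of _ h]) force
    have "- h \<in> P" using hE y by (simp add: P_def)
    define \<tau> where "\<tau> = Sup P"
    have \<tau>: "\<tau> \<in> P" unfolding \<tau>_def using closed_contains_Sup[OF _ Pb PE] \<open>- h \<in> P\<close> by blast
    have \<tau>max: "u \<le> \<tau>" if "u \<in> P" for u unfolding \<tau>_def using Pb that by (rule cSup_upper[rotated])
    have \<tau>E: "\<tau> \<in> E" "f \<tau> \<le> y" using \<tau> by (auto simp: P_def)
    obtain j where j: "j \<in> J" "Complex t \<tau> \<in> ball (x j) (s j)" using \<tau>E(1) J(2) unfolding E_def by blast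
    have sj: "s j > 0" using j(2) by (metis ball_empty empty_iff not_less)
    have j2: "Complex t \<tau> \<in> ball (x j) (2 * s j)" using j(2) sj by auto
    show "y \<in> (\<Union>i\<in>A. {lo i..hi i}) \<union> (\<Union>j\<in>B. {f (\<sigma> j) - d j..f (\<sigma> j) + d j})"
    proof (cases "f \<tau> = y")
      case True
      then show ?thesis using piece[OF j(1) \<tau>E(1) j2] by (intro UnI2 UN_I[of j]) auto
    next
      case False
      then have fy: "f \<tau> < y" using \<tau>E by simp
      define Q where "Q = {u \<in> E. \<tau> < u}"
      have "h \<in> Q"
      proof -
        have "h \<noteq> \<tau>" using fy y by auto
        moreover have "\<tau> \<le> h" using EB[OF \<tau>E(1)] by auto
        ultimately show ?thesis using hE by (simp add: Q_def)
      qed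
      have Qf: "y < f u" if "u \<in> Q" for u using \<tau>max[of u] that unfolding Q_def P_def by force
      have Qbd: "bdd_below Q" unfolding Q_def bdd_below_def by (intro exI[of _ \<tau>]) auto
      define \<tau>' where "\<tau>' = Inf Q"
      have ge: "\<tau> \<le> \<tau>'" unfolding \<tau>'_def using \<open>h \<in> Q\<close> by (intro cInf_greatest) (auto simp: Q_def)
      have "\<exists>e>0. \<forall>u\<in>E. dist u \<tau> < e \<longrightarrow> f u < y"
      proof -
        have "\<exists>e>0. \<forall>u\<in>E. dist u \<tau> < e \<longrightarrow> dist (f u) (f \<tau>) < y - f \<tau>"
          using cf \<tau>E(1) fy unfolding continuous_on_iff by (metis diff_gt_0_iff_gt)
        then show ?thesis by (auto simp: dist_real_def) (metis abs_less_iff diff_less_eq diff_add_cancel add.commute)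
      qed
      then obtain e where e: "e > 0" "\<And>u. u \<in> E \<Longrightarrow> dist u \<tau> < e \<Longrightarrow> f u < y" by blast
      have Qe: "\<tau> + e \<le> u" if "u \<in> Q" for u
      proof (rule ccontr)
        assume "\<not> \<tau> + e \<le> u"
        then have "dist u \<tau> < e" "u \<in> E" using that by (auto simp: Q_def dist_real_def)
        then show False using e(2) Qf[OF that] by force
      qed
      have \<tau>\<tau>': "\<tau> < \<tau>'"
      proof -
        have "\<tau> + e \<le> \<tau>'" unfolding \<tau>'_def using \<open>h \<in> Q\<close> Qe by (intro cInf_greatest) auto
        then show ?thesis using e by linarith
      qed
      have Qcl: "closed Q"
      proof -
        have "Q = E \<inter> {\<tau> + e..}" using Qe e unfolding Q_def by force
        then show ?thesis using closedE by auto
      qed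
      have \<tau>'Q: "\<tau>' \<in> Q" unfolding \<tau>'_def using closed_contains_Inf[OF _ Qbd Qcl] \<open>h \<in> Q\<close> by blast
      then have \<tau>'E: "\<tau>' \<in> E" "y < f \<tau>'" using Qf by (auto simp: Q_def)
      define \<mu> where "\<mu> = (\<tau> + \<tau>') / 2"
      have \<mu>: "\<tau> < \<mu>" "\<mu> < \<tau>'" using \<tau>\<tau>' by (auto simp: \<mu>_def)
      have gap: "u \<notin> E" if "\<tau> < u" "u < \<tau>'" for u
      proof
        assume "u \<in> E"
        then have "u \<in> Q" using that by (simp add: Q_def)
        then have "\<tau>' \<le> u" unfolding \<tau>'_def using Qbd by (intro cInf_lower) auto
        then show False using that by simp
      qed
      have "\<bar>\<mu>\<bar> \<le> h" using EB[OF \<tau>E(1)] EB[OF \<tau>'E(1)] \<mu> by auto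
      then obtain i where i: "i \<in> I" "Complex t \<mu> \<in> ball (c i) (r i)" using EC gap[OF \<mu>] by blast
      note ch = chord[OF i]
      have eq: "\<tau> = Im (c i) - q i" "\<tau>' = Im (c i) + q i"
      proof -
        have "\<not> (Im (c i) - q i < \<tau> \<and> \<tau> < Im (c i) + q i)" "\<not> (Im (c i) - q i < \<tau>' \<and> \<tau>' < Im (c i) + q i)"
          using ch \<tau>E(1) \<tau>'E(1) by blast+
        moreover have "\<not> (\<tau> < Im (c i) - q i \<and> Im (c i) - q i < \<tau>')" "\<not> (\<tau> < Im (c i) + q i \<and> Im (c i) + q i < \<tau>')"
          using ch gap by blast+
        ultimately show "\<tau> = Im (c i) - q i" "\<tau>' = Im (c i) + q i" using ch \<mu> by linarith+
      qed
      show ?thesis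
      proof (cases "i \<in> I0")
        case True
        then have "i \<in> A" using ch by (simp add: A_def)
        moreover have "y \<in> {lo i..hi i}" using fy \<tau>'E(2) unfolding lo_def hi_def eq by auto
        ultimately show ?thesis by blast
      next
        case False
        then have ri: "r i \<le> \<rho>" using I0(3) i by blast
        have "(q i)\<^sup>2 \<le> (r i)\<^sup>2" unfolding q_def using ch by (simp add: q_def)
        then have qr: "q i \<le> r i" using rpos[OF i(1)] by (metis less_imp_le power2_le_imp_le)
        have "dist (x j) (Complex t \<tau>') \<le> dist (x j) (Complex t \<tau>) + dist (Complex t \<tau>) (Complex t \<tau>')" by (rule dist_triangle)
        moreover have "dist (Complex t \<tau>) (Complex t \<tau>') = \<tau>' - \<tau>" using \<tau>\<tau>' by (simp add: dist_norm cmod_def)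
        \<comment> \<open>The gap has length \<open>2 * q i \<le> 2 * \<rho>\<close>, so both its
          ends lie in the doubled ball around \<open>x j\<close>.\<close>
        moreover have "\<tau>' - \<tau> \<le> s j" using J(3)[OF j(1)] ri qr unfolding eq by linarith
        ultimately have "Complex t \<tau>' \<in> ball (x j) (2 * s j)" using j(2) by simp
        then have "j \<in> B" "\<bar>f \<tau>' - f (\<sigma> j)\<bar> \<le> d j" "\<bar>f \<tau> - f (\<sigma> j)\<bar> \<le> d j" using piece[OF j(1) \<tau>'E(1)] piece[OF j(1) \<tau>E(1) j2] by auto
        then have "y \<in> {f (\<sigma> j) - d j..f (\<sigma> j) + d j}" using fy \<tau>'E(2) by auto
        then show ?thesis using \<open>j \<in> B\<close> by blast
      qed
    qed
  qed
  then have "f h - f (- h) \<le> (\<Sum>i\<in>A. hi i - lo i) + (\<Sum>j\<in>B. (f (\<sigma> j) + d j) - (f (\<sigma> j) - d j))"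
    by (intro interval_cover_length) (use I0(1) J(1) d(1) in \<open>auto simp: A_def B_def lo_def hi_def\<close>)
  also have "\<dots> \<le> (\<Sum>i\<in>I0. ?K i) + (\<Sum>j\<in>J. ?M j)"
  proof (rule add_mono)
    have "(\<Sum>i\<in>A. hi i - lo i) \<le> (\<Sum>i\<in>A. ?K i)"
    proof (rule sum_mono)
      fix i assume i: "i \<in> A"
      then have iI: "i \<in> I" and tr: "\<bar>t - Re (c i)\<bar> < r i" using I0(2) by (auto simp: A_def)
      have "hi i - lo i = \<bar>f (Im (c i) + q i) - f (Im (c i) - q i)\<bar>" by (auto simp: hi_def lo_def)
      also have "\<dots> \<le> cmod (\<phi> (Complex t (Im (c i) + q i)) - \<phi> (Complex t (Im (c i) - q i)))" by (rule fd)
      also have "\<dots> = ?K i" unfolding Kpt[OF iI] using tr by auto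
      finally show "hi i - lo i \<le> ?K i" .
    qed
    also have "\<dots> \<le> (\<Sum>i\<in>I0. ?K i)" using I0(1) by (intro sum_mono2) (auto simp: A_def)
    finally show "(\<Sum>i\<in>A. hi i - lo i) \<le> (\<Sum>i\<in>I0. ?K i)" .
    have "(\<Sum>j\<in>B. (f (\<sigma> j) + d j) - (f (\<sigma> j) - d j)) \<le> (\<Sum>j\<in>B. ?M j)"
      by (rule sum_mono) (auto simp: B_def)
    also have "\<dots> \<le> (\<Sum>j\<in>J. ?M j)" using J(1) d(1) by (intro sum_mono2) (auto simp: B_def)
    finally show "(\<Sum>j\<in>B. (f (\<sigma> j) + d j) - (f (\<sigma> j) - d j)) \<le> (\<Sum>j\<in>J. ?M j)" .
  qed
  finally show ?thesis using ftb by simp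
qed

text \<open>Integration of \<open>line_bound\<close> over the abscissa. Substitution in the
  \<open>i\<close>-th term gives the factor \<open>r i\<close>, rescaling the target gives
  \<open>r' i\<close>; a ball contributes \<open>2 * d j\<close> over an interval of length
  \<open>4 * s j\<close>.\<close>

lemma width_bound:
  assumes phi: "continuous_on X \<phi>"
    and I0: "finite I0" "I0 \<subseteq> I" "\<And>i. i \<in> I \<Longrightarrow> i \<notin> I0 \<Longrightarrow> r i \<le> \<rho>"
    and J: "finite J" "X \<subseteq> (\<Union>j\<in>J. ball (x j) (s j))" "\<And>j. j \<in> J \<Longrightarrow> 2 * \<rho> \<le> s j" "\<And>j. j \<in> J \<Longrightarrow> 0 \<le> s j"
    and d: "\<And>j. j \<in> J \<Longrightarrow> 0 \<le> d j" "\<And>j u v. j \<in> J \<Longrightarrow> u \<in> X \<Longrightarrow> v \<in> X \<Longrightarrow> u \<in> ball (x j) (2 * s j) \<Longrightarrow> v \<in> ball (x j) (2 * s j) \<Longrightarrow> cmod (\<phi> u - \<phi> v) \<le> d j"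
    and psi: "\<And>i u. i \<in> I0 \<Longrightarrow> u \<in> sphere 0 1 \<Longrightarrow> \<phi> (c i + r i *\<^sub>R u) = c' i + r' i *\<^sub>R \<psi> i u" "\<And>i. i \<in> I0 \<Longrightarrow> 0 \<le> r' i"
      "\<And>i. i \<in> I0 \<Longrightarrow> continuous_on (sphere 0 1) (\<psi> i)"
  shows "width \<phi> \<le> (\<Sum>i\<in>I0. r i * r' i * width (\<psi> i)) + (\<Sum>j\<in>J. 8 * s j * d j)"
proof -
  define K where "K i t = cmod (\<phi> (c i + r i *\<^sub>R top_pt ((t - Re (c i)) / r i)) - \<phi> (c i + r i *\<^sub>R bot_pt ((t - Re (c i)) / r i)))" for i t
  have Kint: "((\<lambda>t. if t \<in> {Re (c i) - r i..Re (c i) + r i} then K i t else 0) has_integral (r i * r' i * width (\<psi> i))) UNIV" if i: "i \<in> I0" for i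
  proof -
    have ri: "r i > 0" using rpos i I0(2) by blast
    define g where "g t = cmod (\<psi> i (top_pt t) - \<psi> i (bot_pt t))" for t
    have "(g has_integral width (\<psi> i)) (cbox (-1) 1)" unfolding g_def using width_has_integral[OF psi(3)[OF i]] by simp
    from has_integral_affinity[OF this, of "1 / r i" "- Re (c i) / r i"]
    have "((\<lambda>t. g ((1 / r i) * t + - Re (c i) / r i)) has_integral r i * width (\<psi> i)) ((\<lambda>t. r i * t + Re (c i)) ` cbox (-1) 1)"
      using ri by simp
    moreover have "(\<lambda>t. r i * t + Re (c i)) ` cbox (-1) 1 = {Re (c i) - r i..Re (c i) + r i}"
      using ri image_affinity_atLeastAtMost[of "r i" "Re (c i)" "-1" 1] by (simp add: add.commute)
    moreover have "g ((1 / r i) * t + - Re (c i) / r i) = g ((t - Re (c i)) / r i)" for t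
      by (simp add: diff_divide_distrib)
    ultimately have "((\<lambda>t. g ((t - Re (c i)) / r i)) has_integral r i * width (\<psi> i)) {Re (c i) - r i..Re (c i) + r i}" by simp
    then have "((\<lambda>t. r' i * g ((t - Re (c i)) / r i)) has_integral r' i * (r i * width (\<psi> i))) {Re (c i) - r i..Re (c i) + r i}"
      by (rule has_integral_mult_right)
    moreover have "r' i * g ((t - Re (c i)) / r i) = K i t" if "t \<in> {Re (c i) - r i..Re (c i) + r i}" for t
    proof -
      have "(t - Re (c i)) / r i \<in> {-1..1}" using that ri by (auto simp: field_simps)
      note tb = top_bot_sphere[OF this]
      have "K i t = cmod (r' i *\<^sub>R (\<psi> i (top_pt ((t - Re (c i)) / r i)) - \<psi> i (bot_pt ((t - Re (c i)) / r i))))"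
        unfolding K_def psi(1)[OF i tb(1)] psi(1)[OF i tb(2)] by (simp add: scaleR_diff_right)
      then show ?thesis using psi(2)[OF i] by (simp add: g_def)
    qed
    ultimately have "(K i has_integral r' i * (r i * width (\<psi> i))) {Re (c i) - r i..Re (c i) + r i}"
      by (rule has_integral_eq[rotated])
    then show ?thesis unfolding has_integral_restrict_UNIV by (simp add: mult_ac)
  qed
  have Mint: "((\<lambda>t. if t \<in> {Re (x j) - 2 * s j..Re (x j) + 2 * s j} then 2 * d j else 0) has_integral (8 * s j * d j)) UNIV" if j: "j \<in> J" for j
  proof -
    have "((\<lambda>t. 2 * d j) has_integral (measure lborel (cbox (Re (x j) - 2 * s j) (Re (x j) + 2 * s j)) *\<^sub>R (2 * d j))) (cbox (Re (x j) - 2 * s j) (Re (x j) + 2 * s j))"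
      by (rule has_integral_const)
    then show ?thesis unfolding has_integral_restrict_UNIV using J(4)[OF j] by (simp add: mult_ac)
  qed
  have sphX: "continuous_on (sphere 0 1) \<phi>" using continuous_on_subset[OF phi unit_sphere_X] .
  have L: "((\<lambda>t. if t \<in> {-1..1} then cmod (\<phi> (top_pt t) - \<phi> (bot_pt t)) else 0) has_integral width \<phi>) UNIV"
    unfolding has_integral_restrict_UNIV by (rule width_has_integral[OF sphX])
  have R: "((\<lambda>t. (\<Sum>i\<in>I0. if t \<in> {Re (c i) - r i..Re (c i) + r i} then K i t else 0) + (\<Sum>j\<in>J. if t \<in> {Re (x j) - 2 * s j..Re (x j) + 2 * s j} then 2 * d j else 0))
      has_integral ((\<Sum>i\<in>I0. r i * r' i * width (\<psi> i)) + (\<Sum>j\<in>J. 8 * s j * d j))) UNIV"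
    by (intro has_integral_add has_integral_sum Kint Mint I0 J)
  show ?thesis
  proof (rule has_integral_le[OF L R])
    fix t :: real
    show "(if t \<in> {-1..1} then cmod (\<phi> (top_pt t) - \<phi> (bot_pt t)) else 0) \<le>
       (\<Sum>i\<in>I0. if t \<in> {Re (c i) - r i..Re (c i) + r i} then K i t else 0) + (\<Sum>j\<in>J. if t \<in> {Re (x j) - 2 * s j..Re (x j) + 2 * s j} then 2 * d j else 0)"
    proof (cases "t \<in> {-1..1}")
      case True
      then show ?thesis using line_bound[OF phi I0 J(1,2,3) d True] unfolding K_def by simp
    next
      case False
      have "0 \<le> (\<Sum>i\<in>I0. if t \<in> {Re (c i) - r i..Re (c i) + r i} then K i t else 0) + (\<Sum>j\<in>J. if t \<in> {Re (x j) - 2 * s j..Re (x j) + 2 * s j} then 2 * d j else 0)"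
        using d(1) by (intro add_nonneg_nonneg sum_nonneg) (auto simp: K_def)
      then show ?thesis unfolding if_not_P[OF False] .
    qed
  qed
qed

lemma area_bound:
  assumes "finite F" "F \<subseteq> I"
  shows "(\<Sum>i\<in>F. (r i)\<^sup>2) \<le> 1"
proof -
  have m: "measure lebesgue (ball z e) = pi * e\<^sup>2" if "e \<ge> 0" for z :: complex and e
  proof -
    have "measure lebesgue (ball z e) = measure lborel (ball z e)" by (simp add: measure_completion)
    then show ?thesis using that content_ball[of e z] by (simp add: unit_ball_vol_2 DIM_complex)
  qed
  have "(\<Sum>i\<in>F. pi * (r i)\<^sup>2) = (\<Sum>i\<in>F. measure lebesgue (ball (c i) (r i)))"
    by (rule sum.cong) (use assms rpos m in \<open>auto simp: less_imp_le\<close>)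
  also have "\<dots> = measure lebesgue (\<Union>i\<in>F. ball (c i) (r i))"
    by (rule measure_finite_Union[symmetric])
       (use assms disjoint in \<open>auto simp: disjoint_family_on_def\<close>,
         metis emeasure_lborel_ball_finite infinity_ennreal_def less_irrefl)
  also have "\<dots> \<le> measure lebesgue (ball (0::complex) 1)"
    by (rule measure_mono_fmeasurable) (use assms inside in \<open>auto\<close>)
  also have "\<dots> = pi" using m[of 1 0] by simp
  finally have "pi * (\<Sum>i\<in>F. (r i)\<^sup>2) \<le> pi * 1" by (simp add: sum_distrib_left)
  then show ?thesis by (simp only: mult_le_cancel_left_pos pi_gt_zero)
qed

end

section \<open>Centres and radii of disks under inversion\<close>

lemma sphere_subset_sphere:
  fixes a b :: complex
  assumes "R > 0" "sphere a R \<subseteq> sphere b Q"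
  shows "a = b" "R = Q"
proof -
  have on: "(cmod (a - b + u))\<^sup>2 = Q\<^sup>2" if "cmod u = R" for u
  proof -
    have "a + u \<in> sphere a R" using that by (simp add: dist_norm)
    then have "a + u \<in> sphere b Q" using assms(2) by blast
    moreover have "b - (a + u) = - (a - b + u)" by simp
    ultimately show ?thesis by (metis dist_norm mem_sphere norm_minus_cancel)
  qed
  \<comment> \<open>Opposite points of the first circle are equally far from the centre of the
    second; two perpendicular diameters force the centres to agree.\<close>
  have "(cmod (a - b + of_real R))\<^sup>2 = (cmod (a - b + - of_real R))\<^sup>2"
    "(cmod (a - b + \<i> * of_real R))\<^sup>2 = (cmod (a - b + - (\<i> * of_real R)))\<^sup>2"
    using on[of "of_real R"] on[of "- of_real R"] on[of "\<i> * of_real R"] on[of "- (\<i> * of_real R)"] assms(1) by (simp_all add: norm_mult)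
  then have "Re (a - b) * R = 0" "Im (a - b) * R = 0" unfolding cmod_power2 by (simp_all add: power2_eq_square algebra_simps)
  then show "a = b" using assms(1) by (simp add: complex_eq_iff)
  then show "R = Q" using assms on[of "of_real R"] by (auto simp: power2_eq_iff)
qed

text \<open>The denominator is the power of the origin, the centre of inversion, with respect to the
  circle; it is positive if the origin lies outside and negative if it lies inside.\<close>

lemma inversion_sphere:
  fixes u v :: complex
  assumes "v \<noteq> 0" "cmod (v - u) = s" "(cmod u)\<^sup>2 - s\<^sup>2 \<noteq> 0" "r > 0"
  shows "cmod (of_real r / cnj v - of_real (r / ((cmod u)\<^sup>2 - s\<^sup>2)) * u) = r * s / \<bar>(cmod u)\<^sup>2 - s\<^sup>2\<bar>"
proof -
  define \<Delta> where "\<Delta> = (cmod u)\<^sup>2 - s\<^sup>2"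
  have d: "\<Delta> \<noteq> 0" using assms by (simp add: \<Delta>_def)
  have cv: "cnj v \<noteq> 0" using assms by simp
  have "of_real r / cnj v - of_real (r / \<Delta>) * u = of_real (r / \<Delta>) * ((of_real \<Delta> - u * cnj v) / cnj v)"
    using cv d by (simp add: field_simps)
  then have 1: "cmod (of_real r / cnj v - of_real (r / \<Delta>) * u) = (r / \<bar>\<Delta>\<bar>) * (cmod (of_real \<Delta> - u * cnj v) / cmod v)"
    using assms(4) by (simp add: norm_mult norm_divide)
  have s2: "(cmod v)\<^sup>2 - 2 * Re (u * cnj v) + (cmod u)\<^sup>2 = s\<^sup>2"
    unfolding assms(2)[symmetric] cmod_power2 by (simp add: power2_eq_square algebra_simps)
  have "(cmod (of_real \<Delta> - u * cnj v))\<^sup>2 = \<Delta>\<^sup>2 - 2 * \<Delta> * Re (u * cnj v) + (cmod u)\<^sup>2 * (cmod v)\<^sup>2"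
    unfolding cmod_power2 by (simp add: power2_eq_square algebra_simps)
  also have "2 * \<Delta> * Re (u * cnj v) = \<Delta> * ((cmod v)\<^sup>2 + \<Delta>)" using s2 by (simp add: \<Delta>_def algebra_simps)
  finally have "(cmod (of_real \<Delta> - u * cnj v))\<^sup>2 = \<Delta>\<^sup>2 - \<Delta> * ((cmod v)\<^sup>2 + \<Delta>) + (cmod u)\<^sup>2 * (cmod v)\<^sup>2" .
  also have "\<dots> = (s * cmod v)\<^sup>2" by (simp add: \<Delta>_def power2_eq_square algebra_simps)
  finally have "cmod (of_real \<Delta> - u * cnj v) = s * cmod v"
    using assms(2) by (metis norm_ge_zero mult_nonneg_nonneg power2_eq_imp_eq)
  then show ?thesis using 1 assms(1) unfolding \<Delta>_def by simp
qed

definition rad :: "(R3 \<Rightarrow> complex) \<Rightarrow> R3 set \<Rightarrow> real" where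
  "rad m D = (SOME R. R > 0 \<and> (\<exists>z. m ` circ D = sphere z R))"
definition cen :: "(R3 \<Rightarrow> complex) \<Rightarrow> R3 set \<Rightarrow> complex" where
  "cen m D = (SOME z. m ` circ D = sphere z (rad m D))"

lemma cen_rad_eq:
  assumes "m ` circ D = sphere z R" "R > 0"
  shows "cen m D = z" "rad m D = R"
proof -
  have "rad m D > 0 \<and> (\<exists>z. m ` circ D = sphere z (rad m D))"
    unfolding rad_def by (rule someI[of _ R]) (use assms in blast)
  then have "m ` circ D = sphere (cen m D) (rad m D)" unfolding cen_def by (metis (mono_tags, lifting) someI_ex)
  then have "sphere z R \<subseteq> sphere (cen m D) (rad m D)" using assms by simp
  from sphere_subset_sphere[OF assms(2) this] show "cen m D = z" "rad m D = R" by auto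
qed

text \<open>The radius of the \<open>j\<close>-th disk after inversion in the \<open>i\<close>-th disk; \<open>o'\<close> is the outer disk, which the
  inversion moves inside.\<close>
definition rad2 :: "(R3 \<Rightarrow> complex) \<Rightarrow> R3 set \<Rightarrow> R3 set \<Rightarrow> R3 set \<Rightarrow> real" where
  "rad2 m o' i j = (if j = o' then rad m i / (1 - (cmod (cen m i))\<^sup>2)
     else rad m i * rad m j / ((cmod (cen m i - cen m j))\<^sup>2 - (rad m j)\<^sup>2))"

text \<open>The picture obtained from \<open>m\<close> by inversion in the \<open>i\<close>-th disk, scaled to radius 1. The point \<open>p\<close>
  lies at infinity in the picture \<open>m\<close>, hence at 0 in the new one.\<close>
definition child :: "(R3 \<Rightarrow> complex) \<Rightarrow> R3 \<Rightarrow> R3 set \<Rightarrow> R3 \<Rightarrow> complex" where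
  "child m p i = (\<lambda>x. if x = p then 0 else of_real (rad m i) / cnj (m x - cen m i))"

context schottky begin

lemma picture_disk:
  assumes P: "picture \<D> m p k D0" and D: "D \<in> \<D>" "D \<noteq> D0"
  shows "rad m D > 0" "m ` D = ball (cen m D) (rad m D)" "m ` circ D = sphere (cen m D) (rad m D)"
proof -
  note P = pictureD[OF P]
  have "p \<notin> closure D" using disk_unique[OF D(1) P(2), of p] P(3) disk_closure D(2) by blast
  then obtain z R where R: "R > 0" "m ` D = ball z R" "m ` circ D = sphere z R"
    by (rule chart_disk[OF P(1) round[OF D(1)]]) blast
  note e = cen_rad_eq[OF R(3,1)]
  show "rad m D > 0" "m ` D = ball (cen m D) (rad m D)" "m ` circ D = sphere (cen m D) (rad m D)"
    unfolding e by fact+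
qed

lemma picture_inj:
  assumes "picture \<D> m p k D0" "x \<in> S2" "y \<in> S2" "x \<noteq> p" "y \<noteq> p" "m x = m y"
  shows "x = y"
  by (rule inj_onD[OF chartD(4)[OF pictureD(1)[OF assms(1)]] assms(6)]) (use assms in auto)

lemma picture_packing:
  assumes P0: "picture \<D> m p k D0"
  shows "disk_packing (\<D> - {D0}) (cen m) (rad m) (m ` S)"
proof -
  note P = pictureD[OF P0]
  note inj = picture_inj[OF P0]
  have pS: "p \<notin> closure D" "p \<notin> D" if "D \<in> \<D>" "D \<noteq> D0" for D
    using disk_unique[OF that(1) P(2), of p] P(3) disk_closure that by blast+
  have DC: "D \<subseteq> S2 - closure D0" if "D \<in> \<D>" "D \<noteq> D0" for D
    using disj_closure[OF that(1) P(2) that(2)] disk_S2(1)[OF that(1)] disk_closure by blast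
  show ?thesis
  proof
    fix i j assume i: "i \<in> \<D> - {D0}"
    show "rad m i > 0" using picture_disk(1)[OF P0] i by blast
    show "ball (cen m i) (rad m i) \<subseteq> ball 0 1"
      unfolding picture_disk(2)[OF P0, of i, symmetric, OF DiffD1[OF i] ] using i DC[of i] P(4) picture_disk(2)[OF P0, of i] by blast
    assume j: "j \<in> \<D> - {D0}" "i \<noteq> j"
    show "ball (cen m i) (rad m i) \<inter> ball (cen m j) (rad m j) = {}"
    proof (rule ccontr)
      assume "\<not> ?thesis"
      then have "m ` i \<inter> m ` j \<noteq> {}" using picture_disk(2)[OF P0, of i] picture_disk(2)[OF P0, of j] i j by simp
      then obtain x y where xy: "x \<in> i" "y \<in> j" "m x = m y" by blast
      then have "x = y" using inj[of x y] i j pS disk_S2(1) by blast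
      then show False using disk_unique[of i j x] xy disk_closure i j by blast
    qed
  next
    show "m ` S = cball 0 1 - (\<Union>i\<in>\<D> - {D0}. ball (cen m i) (rad m i))"
    proof (intro equalityI subsetI)
      fix z assume "z \<in> m ` S"
      then obtain x where x: "x \<in> S" "z = m x" by blast
      have "z \<notin> ball (cen m i) (rad m i)" if i: "i \<in> \<D> - {D0}" for i
      proof
        assume "z \<in> ball (cen m i) (rad m i)"
        then obtain y where y: "y \<in> i" "z = m y" using picture_disk(2)[OF P0, of i] i by blast
        have "y \<in> S2" "y \<noteq> p" using y(1) pS(2)[of i] i disk_S2(1)[of i] by blast+
        then have "x = y" using inj[of x y] picture_S(1)[OF P0 x(1)] x(2) y(2) by metis
        then show False using y x disk_S2(2)[of i] i by blast
      qed
      then show "z \<in> cball 0 1 - (\<Union>i\<in>\<D> - {D0}. ball (cen m i) (rad m i))" using picture_S(2)[OF P0 x(1)] x by auto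
    next
      fix z assume z: "z \<in> cball 0 1 - (\<Union>i\<in>\<D> - {D0}. ball (cen m i) (rad m i))"
      have "\<exists>x\<in>S2 - D0. m x = z"
      proof (cases "cmod z < 1")
        case True
        then have "z \<in> m ` (S2 - closure D0)" using P(4) by simp
        then show ?thesis using disk_closure by blast
      next
        case False
        then have "z \<in> m ` circ D0" using P(5) z by auto
        then show ?thesis using circ_S[OF P(2)] S_S2 disk_S2(2)[OF P(2)] by blast
      qed
      then obtain x where x: "x \<in> S2" "x \<notin> D0" "m x = z" by blast
      have "x \<in> S"
      proof (rule ccontr)
        assume "x \<notin> S"
        then obtain i where "i \<in> \<D>" "x \<in> i" using disk_cases x by blast
        then have "i \<in> \<D> - {D0}" "z \<in> m ` i" using x by auto
        then show False using z picture_disk(2)[OF P0, of i] by blast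
      qed
      then show "z \<in> m ` S" using x by blast
    qed
  qed
qed

text \<open>Inversion fixes its circle pointwise, so on \<open>circ i\<close> the child is the
  parent up to an affine map; this is what relates the widths of two generations. The new radii come
  from \<open>inversion_sphere\<close>.\<close>

lemma child_picture:
  assumes P0: "picture \<D> m p k D0" and i: "i \<in> \<D>" "i \<noteq> D0"
  shows "\<exists>q k'. picture \<D> (child m p i) q k' i"
    and "x \<in> circ i \<Longrightarrow> child m p i x = (m x - cen m i) / of_real (rad m i)"
    and "j \<in> \<D> \<Longrightarrow> j \<noteq> i \<Longrightarrow> rad (child m p i) j = rad2 m D0 i j"
proof -
  note P = pictureD[OF P0]
  note C = chartD[OF P(1)]
  note inj = picture_inj[OF P0]
  let ?c = "cen m i" and ?r = "rad m i"
  note I = picture_disk[OF P0 i]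
  have pn: "p \<notin> closure i" "p \<notin> i" using disk_unique[OF i(1) P(2), of p] P(3) disk_closure i(2) by blast+
  have "?c \<in> m ` i" using I by simp
  then obtain q where q: "q \<in> i" "m q = ?c" by auto
  have qS: "q \<in> S2" "q \<noteq> p" using q disk_S2(1)[OF i(1)] pn by blast+
  define n where "n = child m p i"
  have n_def': "n = (\<lambda>x. if x = p then 0 else of_real ?r / cnj (m x - m q))" by (simp only: n_def child_def q(2))
  have ch: "chart n q (?r * (dist q p)\<^sup>2 / k)" unfolding n_def' by (rule chart_child[OF P(1) qS I(1)])
  have cl: "m ` closure i = cball ?c ?r"
  proof -
    have "closure i = i \<union> circ i" using closure_subset[of i] by (auto simp: circ_def)
    then have "m ` closure i = ball ?c ?r \<union> sphere ?c ?r" using I by (simp add: image_Un)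
    then show ?thesis by auto
  qed
  have nx: "cmod (n x) = ?r / dist (m x) ?c" if "x \<noteq> p" for x
    using that I(1) by (simp add: n_def child_def norm_divide dist_norm del: complex_cnj_diff)
  have iff: "x \<in> closure i \<longleftrightarrow> dist (m x) ?c \<le> ?r" if "x \<in> S2" "x \<noteq> p" for x
  proof
    assume "x \<in> closure i"
    then have "m x \<in> cball ?c ?r" using cl by blast
    then show "dist (m x) ?c \<le> ?r" by (simp add: dist_commute)
  next
    assume "dist (m x) ?c \<le> ?r"
    then have "m x \<in> m ` closure i" unfolding cl by (simp add: dist_commute)
    then obtain y where y: "y \<in> closure i" "m x = m y" by blast
    then have "x = y" using inj[OF that(1) _ that(2)] disk_S2(3)[OF i(1)] pn by blast
    then show "x \<in> closure i" using y by simp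
  qed
  have lt1: "cmod (n x) < 1 \<longleftrightarrow> x \<notin> closure i" if "x \<in> S2" "x \<noteq> q" for x
  proof (cases "x = p")
    case True then show ?thesis using pn by (simp add: n_def child_def)
  next
    case False
    have "dist (m x) ?c > 0" using inj[OF that(1) qS(1) False qS(2)] that q(2) by auto
    then show ?thesis using nx[OF False] iff[OF that(1) False] by (auto simp: divide_less_eq)
  qed
  have circn: "n x = (m x - ?c) / of_real ?r" if x: "x \<in> circ i" for x
  proof -
    have xp: "x \<noteq> p" using x pn by (auto simp: circ_def)
    have "m x \<in> sphere ?c ?r" using I(3) x by blast
    then have d: "cmod (m x - ?c) = ?r" by (simp add: dist_norm norm_minus_commute)
    define v where "v = m x - ?c"
    have v: "v * cnj v = of_real ?r * of_real ?r" using d unfolding v_def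
      by (metis complex_norm_square of_real_mult power2_eq_square)
    then have "cnj v \<noteq> 0" using I(1) by auto
    then have "of_real ?r / cnj v = v / of_real ?r" using v I(1) by (simp add: field_simps)
    then show ?thesis using xp by (simp add: n_def child_def v_def)
  qed
  have 1: "n ` (S2 - closure i) = ball 0 1"
  proof (intro equalityI subsetI)
    fix z assume "z \<in> n ` (S2 - closure i)"
    then obtain x where x: "x \<in> S2" "x \<notin> closure i" "z = n x" by blast
    then have "x \<noteq> q" using q disk_closure by blast
    then show "z \<in> ball 0 1" using lt1[OF x(1)] x by simp
  next
    fix z assume z: "z \<in> ball (0::complex) 1"
    obtain x where x: "x \<in> S2 - {q}" "n x = z" using chartD(5)[OF ch] by blast
    then show "z \<in> n ` (S2 - closure i)" using lt1[of x] z by auto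
  qed
  have 2: "n ` circ i = sphere 0 1"
  proof (intro equalityI subsetI)
    fix z assume "z \<in> n ` circ i"
    then obtain x where x: "x \<in> circ i" "z = n x" by blast
    then have "m x \<in> sphere ?c ?r" using I(3) by blast
    then show "z \<in> sphere 0 1" using circn[OF x(1)] x I(1) by (simp add: norm_divide dist_norm norm_minus_commute)
  next
    fix z assume z: "z \<in> sphere (0::complex) 1"
    have "?c + of_real ?r * z \<in> sphere ?c ?r" using z I(1) by (simp add: dist_norm norm_mult)
    then obtain x where x: "x \<in> circ i" "m x = ?c + of_real ?r * z" using I(3) by (metis imageE)
    then have "n x = z" using circn[OF x(1)] I(1) by simp
    then show "z \<in> n ` circ i" using x by blast
  qed
  have Pn: "picture \<D> n q (?r * (dist q p)\<^sup>2 / k) i" unfolding picture_def using ch i q 1 2 by blast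
  then show "\<exists>q k'. picture \<D> (child m p i) q k' i" unfolding n_def by blast
  show "x \<in> circ i \<Longrightarrow> child m p i x = (m x - cen m i) / of_real (rad m i)" using circn unfolding n_def .
  assume j: "j \<in> \<D>" "j \<noteq> i"
  note Jn = picture_disk[OF Pn j]
  interpret dp: disk_packing "\<D> - {D0}" "cen m" "rad m" "m ` S" by (rule picture_packing[OF P0])
  \<comment> \<open>The circle of \<open>j\<close> seen from the centre of inversion; in the old
    picture the outer circle has centre 0 and radius 1.\<close>
  define u s where "u = (if j = D0 then 0 else cen m j) - ?c" and "s = (if j = D0 then 1 else rad m j)"
  have mj: "m ` circ j = sphere (if j = D0 then 0 else cen m j) s"
    unfolding s_def using P(5) picture_disk(3)[OF P0 j(1)] by auto
  have sp: "s > 0" using picture_disk(1)[OF P0 j(1)] by (auto simp: s_def)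
  have cin: "cmod ?c < 1" using dp.inside[of i] i I(1) by (metis Diff_iff centre_in_ball dist_0_norm dist_commute mem_ball singletonD subset_iff)
  \<comment> \<open>The power is negative for the outer disk, whose circle surrounds the centre of
    inversion, and positive for the others; hence the case distinction in
    \<open>rad2\<close>.\<close>
  have Dn: "(cmod u)\<^sup>2 - s\<^sup>2 \<noteq> 0"
  proof (cases "j = D0")
    case True
    have "(cmod ?c)\<^sup>2 < 1" using cin by (simp add: abs_square_less_1)
    then show ?thesis using True by (simp add: u_def s_def)
  next
    case False
    have "?c \<notin> cball (cen m j) (rad m j)"
    proof
      assume "?c \<in> cball (cen m j) (rad m j)"
      moreover have "ball ?c ?r \<inter> closure (ball (cen m j) (rad m j)) = {}"
        using dp.disjoint[of i j] i j False open_Int_closure_eq_empty[of "ball ?c ?r"] by auto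
      ultimately show False using I(1) picture_disk(1)[OF P0 j(1) False] by (metis centre_in_ball closure_ball disjoint_iff)
    qed
    then have "rad m j < cmod u" using False by (simp add: u_def dist_norm)
    then have "(rad m j)\<^sup>2 < (cmod u)\<^sup>2" using picture_disk(1)[OF P0 j(1) False] by (intro power_strict_mono) auto
    then show ?thesis using False by (simp add: s_def)
  qed
  have "sphere (cen n j) (rad n j) \<subseteq> sphere (of_real (?r / ((cmod u)\<^sup>2 - s\<^sup>2)) * u) (?r * s / \<bar>(cmod u)\<^sup>2 - s\<^sup>2\<bar>)"
  proof
    fix z assume "z \<in> sphere (cen n j) (rad n j)"
    then obtain x where x: "x \<in> circ j" "z = n x" using Jn(3) by blast
    have xS: "x \<in> S" using x circ_S[OF j(1)] by blast
    have xp: "x \<in> S2" "x \<noteq> p" using picture_S(1)[OF P0 xS] by auto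
    define v where "v = m x - ?c"
    have "x \<noteq> q" using xS q disk_S2(2)[OF i(1)] by blast
    then have v0: "v \<noteq> 0" using inj[OF xp(1) qS(1) xp(2) qS(2)] q(2) by (auto simp: v_def)
    have "m x \<in> sphere (if j = D0 then 0 else cen m j) s" using mj x by blast
    then have vu: "cmod (v - u) = s" by (auto simp: v_def u_def dist_norm norm_minus_commute)
    have "z = of_real ?r / cnj v" using x xp by (simp add: n_def child_def v_def)
    then show "z \<in> sphere (of_real (?r / ((cmod u)\<^sup>2 - s\<^sup>2)) * u) (?r * s / \<bar>(cmod u)\<^sup>2 - s\<^sup>2\<bar>)"
      using inversion_sphere[OF v0 vu Dn I(1)] by (simp only: mem_sphere dist_norm norm_minus_commute)
  qed
  then have e: "rad n j = ?r * s / \<bar>(cmod u)\<^sup>2 - s\<^sup>2\<bar>" by (rule sphere_subset_sphere(2)[OF Jn(1)])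
  show "rad (child m p i) j = rad2 m D0 i j"
  proof (cases "j = D0")
    case True
    have "(cmod ?c)\<^sup>2 < 1" using cin by (simp add: abs_square_less_1)
    then show ?thesis using e True unfolding n_def[symmetric] by (simp add: u_def s_def rad2_def)
  next
    case False
    have "?r * s / \<bar>(cmod u)\<^sup>2 - s\<^sup>2\<bar> = ?r * s / ((cmod u)\<^sup>2 - s\<^sup>2)"
    proof -
      have "?c \<notin> ball (cen m j) (rad m j)"
        using dp.disjoint[of i j] i j False I(1) by force
      then have "rad m j \<le> cmod u" using False by (simp add: u_def dist_norm)
      then have "(rad m j)\<^sup>2 \<le> (cmod u)\<^sup>2" using picture_disk(1)[OF P0 j(1) False] by (intro power_mono) auto
      then show ?thesis using False by (simp add: s_def)
    qed
    then show ?thesis using e False unfolding n_def[symmetric] by (simp add: u_def s_def rad2_def norm_minus_commute)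
  qed
qed

end

section \<open>Nets, tails of sums, and near-equality in Cauchy-Schwarz\<close>

lemma separated_net:
  fixes F :: "'a::metric_space set"
  assumes "finite F" "e > 0"
  shows "\<exists>N\<subseteq>F. (\<forall>x\<in>N. \<forall>y\<in>N. x \<noteq> y \<longrightarrow> e \<le> dist x y) \<and> F \<subseteq> (\<Union>x\<in>N. ball x e)"
  using assms(1)
proof (induction F)
  case empty then show ?case by auto
next
  case (insert x F)
  then obtain N where N: "N \<subseteq> F" "\<forall>x\<in>N. \<forall>y\<in>N. x \<noteq> y \<longrightarrow> e \<le> dist x y" "F \<subseteq> (\<Union>x\<in>N. ball x e)" by blast
  show ?case
  proof (cases "x \<in> (\<Union>x\<in>N. ball x e)")
    case True then show ?thesis using N by (intro exI[of _ N]) auto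
  next
    case False
    then have "\<forall>y\<in>N. e \<le> dist y x" by (auto simp: not_less)
    then show ?thesis using N assms(2) by (intro exI[of _ "insert x N"]) (auto simp: dist_commute)
  qed
qed

text \<open>\<open>F0\<close> nearly realises the supremum of the finite sums, so a set disjoint
  from it can add little.\<close>

lemma bounded_sums_tail:
  fixes a :: "'i \<Rightarrow> real"
  assumes nn: "\<And>i. i \<in> I \<Longrightarrow> 0 \<le> a i" and bd: "\<And>F. finite F \<Longrightarrow> F \<subseteq> I \<Longrightarrow> sum a F \<le> 1" and "\<eta> > 0"
  obtains F0 where "finite F0" "F0 \<subseteq> I" "\<And>F. finite F \<Longrightarrow> F \<subseteq> I \<Longrightarrow> F \<inter> F0 = {} \<Longrightarrow> sum a F \<le> \<eta>"
proof -
  define T where "T = sum a ` {F. finite F \<and> F \<subseteq> I}"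
  have T: "T \<noteq> {}" "bdd_above T" using bd unfolding T_def bdd_above_def by blast+
  have "Sup T - \<eta> < Sup T" using assms(3) by simp
  then obtain y where "y \<in> T" "Sup T - \<eta> < y" using less_cSup_iff[OF T] by blast
  then obtain F0 where F0: "finite F0" "F0 \<subseteq> I" "Sup T - \<eta> < sum a F0" unfolding T_def by blast
  have "sum a F \<le> \<eta>" if F: "finite F" "F \<subseteq> I" "F \<inter> F0 = {}" for F
  proof -
    have "sum a (F \<union> F0) \<in> T" unfolding T_def using F F0 by blast
    then have "sum a (F \<union> F0) \<le> Sup T" using T(2) by (rule cSup_upper)
    then show ?thesis using F0 F by (simp add: sum.union_disjoint)
  qed
  then show ?thesis using that F0 by blast
qed

text \<open>Near-equality in Cauchy-Schwarz: the sum of the squares (a - b)^2 is at most 1 + 1 minus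
  twice the sum of products. The index \<open>i\<close> need not belong to \<open>Q\<close>; adding
  it only increases the sum of products.\<close>

lemma sum_product_close:
  fixes a b :: "'i \<Rightarrow> real"
  assumes "finite Q" "Q \<subseteq> I" "i \<in> I" and nn: "\<And>i. i \<in> I \<Longrightarrow> 0 \<le> a i" "\<And>i. i \<in> I \<Longrightarrow> 0 \<le> b i"
    and bd: "\<And>F. finite F \<Longrightarrow> F \<subseteq> I \<Longrightarrow> (\<Sum>i\<in>F. (a i)\<^sup>2) \<le> 1" "\<And>F. finite F \<Longrightarrow> F \<subseteq> I \<Longrightarrow> (\<Sum>i\<in>F. (b i)\<^sup>2) \<le> 1"
    and s: "1 - \<eta> \<le> (\<Sum>i\<in>Q. a i * b i)"
  shows "(a i - b i)\<^sup>2 \<le> 2 * \<eta>"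
proof -
  let ?F = "insert i Q"
  have F: "finite ?F" "?F \<subseteq> I" using assms by auto
  have "(a i - b i)\<^sup>2 \<le> (\<Sum>i\<in>?F. (a i - b i)\<^sup>2)" using F(1) by (intro member_le_sum) auto
  also have "\<dots> = (\<Sum>i\<in>?F. (a i)\<^sup>2) + (\<Sum>i\<in>?F. (b i)\<^sup>2) - 2 * (\<Sum>i\<in>?F. a i * b i)"
    by (simp add: power2_diff sum.distrib sum_subtractf sum_distrib_left mult.assoc)
  also have "\<dots> \<le> 1 + 1 - 2 * (\<Sum>i\<in>Q. a i * b i)"
  proof -
    have "(\<Sum>i\<in>Q. a i * b i) \<le> (\<Sum>i\<in>?F. a i * b i)" using F nn by (intro sum_mono2) auto
    then show ?thesis using bd(1)[OF F] bd(2)[OF F] by linarith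
  qed
  also have "\<dots> \<le> 2 * \<eta>" using s by linarith
  finally show ?thesis .
qed

lemma sum_product_le_one:
  fixes a b :: "'i \<Rightarrow> real"
  assumes "(\<Sum>i\<in>F. (a i)\<^sup>2) \<le> 1" "(\<Sum>i\<in>F. (b i)\<^sup>2) \<le> 1"
  shows "(\<Sum>i\<in>F. a i * b i) \<le> 1"
proof -
  have "(\<Sum>i\<in>F. 2 * a i * b i) \<le> (\<Sum>i\<in>F. (a i)\<^sup>2 + (b i)\<^sup>2)"
    by (rule sum_mono) (rule sum_squares_bound)
  also have "\<dots> = (\<Sum>i\<in>F. (a i)\<^sup>2) + (\<Sum>i\<in>F. (b i)\<^sup>2)" by (rule sum.distrib)
  finally have "2 * (\<Sum>i\<in>F. a i * b i) \<le> (\<Sum>i\<in>F. (a i)\<^sup>2) + (\<Sum>i\<in>F. (b i)\<^sup>2)"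
    by (simp add: sum_distrib_left mult.assoc)
  then show ?thesis using assms by linarith
qed

context schottky begin

text \<open>The pole is at a positive distance \<open>e\<close> from the compact set
  \<open>S\<close>, so the denominator in the chart formula lies between e^2 and 4.\<close>

lemma picture_bilipschitz:
  assumes P0: "picture \<D> m p k D0"
  obtains K where "K > 0" "\<And>x y. x \<in> S \<Longrightarrow> y \<in> S \<Longrightarrow> dist (m x) (m y) \<le> K * dist x y"
    "\<And>x y. x \<in> S \<Longrightarrow> y \<in> S \<Longrightarrow> dist x y \<le> K * dist (m x) (m y)"
proof -
  note P = pictureD[OF P0]
  note C = chartD[OF P(1)]
  have "p \<notin> S" using P(3) disk_S2(2)[OF P(2)] by blast
  then obtain e where e: "e > 0" "\<And>x. x \<in> S \<Longrightarrow> e \<le> dist p x"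
    using separate_point_closed[OF compact_imp_closed[OF compact_S]] by blast
  define K where "K = max (k / e\<^sup>2) (4 / k)"
  have K: "K > 0" "k / e\<^sup>2 \<le> K" "4 / k \<le> K" using C(2) by (auto simp: K_def less_max_iff_disj)
  have b: "dist (m x) (m y) \<le> K * dist x y \<and> dist x y \<le> K * dist (m x) (m y)" if xy: "x \<in> S" "y \<in> S" for x y
  proof -
    have S2: "x \<in> S2" "x \<noteq> p" "y \<in> S2" "y \<noteq> p" using picture_S(1)[OF P0] xy by auto
    let ?q = "dist x p * dist y p"
    have q1: "e\<^sup>2 \<le> ?q" unfolding power2_eq_square
      using e(1) e(2)[OF xy(1)] e(2)[OF xy(2)] by (intro mult_mono) (auto simp: dist_commute[of p])
    have q2: "?q \<le> 4" using mult_mono[OF S2_dist_le[OF S2(1) C(1)] S2_dist_le[OF S2(3) C(1)]] by simp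
    have q0: "?q > 0" using S2 by simp
    have f: "dist (m x) (m y) = k / ?q * dist x y" using C(6)[OF S2] by simp
    have "k / ?q \<le> k / e\<^sup>2" using q1 q0 e C(2) by (intro divide_left_mono) auto
    then have 1: "dist (m x) (m y) \<le> K * dist x y" unfolding f using K(2) by (intro mult_right_mono) auto
    have "dist x y = ?q / k * dist (m x) (m y)" unfolding f using S2(2,4) C(2) by simp
    also have "\<dots> \<le> K * dist (m x) (m y)"
    proof (rule mult_right_mono)
      have "?q / k \<le> 4 / k" using q2 C(2) by (intro divide_right_mono) auto
      then show "?q / k \<le> K" using K(3) by linarith
    qed simp
    finally show ?thesis using 1 by blast
  qed
  then show ?thesis using that[OF K(1)] by blast
qed

lemma picture_inj_S: "picture \<D> m p k D0 \<Longrightarrow> inj_on m S"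
  by (rule inj_onI) (metis picture_S(1) picture_inj)

lemma picture_cont_S: "picture \<D> m p k D0 \<Longrightarrow> continuous_on S m"
proof -
  assume P0: "picture \<D> m p k D0"
  have "S \<subseteq> S2 - {p}" using picture_S(1)[OF P0] by blast
  then show ?thesis using continuous_on_subset[OF chart_continuous[OF pictureD(1)[OF P0]]] by blast
qed

lemma picture_rad_ge:
  assumes P0: "picture \<D> m p k D0" and D: "D \<in> \<D>" "D \<noteq> D0" and u: "u \<in> circ D" "v \<in> circ D"
  shows "dist (m u) (m v) \<le> 2 * rad m D"
proof -
  have "m u \<in> sphere (cen m D) (rad m D)" "m v \<in> sphere (cen m D) (rad m D)" using picture_disk(3)[OF P0 D] u by blast+
  then show ?thesis using dist_triangle3[of "m u" "m v" "cen m D"] by auto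
qed

text \<open>By the area bound there are at most 1 / \<rho>^2 such disks. This makes the large disks
  of \<open>width_step\<close> a finite set.\<close>

lemma picture_finite_big:
  assumes P0: "picture \<D> m p k D0" and "\<rho> > 0"
  shows "finite {D \<in> \<D> - {D0}. \<rho> < rad m D}" (is "finite ?B")
proof (rule ccontr)
  interpret dp: disk_packing "\<D> - {D0}" "cen m" "rad m" "m ` S" by (rule picture_packing[OF P0])
  assume inf: "infinite ?B"
  obtain n :: nat where n: "1 / \<rho>\<^sup>2 < real n" using reals_Archimedean2 by blast
  obtain F where F: "F \<subseteq> ?B" "finite F" "card F = n" using infinite_arbitrarily_large[OF inf] by blast
  have "real n * \<rho>\<^sup>2 = (\<Sum>D\<in>F. \<rho>\<^sup>2)" using F by simp
  also have "\<dots> \<le> (\<Sum>D\<in>F. (rad m D)\<^sup>2)" using F(1) assms(2) by (intro sum_mono power_mono) auto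
  also have "\<dots> \<le> 1" using F by (intro dp.area_bound) auto
  finally have "real n \<le> 1 / \<rho>\<^sup>2" using assms(2) by (simp add: field_simps)
  then show False using n by simp
qed

end

section \<open>Pairs of Schottky sets\<close>

text \<open>The last assumption is what remains of quasisymmetry: away from a single point \<open>a\<close>, the image of a
  small ball is controlled by the image of a complementary disk of comparable size inside it.\<close>
locale schottky_pair = A: schottky_group S \<D> G \<kappa> + B: schottky_group S' \<D>' G' \<kappa>'
  for S \<D> G \<kappa> S' \<D>' G' \<kappa>' +
  fixes f :: "R3 \<Rightarrow> R3" and \<sigma> :: "R3 set \<Rightarrow> R3 set"
  assumes f_cont: "continuous_on S f" and f_bij: "bij_betw f S S'" and sigma: "bij_betw \<sigma> \<D> \<D>'"
    and f_circ: "D \<in> \<D> \<Longrightarrow> f ` circ D = circ (\<sigma> D)"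
    and err: "\<exists>a\<in>S. \<forall>\<delta>>0. \<forall>L>0. \<exists>C>0. \<exists>\<rho>0>0. \<forall>x\<in>S. \<delta> \<le> dist x a \<longrightarrow> (\<forall>\<rho>. 0 < \<rho> \<and> \<rho> < \<rho>0 \<longrightarrow>
       (\<exists>D\<in>\<D>. closure D \<subseteq> ball x \<rho> \<and> (\<exists>u\<in>circ D. \<exists>v\<in>circ D. \<rho> \<le> C * dist u v) \<and>
         (\<forall>y\<in>S. dist x y < L * \<rho> \<longrightarrow> (\<exists>u\<in>circ (\<sigma> D). \<exists>v\<in>circ (\<sigma> D). dist (f x) (f y) \<le> C * dist u v))))"
begin

definition pull :: "(R3 \<Rightarrow> complex) \<Rightarrow> (R3 \<Rightarrow> complex) \<Rightarrow> complex \<Rightarrow> complex" where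
  "pull m m' z = m' (f (inv_into S m z))"

lemma sigma_D: "D \<in> \<D> \<Longrightarrow> \<sigma> D \<in> \<D>'" "D \<in> \<D> \<Longrightarrow> E \<in> \<D> \<Longrightarrow> \<sigma> D = \<sigma> E \<Longrightarrow> D = E"
  using sigma by (auto simp: bij_betw_def dest: inj_onD)

lemma f_S: "x \<in> S \<Longrightarrow> f x \<in> S'" using f_bij by (auto simp: bij_betw_def)

lemma pull_eq: "picture \<D> m p k D0 \<Longrightarrow> x \<in> S \<Longrightarrow> pull m m' (m x) = m' (f x)"
  unfolding pull_def using A.picture_inj_S by (simp add: inv_into_f_f)

lemma pull_cont:
  assumes P: "picture \<D> m p k D0" and P': "picture \<D>' m' p' k' D0'"
  shows "continuous_on (m ` S) (pull m m')"
proof -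
  have 1: "continuous_on (m ` S) (inv_into S m)"
    by (rule continuous_on_inv[OF A.picture_cont_S[OF P] A.compact_S]) (simp add: A.picture_inj_S[OF P])
  have "inv_into S m ` m ` S \<subseteq> S" by (auto intro: inv_into_into)
  then have 2: "continuous_on (m ` S) (\<lambda>z. f (inv_into S m z))" using continuous_on_compose2[OF f_cont 1] by blast
  have "(\<lambda>z. f (inv_into S m z)) ` m ` S \<subseteq> S'" using f_S by (auto intro!: f_S inv_into_into)
  then show ?thesis unfolding pull_def using continuous_on_compose2[OF B.picture_cont_S[OF P'] 2] by blast
qed

lemma pull_bound:
  assumes P: "picture \<D> m p k D0" and P': "picture \<D>' m' p' k' D0'" and z: "z \<in> m ` S"
  shows "cmod (pull m m' z) \<le> 1"
  using z B.picture_S(2)[OF P'] f_S by (auto simp: pull_eq[OF P])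

lemma sphere_img: "picture \<D> m p k D0 \<Longrightarrow> sphere 0 1 \<subseteq> m ` S"
  using pictureD(5)[of \<D> m p k D0] A.circ_S[OF pictureD(2)] by blast

lemma pull_cont_sphere:
  "picture \<D> m p k D0 \<Longrightarrow> picture \<D>' m' p' k' D0' \<Longrightarrow> continuous_on (sphere 0 1) (pull m m')"
  using continuous_on_subset[OF pull_cont sphere_img] .

lemma rad'_sum:
  assumes P': "picture \<D>' m' p' k' (\<sigma> D0)" and D0: "D0 \<in> \<D>" and F: "finite F" "F \<subseteq> \<D> - {D0}"
  shows "(\<Sum>i\<in>F. (rad m' (\<sigma> i))\<^sup>2) \<le> 1"
proof -
  interpret dp: disk_packing "\<D>' - {\<sigma> D0}" "cen m'" "rad m'" "m' ` S'" by (rule B.picture_packing[OF P'])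
  have inj: "inj_on \<sigma> F" using F sigma_D(2) by (intro inj_onI) blast
  have "(\<Sum>i\<in>F. (rad m' (\<sigma> i))\<^sup>2) = (\<Sum>j\<in>\<sigma> ` F. (rad m' j)\<^sup>2)" by (simp add: sum.reindex[OF inj])
  also have "\<dots> \<le> 1" by (rule dp.area_bound) (use F D0 sigma_D in blast)+
  finally show ?thesis .
qed

text \<open>The disks of radius above a small \<open>\<rho>\<close> give the main term of
  \<open>width_bound\<close>. The rest of the picture is covered by one ball at \<open>a\<close> and
  by balls of radius \<open>4 * \<rho>\<close>, each assigned a disk of size about
  \<open>\<rho>\<close>; Cauchy-Schwarz over these disks makes the error small.\<close>

lemma width_step:
  assumes P: "picture \<D> m p k D0" and P': "picture \<D>' m' p' k' (\<sigma> D0)" and \<epsilon>: "\<epsilon> > 0"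
  shows "\<exists>I0. finite I0 \<and> I0 \<subseteq> \<D> - {D0} \<and>
    width (pull m m') \<le> (\<Sum>i\<in>I0. rad m i * rad m' (\<sigma> i) * width (pull (child m p i) (child m' p' (\<sigma> i)))) + \<epsilon>"
proof -
  interpret dp: disk_packing "\<D> - {D0}" "cen m" "rad m" "m ` S" by (rule A.picture_packing[OF P])
  have D0: "D0 \<in> \<D>" using pictureD(2)[OF P] .
  obtain K where K: "K > 0" "\<And>x y. x \<in> S \<Longrightarrow> y \<in> S \<Longrightarrow> dist (m x) (m y) \<le> K * dist x y"
    "\<And>x y. x \<in> S \<Longrightarrow> y \<in> S \<Longrightarrow> dist x y \<le> K * dist (m x) (m y)" by (rule A.picture_bilipschitz[OF P]) blast
  obtain K' where K': "K' > 0" "\<And>x y. x \<in> S' \<Longrightarrow> y \<in> S' \<Longrightarrow> dist (m' x) (m' y) \<le> K' * dist x y"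
    "\<And>x y. x \<in> S' \<Longrightarrow> y \<in> S' \<Longrightarrow> dist x y \<le> K' * dist (m' x) (m' y)" by (rule B.picture_bilipschitz[OF P']) blast
  obtain a where a: "a \<in> S" and ERR: "\<forall>\<delta>>0. \<forall>L>0. \<exists>C>0. \<exists>\<rho>0>0. \<forall>x\<in>S. \<delta> \<le> dist x a \<longrightarrow> (\<forall>\<rho>. 0 < \<rho> \<and> \<rho> < \<rho>0 \<longrightarrow>
       (\<exists>D\<in>\<D>. closure D \<subseteq> ball x \<rho> \<and> (\<exists>u\<in>circ D. \<exists>v\<in>circ D. \<rho> \<le> C * dist u v) \<and>
         (\<forall>y\<in>S. dist x y < L * \<rho> \<longrightarrow> (\<exists>u\<in>circ (\<sigma> D). \<exists>v\<in>circ (\<sigma> D). dist (f x) (f y) \<le> C * dist u v))))"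
    using err by blast
  \<comment> \<open>The ball at \<open>a\<close> has radius \<delta> and oscillation at most 2, so
    it contributes \<open>8 * \<delta> * 2\<close>, which is half of \<epsilon>.\<close>
  define \<delta> where "\<delta> = \<epsilon> / 32"
  have \<delta>: "\<delta> > 0" using \<epsilon> by (simp add: \<delta>_def)
  \<comment> \<open>Points less than \<open>8 * \<rho>\<close> apart in the picture are less than
    \<open>8 * K * \<rho>\<close> apart on the sphere. At the scale \<open>\<rho> / K\<close>, which
    stays below \<open>\<rho>\<close> in the picture, this is the multiple
    \<open>L = 8 * K\<^sup>2\<close>.\<close>
  have "\<delta> / K > 0" "8 * K\<^sup>2 > 0" using \<delta> K(1) by auto
  note ERR1 = ERR[rule_format, OF this]
  then obtain C where C0: "0 < C \<and> (\<exists>\<rho>0>0. \<forall>x\<in>S. \<delta> / K \<le> dist x a \<longrightarrow> (\<forall>\<rho>. 0 < \<rho> \<and> \<rho> < \<rho>0 \<longrightarrow>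
       (\<exists>D\<in>\<D>. closure D \<subseteq> ball x \<rho> \<and> (\<exists>u\<in>circ D. \<exists>v\<in>circ D. \<rho> \<le> C * dist u v) \<and>
         (\<forall>y\<in>S. dist x y < 8 * K\<^sup>2 * \<rho> \<longrightarrow> (\<exists>u\<in>circ (\<sigma> D). \<exists>v\<in>circ (\<sigma> D). dist (f x) (f y) \<le> C * dist u v)))))"
    by (rule exE)
  from conjunct2[OF C0] obtain \<rho>0 where C1: "0 < \<rho>0 \<and> (\<forall>x\<in>S. \<delta> / K \<le> dist x a \<longrightarrow> (\<forall>\<rho>. 0 < \<rho> \<and> \<rho> < \<rho>0 \<longrightarrow>
       (\<exists>D\<in>\<D>. closure D \<subseteq> ball x \<rho> \<and> (\<exists>u\<in>circ D. \<exists>v\<in>circ D. \<rho> \<le> C * dist u v) \<and>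
         (\<forall>y\<in>S. dist x y < 8 * K\<^sup>2 * \<rho> \<longrightarrow> (\<exists>u\<in>circ (\<sigma> D). \<exists>v\<in>circ (\<sigma> D). dist (f x) (f y) \<le> C * dist u v)))))"
    by (rule exE)
  have C: "C > 0" "\<rho>0 > 0" using C0 C1 by blast+
  note E = conjunct2[OF C1, rule_format, OF _ _ conjI]
  \<comment> \<open>\<open>C1\<close> compares \<open>\<rho>\<close> with the radius of the disk
    found near a centre; \<open>C2 / 2\<close> bounds the deviation from the value at the centre by
    the partner's radius, so \<open>C2\<close> bounds the difference of two values.\<close>
  define C1 where "C1 = 2 * C * K\<^sup>2"
  define C2 where "C2 = 4 * K'\<^sup>2 * C"
  have C12: "C1 > 0" "C2 > 0" using C K K' by (auto simp: C1_def C2_def)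
  \<comment> \<open>Makes the error from the small balls, \<open>32 * C1 * C2 * \<eta>\<close>, the
    other half of \<epsilon>.\<close>
  define \<eta> where "\<eta> = \<epsilon> / (64 * C1 * C2)"
  have \<eta>: "\<eta> > 0" using \<epsilon> C12 by (simp add: \<eta>_def)
  have rad'0: "0 < rad m' (\<sigma> i)" if "i \<in> \<D> - {D0}" for i
    using B.picture_disk(1)[OF P', of "\<sigma> i"] that D0 sigma_D by blast
  \<comment> \<open>Outside \<open>F0\<close> the squared partner radii sum to at most \<eta>^2.
    With \<open>\<rho>\<close> below the radii of the disks in \<open>F0\<close>, the disks found
    near the centres are outside \<open>F0\<close>.\<close>
  obtain F0 where F0: "finite F0" "F0 \<subseteq> \<D> - {D0}" "\<And>F. finite F \<Longrightarrow> F \<subseteq> \<D> - {D0} \<Longrightarrow> F \<inter> F0 = {} \<Longrightarrow> (\<Sum>i\<in>F. (rad m' (\<sigma> i))\<^sup>2) \<le> \<eta>\<^sup>2"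
    by (rule bounded_sums_tail[of "\<D> - {D0}" "\<lambda>i. (rad m' (\<sigma> i))\<^sup>2" "\<eta>\<^sup>2"]) (use rad'_sum[OF P' D0] \<eta> in auto)
  obtain \<rho>1 where \<rho>1: "\<rho>1 > 0" "\<And>i. i \<in> F0 \<Longrightarrow> \<rho>1 \<le> rad m i"
  proof (cases "F0 = {}")
    case False
    have "Min (rad m ` F0) > 0" using F0 False dp.rpos by (subst Min_gr_iff) auto
    then show ?thesis using that[of "Min (rad m ` F0)"] F0(1) by simp
  qed (use that[of 1] in auto)
  \<comment> \<open>The four bounds allow porosity at scale \<open>\<rho> / K\<close>, avoid
    \<open>F0\<close>, exclude the outer disk, and satisfy \<open>2 * \<rho> \<le> s j\<close> for
    the ball at \<open>a\<close>.\<close>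
  define \<rho> where "\<rho> = Min {\<rho>0 * K / 2, \<rho>1 / 2, 1 / 2, \<delta> / 2}"
  have \<rho>: "\<rho> > 0" "\<rho> < \<rho>0 * K" "\<rho> < \<rho>1" "\<rho> < 1" "2 * \<rho> \<le> \<delta>"
  proof -
    have "\<rho>0 * K > 0" using C K by simp
    then show "\<rho> > 0" using \<rho>1(1) \<delta> by (simp add: \<rho>_def)
    have "\<rho> \<le> \<rho>0 * K / 2" "\<rho> \<le> \<rho>1 / 2" "\<rho> \<le> 1 / 2" "\<rho> \<le> \<delta> / 2" by (auto simp: \<rho>_def)
    then show "\<rho> < \<rho>0 * K" "\<rho> < \<rho>1" "\<rho> < 1" "2 * \<rho> \<le> \<delta>" using \<open>\<rho>0 * K > 0\<close> \<rho>1(1) by auto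
  qed
  define I0 where "I0 = {D \<in> \<D> - {D0}. \<rho> < rad m D}"
  have I0: "finite I0" "I0 \<subseteq> \<D> - {D0}" "\<And>i. i \<in> \<D> - {D0} \<Longrightarrow> i \<notin> I0 \<Longrightarrow> rad m i \<le> \<rho>"
    using A.picture_finite_big[OF P \<rho>(1)] by (auto simp: I0_def)
  define X where "X = m ` S"
  have cX: "compact X" unfolding X_def by (rule dp.closed_X(2))
  have "compact (X - ball (m a) \<delta>)" using cX by (rule compact_diff) simp
  moreover have "X - ball (m a) \<delta> \<subseteq> (\<Union>z\<in>X - ball (m a) \<delta>. ball z (2 * \<rho>))" using \<rho>(1) by auto
  ultimately obtain F1 where F1: "finite F1" "F1 \<subseteq> X - ball (m a) \<delta>" "X - ball (m a) \<delta> \<subseteq> (\<Union>z\<in>F1. ball z (2 * \<rho>))"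
    using compactE_image[of "X - ball (m a) \<delta>" "X - ball (m a) \<delta>" "\<lambda>z. ball z (2 * \<rho>)"] by (metis open_ball)
  \<comment> \<open>Separation by \<open>2 * \<rho>\<close> makes different centres receive
    different disks, since the circle of each lies within \<open>\<rho>\<close> of its centre; the
    covering radius grows to \<open>4 * \<rho>\<close>.\<close>
  obtain N where N: "N \<subseteq> F1" "\<And>x y. x \<in> N \<Longrightarrow> y \<in> N \<Longrightarrow> x \<noteq> y \<Longrightarrow> 2 * \<rho> \<le> dist x y" "F1 \<subseteq> (\<Union>x\<in>N. ball x (2 * \<rho>))"
    using separated_net[OF F1(1), of "2 * \<rho>"] \<rho>(1) by auto
  have finN: "finite N" using N(1) F1(1) finite_subset by blast
  have NX: "z \<in> X" "\<delta> \<le> dist (m a) z" if "z \<in> N" for z using that N(1) F1(2) by (auto simp: not_less)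
  have cover: "X \<subseteq> ball (m a) \<delta> \<union> (\<Union>z\<in>N. ball z (4 * \<rho>))"
  proof
    fix z assume z: "z \<in> X"
    show "z \<in> ball (m a) \<delta> \<union> (\<Union>z\<in>N. ball z (4 * \<rho>))"
    proof (cases "z \<in> ball (m a) \<delta>")
      case False
      then obtain y where y: "y \<in> F1" "dist y z < 2 * \<rho>" using F1(3) z by (auto simp: subset_iff)
      then obtain x where x: "x \<in> N" "dist x y < 2 * \<rho>" using N(3) by auto
      then have "dist x z < 4 * \<rho>" using dist_triangle[of x z y] y by linarith
      then show ?thesis using x by auto
    qed auto
  qed
  have "\<exists>D. D \<in> \<D> - {D0} \<and> rad m D \<le> \<rho> \<and> \<rho> \<le> C1 * rad m D \<and> (\<forall>u\<in>circ D. dist (m u) z < \<rho>) \<and>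
      (\<forall>v\<in>X. dist z v < 8 * \<rho> \<longrightarrow> cmod (pull m m' v - pull m m' z) \<le> C2 / 2 * rad m' (\<sigma> D))" if z: "z \<in> N" for z
  proof -
    obtain x where x: "x \<in> S" "z = m x" using NX(1)[OF z] unfolding X_def by blast
    have "\<delta> \<le> K * dist x a" using NX(2)[OF z] K(2)[OF a x(1)] x(2) by (simp add: dist_commute)
    then have 1: "\<delta> / K \<le> dist x a" using K(1) by (simp add: divide_le_eq mult.commute)
    have 2: "0 < \<rho> / K" "\<rho> / K < \<rho>0" using \<rho> K(1) by (auto simp: divide_less_eq)
    obtain D u v where D: "D \<in> \<D>" "closure D \<subseteq> ball x (\<rho> / K)" and uv: "u \<in> circ D" "v \<in> circ D" "\<rho> / K \<le> C * dist u v" and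
      F: "\<And>y. y \<in> S \<Longrightarrow> dist x y < 8 * K\<^sup>2 * (\<rho> / K) \<Longrightarrow> (\<exists>u\<in>circ (\<sigma> D). \<exists>v\<in>circ (\<sigma> D). dist (f x) (f y) \<le> C * dist u v)"
      using E[OF x(1) 1 2] by blast
    have near: "dist (m w) z < \<rho>" if w: "w \<in> circ D" for w
    proof -
      have "w \<in> closure D" using w by (simp add: circ_def)
      then have "dist x w < \<rho> / K" using D(2) by auto
      then have "K * dist w x < \<rho>" using K(1) by (simp add: less_divide_eq dist_commute mult.commute)
      moreover have "dist (m w) (m x) \<le> K * dist w x" using K(2) x(1) w A.circ_S[OF D(1)] by blast
      ultimately show ?thesis using x(2) by simp
    qed
    \<comment> \<open>The outer circle contains 1 and -1, which cannot both lie within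
      \<open>\<rho> < 1\<close> of one point.\<close>
    have DD: "D \<noteq> D0"
    proof
      assume "D = D0"
      then have "1 \<in> m ` circ D" "-1 \<in> m ` circ D" using pictureD(5)[OF P] by auto
      then have "dist 1 z < \<rho>" "dist (-1) z < \<rho>" using near by (metis imageE)+
      then have "dist (1::complex) (-1) < 2" using dist_triangle2[of 1 "-1" z] \<rho>(4) by linarith
      then show False by (simp add: dist_norm)
    qed
    have rr: "rad m D > 0" "m ` circ D = sphere (cen m D) (rad m D)" using A.picture_disk[OF P D(1) DD] by auto
    have "cen m D + of_real (rad m D) \<in> m ` circ D" "cen m D - of_real (rad m D) \<in> m ` circ D"
      unfolding rr(2) using rr(1) by (auto simp: dist_norm)
    then have "dist (cen m D + of_real (rad m D)) z < \<rho>" "dist (cen m D - of_real (rad m D)) z < \<rho>" using near by auto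
    moreover have "dist (cen m D + of_real (rad m D)) (cen m D - of_real (rad m D)) = 2 * rad m D"
    proof -
      have "cen m D + of_real (rad m D) - (cen m D - of_real (rad m D)) = of_real (2 * rad m D)" by simp
      then show ?thesis unfolding dist_norm using rr(1) by (metis abs_of_pos norm_of_real zero_less_mult_iff zero_less_numeral)
    qed
    ultimately have r1: "rad m D \<le> \<rho>"
      using dist_triangle2[of "cen m D + of_real (rad m D)" "cen m D - of_real (rad m D)" z] by linarith
    have uS: "u \<in> S" "v \<in> S" using uv A.circ_S[OF D(1)] by blast+
    have "\<rho> / K \<le> C * (K * (2 * rad m D))"
      using uv(3) K(3)[OF uS] A.picture_rad_ge[OF P D(1) DD uv(1,2)] C(1) K(1)
      by (meson mult_left_mono less_imp_le order_trans)
    then have r2: "\<rho> \<le> C1 * rad m D" using K(1) by (simp add: C1_def divide_le_eq power2_eq_square mult_ac)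
    have "cmod (pull m m' v - pull m m' z) \<le> C2 / 2 * rad m' (\<sigma> D)" if v: "v \<in> X" "dist z v < 8 * \<rho>" for v
    proof -
      obtain y where y: "y \<in> S" "v = m y" using v(1) unfolding X_def by blast
      have "dist x y \<le> K * dist z v" using K(3)[OF x(1) y(1)] x(2) y(2) by simp
      also have "\<dots> < K * (8 * \<rho>)" using v(2) K(1) by simp
      also have "\<dots> = 8 * K\<^sup>2 * (\<rho> / K)" using K(1) by (simp add: power2_eq_square)
      finally obtain s t where st: "s \<in> circ (\<sigma> D)" "t \<in> circ (\<sigma> D)" "dist (f x) (f y) \<le> C * dist s t" using F[OF y(1)] by blast
      have stS: "s \<in> S'" "t \<in> S'" using st B.circ_S[OF sigma_D(1)[OF D(1)]] by blast+
      have sd: "\<sigma> D \<noteq> \<sigma> D0" using sigma_D(2)[OF D(1) D0] DD by blast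
      have "cmod (pull m m' v - pull m m' z) = dist (m' (f x)) (m' (f y))"
        unfolding x(2) y(2) pull_eq[OF P x(1)] pull_eq[OF P y(1)] by (simp add: dist_norm norm_minus_commute)
      also have "\<dots> \<le> K' * dist (f x) (f y)" using K'(2) f_S x(1) y(1) by blast
      also have "\<dots> \<le> K' * (C * (K' * (2 * rad m' (\<sigma> D))))"
        using st(3) K'(3)[OF stS] B.picture_rad_ge[OF P' sigma_D(1)[OF D(1)] sd st(1,2)] C(1) K'(1)
        by (meson mult_left_mono less_imp_le order_trans)
      also have "\<dots> = C2 / 2 * rad m' (\<sigma> D)" by (simp add: C2_def power2_eq_square)
      finally show ?thesis .
    qed
    then show ?thesis using D(1) DD r1 r2 near by blast
  qed
  then have "\<forall>z\<in>N. \<exists>D. D \<in> \<D> - {D0} \<and> rad m D \<le> \<rho> \<and> \<rho> \<le> C1 * rad m D \<and> (\<forall>u\<in>circ D. dist (m u) z < \<rho>) \<and>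
      (\<forall>v\<in>X. dist z v < 8 * \<rho> \<longrightarrow> cmod (pull m m' v - pull m m' z) \<le> C2 / 2 * rad m' (\<sigma> D))" by (rule ballI)
  from bchoice[OF this] obtain Df where Df0: "\<forall>z\<in>N. Df z \<in> \<D> - {D0} \<and> rad m (Df z) \<le> \<rho> \<and> \<rho> \<le> C1 * rad m (Df z) \<and> (\<forall>u\<in>circ (Df z). dist (m u) z < \<rho>) \<and>
      (\<forall>v\<in>X. dist z v < 8 * \<rho> \<longrightarrow> cmod (pull m m' v - pull m m' z) \<le> C2 / 2 * rad m' (\<sigma> (Df z)))" by (rule exE)
  have Df: "\<And>z. z \<in> N \<Longrightarrow> Df z \<in> \<D> - {D0}" "\<And>z. z \<in> N \<Longrightarrow> rad m (Df z) \<le> \<rho>" "\<And>z. z \<in> N \<Longrightarrow> \<rho> \<le> C1 * rad m (Df z)"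
     "\<And>z u. z \<in> N \<Longrightarrow> u \<in> circ (Df z) \<Longrightarrow> dist (m u) z < \<rho>"
     "\<And>z v. z \<in> N \<Longrightarrow> v \<in> X \<Longrightarrow> dist z v < 8 * \<rho> \<Longrightarrow> cmod (pull m m' v - pull m m' z) \<le> C2 / 2 * rad m' (\<sigma> (Df z))"
    using Df0 by (simp_all only: Ball_def)
  have injD: "inj_on Df N"
  proof (rule inj_onI, rule ccontr)
    fix y z assume yz: "y \<in> N" "z \<in> N" "Df y = Df z" "y \<noteq> z"
    obtain u where u: "u \<in> circ (Df y)" using A.circ_two[of "Df y"] Df(1)[OF yz(1)] by blast
    have "dist (m u) y < \<rho>" "dist (m u) z < \<rho>" using Df(4)[OF yz(1)] Df(4)[OF yz(2)] u yz(3) by auto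
    then have "dist y z < 2 * \<rho>" using dist_triangle3[of y z "m u"] by linarith
    then show False using N(2)[OF yz(1,2,4)] by linarith
  qed
  define J where "J = insert (m a) N"
  define s where "s z = (if z = m a then \<delta> else 4 * \<rho>)" for z
  define d where "d z = (if z = m a then 2 else C2 * rad m' (\<sigma> (Df z)))" for z
  have maN: "m a \<notin> N" using NX(2) \<delta> by force
  \<comment> \<open>On the circle of \<open>i\<close> and on that of its partner the children are
    affine copies of the parents, so there the map is a rescaled copy of the map between the
    children.\<close>
  have psi: "pull m m' (cen m i + rad m i *\<^sub>R u) = cen m' (\<sigma> i) + rad m' (\<sigma> i) *\<^sub>R pull (child m p i) (child m' p' (\<sigma> i)) u"
    if i: "i \<in> I0" and u: "u \<in> sphere 0 1" for i u
  proof -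
    have iD: "i \<in> \<D>" "i \<noteq> D0" using i I0(2) by auto
    have sD: "\<sigma> i \<in> \<D>'" "\<sigma> i \<noteq> \<sigma> D0" using iD sigma_D D0 by blast+
    obtain q kq where Pc: "picture \<D> (child m p i) q kq i" using A.child_picture(1)[OF P iD] by blast
    have rr: "rad m i > 0" "m ` circ i = sphere (cen m i) (rad m i)" using A.picture_disk[OF P iD] by auto
    have rr': "rad m' (\<sigma> i) > 0" using B.picture_disk[OF P' sD] by auto
    have "cen m i + rad m i *\<^sub>R u \<in> m ` circ i" unfolding rr(2) using u rr(1) by (simp add: dist_norm)
    then obtain x where x: "x \<in> circ i" "m x = cen m i + rad m i *\<^sub>R u" by (metis imageE)
    have xS: "x \<in> S" using x A.circ_S[OF iD(1)] by blast
    have "child m p i x = u" using A.child_picture(2)[OF P iD x(1)] x(2) rr(1) by (simp add: scaleR_conv_of_real)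
    then have "pull (child m p i) (child m' p' (\<sigma> i)) u = child m' p' (\<sigma> i) (f x)" using pull_eq[OF Pc xS] by metis
    also have "\<dots> = (m' (f x) - cen m' (\<sigma> i)) / of_real (rad m' (\<sigma> i))"
      using B.child_picture(2)[OF P' sD] f_circ[OF iD(1)] x(1) by blast
    finally have "rad m' (\<sigma> i) *\<^sub>R pull (child m p i) (child m' p' (\<sigma> i)) u = m' (f x) - cen m' (\<sigma> i)"
      using rr' by (simp add: scaleR_conv_of_real)
    then show ?thesis using pull_eq[OF P xS, of m'] x(2) by simp
  qed
  have pc: "continuous_on (sphere 0 1) (pull (child m p i) (child m' p' (\<sigma> i)))" if i: "i \<in> I0" for i
  proof -
    have iD: "i \<in> \<D>" "i \<noteq> D0" using i I0(2) by auto
    have sD: "\<sigma> i \<in> \<D>'" "\<sigma> i \<noteq> \<sigma> D0" using iD sigma_D D0 by blast+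
    show ?thesis using A.child_picture(1)[OF P iD] B.child_picture(1)[OF P' sD] pull_cont_sphere by blast
  qed
  have "width (pull m m') \<le> (\<Sum>i\<in>I0. rad m i * rad m' (\<sigma> i) * width (pull (child m p i) (child m' p' (\<sigma> i)))) + (\<Sum>j\<in>J. 8 * s j * d j)"
  proof (rule dp.width_bound[where c'="\<lambda>i. cen m' (\<sigma> i)" and x="\<lambda>z. z" and \<rho>=\<rho>])
    show "continuous_on (m ` S) (pull m m')" by (rule pull_cont[OF P P'])
    show "finite I0" "I0 \<subseteq> \<D> - {D0}" "finite J" using I0 finN by (auto simp: J_def)
    show "rad m i \<le> \<rho>" if "i \<in> \<D> - {D0}" "i \<notin> I0" for i using I0(3) that .
    show "m ` S \<subseteq> (\<Union>j\<in>J. ball j (s j))"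
    proof
      fix z assume "z \<in> m ` S"
      then have "z \<in> ball (m a) \<delta> \<union> (\<Union>z\<in>N. ball z (4 * \<rho>))" using cover X_def by blast
      then show "z \<in> (\<Union>j\<in>J. ball j (s j))"
      proof
        assume "z \<in> ball (m a) \<delta>"
        then show ?thesis by (intro UN_I[of "m a"]) (auto simp: J_def s_def)
      next
        assume "z \<in> (\<Union>z\<in>N. ball z (4 * \<rho>))"
        then obtain y where y: "y \<in> N" "z \<in> ball y (4 * \<rho>)" by blast
        then show ?thesis using maN by (intro UN_I[of y]) (auto simp: J_def s_def)
      qed
    qed
    show "2 * \<rho> \<le> s j" "0 \<le> s j" if "j \<in> J" for j using \<rho>(1,5) \<delta> by (auto simp: s_def)
    show "0 \<le> d j" if "j \<in> J" for j using that rad'0[OF Df(1)] C12 by (auto simp: d_def J_def less_imp_le)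
    show "cmod (pull m m' u - pull m m' v) \<le> d j"
      if j: "j \<in> J" and uv: "u \<in> m ` S" "v \<in> m ` S" "u \<in> ball j (2 * s j)" "v \<in> ball j (2 * s j)" for j u v
    proof (cases "j = m a")
      case True
      have "cmod (pull m m' u - pull m m' v) \<le> cmod (pull m m' u) + cmod (pull m m' v)" by (rule norm_triangle_ineq4)
      also have "\<dots> \<le> 2" using pull_bound[OF P P' uv(1)] pull_bound[OF P P' uv(2)] by linarith
      finally show ?thesis using True by (simp add: d_def)
    next
      case False
      then have jN: "j \<in> N" using j by (simp add: J_def)
      have "dist j u < 8 * \<rho>" "dist j v < 8 * \<rho>" using uv(3,4) False by (auto simp: s_def)
      then have "cmod (pull m m' u - pull m m' j) \<le> C2 / 2 * rad m' (\<sigma> (Df j))" "cmod (pull m m' v - pull m m' j) \<le> C2 / 2 * rad m' (\<sigma> (Df j))"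
        using Df(5)[OF jN] uv(1,2) X_def by auto
      then have "cmod (pull m m' u - pull m m' j) + cmod (pull m m' v - pull m m' j) \<le> C2 * rad m' (\<sigma> (Df j))" by simp
      moreover have "cmod (pull m m' u - pull m m' v) \<le> cmod (pull m m' u - pull m m' j) + cmod (pull m m' v - pull m m' j)"
        by (metis dist_norm dist_triangle2)
      ultimately show ?thesis using False by (simp add: d_def)
    qed
    show "pull m m' (cen m i + rad m i *\<^sub>R u) = cen m' (\<sigma> i) + rad m' (\<sigma> i) *\<^sub>R pull (child m p i) (child m' p' (\<sigma> i)) u"
      if "i \<in> I0" "u \<in> sphere 0 1" for i u using psi that .
    show "0 \<le> rad m' (\<sigma> i)" if "i \<in> I0" for i using less_imp_le[OF rad'0[OF subsetD[OF I0(2) that]]] .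
    show "continuous_on (sphere 0 1) (pull (child m p i) (child m' p' (\<sigma> i)))" if "i \<in> I0" for i using pc that .
  qed
  moreover have "(\<Sum>j\<in>J. 8 * s j * d j) \<le> \<epsilon>"
  proof -
    have "(\<Sum>j\<in>J. 8 * s j * d j) = 16 * \<delta> + (\<Sum>j\<in>N. 8 * s j * d j)"
      unfolding J_def using finN maN by (simp add: s_def d_def)
    also have "(\<Sum>j\<in>N. 8 * s j * d j) \<le> (\<Sum>j\<in>N. 32 * C1 * C2 * (rad m (Df j) * rad m' (\<sigma> (Df j))))"
    proof (rule sum_mono)
      fix j assume j: "j \<in> N"
      then have "j \<noteq> m a" using maN by blast
      then have "8 * s j * d j = 32 * C2 * rad m' (\<sigma> (Df j)) * \<rho>" by (simp add: s_def d_def)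
      also have "\<dots> \<le> 32 * C2 * rad m' (\<sigma> (Df j)) * (C1 * rad m (Df j))"
        using Df(3)[OF j] rad'0[OF Df(1)[OF j]] C12 by (intro mult_left_mono) auto
      finally show "8 * s j * d j \<le> 32 * C1 * C2 * (rad m (Df j) * rad m' (\<sigma> (Df j)))" by (simp add: mult_ac)
    qed
    also have "\<dots> = 32 * C1 * C2 * (\<Sum>i\<in>Df ` N. rad m i * rad m' (\<sigma> i))"
      by (simp add: sum.reindex[OF injD] sum_distrib_left)
    also have "(\<Sum>i\<in>Df ` N. rad m i * rad m' (\<sigma> i)) \<le> \<eta>"
    proof -
      have sub: "Df ` N \<subseteq> \<D> - {D0}" "finite (Df ` N)" using Df(1) finN by auto
      have dis: "Df ` N \<inter> F0 = {}"
      proof (rule ccontr)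
        assume "Df ` N \<inter> F0 \<noteq> {}"
        then obtain z where "z \<in> N" "Df z \<in> F0" by blast
        then show False using Df(2)[of z] \<rho>1(2)[of "Df z"] \<rho>(3) by linarith
      qed
      \<comment> \<open>Division by \<eta> turns the tail bound into a bound by 1, as Cauchy-Schwarz
        was stated.\<close>
      have "(\<Sum>i\<in>Df ` N. rad m i * (rad m' (\<sigma> i) / \<eta>)) \<le> 1"
      proof (rule sum_product_le_one)
        show "(\<Sum>i\<in>Df ` N. (rad m i)\<^sup>2) \<le> 1" by (rule dp.area_bound[OF sub(2,1)])
        have "(\<Sum>i\<in>Df ` N. (rad m' (\<sigma> i) / \<eta>)\<^sup>2) = (\<Sum>i\<in>Df ` N. (rad m' (\<sigma> i))\<^sup>2) / \<eta>\<^sup>2"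
          by (simp add: power_divide sum_divide_distrib)
        also have "\<dots> \<le> \<eta>\<^sup>2 / \<eta>\<^sup>2" using F0(3)[OF sub(2,1) dis] by (intro divide_right_mono) auto
        finally show "(\<Sum>i\<in>Df ` N. (rad m' (\<sigma> i) / \<eta>)\<^sup>2) \<le> 1" using \<eta> by simp
      qed
      then have "(\<Sum>i\<in>Df ` N. rad m i * rad m' (\<sigma> i)) / \<eta> \<le> 1" by (simp add: sum_divide_distrib)
      then show ?thesis using \<eta> by (simp add: divide_le_eq)
    qed
    finally have "(\<Sum>j\<in>J. 8 * s j * d j) \<le> 16 * \<delta> + 32 * C1 * C2 * \<eta>" using C12 by (simp add: mult_left_mono)
    also have "\<dots> = \<epsilon>" using C12 by (simp add: \<delta>_def \<eta>_def field_simps)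
    finally show ?thesis .
  qed
  ultimately have "width (pull m m') \<le> (\<Sum>i\<in>I0. rad m i * rad m' (\<sigma> i) * width (pull (child m p i) (child m' p' (\<sigma> i)))) + \<epsilon>" by linarith
  then show ?thesis using I0(1,2) by blast
qed

end

context schottky begin

lemma rad2_pos:
  assumes P: "picture \<D> m p k D0" and i: "i \<in> \<D>" "i \<noteq> D0" and j: "j \<in> \<D>" "j \<noteq> i"
  shows "rad2 m D0 i j > 0"
proof -
  obtain q k' where Q: "picture \<D> (child m p i) q k' i" using child_picture(1)[OF P i] by blast
  show ?thesis using picture_disk(1)[OF Q j] child_picture(3)[OF P i j] by simp
qed

lemma rad_sum:
  assumes P: "picture \<D> m p k D0" and F: "finite F" "F \<subseteq> \<D> - {D0}"
  shows "(\<Sum>i\<in>F. (rad m i)\<^sup>2) \<le> 1"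
proof -
  interpret dp: disk_packing "\<D> - {D0}" "cen m" "rad m" "m ` S" by (rule picture_packing[OF P])
  show ?thesis using dp.area_bound[OF F] .
qed

text \<open>Each child is itself a picture, so the inner sum over the second generation is at most
  1; the outer sum is the area bound of the parent.\<close>

lemma rad2_sum:
  assumes P: "picture \<D> m p k D0" and F: "finite F" "F \<subseteq> (SIGMA i:\<D> - {D0}. \<D> - {i})"
  shows "(\<Sum>(i, j)\<in>F. (rad m i * rad2 m D0 i j)\<^sup>2) \<le> 1"
proof -
  define A where "A = fst ` F"
  define Fi where "Fi i = {j. (i, j) \<in> F}" for i
  have FS: "F = Sigma A Fi" unfolding A_def Fi_def by force
  have finA: "finite A" "A \<subseteq> \<D> - {D0}" using F unfolding A_def by auto
  have finF: "finite (Fi i)" for i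
    unfolding Fi_def using finite_subset[of "{j. (i, j) \<in> F}" "snd ` F"] F(1) by force
  have "(\<Sum>(i, j)\<in>F. (rad m i * rad2 m D0 i j)\<^sup>2) = (\<Sum>i\<in>A. \<Sum>j\<in>Fi i. (rad m i * rad2 m D0 i j)\<^sup>2)"
    unfolding FS by (rule sum.Sigma[symmetric]) (use finA finF in auto)
  also have "\<dots> \<le> (\<Sum>i\<in>A. (rad m i)\<^sup>2)"
  proof (rule sum_mono)
    fix i assume "i \<in> A"
    then have i: "i \<in> \<D>" "i \<noteq> D0" using finA by auto
    obtain q k' where Q: "picture \<D> (child m p i) q k' i" using child_picture(1)[OF P i] by blast
    have sub: "Fi i \<subseteq> \<D> - {i}" using F(2) unfolding Fi_def by auto
    have "(\<Sum>j\<in>Fi i. (rad m i * rad2 m D0 i j)\<^sup>2) = (rad m i)\<^sup>2 * (\<Sum>j\<in>Fi i. (rad (child m p i) j)\<^sup>2)"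
      unfolding sum_distrib_left
    proof (rule sum.cong)
      fix j assume "j \<in> Fi i"
      then have "j \<in> \<D>" "j \<noteq> i" using sub by blast+
      then show "(rad m i * rad2 m D0 i j)\<^sup>2 = (rad m i)\<^sup>2 * (rad (child m p i) j)\<^sup>2"
        using child_picture(3)[OF P i] by (simp add: power_mult_distrib)
    qed simp
    also have "\<dots> \<le> (rad m i)\<^sup>2 * 1" using rad_sum[OF Q finF sub] by (intro mult_left_mono) auto
    finally show "(\<Sum>j\<in>Fi i. (rad m i * rad2 m D0 i j)\<^sup>2) \<le> (rad m i)\<^sup>2" by simp
  qed
  also have "\<dots> \<le> 1" by (rule rad_sum[OF P finA])
  finally show ?thesis .
qed

end

context schottky_pair begin

lemma rad2'_sum:
  assumes P': "picture \<D>' m' p' k' (\<sigma> D0)" and D0: "D0 \<in> \<D>" and F: "finite F" "F \<subseteq> (SIGMA i:\<D> - {D0}. \<D> - {i})"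
  shows "(\<Sum>(i, j)\<in>F. (rad m' (\<sigma> i) * rad2 m' (\<sigma> D0) (\<sigma> i) (\<sigma> j))\<^sup>2) \<le> 1"
proof -
  have inj: "inj_on (map_prod \<sigma> \<sigma>) F"
  proof (rule inj_onI)
    fix x y assume xy: "x \<in> F" "y \<in> F" "map_prod \<sigma> \<sigma> x = map_prod \<sigma> \<sigma> y"
    obtain a b c d where e: "x = (a, b)" "y = (c, d)" by (metis prod.exhaust)
    have "a \<in> \<D>" "b \<in> \<D>" "c \<in> \<D>" "d \<in> \<D>" using xy F(2) e by auto
    then show "x = y" using xy(3) e sigma_D(2) by auto
  qed
  have "(\<Sum>(i, j)\<in>F. (rad m' (\<sigma> i) * rad2 m' (\<sigma> D0) (\<sigma> i) (\<sigma> j))\<^sup>2)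
     = (\<Sum>(i, j)\<in>map_prod \<sigma> \<sigma> ` F. (rad m' i * rad2 m' (\<sigma> D0) i j)\<^sup>2)"
    by (subst sum.reindex[OF inj]) (auto intro!: sum.cong)
  also have "\<dots> \<le> 1"
  proof (rule B.rad2_sum[OF P'])
    show "finite (map_prod \<sigma> \<sigma> ` F)" using F by simp
    show "map_prod \<sigma> \<sigma> ` F \<subseteq> (SIGMA i:\<D>' - {\<sigma> D0}. \<D>' - {i})"
    proof
      fix x assume "x \<in> map_prod \<sigma> \<sigma> ` F"
      then obtain i j where ij: "(i, j) \<in> F" "x = (\<sigma> i, \<sigma> j)" by auto
      then have "i \<in> \<D>" "i \<noteq> D0" "j \<in> \<D>" "j \<noteq> i" using F(2) by auto
      then show "x \<in> (SIGMA i:\<D>' - {\<sigma> D0}. \<D>' - {i})" using ij(2) sigma_D D0 by blast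
    qed
  qed
  finally show ?thesis .
qed

text \<open>The integrand is at most 2 on an interval of length 2. Positivity comes from the
  vertical diameter, whose ends have distinct images, and from continuity; it is needed because the
  supremum of the widths is divided out.\<close>

lemma width_pos:
  assumes P: "picture \<D> m p k D0" and P': "picture \<D>' m' p' k' (\<sigma> D0)"
  shows "0 < width (pull m m')" "width (pull m m') \<le> 4"
proof -
  let ?g = "\<lambda>t. cmod (pull m m' (top_pt t) - pull m m' (bot_pt t))"
  have c: "continuous_on {-1..1} ?g" by (rule width_integrand_continuous[OF pull_cont_sphere[OF P P']])
  have int: "?g integrable_on {-1..1}" using integrable_continuous_interval[OF c] .
  have "?g t \<le> 2" if "t \<in> {-1..1}" for t
  proof -
    have "top_pt t \<in> m ` S" "bot_pt t \<in> m ` S" using top_bot_sphere[OF that] sphere_img[OF P] by blast+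
    then show ?thesis using pull_bound[OF P P'] norm_triangle_ineq4[of "pull m m' (top_pt t)" "pull m m' (bot_pt t)"]
      by (smt (verit))
  qed
  then have "integral {-1..1} ?g \<le> integral {-1..1::real} (\<lambda>t. 2::real)" using int by (intro integral_le) auto
  then show "width (pull m m') \<le> 4" by (simp add: width_def)
  have "0 \<le> integral {-1..1} ?g" by (intro integral_nonneg int) auto
  moreover have "integral {-1..1} ?g \<noteq> 0"
  proof
    assume "integral {-1..1} ?g = 0"
    then have "integral (cbox (-1) 1) ?g = 0" by simp
    then have z: "\<forall>t\<in>cbox (-1) 1. ?g t = 0"
      using integral_cbox_eq_0_iff[of "-1" 1 ?g] c by auto
    then have "?g 0 = 0" by auto
    then have e: "pull m m' \<i> = pull m m' (- \<i>)" by (simp add: top_pt_def bot_pt_def Complex_eq)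
    have "\<i> \<in> m ` S" "- \<i> \<in> m ` S" using sphere_img[OF P] by auto
    then obtain x y where xy: "x \<in> S" "y \<in> S" "m x = \<i>" "m y = - \<i>" by (metis imageE)
    have "m' (f x) = m' (f y)" using e pull_eq[OF P xy(1), of m'] pull_eq[OF P xy(2), of m'] xy by simp
    then have "f x = f y" using B.picture_inj_S[OF P'] f_S xy by (auto dest: inj_onD)
    then have "x = y" using f_bij xy by (auto simp: bij_betw_def dest: inj_onD)
    then show False using xy by (simp add: complex_eq_iff)
  qed
  ultimately show "0 < width (pull m m')" by (simp add: width_def)
qed

text \<open>Cauchy-Schwarz is applied to \<open>width_step\<close> iterated twice, at a pair whose width is close to
  the supremum.\<close>
lemma near_extremal:
  assumes eps: "\<epsilon> > 0"
  shows "\<exists>m p k D0 m' p' k'. picture \<D> m p k D0 \<and> picture \<D>' m' p' k' (\<sigma> D0) \<and>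
    (\<forall>i\<in>\<D> - {D0}. \<bar>rad m i - rad m' (\<sigma> i)\<bar> \<le> \<epsilon>) \<and>
    (\<forall>i\<in>\<D> - {D0}. \<forall>j\<in>\<D> - {i}. \<bar>rad m i * rad2 m D0 i j - rad m' (\<sigma> i) * rad2 m' (\<sigma> D0) (\<sigma> i) (\<sigma> j)\<bar> \<le> \<epsilon>)"
proof -
  define Vs where "Vs = {width (pull m m') | m p k D0 m' p' k'. picture \<D> m p k D0 \<and> picture \<D>' m' p' k' (\<sigma> D0)}"
  have VsI: "width (pull m m') \<in> Vs" if "picture \<D> m p k D0" "picture \<D>' m' p' k' (\<sigma> D0)" for m p k D0 m' p' k'
    unfolding Vs_def using that by blast
  obtain D1 D2 where D1: "D1 \<in> \<D>" by (rule A.two_disks)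
  obtain m0 p0 k0 where P0: "picture \<D> m0 p0 k0 D1" by (rule A.picture_exists[OF D1])
  obtain m1 p1 k1 where P1: "picture \<D>' m1 p1 k1 (\<sigma> D1)" by (rule B.picture_exists[OF sigma_D(1)[OF D1]])
  have bdd: "bdd_above Vs" unfolding bdd_above_def Vs_def using width_pos(2) by (intro exI[of _ 4]) blast
  define V where "V = Sup Vs"
  have Vle: "width (pull m m') \<le> V" if "picture \<D> m p k D0" "picture \<D>' m' p' k' (\<sigma> D0)" for m p k D0 m' p' k'
    unfolding V_def by (rule cSup_upper[OF VsI[OF that] bdd])
  have V: "V > 0" using width_pos(1)[OF P0 P1] Vle[OF P0 P1] by linarith
  \<comment> \<open>One generation loses \<open>2 * e\<close> and two lose \<open>3 * e\<close>, so
    the sums of products are at least 1 - \<epsilon>^2 / 4 and 1 - 3 \<epsilon>^2 / 8;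
    \<open>sum_product_close\<close> then gives squared differences of at most \<epsilon>^2.\<close>
  define e where "e = V * \<epsilon>\<^sup>2 / 8"
  have e: "e > 0" using V eps by (simp add: e_def)
  have "V - e < Sup Vs" using e by (simp add: V_def)
  then obtain v where "v \<in> Vs" "V - e < v" using less_cSup_iff[OF _ bdd] VsI[OF P0 P1] by blast
  then obtain m p k D0 m' p' k' where P: "picture \<D> m p k D0" and P': "picture \<D>' m' p' k' (\<sigma> D0)" and big: "V - e < width (pull m m')"
    unfolding Vs_def by blast
  have D0: "D0 \<in> \<D>" using pictureD(2)[OF P] .
  obtain I0 where I0: "finite I0" "I0 \<subseteq> \<D> - {D0}"
    "width (pull m m') \<le> (\<Sum>i\<in>I0. rad m i * rad m' (\<sigma> i) * width (pull (child m p i) (child m' p' (\<sigma> i)))) + e"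
    using width_step[OF P P' e] by blast
  have rp: "rad m i > 0" "rad m' (\<sigma> i) > 0" if "i \<in> \<D> - {D0}" for i
    using A.picture_disk(1)[OF P, of i] B.picture_disk(1)[OF P', of "\<sigma> i"] that D0 sigma_D by blast+
  have ch: "\<exists>q kk q' kk'. picture \<D> (child m p i) q kk i \<and> picture \<D>' (child m' p' (\<sigma> i)) q' kk' (\<sigma> i)" if "i \<in> \<D> - {D0}" for i
  proof -
    have "i \<in> \<D>" "i \<noteq> D0" "\<sigma> i \<in> \<D>'" "\<sigma> i \<noteq> \<sigma> D0" using that D0 sigma_D by blast+
    then show ?thesis using A.child_picture(1)[OF P] B.child_picture(1)[OF P'] by blast
  qed
  have c2: "rad (child m p i) j = rad2 m D0 i j" "rad (child m' p' (\<sigma> i)) (\<sigma> j) = rad2 m' (\<sigma> D0) (\<sigma> i) (\<sigma> j)"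
     "rad2 m D0 i j > 0" "rad2 m' (\<sigma> D0) (\<sigma> i) (\<sigma> j) > 0"
    if ij: "i \<in> \<D> - {D0}" "j \<in> \<D> - {i}" for i j
  proof -
    have h: "i \<in> \<D>" "i \<noteq> D0" "\<sigma> i \<in> \<D>'" "\<sigma> i \<noteq> \<sigma> D0" "j \<in> \<D>" "j \<noteq> i" "\<sigma> j \<in> \<D>'" "\<sigma> j \<noteq> \<sigma> i" using ij D0 sigma_D by blast+
    show "rad (child m p i) j = rad2 m D0 i j" "rad2 m D0 i j > 0" using A.child_picture(3)[OF P h(1,2,5,6)] A.rad2_pos[OF P h(1,2,5,6)] by auto
    show "rad (child m' p' (\<sigma> i)) (\<sigma> j) = rad2 m' (\<sigma> D0) (\<sigma> i) (\<sigma> j)" "rad2 m' (\<sigma> D0) (\<sigma> i) (\<sigma> j) > 0"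
      using B.child_picture(3)[OF P' h(3,4,7,8)] B.rad2_pos[OF P' h(3,4,7,8)] by auto
  qed
  have s1: "(\<Sum>i\<in>I0. rad m i * rad m' (\<sigma> i)) \<le> 1"
    by (rule sum_product_le_one[OF A.rad_sum[OF P I0(1,2)] rad'_sum[OF P' D0 I0(1,2)]])
  have "width (pull m m') \<le> (\<Sum>i\<in>I0. rad m i * rad m' (\<sigma> i) * V) + e"
  proof -
    have "(\<Sum>i\<in>I0. rad m i * rad m' (\<sigma> i) * width (pull (child m p i) (child m' p' (\<sigma> i)))) \<le> (\<Sum>i\<in>I0. rad m i * rad m' (\<sigma> i) * V)"
    proof (intro sum_mono mult_left_mono)
      fix i assume "i \<in> I0"
      then have i: "i \<in> \<D> - {D0}" using I0(2) by blast
      show "width (pull (child m p i) (child m' p' (\<sigma> i))) \<le> V" using ch[OF i] Vle by blast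
      show "0 \<le> rad m i * rad m' (\<sigma> i)" using rp[OF i] by simp
    qed
    then show ?thesis using I0(3) by linarith
  qed
  then have "V - 2 * e \<le> V * (\<Sum>i\<in>I0. rad m i * rad m' (\<sigma> i))"
  proof -
    assume "width (pull m m') \<le> (\<Sum>i\<in>I0. rad m i * rad m' (\<sigma> i) * V) + e"
    moreover have "(\<Sum>i\<in>I0. rad m i * rad m' (\<sigma> i) * V) = V * (\<Sum>i\<in>I0. rad m i * rad m' (\<sigma> i))"
      by (simp add: sum_distrib_left mult.commute)
    ultimately show ?thesis using big by linarith
  qed
  then have lev1: "1 - \<epsilon>\<^sup>2 / 4 \<le> (\<Sum>i\<in>I0. rad m i * rad m' (\<sigma> i))"
  proof -
    have "V * (1 - \<epsilon>\<^sup>2 / 4) = V - 2 * e" by (simp add: e_def algebra_simps)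
    then show ?thesis using \<open>V - 2 * e \<le> V * _\<close> V by (metis mult_le_cancel_left_pos)
  qed
  \<comment> \<open>The second generation: children of children are again pictures of partners,
    hence have width at most \<open>V\<close>.\<close>
  have "\<forall>i\<in>I0. \<exists>J. finite J \<and> J \<subseteq> \<D> - {i} \<and> width (pull (child m p i) (child m' p' (\<sigma> i))) \<le> (\<Sum>j\<in>J. rad2 m D0 i j * rad2 m' (\<sigma> D0) (\<sigma> i) (\<sigma> j) * V) + e"
  proof
    fix i assume "i \<in> I0"
    then have i: "i \<in> \<D> - {D0}" using I0(2) by blast
    obtain q kk q' kk' where Q: "picture \<D> (child m p i) q kk i" "picture \<D>' (child m' p' (\<sigma> i)) q' kk' (\<sigma> i)" using ch[OF i] by blast
    obtain J where J: "finite J" "J \<subseteq> \<D> - {i}" "width (pull (child m p i) (child m' p' (\<sigma> i))) \<le>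
       (\<Sum>j\<in>J. rad (child m p i) j * rad (child m' p' (\<sigma> i)) (\<sigma> j) * width (pull (child (child m p i) q j) (child (child m' p' (\<sigma> i)) q' (\<sigma> j)))) + e"
      using width_step[OF Q e] by blast
    have "(\<Sum>j\<in>J. rad (child m p i) j * rad (child m' p' (\<sigma> i)) (\<sigma> j) * width (pull (child (child m p i) q j) (child (child m' p' (\<sigma> i)) q' (\<sigma> j))))
        \<le> (\<Sum>j\<in>J. rad2 m D0 i j * rad2 m' (\<sigma> D0) (\<sigma> i) (\<sigma> j) * V)"
    proof (rule sum_mono)
      fix j assume "j \<in> J"
      then have j: "j \<in> \<D> - {i}" using J(2) by blast
      have h: "j \<in> \<D>" "j \<noteq> i" "\<sigma> j \<in> \<D>'" "\<sigma> j \<noteq> \<sigma> i" using j i sigma_D by blast+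
      have "width (pull (child (child m p i) q j) (child (child m' p' (\<sigma> i)) q' (\<sigma> j))) \<le> V"
        using A.child_picture(1)[OF Q(1) h(1,2)] B.child_picture(1)[OF Q(2) h(3,4)] Vle by blast
      then show "rad (child m p i) j * rad (child m' p' (\<sigma> i)) (\<sigma> j) * width (pull (child (child m p i) q j) (child (child m' p' (\<sigma> i)) q' (\<sigma> j)))
         \<le> rad2 m D0 i j * rad2 m' (\<sigma> D0) (\<sigma> i) (\<sigma> j) * V"
        unfolding c2(1,2)[OF i j] using c2(3,4)[OF i j] by (intro mult_left_mono) auto
    qed
    then have "width (pull (child m p i) (child m' p' (\<sigma> i))) \<le> (\<Sum>j\<in>J. rad2 m D0 i j * rad2 m' (\<sigma> D0) (\<sigma> i) (\<sigma> j) * V) + e" using J(3) by linarith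
    then show "\<exists>J. finite J \<and> J \<subseteq> \<D> - {i} \<and> width (pull (child m p i) (child m' p' (\<sigma> i))) \<le> (\<Sum>j\<in>J. rad2 m D0 i j * rad2 m' (\<sigma> D0) (\<sigma> i) (\<sigma> j) * V) + e"
      using J(1,2) by blast
  qed
  from bchoice[OF this] obtain J where J: "\<forall>i\<in>I0. finite (J i) \<and> J i \<subseteq> \<D> - {i} \<and> width (pull (child m p i) (child m' p' (\<sigma> i))) \<le> (\<Sum>j\<in>J i. rad2 m D0 i j * rad2 m' (\<sigma> D0) (\<sigma> i) (\<sigma> j) * V) + e"
    by (rule exE)
  define a where "a = (\<lambda>(i, j). rad m i * rad2 m D0 i j)"
  define b where "b = (\<lambda>(i, j). rad m' (\<sigma> i) * rad2 m' (\<sigma> D0) (\<sigma> i) (\<sigma> j))"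
  define Q where "Q = Sigma I0 J"
  define QQ where "QQ = (SIGMA i:\<D> - {D0}. \<D> - {i})"
  have Q: "finite Q" "Q \<subseteq> QQ" unfolding Q_def QQ_def using I0 J by auto
  have "width (pull m m') \<le> (\<Sum>i\<in>I0. rad m i * rad m' (\<sigma> i) * ((\<Sum>j\<in>J i. rad2 m D0 i j * rad2 m' (\<sigma> D0) (\<sigma> i) (\<sigma> j) * V) + e)) + e"
  proof -
    have "(\<Sum>i\<in>I0. rad m i * rad m' (\<sigma> i) * width (pull (child m p i) (child m' p' (\<sigma> i)))) \<le>
      (\<Sum>i\<in>I0. rad m i * rad m' (\<sigma> i) * ((\<Sum>j\<in>J i. rad2 m D0 i j * rad2 m' (\<sigma> D0) (\<sigma> i) (\<sigma> j) * V) + e))"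
    proof (intro sum_mono mult_left_mono)
      fix i assume i: "i \<in> I0"
      show "width (pull (child m p i) (child m' p' (\<sigma> i))) \<le> (\<Sum>j\<in>J i. rad2 m D0 i j * rad2 m' (\<sigma> D0) (\<sigma> i) (\<sigma> j) * V) + e"
        using bspec[OF J i] by blast
      show "0 \<le> rad m i * rad m' (\<sigma> i)" using rp[of i] I0(2) i by (simp add: subset_iff)
    qed
    then show ?thesis using I0(3) by linarith
  qed
  \<comment> \<open>Regrouped over pairs (i, j). Each term is a product of two-generation radii,
    which satisfy the bounds \<open>rad2_sum\<close> and \<open>rad2'_sum\<close>.\<close>
  also have "(\<Sum>i\<in>I0. rad m i * rad m' (\<sigma> i) * ((\<Sum>j\<in>J i. rad2 m D0 i j * rad2 m' (\<sigma> D0) (\<sigma> i) (\<sigma> j) * V) + e))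
     = V * (\<Sum>i\<in>I0. \<Sum>j\<in>J i. a (i, j) * b (i, j)) + e * (\<Sum>i\<in>I0. rad m i * rad m' (\<sigma> i))"
    unfolding a_def b_def by (simp add: distrib_left sum.distrib sum_distrib_left sum_distrib_right mult_ac)
  also have "(\<Sum>i\<in>I0. \<Sum>j\<in>J i. a (i, j) * b (i, j)) = (\<Sum>x\<in>Q. a x * b x)"
    unfolding Q_def using I0(1) J by (subst sum.Sigma) auto
  finally have "width (pull m m') \<le> V * (\<Sum>x\<in>Q. a x * b x) + e * (\<Sum>i\<in>I0. rad m i * rad m' (\<sigma> i)) + e" .
  moreover have "e * (\<Sum>i\<in>I0. rad m i * rad m' (\<sigma> i)) \<le> e" using s1 e by simp
  ultimately have "V - 3 * e \<le> V * (\<Sum>x\<in>Q. a x * b x)" using big by linarith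
  then have lev2: "1 - 3 * \<epsilon>\<^sup>2 / 8 \<le> (\<Sum>x\<in>Q. a x * b x)"
  proof -
    have "V * (1 - 3 * \<epsilon>\<^sup>2 / 8) = V - 3 * e" by (simp add: e_def algebra_simps)
    then show ?thesis using \<open>V - 3 * e \<le> V * _\<close> V by (metis mult_le_cancel_left_pos)
  qed
  have absle: "\<bar>x\<bar> \<le> \<epsilon>" if "x\<^sup>2 \<le> \<epsilon>\<^sup>2" for x :: real using that eps by (metis abs_le_square_iff abs_of_pos)
  have "\<bar>rad m i - rad m' (\<sigma> i)\<bar> \<le> \<epsilon>" if i: "i \<in> \<D> - {D0}" for i
  proof (rule absle)
    have "(rad m i - rad m' (\<sigma> i))\<^sup>2 \<le> 2 * (\<epsilon>\<^sup>2 / 4)"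
      by (rule sum_product_close[OF I0(1,2) i]) (use rp A.rad_sum[OF P] rad'_sum[OF P' D0] lev1 in \<open>auto simp: less_imp_le\<close>)
    also have "\<dots> \<le> \<epsilon>\<^sup>2" by simp
    finally show "(rad m i - rad m' (\<sigma> i))\<^sup>2 \<le> \<epsilon>\<^sup>2" .
  qed
  moreover have "\<bar>rad m i * rad2 m D0 i j - rad m' (\<sigma> i) * rad2 m' (\<sigma> D0) (\<sigma> i) (\<sigma> j)\<bar> \<le> \<epsilon>" if ij: "i \<in> \<D> - {D0}" "j \<in> \<D> - {i}" for i j
  proof (rule absle)
    have x: "(i, j) \<in> QQ" using ij by (simp add: QQ_def)
    have "(a (i, j) - b (i, j))\<^sup>2 \<le> 2 * (3 * \<epsilon>\<^sup>2 / 8)"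
    proof (rule sum_product_close[OF Q x])
      show "0 \<le> a x" "0 \<le> b x" if "x \<in> QQ" for x
      proof -
        obtain i j where x: "x = (i, j)" by (metis prod.exhaust)
        have ij: "i \<in> \<D> - {D0}" "j \<in> \<D> - {i}" using that x by (auto simp: QQ_def)
        show "0 \<le> a x" "0 \<le> b x" unfolding x a_def b_def using rp[OF ij(1)] c2(3,4)[OF ij] by auto
      qed
      show "(\<Sum>x\<in>F. (a x)\<^sup>2) \<le> 1" if "finite F" "F \<subseteq> QQ" for F
        using A.rad2_sum[OF P that(1), folded QQ_def, OF that(2)] unfolding a_def by (simp add: case_prod_unfold)
      show "(\<Sum>x\<in>F. (b x)\<^sup>2) \<le> 1" if "finite F" "F \<subseteq> QQ" for F
        using rad2'_sum[OF P' D0 that(1), folded QQ_def, OF that(2)] unfolding b_def by (simp add: case_prod_unfold)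
      show "1 - 3 * \<epsilon>\<^sup>2 / 8 \<le> (\<Sum>x\<in>Q. a x * b x)" by (rule lev2)
    qed
    also have "\<dots> \<le> \<epsilon>\<^sup>2" by simp
    finally show "(rad m i * rad2 m D0 i j - rad m' (\<sigma> i) * rad2 m' (\<sigma> D0) (\<sigma> i) (\<sigma> j))\<^sup>2 \<le> \<epsilon>\<^sup>2" by (simp add: a_def b_def)
  qed
  ultimately show ?thesis using P P' by blast
qed

end

section \<open>Compactness of pictures and extension of plane isometries\<close>

lemma bounded_ultralimit:
  fixes x :: "'b \<Rightarrow> 'a::heine_borel"
  assumes "ultra U" "eventually (\<lambda>n. dist (x n) a \<le> R) U"
  shows "\<exists>l. (x \<longlongrightarrow> l) U"
  using ultra_compact_limit[OF assms(1) compact_cball[of a R], of x] assms(2) by (auto simp: dist_commute)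

context schottky begin

text \<open>Poles that stay \<open>e\<close> away from \<open>S\<close> converge to a pole inside a
  disk, and the chart constants are bounded both ways, so the charts converge pointwise. The
  comparison by \<open>C\<close> is uniform in \<open>n\<close> and \<open>D\<close>: pointwise
  convergence of radii would not control disks that vary with \<open>n\<close>.\<close>

lemma limit_picture:
  assumes U: "ultra U" and P: "\<And>n. picture \<D> (M n) (q n) (K n) (E n)"
    and far: "\<And>n x. x \<in> S \<Longrightarrow> e \<le> dist (q n) x" and e: "e > 0"
  obtains m q0 k E0 C where "picture \<D> m q0 k E0" "eventually (\<lambda>n. E n = E0) U"
    "\<And>D. D \<in> \<D> \<Longrightarrow> D \<noteq> E0 \<Longrightarrow> ((\<lambda>n. rad (M n) D) \<longlongrightarrow> rad m D) U"
    "\<And>D. D \<in> \<D> \<Longrightarrow> D \<noteq> E0 \<Longrightarrow> ((\<lambda>n. cen (M n) D) \<longlongrightarrow> cen m D) U"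
    "\<And>D n. D \<in> \<D> \<Longrightarrow> D \<noteq> E0 \<Longrightarrow> E n = E0 \<Longrightarrow> rad (M n) D \<le> C * rad m D" "C > 0"
proof -
  note PP = pictureD[OF P]
  note CC = chartD[OF PP(1)]
  have Unb: "U \<noteq> bot" using U by (simp add: ultra_def)
  obtain q0 where q0: "q0 \<in> S2" "(q \<longlongrightarrow> q0) U"
    using ultra_compact_limit[OF U, of S2 q] CC(1) by (auto simp: S2_def)
  have qfar: "e \<le> dist q0 x" if "x \<in> S" for x
    by (rule tendsto_lowerbound[OF tendsto_dist[OF q0(2) tendsto_const] _ Unb]) (use far[OF that] in auto)
  then have "q0 \<notin> S" using e by force
  then obtain E0 where E0: "E0 \<in> \<D>" "q0 \<in> E0" using disk_cases q0 by blast
  obtain T where T: "open T" "E0 = S2 \<inter> T" by (rule disk_open[OF E0(1)])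
  have "eventually (\<lambda>n. q n \<in> T) U" using topological_tendstoD[OF q0(2) T(1)] E0 T by blast
  then have evE: "eventually (\<lambda>n. E n = E0) U"
  proof eventually_elim
    case (elim n)
    then have "q n \<in> E0" using T CC(1) by blast
    then show ?case using disk_unique[OF PP(2) E0(1)] PP(3) disk_closure by blast
  qed
  obtain a b where ab: "a \<in> S" "b \<in> S" "a \<noteq> b" by (rule two_points)
  have SS: "x \<in> S2" "x \<noteq> q n" if "x \<in> S" for x n using picture_S(1)[OF P that] by auto
  \<comment> \<open>Two fixed points of \<open>S\<close> are at most 2 apart in every picture, which
    bounds \<open>K n\<close> from above.\<close>
  define Km where "Km = 8 / dist a b"
  have Kup: "K n \<le> Km" for n
  proof -
    have "dist (M n a) (M n b) \<le> 2"
      using picture_S(2)[OF P ab(1)] picture_S(2)[OF P ab(2)] norm_triangle_ineq4[of "M n a" "M n b"] by (smt (verit) dist_norm)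
    then have 1: "K n * dist a b \<le> 2 * (dist a (q n) * dist b (q n))"
      using CC(6)[OF SS[OF ab(1)] SS[OF ab(2)]] SS(2)[OF ab(1)] SS(2)[OF ab(2)] by (simp add: divide_le_eq)
    have "dist a (q n) * dist b (q n) \<le> 2 * 2" using S2_dist_le SS CC(1) ab by (intro mult_mono) auto
    then have "K n * dist a b \<le> 8" using 1 by linarith
    then show ?thesis using ab by (simp add: Km_def field_simps)
  qed
  \<comment> \<open>Points of the outer circle with images 1 and -1 bound \<open>K n\<close> from
    below, since the pole is \<open>e\<close> away from both.\<close>
  have Klow: "e\<^sup>2 \<le> K n" for n
  proof -
    have "1 \<in> M n ` circ (E n)" "-1 \<in> M n ` circ (E n)" using PP(5) by auto
    then obtain x y where "x \<in> circ (E n)" "y \<in> circ (E n)" and xy: "M n x = 1" "M n y = -1" by (metis imageE)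
    then have S: "x \<in> S" "y \<in> S" using circ_S[OF PP(2)] by blast+
    have "2 = K n * dist x y / (dist x (q n) * dist y (q n))"
      using CC(6)[OF SS[OF S(1)] SS[OF S(2)], of n] xy by (simp add: dist_norm)
    then have "2 * (dist x (q n) * dist y (q n)) = K n * dist x y" using SS(2)[OF S(1)] SS(2)[OF S(2)] by (simp add: field_simps)
    moreover have "e * e \<le> dist x (q n) * dist y (q n)" using far[OF S(1)] far[OF S(2)] e by (intro mult_mono) (auto simp: dist_commute)
    moreover have "K n * dist x y \<le> K n * 2" using S2_dist_le SS S CC(2) by (intro mult_left_mono) (auto simp: less_imp_le)
    ultimately show ?thesis by (simp add: power2_eq_square)
  qed
  have "eventually (\<lambda>n. K n \<in> {e\<^sup>2..Km}) U" using Kup Klow by simp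
  then obtain k where k: "k \<in> {e\<^sup>2..Km}" "(K \<longlongrightarrow> k) U" using ultra_compact_limit[OF U, of "{e\<^sup>2..Km}" K] by auto
  have kp: "k > 0"
  proof -
    have "e\<^sup>2 > 0" using e by simp
    moreover have "e\<^sup>2 \<le> k" using k(1) by (simp only: atLeastAtMost_iff)
    ultimately show ?thesis by linarith
  qed
  have form: "dist (M n x) (M n y) * (dist x (q n) * dist y (q n)) = K n * dist x y" if "x \<in> S2" "x \<noteq> q n" "y \<in> S2" "y \<noteq> q n" for n x y
    using CC(6)[OF that] that by simp
  have evne: "eventually (\<lambda>n. x \<noteq> q n \<and> dist x q0 / 2 \<le> dist x (q n)) U" if "x \<noteq> q0" for x
  proof -
    have "((\<lambda>n. dist x (q n)) \<longlongrightarrow> dist x q0) U" by (intro tendsto_intros q0)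
    then have "eventually (\<lambda>n. dist x q0 / 2 < dist x (q n)) U" by (rule order_tendstoD(1)) (use that in simp)
    then show ?thesis by eventually_elim (use that in \<open>auto dest: less_imp_le simp: not_less\<close>)
  qed
  have aq: "a \<noteq> q0" using \<open>q0 \<notin> S\<close> ab by blast
  have "\<exists>l. ((\<lambda>n. M n x) \<longlongrightarrow> l) U" if x: "x \<in> S2 - {q0}" for x
  proof (rule bounded_ultralimit[OF U, of _ 0 "Km * 2 / (dist x q0 / 2 * e) + 1"])
    have xq: "dist x q0 > 0" using x by simp
    have "eventually (\<lambda>n. x \<noteq> q n \<and> dist x q0 / 2 \<le> dist x (q n)) U" using evne x by blast
    then show "eventually (\<lambda>n. dist (M n x) 0 \<le> Km * 2 / (dist x q0 / 2 * e) + 1) U"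
    proof eventually_elim
      case (elim n)
      have "dist (M n x) (M n a) * (dist x q0 / 2 * e) \<le> dist (M n x) (M n a) * (dist x (q n) * dist a (q n))"
        using elim far[OF ab(1), of n] e xq by (intro mult_left_mono mult_mono) (auto simp: dist_commute)
      also have "\<dots> = K n * dist x a" using form[of x n a] x elim SS[OF ab(1)] by blast
      also have "\<dots> \<le> Km * 2" using Kup[of n] Klow[of n] S2_dist_le[of x a] x SS(1)[OF ab(1)] e CC(2)[of n] by (intro mult_mono) auto
      finally have "dist (M n x) (M n a) \<le> Km * 2 / (dist x q0 / 2 * e)" using xq e by (subst pos_le_divide_eq) auto
      moreover have "dist (M n x) 0 \<le> dist (M n x) (M n a) + dist (M n a) 0" by (rule dist_triangle)
      moreover have "dist (M n a) 0 \<le> 1" using picture_S(2)[OF P ab(1)] by simp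
      ultimately show ?case by linarith
    qed
  qed
  then obtain m where m: "\<And>x. x \<in> S2 - {q0} \<Longrightarrow> ((\<lambda>n. M n x) \<longlongrightarrow> m x) U" by metis
  have md: "dist (m x) (m y) = k * dist x y / (dist x q0 * dist y q0)" if x: "x \<in> S2 - {q0}" and y: "y \<in> S2 - {q0}" for x y
  proof -
    have "((\<lambda>n. K n * dist x y / (dist x (q n) * dist y (q n))) \<longlongrightarrow> k * dist x y / (dist x q0 * dist y q0)) U"
      by (intro tendsto_intros k q0) (use x y in auto)
    moreover have "eventually (\<lambda>n. K n * dist x y / (dist x (q n) * dist y (q n)) = dist (M n x) (M n y)) U"
    proof -
      have "eventually (\<lambda>n. x \<noteq> q n \<and> dist x q0 / 2 \<le> dist x (q n)) U" "eventually (\<lambda>n. y \<noteq> q n \<and> dist y q0 / 2 \<le> dist y (q n)) U" using evne x y by blast+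
      then show ?thesis by eventually_elim (use CC(6) x y in auto)
    qed
    ultimately have "((\<lambda>n. dist (M n x) (M n y)) \<longlongrightarrow> k * dist x y / (dist x q0 * dist y q0)) U" by (rule Lim_transform_eventually)
    moreover have "((\<lambda>n. dist (M n x) (M n y)) \<longlongrightarrow> dist (m x) (m y)) U" by (intro tendsto_intros m x y)
    ultimately show ?thesis using tendsto_unique[OF Unb] by blast
  qed
  have inj: "inj_on m (S2 - {q0})"
  proof (rule inj_onI)
    fix x y assume xy: "x \<in> S2 - {q0}" "y \<in> S2 - {q0}" "m x = m y"
    then show "x = y" using md[OF xy(1,2)] kp by auto
  qed
  \<comment> \<open>Preimages of \<open>z\<close> converge along \<open>U\<close>. They cannot
    approach the pole, because the charts would be unbounded there.\<close>
  have surj: "\<exists>x\<in>S2 - {q0}. m x = z" for z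
  proof -
    have "\<forall>n. \<exists>x. x \<in> S2 \<and> x \<noteq> q n \<and> M n x = z" using CC(5) by blast
    then obtain x where x: "\<And>n. x n \<in> S2" "\<And>n. x n \<noteq> q n" "\<And>n. M n (x n) = z" by metis
    obtain x0 where x0: "x0 \<in> S2" "(x \<longlongrightarrow> x0) U" using ultra_compact_limit[OF U, of S2 x] x(1) by (auto simp: S2_def)
    have "x0 \<noteq> q0"
    proof
      assume eq: "x0 = q0"
      have "((\<lambda>n. K n * dist (x n) a) \<longlongrightarrow> k * dist q0 a) U" using x0 eq by (intro tendsto_intros k) auto
      moreover have "((\<lambda>n. (cmod z + 1) * (dist (x n) (q n) * 2)) \<longlongrightarrow> (cmod z + 1) * (dist q0 q0 * 2)) U"
        using x0 eq q0 by (intro tendsto_intros) auto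
      moreover have "eventually (\<lambda>n. K n * dist (x n) a \<le> (cmod z + 1) * (dist (x n) (q n) * 2)) U"
      proof (rule always_eventually, rule allI)
        fix n
        have "K n * dist (x n) a = dist z (M n a) * (dist (x n) (q n) * dist a (q n))"
          using form[OF x(1,2) SS[OF ab(1)], of n] x(3) by simp
        also have "\<dots> \<le> (cmod z + 1) * (dist (x n) (q n) * 2)"
        proof (intro mult_mono)
          show "dist z (M n a) \<le> cmod z + 1" using picture_S(2)[OF P ab(1), of n] norm_triangle_ineq4[of z "M n a"] by (simp add: dist_norm)
          show "dist a (q n) \<le> 2" using S2_dist_le SS(1)[OF ab(1)] CC(1) by blast
        qed auto
        finally show "K n * dist (x n) a \<le> (cmod z + 1) * (dist (x n) (q n) * 2)" .
      qed
      ultimately have "k * dist q0 a \<le> (cmod z + 1) * (dist q0 q0 * 2)" using tendsto_le[OF Unb] by blast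
      moreover have "k * dist q0 a > 0" using kp aq by simp
      ultimately show False by simp
    qed
    then have x0q: "x0 \<in> S2 - {q0}" using x0 by blast
    have "((\<lambda>n. K n * dist (x n) x0 / (dist (x n) (q n) * dist x0 (q n))) \<longlongrightarrow> k * dist x0 x0 / (dist x0 q0 * dist x0 q0)) U"
      by (intro tendsto_intros k x0 q0) (use x0q in auto)
    moreover have "eventually (\<lambda>n. K n * dist (x n) x0 / (dist (x n) (q n) * dist x0 (q n)) = dist z (M n x0)) U"
    proof -
      have "eventually (\<lambda>n. x0 \<noteq> q n \<and> dist x0 q0 / 2 \<le> dist x0 (q n)) U" using evne x0q by blast
      then show ?thesis by eventually_elim (use CC(6)[OF x(1,2) x0(1)] x(3) in auto)
    qed
    ultimately have "((\<lambda>n. dist z (M n x0)) \<longlongrightarrow> 0) U" using Lim_transform_eventually by fastforce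
    moreover have "((\<lambda>n. dist z (M n x0)) \<longlongrightarrow> dist z (m x0)) U" by (intro tendsto_intros m x0q)
    ultimately have "dist z (m x0) = 0" using tendsto_unique[OF Unb] by blast
    then show ?thesis using x0q by auto
  qed
  have "m ` (S2 - {q0}) = UNIV"
  proof (rule UNIV_eq_I[symmetric])
    fix z show "z \<in> m ` (S2 - {q0})" using surj[of z] by (blast intro: image_eqI[OF sym])
  qed
  then have ch: "chart m q0 k" unfolding chart_def bij_betw_def using q0 kp inj md by blast
  have Sq: "x \<in> S \<Longrightarrow> x \<in> S2 - {q0}" for x using S_S2 \<open>q0 \<notin> S\<close> by blast
  obtain z R where R: "R > 0" "m ` (S2 - closure E0) = ball z R" "m ` circ E0 = sphere z R"
    by (rule chart_outer[OF ch round[OF E0(1)] E0(2)]) blast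
  \<comment> \<open>Limits of unit vectors are unit vectors, and a circle contained in the unit
    circle is the unit circle; so the limit chart is again normalised.\<close>
  have "sphere z R \<subseteq> sphere 0 1"
  proof
    fix w assume "w \<in> sphere z R"
    then obtain x where x: "x \<in> circ E0" "w = m x" using R(3) by blast
    then have xS: "x \<in> S" using circ_S[OF E0(1)] by blast
    have "((\<lambda>n. cmod (M n x)) \<longlongrightarrow> cmod (m x)) U" by (intro tendsto_intros m Sq xS)
    moreover have "((\<lambda>n. cmod (M n x)) \<longlongrightarrow> 1) U"
    proof (rule tendsto_eventually)
      show "eventually (\<lambda>n. cmod (M n x) = 1) U" using evE
      proof eventually_elim
        case (elim n)
        then have "M n x \<in> sphere 0 1" using PP(5)[of n] x(1) by blast
        then show ?case by simp
      qed
    qed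
    ultimately show "w \<in> sphere 0 1" using tendsto_unique[OF Unb] x(2) by fastforce
  qed
  from sphere_subset_sphere[OF R(1) this] have "z = 0" "R = 1" by auto
  then have Pm: "picture \<D> m q0 k E0" unfolding picture_def using ch E0 R by simp
  have conv: "((\<lambda>n. rad (M n) D) \<longlongrightarrow> rad m D) U \<and> ((\<lambda>n. cen (M n) D) \<longlongrightarrow> cen m D) U" if D: "D \<in> \<D>" "D \<noteq> E0" for D
  proof -
    have bd: "eventually (\<lambda>n. dist (rad (M n) D) 0 \<le> 1 \<and> dist (cen (M n) D) 0 \<le> 1) U" using evE
    proof eventually_elim
      case (elim n)
      interpret dp: disk_packing "\<D> - {E n}" "cen (M n)" "rad (M n)" "M n ` S" by (rule picture_packing[OF P])
      have Dn: "D \<in> \<D> - {E n}" using D elim by blast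
      have "(rad (M n) D)\<^sup>2 \<le> 1" using dp.area_bound[of "{D}"] Dn by simp
      then have "dist (rad (M n) D) 0 \<le> 1" by (simp add: abs_square_le_1)
      moreover have "cen (M n) D \<in> ball 0 1" using dp.inside[OF Dn] dp.rpos[OF Dn] centre_in_ball by blast
      ultimately show ?case by (simp add: dist_norm)
    qed
    obtain \<rho> where \<rho>: "((\<lambda>n. rad (M n) D) \<longlongrightarrow> \<rho>) U"
      using bounded_ultralimit[OF U, of "\<lambda>n. rad (M n) D" 0 1] eventually_conj_iff[THEN iffD1, OF bd] by blast
    obtain c where c: "((\<lambda>n. cen (M n) D) \<longlongrightarrow> c) U"
      using bounded_ultralimit[OF U, of "\<lambda>n. cen (M n) D" 0 1] eventually_conj_iff[THEN iffD1, OF bd] by blast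
    note Dm = picture_disk[OF Pm D]
    have "sphere (cen m D) (rad m D) \<subseteq> sphere c \<rho>"
    proof
      fix w assume "w \<in> sphere (cen m D) (rad m D)"
      then obtain x where x: "x \<in> circ D" "w = m x" using Dm(3) by blast
      then have xS: "x \<in> S" using circ_S[OF D(1)] by blast
      have "((\<lambda>n. dist (cen (M n) D) (M n x)) \<longlongrightarrow> dist c (m x)) U" by (intro tendsto_intros c m Sq xS)
      moreover have "((\<lambda>n. dist (cen (M n) D) (M n x)) \<longlongrightarrow> \<rho>) U"
      proof (rule Lim_transform_eventually[OF \<rho>])
        show "eventually (\<lambda>n. rad (M n) D = dist (cen (M n) D) (M n x)) U" using evE
        proof eventually_elim
          case (elim n)
          then have "M n x \<in> sphere (cen (M n) D) (rad (M n) D)" using picture_disk(3)[OF P D(1), of n] D(2) x(1) by blast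
          then show ?case by simp
        qed
      qed
      ultimately show "w \<in> sphere c \<rho>" using tendsto_unique[OF Unb] x(2) by fastforce
    qed
    from sphere_subset_sphere[OF Dm(1) this] show ?thesis using \<rho> c by simp
  qed
  \<comment> \<open>Combines the expansion bound \<open>Km / e\<^sup>2\<close> of the charts
    \<open>M n\<close> on \<open>S\<close> with the Lipschitz bound \<open>4 / k\<close> for the
    inverse of \<open>m\<close>.\<close>
  define C where "C = Km / e\<^sup>2 * (4 / k)"
  have Kmp: "Km > 0" using ab by (simp add: Km_def)
  have Cp: "C > 0" using Kmp e kp by (simp add: C_def)
  have comp: "rad (M n) D \<le> C * rad m D" if D: "D \<in> \<D>" "D \<noteq> E0" and En: "E n = E0" for D n
  proof -
    have DE: "D \<noteq> E n" using D En by simp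
    note Dn = picture_disk[OF P D(1) DE]
    have "cen (M n) D + of_real (rad (M n) D) \<in> M n ` circ D"
      unfolding Dn(3) using Dn(1) by (simp add: dist_norm)
    then obtain u where u: "cen (M n) D + of_real (rad (M n) D) = M n u" "u \<in> circ D" by (rule imageE)
    have "cen (M n) D - of_real (rad (M n) D) \<in> M n ` circ D"
      unfolding Dn(3) using Dn(1) by (simp add: dist_norm)
    then obtain v where v: "cen (M n) D - of_real (rad (M n) D) = M n v" "v \<in> circ D" by (rule imageE)
    note uv = u(2) v(2) u(1)[symmetric] v(1)[symmetric]
    have S: "u \<in> S" "v \<in> S" using uv circ_S[OF D(1)] by blast+
    have "M n u - M n v = of_real (2 * rad (M n) D)" using uv by simp
    then have "2 * rad (M n) D = dist (M n u) (M n v)" using Dn(1) by (simp only: dist_norm norm_of_real)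
    also have "\<dots> = K n * dist u v / (dist u (q n) * dist v (q n))" using CC(6)[OF SS[OF S(1)] SS[OF S(2)]] .
    also have "\<dots> \<le> Km * dist u v / (e * e)"
      using Kup[of n] far[OF S(1), of n] far[OF S(2), of n] e Kmp
      by (intro frac_le mult_right_mono mult_mono mult_nonneg_nonneg) (auto simp: dist_commute)
    also have "dist u v \<le> 4 / k * dist (m u) (m v)"
    proof -
      have uS: "u \<in> S2 - {q0}" "v \<in> S2 - {q0}" using Sq S by auto
      have "k * dist u v = dist (m u) (m v) * (dist u q0 * dist v q0)" using md[OF uS] uS by simp
      also have "\<dots> \<le> dist (m u) (m v) * (2 * 2)" using S2_dist_le q0(1) uS by (intro mult_left_mono mult_mono) auto
      finally show ?thesis using kp by (simp add: field_simps)
    qed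
    also have "dist (m u) (m v) \<le> 2 * rad m D" by (rule picture_rad_ge[OF Pm D uv(1,2)])
    finally have "2 * rad (M n) D \<le> Km * (4 / k * (2 * rad m D)) / (e * e)" using Kmp kp e by (simp add: divide_right_mono mult_left_mono)
    moreover have "Km * (4 / k * (2 * rad m D)) / (e * e) = 2 * (C * rad m D)" by (simp add: C_def power2_eq_square mult_ac)
    ultimately show ?thesis by linarith
  qed
  show ?thesis by (rule that[OF Pm evE]) (use conv comp Cp in blast)+
qed

end

text \<open>Norms and distances determine the real inner products. After division by one nonzero
  vector and by its partner, real parts agree and imaginary parts have equal pairwise products, so
  the imaginary parts agree throughout or are all opposite: a rotation or a reflection.\<close>

lemma isometry_extend_complex:
  fixes c c' :: "'i \<Rightarrow> complex"
  assumes n: "\<And>i. i \<in> I \<Longrightarrow> cmod (c i) = cmod (c' i)"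
    and d: "\<And>i j. i \<in> I \<Longrightarrow> j \<in> I \<Longrightarrow> cmod (c i - c j) = cmod (c' i - c' j)"
  shows "\<exists>T. (\<forall>i\<in>I. T (c i) = c' i) \<and> (\<forall>x y. dist (T x) (T y) = dist x y) \<and> T 0 = 0 \<and> surj T"
proof (cases "\<forall>i\<in>I. c i = 0")
  case True
  then have "\<forall>i\<in>I. c' i = 0" using n by (metis norm_eq_zero)
  then show ?thesis using True by (intro exI[of _ "\<lambda>z. z"]) auto
next
  case False
  then obtain k where k: "k \<in> I" "c k \<noteq> 0" by blast
  have k': "c' k \<noteq> 0" using n[OF k(1)] k(2) by auto
  define A where "A i = c i / c k" for i
  define B where "B i = c' i / c' k" for i
  have in_: "Re (c i * cnj (c j)) = Re (c' i * cnj (c' j))" if "i \<in> I" "j \<in> I" for i j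
  proof -
    have e: "(cmod (x - y))\<^sup>2 = (cmod x)\<^sup>2 + (cmod y)\<^sup>2 - 2 * Re (x * cnj y)" for x y
      unfolding cmod_power2 by (simp add: power2_eq_square algebra_simps)
    show ?thesis using e[of "c i" "c j"] e[of "c' i" "c' j"] n that d[OF that] by simp
  qed
  have nk: "(cmod (c k))\<^sup>2 = (cmod (c' k))\<^sup>2" using n k by simp
  have AB: "Re (A i * cnj (A j)) = Re (B i * cnj (B j))" if "i \<in> I" "j \<in> I" for i j
  proof -
    have "Re (x / z * cnj (y / z)) = Re (x * cnj y) / (cmod z)\<^sup>2" for x y z
    proof -
      have "x / z * cnj (y / z) = x * cnj y / of_real ((cmod z)\<^sup>2)"
        unfolding complex_norm_square by simp
      then show ?thesis by (simp only: Re_divide_of_real)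
    qed
    then show ?thesis unfolding A_def B_def using in_[OF that] nk by simp
  qed
  have Ak: "A k = 1" "B k = 1" using k k' by (simp_all add: A_def B_def)
  have Re_eq: "Re (A i) = Re (B i)" if "i \<in> I" for i using AB[OF that k(1)] Ak by simp
  have Im_eq: "Im (A i) * Im (A j) = Im (B i) * Im (B j)" if "i \<in> I" "j \<in> I" for i j
    using AB[OF that] Re_eq that by simp
  show ?thesis
  proof (cases "\<forall>i\<in>I. Im (A i) = Im (B i)")
    case True
    define u where "u = c' k / c k"
    have u1: "cmod u = 1" using n[OF k(1)] k(2) k' by (simp add: u_def norm_divide)
    have "u * c i = c' i" if "i \<in> I" for i
    proof -
      have "A i = B i" using True Re_eq that by (simp add: complex_eq_iff)
      then show ?thesis using k k' by (simp add: A_def B_def u_def field_simps)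
    qed
    moreover have "surj (\<lambda>z. u * z)"
      by (rule surjI[of _ "\<lambda>z. z / u"]) (use u1 in auto)
    moreover have "dist (u * x) (u * y) = dist x y" for x y
      unfolding dist_norm using u1 by (simp add: norm_mult flip: right_diff_distrib)
    ultimately show ?thesis by (intro exI[of _ "\<lambda>z. u * z"]) auto
  next
    case False
    then obtain l where l: "l \<in> I" "Im (A l) \<noteq> Im (B l)" by blast
    have "(Im (A l))\<^sup>2 = (Im (B l))\<^sup>2" using Im_eq[OF l(1) l(1)] by (simp add: power2_eq_square)
    then have ml: "Im (B l) = - Im (A l)" "Im (A l) \<noteq> 0" using l(2) by (auto simp: power2_eq_iff)
    have im: "Im (B i) = - Im (A i)" if "i \<in> I" for i
    proof -
      have "(Im (A i) + Im (B i)) * Im (A l) = 0" using Im_eq[OF that l(1)] ml(1) by (simp add: distrib_right)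
      then show ?thesis using ml(2) by simp
    qed
    define u where "u = c' k / cnj (c k)"
    have u1: "cmod u = 1" using n[OF k(1)] k(2) k' by (simp add: u_def norm_divide)
    have "u * cnj (c i) = c' i" if "i \<in> I" for i
    proof -
      have "B i = cnj (A i)" using im Re_eq that by (simp add: complex_eq_iff)
      then show ?thesis using k k' by (simp add: A_def B_def u_def field_simps)
    qed
    moreover have "surj (\<lambda>z. u * cnj z)"
      by (rule surjI[of _ "\<lambda>z. cnj (z / u)"]) (use u1 in auto)
    moreover have "dist (u * cnj x) (u * cnj y) = dist x y" for x y
      unfolding dist_norm using u1 by (simp add: norm_mult flip: right_diff_distrib complex_cnj_diff)
    ultimately show ?thesis by (intro exI[of _ "\<lambda>z. u * cnj z"]) auto
  qed
qed

context schottky begin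

lemma Mob_image_circ:
  assumes g: "Mob g" "g ` S = S" and h: "\<And>x. x \<in> S2 \<Longrightarrow> h (g x) = x" and D: "D \<in> \<D>"
  shows "(m \<circ> h) ` circ (g ` D) = m ` circ D" "h ` g ` D = D" "rad (m \<circ> h) (g ` D) = rad m D" "cen (m \<circ> h) (g ` D) = cen m D"
proof -
  have "h ` g ` circ D = circ D" using h circ_S[OF D] S_S2 by (force simp: image_image)
  then have "(m \<circ> h) ` g ` circ D = m ` circ D" by (metis image_comp)
  then show e: "(m \<circ> h) ` circ (g ` D) = m ` circ D" unfolding Mob_disk(3)[OF g D] .
  show "h ` g ` D = D" using h disk_S2(1)[OF D] by (force simp: image_image)
  show r: "rad (m \<circ> h) (g ` D) = rad m D" unfolding rad_def e ..
  show "cen (m \<circ> h) (g ` D) = cen m D" unfolding cen_def e r ..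
qed

lemma Mob_image_rad2:
  assumes g: "Mob g" "g ` S = S" and h: "\<And>x. x \<in> S2 \<Longrightarrow> h (g x) = x" and D: "D0 \<in> \<D>" "i \<in> \<D>" "j \<in> \<D>"
  shows "rad2 (m \<circ> h) (g ` D0) (g ` i) (g ` j) = rad2 m D0 i j"
proof -
  have "g ` j = g ` D0 \<longleftrightarrow> j = D0" using Mob_image_circ(2)[OF g h D(1)] Mob_image_circ(2)[OF g h D(3)] by metis
  then show ?thesis unfolding rad2_def
    using Mob_image_circ(3,4)[OF g h D(2), of m] Mob_image_circ(3,4)[OF g h D(3), of m] by simp
qed

lemma Mob_inverse_S:
  assumes "Mob g" "g ` S = S"
  obtains h where "Mob h" "h ` S = S" "\<And>x. x \<in> S2 \<Longrightarrow> h x \<in> S2" "\<And>x. x \<in> S2 \<Longrightarrow> h (g x) = x" "\<And>x. x \<in> S2 \<Longrightarrow> g (h x) = x"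
proof -
  obtain h where h: "Mob h" "\<And>x. x \<in> S2 \<Longrightarrow> h x \<in> S2" "\<And>x. x \<in> S2 \<Longrightarrow> h (g x) = x" "\<And>x. x \<in> S2 \<Longrightarrow> g (h x) = x"
    by (rule Mob_inverse[OF assms(1)]) blast
  have "h ` g ` S = S" using h(3) S_S2 by (force simp: image_image)
  then show ?thesis using that[OF h(1) _ h(2-4)] assms(2) by simp
qed

end

context schottky_pair begin

section \<open>The limit pictures\<close>

text \<open>The state after each side has been renormalised by its own group element. Only the
  bijection \<open>\<tau>\<close> between the disks links the two sides now; \<open>e\<close> and
  \<open>e'\<close> keep the poles away from the Schottky sets, as \<open>limit_picture\<close>
  requires.\<close>

definition close_pair where
  "close_pair e e' \<epsilon> M q K E M' q' K' E' \<tau> \<longleftrightarrow> picture \<D> M q K E \<and> picture \<D>' M' q' K' E' \<and>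
     (\<forall>x\<in>S. e \<le> dist q x) \<and> (\<forall>x\<in>S'. e' \<le> dist q' x) \<and> bij_betw \<tau> \<D> \<D>' \<and> \<tau> E = E' \<and>
     (\<forall>i\<in>\<D> - {E}. \<bar>rad M i - rad M' (\<tau> i)\<bar> \<le> \<epsilon>) \<and>
     (\<forall>i\<in>\<D> - {E}. \<forall>j\<in>\<D> - {i}. \<bar>rad M i * rad2 M E i j - rad M' (\<tau> i) * rad2 M' E' (\<tau> i) (\<tau> j)\<bar> \<le> \<epsilon>)"

lemma close_pair_exists:
  "\<exists>e>0. \<exists>e'>0. \<forall>\<epsilon>>0. \<exists>M q K E M' q' K' E' \<tau>. close_pair e e' \<epsilon> M q K E M' q' K' E' \<tau>"
proof -
  obtain e where e: "e > 0" "\<And>m p k D. picture \<D> m p k D \<Longrightarrow> \<exists>g\<in>G. \<forall>x\<in>S. e \<le> dist (g p) x"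
    using A.interior_cocompact by blast
  obtain e' where e': "e' > 0" "\<And>m p k D. picture \<D>' m p k D \<Longrightarrow> \<exists>g\<in>G'. \<forall>x\<in>S'. e' \<le> dist (g p) x"
    using B.interior_cocompact by blast
  have "\<exists>M q K E M' q' K' E' \<tau>. close_pair e e' \<epsilon> M q K E M' q' K' E' \<tau>" if eps: "\<epsilon> > 0" for \<epsilon>
  proof -
    from near_extremal[OF eps] obtain m p k D0 m' p' k' where NE: "picture \<D> m p k D0 \<and> picture \<D>' m' p' k' (\<sigma> D0) \<and>
        (\<forall>i\<in>\<D> - {D0}. \<bar>rad m i - rad m' (\<sigma> i)\<bar> \<le> \<epsilon>) \<and>
        (\<forall>i\<in>\<D> - {D0}. \<forall>j\<in>\<D> - {i}. \<bar>rad m i * rad2 m D0 i j - rad m' (\<sigma> i) * rad2 m' (\<sigma> D0) (\<sigma> i) (\<sigma> j)\<bar> \<le> \<epsilon>)"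
      by (elim exE)
    note P = NE[THEN conjunct1] and P' = NE[THEN conjunct2, THEN conjunct1]
      and c1 = NE[THEN conjunct2, THEN conjunct2, THEN conjunct1, rule_format]
      and c2 = NE[THEN conjunct2, THEN conjunct2, THEN conjunct2, rule_format]
    have D0: "D0 \<in> \<D>" "\<sigma> D0 \<in> \<D>'" using pictureD(2)[OF P] sigma_D by auto
    obtain g where g0: "g \<in> G" "\<forall>x\<in>S. e \<le> dist (g p) x" using e(2)[OF P] by blast
    have g: "Mob g" "g ` S = S" using A.G_Mob A.G_S g0 by auto
    obtain g' where g0': "g' \<in> G'" "\<forall>x\<in>S'. e' \<le> dist (g' p') x" using e'(2)[OF P'] by blast
    have g': "Mob g'" "g' ` S' = S'" using B.G_Mob B.G_S g0' by auto
    obtain h where h: "Mob h" "h ` S = S" "\<And>x. x \<in> S2 \<Longrightarrow> h x \<in> S2" "\<And>x. x \<in> S2 \<Longrightarrow> h (g x) = x" "\<And>x. x \<in> S2 \<Longrightarrow> g (h x) = x"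
      by (rule A.Mob_inverse_S[OF g]) blast
    obtain h' where h': "Mob h'" "h' ` S' = S'" "\<And>x. x \<in> S2 \<Longrightarrow> h' x \<in> S2" "\<And>x. x \<in> S2 \<Longrightarrow> h' (g' x) = x" "\<And>x. x \<in> S2 \<Longrightarrow> g' (h' x) = x"
      by (rule B.Mob_inverse_S[OF g']) blast
    obtain K where Q: "picture \<D> (m \<circ> h) (g p) K (g ` D0)" using A.picture_Mob[OF P g h(1,3,4,5)] by blast
    obtain K' where Q': "picture \<D>' (m' \<circ> h') (g' p') K' (g' ` \<sigma> D0)" using B.picture_Mob[OF P' g' h'(1,3,4,5)] by blast
    \<comment> \<open>\<open>\<sigma>\<close> with its source relabelled by the inverse of
      \<open>g\<close> and its target by \<open>g'\<close>. Radii are unaffected, since the planar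
      images do not change.\<close>
    define \<tau> where "\<tau> = (\<lambda>D. g' ` \<sigma> (h ` D))"
    have hD: "h ` D \<in> \<D>" "g ` h ` D = D" if "D \<in> \<D>" for D
      using A.Mob_disk(1)[OF h(1,2) that] A.Mob_image_circ(2)[OF h(1,2) h(5) that] by auto
    have gD': "g' ` D \<in> \<D>'" "h' ` g' ` D = D" if "D \<in> \<D>'" for D
      using B.Mob_disk(1)[OF g' that] B.Mob_image_circ(2)[OF g' h'(4) that] by auto
    have "bij_betw \<tau> \<D> \<D>'"
    proof -
      have 1: "bij_betw (\<lambda>D. h ` D) \<D> \<D>"
      proof (rule bij_betw_byWitness[where f'="\<lambda>D. g ` D"])
        show "\<forall>D\<in>\<D>. g ` h ` D = D" using hD by blast
        show "\<forall>D\<in>\<D>. h ` g ` D = D" using A.Mob_image_circ(2)[OF g h(4)] by blast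
        show "(\<lambda>D. h ` D) ` \<D> \<subseteq> \<D>" using hD by blast
        show "(\<lambda>D. g ` D) ` \<D> \<subseteq> \<D>" using A.Mob_disk(1)[OF g] by blast
      qed
      have 2: "bij_betw (\<lambda>D. g' ` D) \<D>' \<D>'"
      proof (rule bij_betw_byWitness[where f'="\<lambda>D. h' ` D"])
        show "\<forall>D\<in>\<D>'. h' ` g' ` D = D" using gD' by blast
        show "\<forall>D\<in>\<D>'. g' ` h' ` D = D" using B.Mob_image_circ(2)[OF h'(1,2) h'(5)] by blast
        show "(\<lambda>D. g' ` D) ` \<D>' \<subseteq> \<D>'" using gD' by blast
        show "(\<lambda>D. h' ` D) ` \<D>' \<subseteq> \<D>'" using B.Mob_disk(1)[OF h'(1,2)] by blast
      qed
      show ?thesis using bij_betw_trans[OF bij_betw_trans[OF 1 sigma] 2] by (simp add: \<tau>_def comp_def)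
    qed
    moreover have hg0: "h ` g ` D0 = D0" by (rule A.Mob_image_circ(2)[OF g h(4) D0(1)])
    have "\<tau> (g ` D0) = g' ` \<sigma> D0" by (simp only: \<tau>_def hg0)
    moreover have "\<bar>rad (m \<circ> h) I - rad (m' \<circ> h') (\<tau> I)\<bar> \<le> \<epsilon>" if I: "I \<in> \<D> - {g ` D0}" for I
    proof -
      define i where "i = h ` I"
      have i: "i \<in> \<D>" "I = g ` i" using hD I by (auto simp: i_def)
      have i0: "i \<in> \<D> - {D0}" using i I by auto
      have "rad (m \<circ> h) I = rad m i" unfolding i(2) by (rule A.Mob_image_circ(3)[OF g h(4) i(1)])
      moreover have "rad (m' \<circ> h') (\<tau> I) = rad m' (\<sigma> i)" unfolding \<tau>_def i_def[symmetric]
        by (rule B.Mob_image_circ(3)[OF g' h'(4) sigma_D(1)[OF i(1)]])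
      ultimately show ?thesis using c1[OF i0] by simp
    qed
    moreover have "\<bar>rad (m \<circ> h) I * rad2 (m \<circ> h) (g ` D0) I J - rad (m' \<circ> h') (\<tau> I) * rad2 (m' \<circ> h') (g' ` \<sigma> D0) (\<tau> I) (\<tau> J)\<bar> \<le> \<epsilon>"
      if I: "I \<in> \<D> - {g ` D0}" and J: "J \<in> \<D> - {I}" for I J
    proof -
      define i j where "i = h ` I" and "j = h ` J"
      have i: "i \<in> \<D>" "I = g ` i" using hD I by (auto simp: i_def)
      have j: "j \<in> \<D>" "J = g ` j" using hD J by (auto simp: j_def)
      have i0: "i \<in> \<D> - {D0}" "j \<in> \<D> - {i}" using i j I J by auto
      have "rad (m \<circ> h) I = rad m i" unfolding i(2) by (rule A.Mob_image_circ(3)[OF g h(4) i(1)])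
      moreover have "rad (m' \<circ> h') (\<tau> I) = rad m' (\<sigma> i)" unfolding \<tau>_def i_def[symmetric]
        by (rule B.Mob_image_circ(3)[OF g' h'(4) sigma_D(1)[OF i(1)]])
      moreover have "rad2 (m \<circ> h) (g ` D0) I J = rad2 m D0 i j" unfolding i(2) j(2)
        by (rule A.Mob_image_rad2[OF g h(4) D0(1) i(1) j(1)])
      moreover have "rad2 (m' \<circ> h') (g' ` \<sigma> D0) (\<tau> I) (\<tau> J) = rad2 m' (\<sigma> D0) (\<sigma> i) (\<sigma> j)"
        unfolding \<tau>_def i_def[symmetric] j_def[symmetric]
        by (rule B.Mob_image_rad2[OF g' h'(4) D0(2) sigma_D(1)[OF i(1)] sigma_D(1)[OF j(1)]])
      ultimately show ?thesis using c2[OF i0] by simp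
    qed
    ultimately have "close_pair e e' \<epsilon> (m \<circ> h) (g p) K (g ` D0) (m' \<circ> h') (g' p') K' (g' ` \<sigma> D0) \<tau>"
      unfolding close_pair_def using Q Q' g0(2) g0'(2) by blast
    then show ?thesis by blast
  qed
  then show ?thesis using e(1) e'(1) by blast
qed

text \<open>Positivity of the limit value excludes a vanishing denominator, because division by zero
  would give 0; elsewhere \<open>rad2\<close> is continuous in centres and radii.\<close>

lemma rad2_tendsto:
  assumes U: "U \<noteq> bot" and m: "picture \<D>1 m q k E0" "rad2 m E0 i j > 0"
    and r: "((\<lambda>n. rad (M n) i) \<longlongrightarrow> rad m i) U" "((\<lambda>n. cen (M n) i) \<longlongrightarrow> cen m i) U"
    and j: "j \<noteq> E0 \<Longrightarrow> ((\<lambda>n. rad (M n) j) \<longlongrightarrow> rad m j) U" "j \<noteq> E0 \<Longrightarrow> ((\<lambda>n. cen (M n) j) \<longlongrightarrow> cen m j) U"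
  shows "((\<lambda>n. rad2 (M n) E0 i j) \<longlongrightarrow> rad2 m E0 i j) U"
proof (cases "j = E0")
  case True
  have "1 - (cmod (cen m i))\<^sup>2 \<noteq> 0" using m(2) True by (auto simp: rad2_def)
  then have "((\<lambda>n. rad (M n) i / (1 - (cmod (cen (M n) i))\<^sup>2)) \<longlongrightarrow> rad m i / (1 - (cmod (cen m i))\<^sup>2)) U"
    by (intro tendsto_intros r)
  then show ?thesis using True by (simp add: rad2_def)
next
  case False
  have "(cmod (cen m i - cen m j))\<^sup>2 - (rad m j)\<^sup>2 \<noteq> 0" using m(2) False by (auto simp: rad2_def)
  then have "((\<lambda>n. rad (M n) i * rad (M n) j / ((cmod (cen (M n) i - cen (M n) j))\<^sup>2 - (rad (M n) j)\<^sup>2)) \<longlongrightarrow>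
     rad m i * rad m j / ((cmod (cen m i - cen m j))\<^sup>2 - (rad m j)\<^sup>2)) U"
    by (intro tendsto_intros r j[OF False])
  then show ?thesis using False by (simp add: rad2_def)
qed

theorem pair_Mob: "\<exists>F. Mob F \<and> F ` S = S'"
proof -
  obtain e e' where e: "e > 0" "e' > 0" "\<And>\<epsilon>. \<epsilon> > 0 \<Longrightarrow> \<exists>M q K E M' q' K' E' \<tau>. close_pair e e' \<epsilon> M q K E M' q' K' E' \<tau>"
    using close_pair_exists by blast
  have "\<forall>n::nat. \<exists>M q K E M' q' K' E' \<tau>. close_pair e e' (1 / (real n + 1)) M q K E M' q' K' E' \<tau>" by (intro allI e(3)) simp
  then obtain M q K E M' q' K' E' \<tau> where cp: "\<And>n::nat. close_pair e e' (1 / (real n + 1)) (M n) (q n) (K n) (E n) (M' n) (q' n) (K' n) (E' n) (\<tau> n)"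
    by metis
  have P: "\<And>n. picture \<D> (M n) (q n) (K n) (E n)" "\<And>n. picture \<D>' (M' n) (q' n) (K' n) (E' n)"
    "\<And>n x. x \<in> S \<Longrightarrow> e \<le> dist (q n) x" "\<And>n x. x \<in> S' \<Longrightarrow> e' \<le> dist (q' n) x"
    "\<And>n. bij_betw (\<tau> n) \<D> \<D>'" "\<And>n. \<tau> n (E n) = E' n"
    "\<And>n i. i \<in> \<D> - {E n} \<Longrightarrow> \<bar>rad (M n) i - rad (M' n) (\<tau> n i)\<bar> \<le> 1 / (real n + 1)"
    "\<And>n i j. i \<in> \<D> - {E n} \<Longrightarrow> j \<in> \<D> - {i} \<Longrightarrow> \<bar>rad (M n) i * rad2 (M n) (E n) i j - rad (M' n) (\<tau> n i) * rad2 (M' n) (E' n) (\<tau> n i) (\<tau> n j)\<bar> \<le> 1 / (real n + 1)"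
  proof -
    note c0 = cp[unfolded close_pair_def]
    note c1 = c0[THEN conjunct2] note c2 = c1[THEN conjunct2] note c3 = c2[THEN conjunct2] note c4 = c3[THEN conjunct2]
    note c5 = c4[THEN conjunct2] note c6 = c5[THEN conjunct2]
    show "\<And>n. picture \<D> (M n) (q n) (K n) (E n)" by (rule c0[THEN conjunct1])
    show "\<And>n. picture \<D>' (M' n) (q' n) (K' n) (E' n)" by (rule c1[THEN conjunct1])
    show "\<And>n x. x \<in> S \<Longrightarrow> e \<le> dist (q n) x" by (rule c2[THEN conjunct1, THEN bspec])
    show "\<And>n x. x \<in> S' \<Longrightarrow> e' \<le> dist (q' n) x" by (rule c3[THEN conjunct1, THEN bspec])
    show "\<And>n. bij_betw (\<tau> n) \<D> \<D>'" by (rule c4[THEN conjunct1])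
    show "\<And>n. \<tau> n (E n) = E' n" by (rule c5[THEN conjunct1])
    show "\<And>n i. i \<in> \<D> - {E n} \<Longrightarrow> \<bar>rad (M n) i - rad (M' n) (\<tau> n i)\<bar> \<le> 1 / (real n + 1)" by (rule c6[THEN conjunct1, THEN bspec])
    show "\<And>n i j. i \<in> \<D> - {E n} \<Longrightarrow> j \<in> \<D> - {i} \<Longrightarrow> \<bar>rad (M n) i * rad2 (M n) (E n) i j - rad (M' n) (\<tau> n i) * rad2 (M' n) (E' n) (\<tau> n i) (\<tau> n j)\<bar> \<le> 1 / (real n + 1)"
      by (rule c6[THEN conjunct2, THEN bspec, THEN bspec])
  qed
  obtain U :: "nat filter" where U: "ultra U" "U \<le> sequentially" using ultra_exists by blast
  have Unb: "U \<noteq> bot" using U by (simp add: ultra_def)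
  have "(\<lambda>n. 1 / (real n + 1)) \<longlonglongrightarrow> 0" using LIMSEQ_Suc[OF lim_const_over_n[of "1::real"]] by (simp add: add.commute)
  then have inv0: "((\<lambda>n. 1 / (real n + 1)) \<longlongrightarrow> 0) U" by (rule tendsto_mono[OF U(2)])
  obtain m q0 k E0 C where m: "picture \<D> m q0 k E0" "eventually (\<lambda>n. E n = E0) U"
    "\<And>D. D \<in> \<D> \<Longrightarrow> D \<noteq> E0 \<Longrightarrow> ((\<lambda>n. rad (M n) D) \<longlongrightarrow> rad m D) U"
    "\<And>D. D \<in> \<D> \<Longrightarrow> D \<noteq> E0 \<Longrightarrow> ((\<lambda>n. cen (M n) D) \<longlongrightarrow> cen m D) U"
    "\<And>D n. D \<in> \<D> \<Longrightarrow> D \<noteq> E0 \<Longrightarrow> E n = E0 \<Longrightarrow> rad (M n) D \<le> C * rad m D" "C > 0"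
  proof (rule A.limit_picture[where M=M and q=q and K=K and E=E, OF U(1) P(1,3) e(1)])
    fix m q0 k E0 C
    assume "picture \<D> m q0 k E0" "eventually (\<lambda>n. E n = E0) U"
      "\<And>D. D \<in> \<D> \<Longrightarrow> D \<noteq> E0 \<Longrightarrow> ((\<lambda>n. rad (M n) D) \<longlongrightarrow> rad m D) U"
      "\<And>D. D \<in> \<D> \<Longrightarrow> D \<noteq> E0 \<Longrightarrow> ((\<lambda>n. cen (M n) D) \<longlongrightarrow> cen m D) U"
      "\<And>D n. D \<in> \<D> \<Longrightarrow> D \<noteq> E0 \<Longrightarrow> E n = E0 \<Longrightarrow> rad (M n) D \<le> C * rad m D" "C > 0"
    then show thesis by (rule that)
  qed
  obtain m' q0' k' E0' C' where m': "picture \<D>' m' q0' k' E0'" "eventually (\<lambda>n. E' n = E0') U"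
    "\<And>D. D \<in> \<D>' \<Longrightarrow> D \<noteq> E0' \<Longrightarrow> ((\<lambda>n. rad (M' n) D) \<longlongrightarrow> rad m' D) U"
    "\<And>D. D \<in> \<D>' \<Longrightarrow> D \<noteq> E0' \<Longrightarrow> ((\<lambda>n. cen (M' n) D) \<longlongrightarrow> cen m' D) U"
    "\<And>D n. D \<in> \<D>' \<Longrightarrow> D \<noteq> E0' \<Longrightarrow> E' n = E0' \<Longrightarrow> rad (M' n) D \<le> C' * rad m' D" "C' > 0"
  proof (rule B.limit_picture[where M=M' and q=q' and K=K' and E=E', OF U(1) P(2,4) e(2)])
    fix m q0 k E0 C
    assume "picture \<D>' m q0 k E0" "eventually (\<lambda>n. E' n = E0) U"
      "\<And>D. D \<in> \<D>' \<Longrightarrow> D \<noteq> E0 \<Longrightarrow> ((\<lambda>n. rad (M' n) D) \<longlongrightarrow> rad m D) U"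
      "\<And>D. D \<in> \<D>' \<Longrightarrow> D \<noteq> E0 \<Longrightarrow> ((\<lambda>n. cen (M' n) D) \<longlongrightarrow> cen m D) U"
      "\<And>D n. D \<in> \<D>' \<Longrightarrow> D \<noteq> E0 \<Longrightarrow> E' n = E0 \<Longrightarrow> rad (M' n) D \<le> C * rad m D" "C > 0"
    then show thesis by (rule that)
  qed
  have \<tau>in: "\<tau> n D \<in> \<D>'" "\<tau> n D = \<tau> n D2 \<Longrightarrow> D2 \<in> \<D> \<Longrightarrow> D = D2" if "D \<in> \<D>" for n D D2
    using P(5)[of n] that by (auto simp: bij_betw_def dest: inj_onD)
  have EE: "E0 \<in> \<D>" "E0' \<in> \<D>'" using pictureD(2)[OF m(1)] pictureD(2)[OF m'(1)] by auto
  have cl: "((\<lambda>n. x n - y n) \<longlongrightarrow> 0) U" if "eventually (\<lambda>n. \<bar>x n - y n\<bar> \<le> 1 / (real n + 1)) U" for x y :: "nat \<Rightarrow> real"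
    by (rule Lim_null_comparison[OF _ inv0]) (use that in simp)
  have rlim: "((\<lambda>n. rad (M' n) (\<tau> n D)) \<longlongrightarrow> rad m D) U" if D: "D \<in> \<D>" "D \<noteq> E0" for D
  proof -
    have "((\<lambda>n. rad (M n) D - rad (M' n) (\<tau> n D)) \<longlongrightarrow> 0) U"
    proof (rule cl)
      show "eventually (\<lambda>n. \<bar>rad (M n) D - rad (M' n) (\<tau> n D)\<bar> \<le> 1 / (real n + 1)) U" using m(2)
        by eventually_elim (use P(7) D in auto)
    qed
    from tendsto_diff[OF m(3)[OF D] this] show ?thesis by simp
  qed
  \<comment> \<open>The radius of \<open>\<tau> n D\<close> stays above half of
    \<open>rad m D\<close>, so comparison with the limit picture leaves finitely many candidates and
    the choice is constant along \<open>U\<close>. This defines the limit correspondence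
    \<open>\<theta>\<close>.\<close>
  have "\<exists>D'\<in>\<D>' - {E0'}. eventually (\<lambda>n. \<tau> n D = D') U" if D: "D \<in> \<D>" "D \<noteq> E0" for D
  proof -
    have rp: "rad m D > 0" using A.picture_disk(1)[OF m(1) D] .
    let ?B = "{D' \<in> \<D>' - {E0'}. rad m D / (2 * C') < rad m' D'}"
    have fin: "finite ?B" using B.picture_finite_big[OF m'(1)] rp m'(6) by simp
    have "eventually (\<lambda>n. rad m D / 2 < rad (M' n) (\<tau> n D)) U" by (rule order_tendstoD(1)[OF rlim[OF D]]) (use rp in simp)
    then have "eventually (\<lambda>n. \<tau> n D \<in> ?B) U" using m(2) m'(2)
    proof eventually_elim
      case (elim n)
      have tD: "\<tau> n D \<in> \<D>'" using \<tau>in D by blast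
      have ne: "\<tau> n D \<noteq> E0'" using \<tau>in(2)[OF D(1), of n E0] EE P(6)[of n] elim D(2) by auto
      have "rad m D / 2 < C' * rad m' (\<tau> n D)" using m'(5)[OF tD ne elim(3)] elim(1) by linarith
      then have "rad m D / (2 * C') < rad m' (\<tau> n D)" using m'(6) by (simp add: field_simps)
      then show ?case using tD ne by blast
    qed
    from ultra_finite_limit[OF U(1) fin this] obtain D' where D': "D' \<in> ?B" "eventually (\<lambda>n. \<tau> n D = D') U" by (rule bexE)
    from D'(1) have "D' \<in> \<D>' - {E0'}" by (rule CollectE) (rule conjunct1)
    then show ?thesis using D'(2) by (rule bexI[rotated])
  qed
  then obtain \<theta> where \<theta>: "\<And>D. D \<in> \<D> \<Longrightarrow> D \<noteq> E0 \<Longrightarrow> \<theta> D \<in> \<D>' \<and> \<theta> D \<noteq> E0' \<and> eventually (\<lambda>n. \<tau> n D = \<theta> D) U"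
    by (metis DiffE insertI1)
  have req: "rad m' (\<theta> D) = rad m D" if D: "D \<in> \<D>" "D \<noteq> E0" for D
  proof -
    note t = \<theta>[OF D]
    have "((\<lambda>n. rad (M' n) (\<theta> D)) \<longlongrightarrow> rad m D) U"
      by (rule Lim_transform_eventually[OF rlim[OF D]]) (use conjunct2[OF conjunct2[OF t]] in \<open>eventually_elim, simp\<close>)
    moreover have "((\<lambda>n. rad (M' n) (\<theta> D)) \<longlongrightarrow> rad m' (\<theta> D)) U" using m'(3) t by blast
    ultimately show ?thesis using tendsto_unique[OF Unb] by blast
  qed
  have r2eq: "rad m i * rad2 m E0 i j = rad m' (\<theta> i) * rad2 m' E0' (\<theta> i) j'"
    if i: "i \<in> \<D>" "i \<noteq> E0" and j: "j \<in> \<D>" "j \<noteq> i" and j': "j' \<in> \<D>'" "j' \<noteq> \<theta> i" "eventually (\<lambda>n. \<tau> n j = j') U" "j' = E0' \<longleftrightarrow> j = E0" for i j j'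
  proof -
    note ti = \<theta>[OF i]
    have l1: "((\<lambda>n. rad (M n) i * rad2 (M n) E0 i j) \<longlongrightarrow> rad m i * rad2 m E0 i j) U"
      by (intro tendsto_intros m(3)[OF i] rad2_tendsto[OF Unb m(1) A.rad2_pos[OF m(1) i j] m(3,4)[OF i]] m(3,4) j)
    have l2: "((\<lambda>n. rad (M' n) (\<theta> i) * rad2 (M' n) E0' (\<theta> i) j') \<longlongrightarrow> rad m' (\<theta> i) * rad2 m' E0' (\<theta> i) j') U"
    proof -
      have t: "\<theta> i \<in> \<D>'" "\<theta> i \<noteq> E0'" using ti by auto
      show ?thesis
        by (intro tendsto_intros m'(3)[OF t] rad2_tendsto[OF Unb m'(1) B.rad2_pos[OF m'(1) t j'(1,2)] m'(3,4)[OF t]] m'(3,4) j'(1))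
    qed
    have l3: "((\<lambda>n. rad (M n) i * rad2 (M n) E0 i j - rad (M' n) (\<theta> i) * rad2 (M' n) E0' (\<theta> i) j') \<longlongrightarrow> 0) U"
    proof (rule cl)
      have "eventually (\<lambda>n. \<tau> n i = \<theta> i) U" using ti by blast
      then show "eventually (\<lambda>n. \<bar>rad (M n) i * rad2 (M n) E0 i j - rad (M' n) (\<theta> i) * rad2 (M' n) E0' (\<theta> i) j'\<bar> \<le> 1 / (real n + 1)) U"
        using m(2) m'(2) j'(3)
      proof eventually_elim
        case (elim n)
        have "i \<in> \<D> - {E n}" "j \<in> \<D> - {i}" using i j elim by auto
        then show ?case using P(8)[of i n j] elim by simp
      qed
    qed
    have "rad m i * rad2 m E0 i j - rad m' (\<theta> i) * rad2 m' E0' (\<theta> i) j' = 0"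
      by (rule tendsto_unique[OF Unb tendsto_diff[OF l1 l2] l3])
    then show ?thesis by simp
  qed
  have \<theta>inj: "i = j" if "i \<in> \<D>" "i \<noteq> E0" "j \<in> \<D>" "j \<noteq> E0" "\<theta> i = \<theta> j" for i j
  proof -
    have "eventually (\<lambda>n. \<tau> n i = \<theta> i) U" "eventually (\<lambda>n. \<tau> n j = \<theta> j) U" using \<theta> that by blast+
    then have "eventually (\<lambda>n. i = j) U"
    proof eventually_elim
      case (elim n)
      then have "\<tau> n i = \<tau> n j" using that(5) by simp
      then show ?case using \<tau>in(2)[OF that(1)] that(3) by blast
    qed
    then show ?thesis using ultra_const[OF U(1)] by blast
  qed
  \<comment> \<open>The preimages \<open>dn n\<close> of a fixed disk are frozen in the same way;
    they vary with \<open>n\<close>, so the uniform constant \<open>C\<close> is essential.\<close>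
  have \<theta>surj: "\<exists>D\<in>\<D> - {E0}. \<theta> D = D'" if D': "D' \<in> \<D>'" "D' \<noteq> E0'" for D'
  proof -
    have "\<forall>n. \<exists>D\<in>\<D>. \<tau> n D = D'" using P(5) D' by (metis bij_betw_def imageE)
    then obtain dn where dn: "\<And>n. dn n \<in> \<D>" "\<And>n. \<tau> n (dn n) = D'" by metis
    have rp: "rad m' D' > 0" using B.picture_disk(1)[OF m'(1) D'] .
    let ?B = "{D \<in> \<D> - {E0}. rad m' D' / (2 * C) < rad m D}"
    have fin: "finite ?B" using A.picture_finite_big[OF m(1)] rp m(6) by simp
    have "((\<lambda>n. rad (M' n) D' - 1 / (real n + 1)) \<longlongrightarrow> rad m' D' - 0) U" by (intro tendsto_diff m'(3) D' inv0)
    then have "eventually (\<lambda>n. rad m' D' / 2 < rad (M' n) D' - 1 / (real n + 1)) U" by (rule order_tendstoD(1)) (use rp in simp)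
    then have "eventually (\<lambda>n. dn n \<in> ?B) U" using m(2) m'(2)
    proof eventually_elim
      case (elim n)
      have ne: "dn n \<noteq> E0" using dn(2)[of n] P(6)[of n] elim D'(2) by auto
      have "\<bar>rad (M n) (dn n) - rad (M' n) D'\<bar> \<le> 1 / (real n + 1)" using P(7)[of "dn n" n] dn ne elim by auto
      then have "rad m' D' / 2 < rad (M n) (dn n)" using elim(1) by linarith
      then have "rad m' D' / 2 < C * rad m (dn n)" using m(5)[OF dn(1) ne elim(2)] by linarith
      then have "rad m' D' / (2 * C) < rad m (dn n)" using m(6) by (simp add: field_simps)
      then show ?case using dn(1) ne by blast
    qed
    from ultra_finite_limit[OF U(1) fin this] obtain D where D: "D \<in> ?B" "eventually (\<lambda>n. dn n = D) U" by (rule bexE)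
    have "eventually (\<lambda>n. \<tau> n D = \<theta> D) U" using \<theta> D(1) by blast
    then have "eventually (\<lambda>n. \<theta> D = D') U" using D(2) by eventually_elim (use dn(2) in metis)
    then show ?thesis using ultra_const[OF U(1)] D(1) by blast
  qed
  have evE: "eventually (\<lambda>n. \<tau> n E0 = E0') U" using m(2) m'(2) by eventually_elim (use P(6) in metis)
  have pos: "rad m i > 0" if "i \<in> \<D>" "i \<noteq> E0" for i using A.picture_disk(1)[OF m(1) that] .
  \<comment> \<open>Take the outer disk for \<open>j\<close>. Its radius after inversion is
    \<open>rad m i / (1 - (cmod (cen m i))\<^sup>2)\<close>, which determines the modulus of the
    centre.\<close>
  have n1: "cmod (cen m i) = cmod (cen m' (\<theta> i))" if i: "i \<in> \<D>" "i \<noteq> E0" for i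
  proof -
    note ti = \<theta>[OF i]
    have "rad m i * rad2 m E0 i E0 = rad m' (\<theta> i) * rad2 m' E0' (\<theta> i) E0'"
      by (rule r2eq[OF i EE(1) _ EE(2) _ evE]) (use i ti in auto)
    then have eq: "rad m i / (1 - (cmod (cen m i))\<^sup>2) = rad m i / (1 - (cmod (cen m' (\<theta> i)))\<^sup>2)"
      unfolding rad2_def req[OF i] using pos[OF i] by simp
    have "rad2 m E0 i E0 > 0" by (rule A.rad2_pos[OF m(1) i EE(1)]) (use i in auto)
    then have "1 - (cmod (cen m i))\<^sup>2 \<noteq> 0" by (auto simp: rad2_def)
    moreover have "rad2 m' E0' (\<theta> i) E0' > 0" by (rule B.rad2_pos[OF m'(1) _ _ EE(2)]) (use ti in auto)
    then have "1 - (cmod (cen m' (\<theta> i)))\<^sup>2 \<noteq> 0" by (auto simp: rad2_def)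
    ultimately have "1 - (cmod (cen m i))\<^sup>2 = 1 - (cmod (cen m' (\<theta> i)))\<^sup>2" using eq pos[OF i] by (simp add: frac_eq_eq)
    then show ?thesis by simp
  qed
  \<comment> \<open>For two inner disks the radius after inversion determines the distance of the
    centres, once their own radii are known.\<close>
  have n2: "cmod (cen m i - cen m j) = cmod (cen m' (\<theta> i) - cen m' (\<theta> j))" if i: "i \<in> \<D>" "i \<noteq> E0" and j: "j \<in> \<D>" "j \<noteq> E0" for i j
  proof (cases "i = j")
    case False
    note ti = \<theta>[OF i] and tj = \<theta>[OF j]
    have ne: "\<theta> j \<noteq> \<theta> i" using \<theta>inj i j False by blast
    have "rad m i * rad2 m E0 i j = rad m' (\<theta> i) * rad2 m' E0' (\<theta> i) (\<theta> j)"
      by (rule r2eq[OF i j(1)]) (use tj ne False j in auto)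
    then have eq: "rad m i * rad m j / ((cmod (cen m i - cen m j))\<^sup>2 - (rad m j)\<^sup>2) = rad m i * rad m j / ((cmod (cen m' (\<theta> i) - cen m' (\<theta> j)))\<^sup>2 - (rad m j)\<^sup>2)"
      unfolding rad2_def req[OF i] req[OF j] using pos[OF i] j tj by simp
    have "rad2 m E0 i j > 0" by (rule A.rad2_pos[OF m(1) i j(1)]) (use False in auto)
    then have "(cmod (cen m i - cen m j))\<^sup>2 - (rad m j)\<^sup>2 \<noteq> 0" using j by (auto simp: rad2_def)
    moreover have "rad2 m' E0' (\<theta> i) (\<theta> j) > 0" by (rule B.rad2_pos[OF m'(1)]) (use ti tj ne in auto)
    then have "(cmod (cen m' (\<theta> i) - cen m' (\<theta> j)))\<^sup>2 - (rad m j)\<^sup>2 \<noteq> 0" using tj req[OF j] by (auto simp: rad2_def)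
    ultimately have "(cmod (cen m i - cen m j))\<^sup>2 - (rad m j)\<^sup>2 = (cmod (cen m' (\<theta> i) - cen m' (\<theta> j)))\<^sup>2 - (rad m j)\<^sup>2"
      using eq pos[OF i] pos[OF j] by (simp add: frac_eq_eq)
    then show ?thesis by simp
  qed simp
  obtain T where T: "\<And>i. i \<in> \<D> - {E0} \<Longrightarrow> T (cen m i) = cen m' (\<theta> i)" "\<And>x y. dist (T x) (T y) = dist x y" "T 0 = 0" "surj T"
  proof -
    have "\<exists>T. (\<forall>i\<in>\<D> - {E0}. T (cen m i) = cen m' (\<theta> i)) \<and> (\<forall>x y. dist (T x) (T y) = dist x y) \<and> T 0 = 0 \<and> surj T"
      by (rule isometry_extend_complex) (use n1 n2 in auto)
    then obtain T0 where T0: "(\<forall>i\<in>\<D> - {E0}. T0 (cen m i) = cen m' (\<theta> i)) \<and> (\<forall>x y. dist (T0 x) (T0 y) = dist x y) \<and> T0 0 = 0 \<and> surj T0"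
      by (elim exE)
    show thesis
    proof (rule that[of T0])
      show "T0 (cen m i) = cen m' (\<theta> i)" if "i \<in> \<D> - {E0}" for i using T0[THEN conjunct1, THEN bspec, OF that] .
      show "dist (T0 x) (T0 y) = dist x y" for x y using T0 by simp
      show "T0 0 = 0" "surj T0" using T0 by (simp_all only:)
    qed
  qed
  have Tb: "T z \<in> ball (T c) r \<longleftrightarrow> z \<in> ball c r" for z c r using T(2) by simp
  interpret dA: disk_packing "\<D> - {E0}" "cen m" "rad m" "m ` S" by (rule A.picture_packing[OF m(1)])
  interpret dB: disk_packing "\<D>' - {E0'}" "cen m'" "rad m'" "m' ` S'" by (rule B.picture_packing[OF m'(1)])
  \<comment> \<open>An isometry that fixes 0 and matches all disks also matches what they leave of
    the closed unit disk, that is, the two pictures.\<close>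
  have TS: "T z \<in> m' ` S' \<longleftrightarrow> z \<in> m ` S" for z
  proof -
    have "T z \<in> cball 0 1 \<longleftrightarrow> z \<in> cball 0 1" using T(2)[of 0 z] T(3) by simp
    moreover have "T z \<in> (\<Union>i\<in>\<D>' - {E0'}. ball (cen m' i) (rad m' i)) \<longleftrightarrow> z \<in> (\<Union>i\<in>\<D> - {E0}. ball (cen m i) (rad m i))"
    proof
      assume "T z \<in> (\<Union>i\<in>\<D>' - {E0'}. ball (cen m' i) (rad m' i))"
      then obtain i' where i': "i' \<in> \<D>'" "i' \<noteq> E0'" "T z \<in> ball (cen m' i') (rad m' i')" by blast
      then obtain i where i: "i \<in> \<D> - {E0}" "\<theta> i = i'" using \<theta>surj by blast
      then have "T z \<in> ball (T (cen m i)) (rad m i)" using i' T(1)[OF i(1)] req[of i] by auto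
      then show "z \<in> (\<Union>i\<in>\<D> - {E0}. ball (cen m i) (rad m i))" using Tb i(1) by blast
    next
      assume "z \<in> (\<Union>i\<in>\<D> - {E0}. ball (cen m i) (rad m i))"
      then obtain i where i: "i \<in> \<D> - {E0}" "z \<in> ball (cen m i) (rad m i)" by blast
      then have "T z \<in> ball (cen m' (\<theta> i)) (rad m' (\<theta> i))" using Tb[of z "cen m i" "rad m i"] T(1)[OF i(1)] req[of i] by auto
      then show "T z \<in> (\<Union>i\<in>\<D>' - {E0'}. ball (cen m' i) (rad m' i))" using \<theta>[of i] i(1) by blast
    qed
    ultimately show ?thesis unfolding dA.X_def dB.X_def by blast
  qed
  note Cm = chartD[OF pictureD(1)[OF m(1)]] and Cm' = chartD[OF pictureD(1)[OF m'(1)]]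
  define h where "h = inv_into (S2 - {q0'}) m'"
  have h: "h z \<in> S2" "h z \<noteq> q0'" "m' (h z) = z" for z
  proof -
    have "z \<in> m' ` (S2 - {q0'})" using Cm'(3) by (simp add: bij_betw_def)
    then show "h z \<in> S2" "h z \<noteq> q0'" "m' (h z) = z" unfolding h_def using inv_into_into f_inv_into_f by (metis DiffD1, metis DiffD2 singletonI, metis)
  qed
  have hm: "h (m' x) = x" if "x \<in> S2" "x \<noteq> q0'" for x unfolding h_def using Cm'(4) that by (simp add: inv_into_f_f)
  define F where "F x = (if x = q0 then q0' else h (T (m x)))" for x
  have FS2: "F x \<in> S2" for x using h(1) Cm'(1) by (simp add: F_def)
  have Fq: "F x \<noteq> q0'" if "x \<noteq> q0" for x using h(2) that by (simp add: F_def)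
  have kp: "k > 0" "k' > 0" using Cm(2) Cm'(2) by auto
  \<comment> \<open>Division of the two chart formulas gives the weight away from the pole; the
    value at \<open>q0\<close> is forced by pairs containing the pole.\<close>
  define w where "w x = (if x = q0 then sqrt (k' / k) else sqrt (k / k') * dist (F x) q0' / dist x q0)" for x
  have wp: "w x > 0" for x using kp Fq by (auto simp: w_def)
  have main: "dist (F x) (F y) = w x * w y * dist x y" if x: "x \<in> S2" "x \<noteq> q0" and y: "y \<in> S2" "y \<noteq> q0" for x y
  proof -
    have Fx: "F x = h (T (m x))" "F y = h (T (m y))" using x y by (auto simp: F_def)
    have "dist (m' (F x)) (m' (F y)) = dist (m x) (m y)" unfolding Fx h(3) T(2) ..
    then have "k' * dist (F x) (F y) / (dist (F x) q0' * dist (F y) q0') = k * dist x y / (dist x q0 * dist y q0)"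
      using Cm(6)[OF x y] Cm'(6)[OF FS2 Fq[OF x(2)] FS2 Fq[OF y(2)]] by simp
    then have "dist (F x) (F y) = (k / k') * (dist (F x) q0' / dist x q0) * (dist (F y) q0' / dist y q0) * dist x y"
      using kp Fq x y by (simp add: field_simps)
    also have "\<dots> = (sqrt (k / k') * dist (F x) q0' / dist x q0) * (sqrt (k / k') * dist (F y) q0' / dist y q0) * dist x y"
    proof -
      have gen: "(t * t) * (A / a) * (B / b) * d = (t * A / a) * (t * B / b) * d" for t A a B b d :: real by simp
      have "k / k' = sqrt (k / k') * sqrt (k / k')" using kp by simp
      then show ?thesis by (metis gen)
    qed
    finally show ?thesis unfolding w_def if_not_P[OF x(2)] if_not_P[OF y(2)] .
  qed
  have sq: "sqrt (k / k') * sqrt (k' / k) = 1" using kp by (simp flip: real_sqrt_mult)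
  have main2: "dist (F x) (F q0) = w x * w q0 * dist x q0" if x: "x \<in> S2" "x \<noteq> q0" for x
  proof -
    have "w x * w q0 * dist x q0 = (sqrt (k / k') * sqrt (k' / k)) * dist (F x) q0'" using x by (simp add: w_def)
    then show ?thesis using sq by (simp add: F_def)
  qed
  have dF: "dist (F x) (F y) = w x * w y * dist x y" if "x \<in> S2" "y \<in> S2" for x y
    using main[of x y] main2[of x] main2[of y] that by (cases "x = q0"; cases "y = q0") (auto simp: dist_commute mult_ac)
  have inj: "inj_on F S2"
  proof (rule inj_onI)
    fix x y assume "x \<in> S2" "y \<in> S2" "F x = F y"
    then have "w x * w y * dist x y = 0" using dF[of x y] by simp
    then show "x = y" using wp[of x] wp[of y] by simp
  qed
  have pre: "\<exists>x. x \<in> S2 \<and> x \<noteq> q0 \<and> T (m x) = m' y" for y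
  proof -
    obtain z where "T z = m' y" using T(4) by (metis surjD)
    moreover obtain x where "x \<in> S2 - {q0}" "m x = z" using Cm(5) by blast
    ultimately show ?thesis by auto
  qed
  have surj: "F ` S2 = S2"
  proof (intro equalityI subsetI)
    fix y assume "y \<in> F ` S2" then show "y \<in> S2" using FS2 by blast
  next
    fix y assume y: "y \<in> S2"
    show "y \<in> F ` S2"
    proof (cases "y = q0'")
      case True then show ?thesis using Cm(1) by (intro image_eqI[of _ _ q0]) (auto simp: F_def)
    next
      case False
      obtain x where x: "x \<in> S2" "x \<noteq> q0" "T (m x) = m' y" using pre by blast
      then have "F x = y" using hm[OF y False] by (simp add: F_def)
      then show ?thesis using x by blast
    qed
  qed
  have "Mob F" unfolding Mob_def bij_betw_def using inj surj wp dF by blast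
  moreover have "F ` S = S'"
  proof (intro equalityI subsetI)
    fix y assume "y \<in> F ` S"
    then obtain x where x: "x \<in> S" "y = F x" by blast
    have xq: "x \<in> S2" "x \<noteq> q0" using A.picture_S(1)[OF m(1) x(1)] by auto
    have "T (m x) \<in> m' ` S'" using TS x(1) by blast
    then obtain y' where y': "y' \<in> S'" "T (m x) = m' y'" by blast
    have "y = y'" using x(2) xq y' hm[of y'] B.picture_S(1)[OF m'(1) y'(1)] by (simp add: F_def)
    then show "y \<in> S'" using y' by simp
  next
    fix y assume y: "y \<in> S'"
    have yq: "y \<in> S2" "y \<noteq> q0'" using B.picture_S(1)[OF m'(1) y] by auto
    obtain x where x: "x \<in> S2" "x \<noteq> q0" "T (m x) = m' y" using pre by blast
    then have "m x \<in> m ` S" using TS[of "m x"] y by auto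
    then obtain x' where x': "x' \<in> S" "m x = m x'" by blast
    have "x = x'" using A.picture_inj[OF m(1) x(1) _ x(2) _ x'(2)] A.picture_S(1)[OF m(1) x'(1)] by blast
    moreover have "F x = y" using x hm[OF yq] by (simp add: F_def)
    ultimately show "y \<in> F ` S" using x'(1) by blast
  qed
  ultimately show ?thesis by blast
qed

end

section \<open>Peripheral circles\<close>

text \<open>The connected set \<open>X - path_image g\<close> lies on one side of the Jordan curve.
  The other side misses \<open>X\<close>, so it is a component of the complement of
  \<open>X\<close>, that is, one of the disks or the exterior; its frontier is the curve.\<close>

lemma (in disk_packing) curve_is_boundary:
  assumes g: "simple_path g" "pathfinish g = pathstart g" "path_image g \<subseteq> X"
    and conn: "connected (X - path_image g)"
  shows "path_image g = sphere 0 1 \<or> (\<exists>i\<in>I. path_image g = sphere (c i) (r i))"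
proof -
  let ?J = "path_image g"
  note J = Jordan_inside_outside[OF g(1,2)]
  have J': "open (inside ?J)" "open (outside ?J)" "connected (inside ?J)" "connected (outside ?J)" "inside ?J \<noteq> {}"
    "bounded (inside ?J)" "\<not> bounded (outside ?J)" "inside ?J \<inter> outside ?J = {}" "inside ?J \<union> outside ?J = - ?J"
    "frontier (inside ?J) = ?J" "frontier (outside ?J) = ?J" using J by blast+
  let ?W = "- cball (0::complex) 1"
  have conW: "connected ?W" by (rule connected_complement_bounded_convex) auto
  \<comment> \<open>A connected set that misses \<open>X\<close> cannot cross a frontier contained
    in \<open>X\<close>.\<close>
  have absorb: "W \<subseteq> V" if "connected W" "W \<inter> V \<noteq> {}" "frontier V \<subseteq> X" "W \<inter> X = {}" for W V
    using connected_Int_frontier[OF that(1,2)] that(3,4) by blast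
  have frW: "frontier ?W \<subseteq> X" "frontier ?W = sphere 0 1" using unit_sphere_X by (auto simp: frontier_complement)
  have WX: "?W \<inter> X = {}" by (auto simp: X_def)
  have bX: "ball (c i) (r i) \<inter> X = {}" if "i \<in> I" for i using that by (auto simp: X_def)
  have frb: "frontier (ball (c i) (r i)) = sphere (c i) (r i)" "frontier (ball (c i) (r i)) \<subseteq> X" if "i \<in> I" for i
    using rpos[OF that] sphere_X[OF that] by auto
  have comp: "V = ?W \<or> (\<exists>i\<in>I. V = ball (c i) (r i))"
    if V: "connected V" "V \<noteq> {}" "V \<inter> X = {}" "frontier V = ?J" for V
  proof -
    obtain z where z: "z \<in> V" using V(2) by blast
    then have "z \<notin> X" using V(3) by blast
    then consider "z \<in> ?W" | i where "i \<in> I" "z \<in> ball (c i) (r i)" unfolding X_def by blast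
    then show ?thesis
    proof cases
      case 1
      then have ne: "?W \<inter> V \<noteq> {}" "V \<inter> ?W \<noteq> {}" using z by blast+
      have "?W \<subseteq> V" by (rule absorb[OF conW ne(1) _ WX]) (use V(4) g(3) in simp)
      moreover have "V \<subseteq> ?W" by (rule absorb[OF V(1) ne(2) frW(1) V(3)])
      ultimately show ?thesis by blast
    next
      case 2
      then have ne: "ball (c i) (r i) \<inter> V \<noteq> {}" "V \<inter> ball (c i) (r i) \<noteq> {}" using z by blast+
      have "ball (c i) (r i) \<subseteq> V" by (rule absorb[OF connected_ball ne(1) _ bX[OF 2(1)]]) (use V(4) g(3) in simp)
      moreover have "V \<subseteq> ball (c i) (r i)" by (rule absorb[OF V(1) ne(2) frb(2)[OF 2(1)] V(3)])
      ultimately show ?thesis using 2(1) by blast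
    qed
  qed
  have fin: ?thesis if V: "connected V" "V \<noteq> {}" "V \<inter> X = {}" "frontier V = ?J" for V
    using comp[OF V] V(4) frW(2) frb(1) by metis
  have "X - ?J \<subseteq> inside ?J \<union> outside ?J" using J'(9) by blast
  then have "inside ?J \<inter> (X - ?J) = {} \<or> outside ?J \<inter> (X - ?J) = {}"
    using connectedD[OF conn J'(1,2)] J'(8) by blast
  then show ?thesis
  proof
    assume "inside ?J \<inter> (X - ?J) = {}"
    then have "inside ?J \<inter> X = {}" using J'(9) by blast
    then show ?thesis using fin[of "inside ?J"] J' by blast
  next
    assume "outside ?J \<inter> (X - ?J) = {}"
    then have "outside ?J \<inter> X = {}" using J'(9) by blast
    moreover have "outside ?J \<noteq> {}" using J'(7) by auto
    ultimately show ?thesis using fin[of "outside ?J"] J' by blast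
  qed
qed

text \<open>In a picture the image of a peripheral circle is a simple closed curve whose complement
  in the image of \<open>S'\<close> is connected, and \<open>curve_is_boundary\<close> recognises
  it. The unit circle stands for the outer disk \<open>D1\<close>.\<close>

lemma circle_to_circle:
  assumes A: "schottky S \<D>" and B: "schottky S' \<D>'"
    and f: "continuous_on S f" "bij_betw f S S'" and D: "D \<in> \<D>"
  shows "\<exists>D'\<in>\<D>'. f ` circ D = circ D'"
proof -
  interpret A: schottky S \<D> by (rule A)
  interpret B: schottky S' \<D>' by (rule B)
  obtain m p k where P: "picture \<D> m p k D" by (rule A.picture_exists[OF D])
  obtain D1 D2 where D1: "D1 \<in> \<D>'" by (rule B.two_disks)
  obtain m' p' k' where P': "picture \<D>' m' p' k' D1" by (rule B.picture_exists[OF D1])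
  interpret dp: disk_packing "\<D>' - {D1}" "cen m'" "rad m'" "m' ` S'" by (rule B.picture_packing[OF P'])
  have cS: "circ D \<subseteq> S" by (rule A.circ_S[OF D])
  have mc: "m ` circ D = sphere 0 1" using pictureD(5)[OF P] .
  define \<phi> where "\<phi> = (\<lambda>z. m' (f (inv_into S m z)))"
  have injm: "inj_on m S" by (rule A.picture_inj_S[OF P])
  have injm': "inj_on m' S'" by (rule B.picture_inj_S[OF P'])
  have fS: "f x \<in> S'" if "x \<in> S" for x using f(2) that by (auto simp: bij_betw_def)
  have injf: "inj_on f S" using f(2) by (simp add: bij_betw_def)
  have \<phi>m: "\<phi> (m x) = m' (f x)" if "x \<in> S" for x unfolding \<phi>_def using injm that by simp
  have ci: "continuous_on (m ` S) (inv_into S m)"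
    by (rule continuous_on_inv[OF A.picture_cont_S[OF P] A.compact_S]) (simp add: injm)
  have s1: "inv_into S m ` m ` S \<subseteq> S" using injm by (simp add: image_subset_iff)
  have c1: "continuous_on (m ` S) (\<lambda>z. f (inv_into S m z))" by (rule continuous_on_compose2[OF f(1) ci s1])
  have s2: "(\<lambda>z. f (inv_into S m z)) ` m ` S \<subseteq> S'" using injm fS by (simp add: image_subset_iff)
  have c2: "continuous_on (m ` S) \<phi>" unfolding \<phi>_def by (rule continuous_on_compose2[OF B.picture_cont_S[OF P'] c1 s2])
  have sph: "sphere 0 1 \<subseteq> m ` S" using mc cS by blast
  have inj\<phi>: "inj_on \<phi> (sphere 0 1)"
  proof (rule inj_onI)
    fix z w assume zw: "z \<in> sphere 0 1" "w \<in> sphere 0 1" "\<phi> z = \<phi> w"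
    obtain x y where xy: "x \<in> S" "y \<in> S" "z = m x" "w = m y" using zw(1,2) sph by blast
    then have "m' (f x) = m' (f y)" using zw(3) \<phi>m by simp
    then have "f x = f y" using injm' fS xy by (auto dest: inj_onD)
    then show "z = w" using injf xy by (auto dest: inj_onD)
  qed
  define g where "g = \<phi> \<circ> circlepath 0 1"
  have pi: "path_image (circlepath 0 1) = sphere 0 1" by simp
  have img: "path_image g = m' ` f ` circ D"
  proof -
    have "path_image g = \<phi> ` sphere 0 1" unfolding g_def path_image_compose pi ..
    also have "\<dots> = \<phi> ` m ` circ D" using mc by simp
    also have "\<dots> = m' ` f ` circ D" using \<phi>m cS by (force simp: image_image)
    finally show ?thesis .
  qed
  have sg: "simple_path g" unfolding g_def
    by (rule simple_path_continuous_image) (use continuous_on_subset[OF c2 sph] inj\<phi> pi in \<open>auto simp: simple_path_circlepath\<close>)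
  have cg: "pathfinish g = pathstart g" by (simp add: g_def pathfinish_compose pathstart_compose)
  have fc: "f ` circ D \<subseteq> S'" using fS cS by blast
  have sub: "path_image g \<subseteq> m' ` S'" unfolding img using fc by blast
  have "connected (m' ` S' - path_image g)"
  proof -
    have "S' - f ` circ D = f ` (S - circ D)"
      using f(2) cS inj_on_image_set_diff[OF injf, of S "circ D"] by (simp add: bij_betw_def)
    moreover have "m' ` (S' - f ` circ D) = m' ` S' - m' ` f ` circ D"
      by (rule inj_on_image_set_diff[OF injm']) (use fc in auto)
    ultimately have "m' ` S' - path_image g = m' ` f ` (S - circ D)" unfolding img by simp
    moreover have "connected (f ` (S - circ D))"
      by (intro connected_continuous_image continuous_on_subset[OF f(1)] A.connected_S_minus_circ[OF D]) auto
    moreover have "continuous_on (f ` (S - circ D)) m'"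
      by (rule continuous_on_subset[OF B.picture_cont_S[OF P']]) (use fS in auto)
    ultimately show ?thesis using connected_continuous_image by metis
  qed
  then have "path_image g = sphere 0 1 \<or> (\<exists>i\<in>\<D>' - {D1}. path_image g = sphere (cen m' i) (rad m' i))"
    by (rule dp.curve_is_boundary[OF sg cg sub])
  then have "\<exists>i\<in>\<D>'. m' ` f ` circ D = m' ` circ i"
  proof
    assume "path_image g = sphere 0 1"
    then show ?thesis using img pictureD(5)[OF P'] D1 by (intro bexI[of _ D1]) simp_all
  next
    assume "\<exists>i\<in>\<D>' - {D1}. path_image g = sphere (cen m' i) (rad m' i)"
    then obtain i where "i \<in> \<D>'" "i \<noteq> D1" "path_image g = sphere (cen m' i) (rad m' i)" by blast
    then show ?thesis using img B.picture_disk(3)[OF P', of i] by (intro bexI[of _ i]) simp_all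
  qed
  then obtain i where i: "i \<in> \<D>'" "m' ` f ` circ D = m' ` circ i" by blast
  have "f ` circ D = circ i" using inj_on_image_eq_iff[OF injm' fc B.circ_S[OF i(1)]] i(2) by blast
  then show ?thesis using i(1) by blast
qed

text \<open>Apply \<open>circle_to_circle\<close> to \<open>f\<close> and to its inverse, continuous
  by compactness. A disk is determined by its circle, because closures of distinct disks are
  disjoint.\<close>

lemma schottky_disk_correspondence:
  assumes A: "schottky S \<D>" and B: "schottky S' \<D>'" and f: "continuous_on S f" "bij_betw f S S'"
  obtains \<sigma> where "bij_betw \<sigma> \<D> \<D>'" "\<And>D. D \<in> \<D> \<Longrightarrow> f ` circ D = circ (\<sigma> D)"
proof -
  interpret A: schottky S \<D> by (rule A)
  interpret B: schottky S' \<D>' by (rule B)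
  have "\<forall>D\<in>\<D>. \<exists>D'. D' \<in> \<D>' \<and> f ` circ D = circ D'" using circle_to_circle[OF A B f] by blast
  then obtain \<sigma> where \<sigma>: "\<And>D. D \<in> \<D> \<Longrightarrow> \<sigma> D \<in> \<D>'" "\<And>D. D \<in> \<D> \<Longrightarrow> f ` circ D = circ (\<sigma> D)" by metis
  define h where "h = inv_into S f"
  have injf: "inj_on f S" "f ` S = S'" using f(2) by (auto simp: bij_betw_def)
  have h: "continuous_on S' h"
    using continuous_on_inv[OF f(1) A.compact_S, of h] injf by (simp add: h_def)
  have hb: "bij_betw h S' S" unfolding h_def by (rule bij_betw_inv_into[OF f(2)])
  have ne: "circ D \<noteq> {}" if "D \<in> \<D>" for D by (rule round_disk_obtain[OF A.round[OF that]]) blast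
  have ne': "circ D \<noteq> {}" if "D \<in> \<D>'" for D by (rule round_disk_obtain[OF B.round[OF that]]) blast
  have uA: "D = E" if "D \<in> \<D>" "E \<in> \<D>" "circ D = circ E" for D E
    using ne[OF that(1)] A.disk_unique[OF that(1,2)] that(3) by (auto simp: circ_def)
  have uB: "D = E" if "D \<in> \<D>'" "E \<in> \<D>'" "circ D = circ E" for D E
    using ne'[OF that(1)] B.disk_unique[OF that(1,2)] that(3) by (auto simp: circ_def)
  have "inj_on \<sigma> \<D>"
  proof (rule inj_onI)
    fix D E assume DE: "D \<in> \<D>" "E \<in> \<D>" "\<sigma> D = \<sigma> E"
    then have "f ` circ D = f ` circ E" using \<sigma>(2) by simp
    then have "circ D = circ E" using inj_on_image_eq_iff[OF injf(1) A.circ_S[OF DE(1)] A.circ_S[OF DE(2)]] by blast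
    then show "D = E" using uA DE by blast
  qed
  moreover have "\<sigma> ` \<D> = \<D>'"
  proof (intro equalityI subsetI)
    fix D' assume "D' \<in> \<sigma> ` \<D>" then show "D' \<in> \<D>'" using \<sigma>(1) by blast
  next
    fix D' assume D': "D' \<in> \<D>'"
    obtain D where D: "D \<in> \<D>" "h ` circ D' = circ D" using circle_to_circle[OF B A h hb D'] by blast
    have "f ` h ` circ D' = circ D'" using B.circ_S[OF D'] injf unfolding h_def image_image by (force simp: f_inv_into_f)
    then have "circ (\<sigma> D) = circ D'" using \<sigma>(2)[OF D(1)] D(2) by simp
    then have "\<sigma> D = D'" using uB[OF \<sigma>(1)[OF D(1)] D'] by blast
    then show "D' \<in> \<sigma> ` \<D>" using D(1) by blast
  qed
  ultimately show ?thesis using that \<sigma>(2) by (simp add: bij_betw_def)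
qed

section \<open>From a quasisymmetry of weak tangents to a pair of Schottky sets\<close>

lemma gauge_zero:
  fixes \<eta> :: "real \<Rightarrow> real"
  assumes "homeomorphism {0..} {0..} \<eta> \<eta>'"
  shows "\<eta> 0 = 0" "continuous_on {0..} \<eta>" "\<And>t. t \<ge> 0 \<Longrightarrow> \<eta> t \<ge> 0"
proof -
  show c: "continuous_on {0..} \<eta>" using assms homeomorphism_def by blast
  have im: "\<eta> ` {0..} = {0..}" using assms homeomorphism_image1 by blast
  then show nn: "\<eta> t \<ge> 0" if "t \<ge> 0" for t using that by force
  have inj: "inj_on \<eta> {0..}" by (rule inj_on_inverseI[of _ \<eta>']) (use assms homeomorphism_apply1 in blast)
  show "\<eta> 0 = 0"
  proof (rule ccontr)
    assume "\<eta> 0 \<noteq> 0"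
    then have pos: "\<eta> 0 > 0" using nn[of 0] by simp
    \<comment> \<open>Removing the end point 0 from the half line leaves it connected, whereas
      removing the interior point \<open>\<eta> 0\<close> does not.\<close>
    have "connected (\<eta> ` {0<..})" by (intro connected_continuous_image continuous_on_subset[OF c]) auto
    moreover have e: "\<eta> ` {0<..} = {0..} - {\<eta> 0}"
    proof -
      have "{0<..} = {0..} - {0::real}" by auto
      then show ?thesis using inj_on_image_set_diff[OF inj, of "{0..}" "{0}"] im by simp
    qed
    moreover have "0 \<in> \<eta> ` {0<..}" "\<eta> 0 + 1 \<in> \<eta> ` {0<..}" unfolding e using pos by auto
    ultimately have "\<eta> 0 \<in> \<eta> ` {0<..}" using pos unfolding connected_iff_interval
      by (metis less_add_one less_imp_le)
    then show False unfolding e by simp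
  qed
qed

text \<open>In a quotient of tangent distances from a common point the scale and the distance of
  that point to the pole cancel. What remains is the cross-ratio inequality \<open>QS\<close> with
  \<open>a\<close> as fourth point; it gives continuity of the extension, also at \<open>a\<close>,
  and the distortion bound.\<close>

lemma quasisymmetric_schottky_pair:
  assumes A: "schottky_group S \<D> G \<kappa>" and B: "schottky_group S' \<D>' G' \<kappa>'"
    and a: "a \<in> S" and a': "a' \<in> S'" and s: "s > 0" and s': "s' > 0"
    and \<phi>: "bij_betw \<phi> (S - {a}) (S' - {a'})" and \<eta>: "homeomorphism {0::real..} {0..} \<eta> \<eta>'"
    and qs: "\<And>x y z. x \<in> S - {a} \<Longrightarrow> y \<in> S - {a} \<Longrightarrow> z \<in> S - {a} \<Longrightarrow> x \<noteq> z \<Longrightarrow>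
       (s' * dist (\<phi> x) (\<phi> y) / (dist (\<phi> x) a' * dist (\<phi> y) a')) / (s' * dist (\<phi> x) (\<phi> z) / (dist (\<phi> x) a' * dist (\<phi> z) a'))
       \<le> \<eta> ((s * dist x y / (dist x a * dist y a)) / (s * dist x z / (dist x a * dist z a)))"
  shows "\<exists>f \<sigma>. schottky_pair S \<D> G \<kappa> S' \<D>' G' \<kappa>' f \<sigma>"
proof -
  interpret A: schottky_group S \<D> G \<kappa> by (rule A)
  interpret B: schottky_group S' \<D>' G' \<kappa>' by (rule B)
  note \<eta>0 = gauge_zero[OF \<eta>]
  have \<phi>in: "\<phi> x \<in> S'" "\<phi> x \<noteq> a'" if "x \<in> S" "x \<noteq> a" for x using bij_betwE[OF \<phi>] that by auto
  have \<phi>inj: "\<phi> x \<noteq> \<phi> z" if "x \<in> S" "x \<noteq> a" "z \<in> S" "z \<noteq> a" "x \<noteq> z" for x z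
    using \<phi> that by (auto simp: bij_betw_def dest: inj_onD)
  have le2: "dist x y \<le> 2" if "x \<in> S" "y \<in> S" for x y using S2_dist_le A.S_S2 that by blast
  have le2': "dist x y \<le> 2" if "x \<in> S'" "y \<in> S'" for x y using S2_dist_le B.S_S2 that by blast
  have QS: "dist (\<phi> x) (\<phi> y) * dist (\<phi> z) a' \<le> \<eta> (dist x y * dist z a / (dist x z * dist y a)) * (dist (\<phi> x) (\<phi> z) * dist (\<phi> y) a')"
    if x: "x \<in> S" "x \<noteq> a" and y: "y \<in> S" "y \<noteq> a" and z: "z \<in> S" "z \<noteq> a" and xz: "x \<noteq> z" for x y z
  proof -
    have p: "dist x a > 0" "dist y a > 0" "dist z a > 0" "dist x z > 0" using x y z xz by auto
    have p': "dist (\<phi> x) a' > 0" "dist (\<phi> y) a' > 0" "dist (\<phi> z) a' > 0" "dist (\<phi> x) (\<phi> z) > 0"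
      using \<phi>in x y z \<phi>inj[OF x z xz] by auto
    have e1: "(t * A / (X * Y)) / (t * C / (X * Z)) = A * Z / (C * Y)" if "t > 0" "X > 0" "Y > 0" "Z > 0" "C > 0" for t A C X Y Z :: real
      using that by (simp add: field_simps)
    have "dist (\<phi> x) (\<phi> y) * dist (\<phi> z) a' / (dist (\<phi> x) (\<phi> z) * dist (\<phi> y) a') \<le> \<eta> (dist x y * dist z a / (dist x z * dist y a))"
      using qs[of x y z] x y z xz unfolding e1[OF s' p'(1,2,3,4)] e1[OF s p(1,2,3,4)] by auto
    then show ?thesis using p' by (simp add: pos_divide_le_eq)
  qed
  define f where "f x = (if x = a then a' else \<phi> x)" for x
  have fS: "f x \<in> S'" if "x \<in> S" for x using \<phi>in a' that by (simp add: f_def)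
  have fbij: "bij_betw f S S'"
  proof -
    have "bij_betw f ({a} \<union> (S - {a})) ({a'} \<union> (S' - {a'}))"
    proof (rule bij_betw_combine)
      show "bij_betw f {a} {a'}" by (simp add: bij_betw_def f_def)
      show "bij_betw f (S - {a}) (S' - {a'})" using \<phi> by (rule bij_betw_cong[THEN iffD1, rotated]) (simp add: f_def)
    qed auto
    moreover have "{a} \<union> (S - {a}) = S" "{a'} \<union> (S' - {a'}) = S'" using a a' by auto
    ultimately show ?thesis by simp
  qed
  have other: "\<exists>z\<in>S. z \<noteq> a \<and> z \<noteq> x" for x
  proof -
    obtain t0 where t0: "t0 > 0" "\<And>t. 0 < t \<Longrightarrow> t \<le> t0 \<Longrightarrow> \<exists>y\<in>S. dist a y = t" using A.scale_points a by blast
    obtain y where y: "y \<in> S" "dist a y = t0" using t0(2)[of t0] t0(1) by auto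
    obtain z where z: "z \<in> S" "dist a z = t0 / 2" using t0(2)[of "t0 / 2"] t0(1) by auto
    have "y \<noteq> a" "z \<noteq> a" "y \<noteq> z" using y z t0(1) by auto
    then show ?thesis using y z by metis
  qed
  have \<eta>lim: "((\<lambda>y. K * \<eta> (g y)) \<longlongrightarrow> 0) F" if "(g \<longlongrightarrow> 0) F" "eventually (\<lambda>y. 0 \<le> g y) F" for g K and F :: "R3 filter"
  proof -
    have "((\<lambda>y. \<eta> (g y)) \<longlongrightarrow> \<eta> 0) F"
      by (rule continuous_on_tendsto_compose[OF \<eta>0(2) that(1)]) (use that(2) in auto)
    from tendsto_mult_left[OF this, of K] show ?thesis using \<eta>0(1) by simp
  qed
  have fcont: "continuous_on S f"
    unfolding continuous_on_def
  proof
    fix x assume x: "x \<in> S"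
    show "(f \<longlongrightarrow> f x) (at x within S)"
    proof (cases "x = a")
      case False
      obtain z where z: "z \<in> S" "z \<noteq> a" "z \<noteq> x" using other by blast
      have pz: "dist (\<phi> z) a' > 0" using \<phi>in z by simp
      define K where "K = 4 / dist (\<phi> z) a'"
      define g where "g y = dist x y * dist z a / (dist x z * dist y a)" for y
      have "(g \<longlongrightarrow> dist x x * dist z a / (dist x z * dist x a)) (at x within S)"
        unfolding g_def by (intro tendsto_intros) (use z False in auto)
      then have g0: "(g \<longlongrightarrow> 0) (at x within S)" by simp
      have "eventually (\<lambda>y. 0 \<le> g y) (at x within S)" by (simp add: g_def)
      from \<eta>lim[OF g0 this] have "((\<lambda>y. K * \<eta> (g y)) \<longlongrightarrow> 0) (at x within S)" .
      moreover have "eventually (\<lambda>y. norm (dist (f y) (f x)) \<le> K * \<eta> (g y)) (at x within S)"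
      proof -
        have "eventually (\<lambda>y. y \<noteq> a) (at x within S)" using False tendsto_imp_eventually_ne[OF tendsto_ident_at, of x a S] by blast
        moreover have "eventually (\<lambda>y. y \<in> S) (at x within S)" by (simp add: eventually_at_filter)
        ultimately show ?thesis
        proof eventually_elim
          case (elim y)
          have "dist (\<phi> x) (\<phi> y) * dist (\<phi> z) a' \<le> \<eta> (g y) * (dist (\<phi> x) (\<phi> z) * dist (\<phi> y) a')"
            unfolding g_def using QS[of x y z] x z elim False by auto
          also have "\<dots> \<le> \<eta> (g y) * (2 * 2)"
            using \<phi>in x z elim False le2' a' by (intro mult_left_mono mult_mono \<eta>0(3)) (auto simp: g_def)
          finally have "dist (\<phi> x) (\<phi> y) \<le> K * \<eta> (g y)" using pz by (simp add: K_def field_simps)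
          then show ?case using False elim by (simp add: f_def dist_commute)
        qed
      qed
      ultimately have "((\<lambda>y. dist (f y) (f x)) \<longlongrightarrow> 0) (at x within S)" by (rule Lim_null_comparison[rotated])
      then show ?thesis by (subst tendsto_dist_iff)
    next
      case True
      obtain w where w: "w \<in> S" "w \<noteq> a" using other by blast
      obtain z where z: "z \<in> S" "z \<noteq> a" "z \<noteq> w" using other by blast
      have pz: "dist (\<phi> w) (\<phi> z) > 0" using \<phi>inj w z by auto
      define K where "K = 4 / dist (\<phi> w) (\<phi> z)"
      \<comment> \<open>At the pole the moving point \<open>y\<close> takes the third place in
        \<open>QS\<close>, so that its distance to \<open>a\<close> is the factor tending to
        0.\<close>
      define g where "g y = dist w z * dist y a / (dist w y * dist z a)" for y
      have "(g \<longlongrightarrow> dist w z * dist a a / (dist w a * dist z a)) (at a within S)"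
        unfolding g_def by (intro tendsto_intros) (use w z in auto)
      then have g0: "(g \<longlongrightarrow> 0) (at a within S)" by simp
      have "eventually (\<lambda>y. 0 \<le> g y) (at a within S)" by (simp add: g_def)
      from \<eta>lim[OF g0 this] have "((\<lambda>y. K * \<eta> (g y)) \<longlongrightarrow> 0) (at a within S)" .
      moreover have "eventually (\<lambda>y. norm (dist (f y) a') \<le> K * \<eta> (g y)) (at a within S)"
      proof -
        have "eventually (\<lambda>y. y \<noteq> w) (at a within S)" using w(2) tendsto_imp_eventually_ne[OF tendsto_ident_at, of a w S] by blast
        moreover have "eventually (\<lambda>y. y \<in> S \<and> y \<noteq> a) (at a within S)" by (simp add: eventually_at_filter)
        ultimately show ?thesis
        proof eventually_elim
          case (elim y)
          have "dist (\<phi> w) (\<phi> z) * dist (\<phi> y) a' \<le> \<eta> (g y) * (dist (\<phi> w) (\<phi> y) * dist (\<phi> z) a')"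
            unfolding g_def using QS[of w z y] w z elim by auto
          also have "\<dots> \<le> \<eta> (g y) * (2 * 2)"
            using \<phi>in w z elim le2' a' by (intro mult_left_mono mult_mono \<eta>0(3)) (auto simp: g_def)
          finally have "dist (\<phi> y) a' \<le> K * \<eta> (g y)" using pz by (simp add: K_def field_simps)
          then show ?case using elim by (simp add: f_def)
        qed
      qed
      ultimately have "((\<lambda>y. dist (f y) a') \<longlongrightarrow> 0) (at a within S)" by (rule Lim_null_comparison[rotated])
      then have "(f \<longlongrightarrow> a') (at a within S)" by (subst tendsto_dist_iff)
      then show ?thesis using True by (simp add: f_def)
    qed
  qed
  obtain \<sigma> where \<sigma>: "bij_betw \<sigma> \<D> \<D>'" "\<And>D. D \<in> \<D> \<Longrightarrow> f ` circ D = circ (\<sigma> D)"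
    by (rule schottky_disk_correspondence[OF A.schottky_axioms B.schottky_axioms fcont fbij]) blast
  from A.porosity obtain C0 where C00: "C0 > 0 \<and> (\<exists>\<rho>0>0. \<forall>x\<in>S. \<forall>\<rho>. 0 < \<rho> \<and> \<rho> < \<rho>0 \<longrightarrow>
     (\<exists>D\<in>\<D>. closure D \<subseteq> ball x \<rho> \<and> (\<exists>u\<in>circ D. \<exists>v\<in>circ D. \<rho> \<le> C0 * dist u v)))" by (rule exE)
  from conjunct2[OF C00] obtain \<rho>1 where R00: "\<rho>1 > 0 \<and> (\<forall>x\<in>S. \<forall>\<rho>. 0 < \<rho> \<and> \<rho> < \<rho>1 \<longrightarrow>
     (\<exists>D\<in>\<D>. closure D \<subseteq> ball x \<rho> \<and> (\<exists>u\<in>circ D. \<exists>v\<in>circ D. \<rho> \<le> C0 * dist u v)))" by (rule exE)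
  have C0: "C0 > 0" "\<rho>1 > 0" using C00 R00 by blast+
  note por = conjunct2[OF R00, THEN bspec, THEN spec, THEN mp, OF _ conjI]
  have err: "\<exists>C>0. \<exists>\<rho>0>0. \<forall>x\<in>S. \<delta> \<le> dist x a \<longrightarrow> (\<forall>\<rho>. 0 < \<rho> \<and> \<rho> < \<rho>0 \<longrightarrow>
       (\<exists>D\<in>\<D>. closure D \<subseteq> ball x \<rho> \<and> (\<exists>u\<in>circ D. \<exists>v\<in>circ D. \<rho> \<le> C * dist u v) \<and>
         (\<forall>y\<in>S. dist x y < L * \<rho> \<longrightarrow> (\<exists>u\<in>circ (\<sigma> D). \<exists>v\<in>circ (\<sigma> D). dist (f x) (f y) \<le> C * dist u v))))"
    if \<delta>: "\<delta> > 0" and L: "L > 0" for \<delta> L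
  proof -
    \<comment> \<open>An upper bound for the arguments of \<open>\<eta>\<close> that occur below:
      the numerator is at most \<open>2 * (L + 1) * \<rho>\<close>, and the denominator at least
      \<open>\<rho> * \<delta> / (2 * C0)\<close>.\<close>
    define \<tau> where "\<tau> = 4 * (L + 1) * C0 / \<delta>"
    have \<tau>: "\<tau> > 0" using \<delta> L C0 by (simp add: \<tau>_def)
    have "compact (\<eta> ` {0..\<tau>})" by (intro compact_continuous_image continuous_on_subset[OF \<eta>0(2)]) auto
    then have "bdd_above (\<eta> ` {0..\<tau>})" by (intro bounded_imp_bdd_above compact_imp_bounded)
    then have M0: "\<eta> t \<le> Sup (\<eta> ` {0..\<tau>})" if "t \<in> {0..\<tau>}" for t using that by (intro cSUP_upper)
    define M where "M = max (Sup (\<eta> ` {0..\<tau>})) 1"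
    have M: "M > 0" "\<And>t. t \<in> {0..\<tau>} \<Longrightarrow> \<eta> t \<le> M" using M0 by (auto simp: M_def le_max_iff_disj)
    \<comment> \<open>By compactness, points at distance at least \<open>\<delta> / 2\<close> from
      \<open>a\<close> have images at a definite distance \<open>\<delta>'\<close> from
      \<open>a'\<close>.\<close>
    have "compact (S - ball a (\<delta> / 2))" by (intro compact_diff A.compact_S) simp
    then have cl: "compact (f ` (S - ball a (\<delta> / 2)))" by (intro compact_continuous_image continuous_on_subset[OF fcont]) auto
    have a'n: "a' \<notin> f ` (S - ball a (\<delta> / 2))"
    proof
      assume "a' \<in> f ` (S - ball a (\<delta> / 2))"
      then obtain x where "x \<in> S" "x \<notin> ball a (\<delta> / 2)" "f x = a'" by auto
      then show False using \<phi>in(2)[of x] \<delta> by (auto simp: f_def split: if_splits)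
    qed
    obtain \<delta>' where \<delta>': "\<delta>' > 0" "\<And>y. y \<in> f ` (S - ball a (\<delta> / 2)) \<Longrightarrow> \<delta>' \<le> dist a' y"
      using separate_point_closed[OF compact_imp_closed[OF cl] a'n] by (elim exE conjE) (simp only: Ball_def simp_thms)
    \<comment> \<open>The second entry is twice the constant of \<open>key\<close>, which is used
      for \<open>x\<close> and for \<open>y\<close>.\<close>
    define C where "C = max C0 (4 * M / \<delta>')"
    \<comment> \<open>The second bound keeps every point under consideration at distance at least
      \<open>\<delta> / 2\<close> from \<open>a\<close>.\<close>
    define \<rho>0 where "\<rho>0 = min \<rho>1 (\<delta> / (2 * (L + 1)))"
    have C: "C > 0" "C0 \<le> C" "4 * M / \<delta>' \<le> C" using C0 by (auto simp: C_def less_max_iff_disj)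
    have \<rho>0: "\<rho>0 > 0" using C0 \<delta> L by (simp add: \<rho>0_def)
    show ?thesis
    proof (rule exI[of _ C], intro conjI exI[of _ \<rho>0] C(1) \<rho>0 ballI impI allI)
      fix x \<rho> assume x: "x \<in> S" "\<delta> \<le> dist x a" and \<rho>: "0 < \<rho> \<and> \<rho> < \<rho>0"
      have r1: "0 < \<rho>" "\<rho> < \<rho>1" using \<rho> by (auto simp: \<rho>0_def)
      have "\<rho> < \<delta> / (2 * (L + 1))" using \<rho> by (simp add: \<rho>0_def)
      then have "\<rho> * (2 * (L + 1)) < \<delta>" using L by (simp add: pos_less_divide_eq)
      then have r2: "2 * (L * \<rho>) + 2 * \<rho> < \<delta>" by (simp add: algebra_simps)
      have Lr: "L * \<rho> > 0" using L r1 by simp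
      obtain D u v where D: "D \<in> \<D>" "closure D \<subseteq> ball x \<rho>" and uv: "u \<in> circ D" "v \<in> circ D" "\<rho> \<le> C0 * dist u v"
        using por[OF x(1) r1] by blast
      have uvx: "dist x u < \<rho>" "dist x v < \<rho>" using uv D(2) by (auto simp: circ_def)
      have uvS: "u \<in> S" "v \<in> S" using uv A.circ_S[OF D(1)] by blast+
      have far: "\<delta> / 2 \<le> dist y a \<and> y \<noteq> a" if "dist x y < L * \<rho> + \<rho>" for y
      proof -
        have "dist x a \<le> dist x y + dist y a" by (rule dist_triangle)
        then have "\<delta> / 2 \<le> dist y a" using that x(2) r2 by linarith
        then show ?thesis using \<delta> by auto
      qed
      have fu: "\<delta> / 2 \<le> dist u a" "u \<noteq> a" "\<delta> / 2 \<le> dist v a" "v \<noteq> a" using far[of u] far[of v] uvx Lr by auto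
      have duv: "dist u v > 0"
      proof -
        have "0 < C0 * dist u v" using uv(3) r1 by linarith
        then show ?thesis using C0 by (simp add: zero_less_mult_iff)
      qed
      have key: "dist (f u) (f y) \<le> 2 * M / \<delta>' * dist (f u) (f v)" if y: "y \<in> S" "dist x y < L * \<rho> + \<rho>" "dist u y \<le> (L + 1) * \<rho>" for y
      proof -
        note fy = far[OF y(2)]
        define t where "t = dist u y * dist v a / (dist u v * dist y a)"
        have den: "\<rho> * \<delta> \<le> 2 * C0 * (dist u v * dist y a)"
        proof -
          have "\<rho> * (\<delta> / 2) \<le> (C0 * dist u v) * dist y a" using uv(3) fy \<delta> r1 C0 duv by (intro mult_mono) auto
          then show ?thesis by (simp add: mult_ac)
        qed
        have "t \<le> \<tau>"
        proof -
          have dp: "dist u v * dist y a > 0" using duv fy by simp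
          have "dist u y * dist v a \<le> (L + 1) * \<rho> * 2" using y(3) le2[OF uvS(2) a] L r1 by (intro mult_mono) auto
          also have "\<dots> = \<tau> * (\<rho> * \<delta>) / (2 * C0)" using \<delta> C0 by (simp add: \<tau>_def field_simps)
          also have "\<dots> \<le> \<tau> * (2 * C0 * (dist u v * dist y a)) / (2 * C0)"
            using den \<tau> C0 by (intro divide_right_mono mult_left_mono) auto
          also have "\<dots> = \<tau> * (dist u v * dist y a)" using C0 by simp
          finally show ?thesis unfolding t_def using dp by (simp add: pos_divide_le_eq)
        qed
        moreover have "0 \<le> t" by (simp add: t_def)
        ultimately have tM: "\<eta> t \<le> M" using M(2) by simp
        have "v \<in> S - ball a (\<delta> / 2)" using uvS fu by (simp add: dist_commute)
        then have dv: "\<delta>' \<le> dist (f v) a'" using \<delta>'(2) by (metis dist_commute imageI)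
        have "dist (\<phi> u) (\<phi> y) * dist (\<phi> v) a' \<le> \<eta> t * (dist (\<phi> u) (\<phi> v) * dist (\<phi> y) a')"
          unfolding t_def using QS[of u y v] uvS fu y(1) fy duv by auto
        also have "\<dots> \<le> M * (dist (\<phi> u) (\<phi> v) * 2)"
          using tM \<phi>in(1)[OF y(1)] fy le2' a' M(1) by (intro mult_mono) auto
        finally have 1: "dist (f u) (f y) * dist (f v) a' \<le> M * (dist (f u) (f v) * 2)" using fu fy by (simp add: f_def)
        have "dist (f u) (f y) * \<delta>' \<le> dist (f u) (f y) * dist (f v) a'" using dv by (intro mult_left_mono) auto
        then have "dist (f u) (f y) * \<delta>' \<le> M * (dist (f u) (f v) * 2)" using 1 by linarith
        then show ?thesis using \<delta>'(1) by (simp add: field_simps)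
      qed
      show "\<exists>D\<in>\<D>. closure D \<subseteq> ball x \<rho> \<and> (\<exists>u\<in>circ D. \<exists>v\<in>circ D. \<rho> \<le> C * dist u v) \<and>
         (\<forall>y\<in>S. dist x y < L * \<rho> \<longrightarrow> (\<exists>u\<in>circ (\<sigma> D). \<exists>v\<in>circ (\<sigma> D). dist (f x) (f y) \<le> C * dist u v))"
      proof (intro bexI[of _ D] conjI ballI impI D)
        have "C0 * dist u v \<le> C * dist u v" using C(2) by (intro mult_right_mono) auto
        then have "\<rho> \<le> C * dist u v" using uv(3) by linarith
        then show "\<exists>u\<in>circ D. \<exists>v\<in>circ D. \<rho> \<le> C * dist u v" using uv by blast
        fix y assume y: "y \<in> S" "dist x y < L * \<rho>"
        have "dist u y \<le> dist x u + dist x y" by (metis dist_commute dist_triangle)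
        then have "dist u y \<le> (L + 1) * \<rho>" using y(2) uvx(1) by (simp add: distrib_right)
        then have 1: "dist (f u) (f y) \<le> 2 * M / \<delta>' * dist (f u) (f v)" using key[of y] y r1 by simp
        have "dist u x \<le> (L + 1) * \<rho>" using uvx(1) Lr by (simp add: distrib_right dist_commute)
        then have 2: "dist (f u) (f x) \<le> 2 * M / \<delta>' * dist (f u) (f v)" using key[of x] x(1) r1 Lr by simp
        have "dist (f x) (f y) \<le> dist (f u) (f x) + dist (f u) (f y)" by (metis dist_commute dist_triangle)
        also have "\<dots> \<le> 2 * M / \<delta>' * dist (f u) (f v) + 2 * M / \<delta>' * dist (f u) (f v)" using 1 2 by linarith
        also have "\<dots> = 4 * M / \<delta>' * dist (f u) (f v)" by (simp add: field_simps)
        also have "\<dots> \<le> C * dist (f u) (f v)" using C(3) by (intro mult_right_mono) auto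
        finally have "dist (f x) (f y) \<le> C * dist (f u) (f v)" .
        moreover have "f u \<in> circ (\<sigma> D)" "f v \<in> circ (\<sigma> D)" using \<sigma>(2)[OF D(1)] uv by blast+
        ultimately show "\<exists>u\<in>circ (\<sigma> D). \<exists>v\<in>circ (\<sigma> D). dist (f x) (f y) \<le> C * dist u v" by blast
      qed
    qed
  qed
  have "schottky_pair S \<D> G \<kappa> S' \<D>' G' \<kappa>' f \<sigma>"
  proof
    show "continuous_on S f" "bij_betw f S S'" "bij_betw \<sigma> \<D> \<D>'" by fact+
    show "f ` circ D = circ (\<sigma> D)" if "D \<in> \<D>" for D using \<sigma>(2) that .
    show "\<exists>a\<in>S. \<forall>\<delta>>0. \<forall>L>0. \<exists>C>0. \<exists>\<rho>0>0. \<forall>x\<in>S. \<delta> \<le> dist x a \<longrightarrow> (\<forall>\<rho>. 0 < \<rho> \<and> \<rho> < \<rho>0 \<longrightarrow>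
       (\<exists>D\<in>\<D>. closure D \<subseteq> ball x \<rho> \<and> (\<exists>u\<in>circ D. \<exists>v\<in>circ D. \<rho> \<le> C * dist u v) \<and>
         (\<forall>y\<in>S. dist x y < L * \<rho> \<longrightarrow> (\<exists>u\<in>circ (\<sigma> D). \<exists>v\<in>circ (\<sigma> D). dist (f x) (f y) \<le> C * dist u v))))"
      by (rule bexI[OF _ a], intro allI impI) (rule err)
  qed
  then show ?thesis by blast
qed

theorem theorem1p4:
  fixes \<Gamma> \<Gamma>' :: "(R3 \<Rightarrow> R3) set"
    and p p' :: R3
    and Z :: "'a set" and d :: "'a \<Rightarrow> 'a \<Rightarrow> real" and z :: 'a
    and Z' :: "'b set" and d' :: "'b \<Rightarrow> 'b \<Rightarrow> real" and z' :: 'b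
  assumes "kleinian \<Gamma>" and "kleinian \<Gamma>'"
    and "schottky_set (limit_set \<Gamma>)" and "schottky_set (limit_set \<Gamma>')"
    and "uniform_convergence_group \<Gamma> bext (limit_set \<Gamma>)"
    and "uniform_convergence_group \<Gamma>' bext (limit_set \<Gamma>')"
    and "p \<in> limit_set \<Gamma>" and "p' \<in> limit_set \<Gamma>'"
    and "weak_tangent (limit_set \<Gamma>) p Z d z"
    and "weak_tangent (limit_set \<Gamma>') p' Z' d' z'"
    and "qs_equivalent Z d Z' d'"
  shows "\<exists>f. moebius f \<and> f ` limit_set \<Gamma> = limit_set \<Gamma>'"
proof -
  let ?S = "limit_set \<Gamma>" and ?S' = "limit_set \<Gamma>'"
  obtain \<D> \<kappa> where A: "schottky_group ?S \<D> (bext ` \<Gamma>) \<kappa>"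
    by (rule kleinian_schottky_group[OF assms(1,3,5)])
  obtain \<D>' \<kappa>' where B: "schottky_group ?S' \<D>' (bext ` \<Gamma>') \<kappa>'"
    by (rule kleinian_schottky_group[OF assms(2,4,6)])
  obtain a s \<psi> where a: "a \<in> ?S" and s: "s > 0" and \<psi>: "bij_betw \<psi> (?S - {a}) Z"
     and \<psi>d: "\<And>x y. x \<in> ?S - {a} \<Longrightarrow> y \<in> ?S - {a} \<Longrightarrow> d (\<psi> x) (\<psi> y) = s * dist x y / (dist x a * dist y a)"
    using schottky_group.tangent[OF A assms(9,7)] by blast
  obtain a' s' \<psi>' where a': "a' \<in> ?S'" and s': "s' > 0" and \<psi>': "bij_betw \<psi>' (?S' - {a'}) Z'"
     and \<psi>d': "\<And>x y. x \<in> ?S' - {a'} \<Longrightarrow> y \<in> ?S' - {a'} \<Longrightarrow> d' (\<psi>' x) (\<psi>' y) = s' * dist x y / (dist x a' * dist y a')"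
    using schottky_group.tangent[OF B assms(10,8)] by blast
  have MZ: "Metric_space Z d" "Metric_space Z' d'" using assms(9,10) unfolding weak_tangent_def pGH_conv_def by blast+
  obtain F \<eta> \<eta>' where F: "homeomorphic_map (Metric_space.mtopology Z d) (Metric_space.mtopology Z' d') F"
    and \<eta>: "homeomorphism {0::real..} {0..} \<eta> \<eta>'"
    and qs: "\<And>x y z. x \<in> Z \<Longrightarrow> y \<in> Z \<Longrightarrow> z \<in> Z \<Longrightarrow> x \<noteq> z \<Longrightarrow> d' (F x) (F y) / d' (F x) (F z) \<le> \<eta> (d x y / d x z)"
    using assms(11) unfolding qs_equivalent_def quasisymmetric_def by blast
  have Fb: "bij_betw F Z Z'"
    using homeomorphic_imp_injective_map[OF F] homeomorphic_imp_surjective_map[OF F]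
      Metric_space.topspace_mtopology[OF MZ(1)] Metric_space.topspace_mtopology[OF MZ(2)]
    by (simp add: bij_betw_def)
  \<comment> \<open>The quasisymmetry in the coordinates \<open>S - {a}\<close> and
    \<open>S' - {a'}\<close> of the two tangents.\<close>
  define \<phi> where "\<phi> = inv_into (?S' - {a'}) \<psi>' \<circ> (F \<circ> \<psi>)"
  have \<phi>: "bij_betw \<phi> (?S - {a}) (?S' - {a'})"
    unfolding \<phi>_def by (intro bij_betw_trans[OF _ bij_betw_inv_into[OF \<psi>']] bij_betw_trans[OF \<psi> Fb])
  have \<psi>\<phi>: "\<psi>' (\<phi> x) = F (\<psi> x)" if "x \<in> ?S - {a}" for x
  proof -
    have "F (\<psi> x) \<in> \<psi>' ` (?S' - {a'})" using \<psi> \<psi>' Fb that by (auto simp: bij_betw_def)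
    then show ?thesis unfolding \<phi>_def by (simp add: f_inv_into_f)
  qed
  have "\<exists>f \<sigma>. schottky_pair ?S \<D> (bext ` \<Gamma>) \<kappa> ?S' \<D>' (bext ` \<Gamma>') \<kappa>' f \<sigma>"
  proof (rule quasisymmetric_schottky_pair[OF A B a a' s s' \<phi> \<eta>])
    fix x y z assume xyz: "x \<in> ?S - {a}" "y \<in> ?S - {a}" "z \<in> ?S - {a}" "x \<noteq> z"
    have Z: "\<psi> x \<in> Z" "\<psi> y \<in> Z" "\<psi> z \<in> Z" using \<psi> xyz by (auto dest: bij_betwE)
    have ne: "\<psi> x \<noteq> \<psi> z" using \<psi> xyz by (auto simp: bij_betw_def dest: inj_onD)
    have \<phi>in: "\<phi> x \<in> ?S' - {a'}" "\<phi> y \<in> ?S' - {a'}" "\<phi> z \<in> ?S' - {a'}" using bij_betwE[OF \<phi>] xyz by blast+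
    show "(s' * dist (\<phi> x) (\<phi> y) / (dist (\<phi> x) a' * dist (\<phi> y) a')) / (s' * dist (\<phi> x) (\<phi> z) / (dist (\<phi> x) a' * dist (\<phi> z) a'))
       \<le> \<eta> ((s * dist x y / (dist x a * dist y a)) / (s * dist x z / (dist x a * dist z a)))"
      using qs[OF Z ne] unfolding \<psi>d[OF xyz(1,2), symmetric] \<psi>d[OF xyz(1,3), symmetric]
        \<psi>d'[OF \<phi>in(1,2), symmetric] \<psi>d'[OF \<phi>in(1,3), symmetric] \<psi>\<phi>[OF xyz(1)] \<psi>\<phi>[OF xyz(2)] \<psi>\<phi>[OF xyz(3)] .
  qed
  then obtain f \<sigma> where P: "schottky_pair ?S \<D> (bext ` \<Gamma>) \<kappa> ?S' \<D>' (bext ` \<Gamma>') \<kappa>' f \<sigma>" by blast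
  obtain H where H: "Mob H" "H ` ?S = ?S'" using schottky_pair.pair_Mob[OF P] by blast
  obtain g where g: "moebius g" "\<And>x. x \<in> S2 \<Longrightarrow> g x = H x" using Mob_moebius[OF H(1)] by metis
  have "?S \<subseteq> S2" by (auto simp: limit_set_def)
  then have "g ` ?S = H ` ?S" using g(2) by (intro image_cong) auto
  then show ?thesis using g(1) H(2) by blast
qed

end
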